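(* Let $G$ be a finite group such that $\alpha(\Gamma(G))\leq 14$, where $\Gamma(G)$ is the comaximal subgroup graph of $G$ and $\alpha$ denotes the independence number. Then $G$ is supersolvable, or $G$ is isomorphic to one of the following groups: $A_4$, $SL(2,3)$, $(\mathbb{Z}_2\times \mathbb{Z}_2)\rtimes \mathbb{Z}_9$.
   Context: For a group $G$, the comaximal subgroup graph $\Gamma(G)$ is the simple undirected graph whose vertices are the non-trivial proper subgroups of $G$ (all subgroups $H$ with $H\neq\{e\}$ and $H\neq G$), where two distinct vertices $H$ and $K$ are adjacent if and only if $HK=G$, with $HK=\{hk: h\in H, k\in K\}$. The independence number $\alpha(\Gamma)$ of a finite graph $\Gamma$ is the maximum cardinality of a set of pairwise non-adjacent vertices (it is $0$ if the graph has no vertices). $\mathbb{Z}_n$ is the cyclic group of order $n$, $A_4$ is the alternating group on $4$ letters, and $SL(2,3)$ is the group of $2\times 2$ matrices of determinant $1$ over the field with $3$ elements. $(\mathbb{Z}_2\times \mathbb{Z}_2)\rtimes \mathbb{Z}_9$ denotes the semidirect product of order $36$ in which $\mathbb{Z}_9$ acts non-trivially on $\mathbb{Z}_2\times\mathbb{Z}_2$ (a generator of $\mathbb{Z}_9$ acts by an automorphism of order $3$; this group is unique up to isomorphism). *)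

theory Defs
  imports
    "HOL-Library.Ramsey"
    "HOL-Algebra.Elementary_Groups"
    "HOL-Algebra.Sym_Groups"
    "HOL-Algebra.Multiplicative_Group"
    "HOL-Algebra.Bij"
    "HOL-Analysis.Determinants"
begin

text \<open>A simple graph is a pair of a vertex set and a set of two-element edges, so that
  \<^const>\<open>indep\<close> from \<^theory>\<open>HOL-Library.Ramsey\<close> applies. The maximum below is only
  meaningful for a finite vertex set; as the empty set is independent, it is then taken over a
  nonempty set and equals 0 for the graph without vertices.\<close>

definition independence_number :: "'v set \<times> 'v set set \<Rightarrow> nat" where
  "independence_number \<Gamma> = Max (card ` {S. S \<subseteq> fst \<Gamma> \<and> indep S (snd \<Gamma>)})"

definition nontrivial_proper_subgroups :: "('a, 'b) monoid_scheme \<Rightarrow> 'a set set" where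
  "nontrivial_proper_subgroups G = {H. subgroup H G \<and> H \<noteq> {\<one>\<^bsub>G\<^esub>} \<and> H \<noteq> carrier G}"

definition comaximal_subgroup_graph ::
    "('a, 'b) monoid_scheme \<Rightarrow> 'a set set \<times> 'a set set set" where
  "comaximal_subgroup_graph G =
     (nontrivial_proper_subgroups G,
      {{H, K} | H K. H \<in> nontrivial_proper_subgroups G \<and> K \<in> nontrivial_proper_subgroups G \<and>
                     H \<noteq> K \<and> H <#>\<^bsub>G\<^esub> K = carrier G})"

text \<open>Every member of the series has to be normal in the whole group.\<close>

definition supersolvable :: "('a, 'b) monoid_scheme \<Rightarrow> bool" where
  "supersolvable G \<longleftrightarrow>
     (\<exists>(n::nat) N. N 0 = {\<one>\<^bsub>G\<^esub>} \<and> N n = carrier G \<and>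
        (\<forall>i\<le>n. N i \<lhd> G) \<and>
        (\<forall>i<n. N i \<subseteq> N (Suc i) \<and> cyclic_group (G\<lparr>carrier := N (Suc i)\<rparr> Mod N i)))"

definition special_linear_group :: "('a::comm_ring_1 ^ 'n ^ 'n) monoid" where
  "special_linear_group = \<lparr>carrier = {A. det A = 1}, monoid.mult = (**), one = mat 1\<rparr>"

text \<open>The numeral type \<^typ>\<open>3\<close> carries arithmetic modulo 3, so it is the field with 3 elements.\<close>

lemma numeral_type_3_inverse: "\<exists>y. x * y = 1" if "x \<noteq> 0" for x :: 3
  using that exhaust_3[of x] by (auto intro: exI[of _ 1] exI[of _ 2])

abbreviation SL_2_3 :: "(3 ^ 2 ^ 2) monoid" where
  "SL_2_3 \<equiv> special_linear_group"

definition semidirect_product ::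
    "('a, 'c) monoid_scheme \<Rightarrow> ('h \<Rightarrow> 'a \<Rightarrow> 'a) \<Rightarrow> ('h, 'd) monoid_scheme \<Rightarrow> ('a \<times> 'h) monoid" where
  "semidirect_product N \<phi> H =
     \<lparr>carrier = carrier N \<times> carrier H,
      monoid.mult = (\<lambda>(a, h) (b, k). (a \<otimes>\<^bsub>N\<^esub> \<phi> h b, h \<otimes>\<^bsub>H\<^esub> k)),
      one = (\<one>\<^bsub>N\<^esub>, \<one>\<^bsub>H\<^esub>)\<rparr>"

lemma semidirect_product_group:
  assumes N: "group N" and H: "group H" and hom: "\<phi> \<in> hom H (AutoGroup N)"
  shows "group (semidirect_product N \<phi> H)"
proof -
  interpret N: group N by fact
  interpret H: group H by fact
  interpret A: group "AutoGroup N" by (rule N.AutoGroup)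
  interpret h: group_hom H "AutoGroup N" \<phi> by unfold_locales (rule hom)
  have aut: "\<phi> h \<in> auto N" if "h \<in> carrier H" for h
    using h.hom_closed[OF that] by (simp add: AutoGroup_def)
  have cl: "\<phi> h a \<in> carrier N" if "h \<in> carrier H" "a \<in> carrier N" for h a
    using aut[OF that(1)] that(2) by (auto simp: auto_def hom_def)
  have mu: "\<phi> h (a \<otimes>\<^bsub>N\<^esub> b) = \<phi> h a \<otimes>\<^bsub>N\<^esub> \<phi> h b"
    if "h \<in> carrier H" "a \<in> carrier N" "b \<in> carrier N" for h a b
    using aut[OF that(1)] that by (auto simp: auto_def hom_def)
  have comp: "\<phi> (h \<otimes>\<^bsub>H\<^esub> k) a = \<phi> h (\<phi> k a)"
    if "h \<in> carrier H" "k \<in> carrier H" "a \<in> carrier N" for h k a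
    using that aut[OF that(1)] aut[OF that(2)]
    by (simp add: AutoGroup_def BijGroup_def auto_def compose_def)
  have one: "\<phi> \<one>\<^bsub>H\<^esub> a = a" if "a \<in> carrier N" for a
    using h.hom_one that by (simp add: AutoGroup_def BijGroup_def)
  show ?thesis
  proof (rule groupI)
    fix x assume "x \<in> carrier (semidirect_product N \<phi> H)"
    then obtain a h where x: "x = (a, h)" "a \<in> carrier N" "h \<in> carrier H"
      by (auto simp: semidirect_product_def)
    let ?y = "(\<phi> (inv\<^bsub>H\<^esub> h) (inv\<^bsub>N\<^esub> a), inv\<^bsub>H\<^esub> h)"
    have "?y \<in> carrier (semidirect_product N \<phi> H)"
      using x cl[of "inv\<^bsub>H\<^esub> h" "inv\<^bsub>N\<^esub> a"]
      by (simp add: semidirect_product_def del: h.hom_inv)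
    moreover have "?y \<otimes>\<^bsub>semidirect_product N \<phi> H\<^esub> x = \<one>\<^bsub>semidirect_product N \<phi> H\<^esub>"
    proof -
      have "\<phi> (inv\<^bsub>H\<^esub> h) \<one>\<^bsub>N\<^esub> = \<one>\<^bsub>N\<^esub>"
        by (metis N.one_closed N.l_one N.r_cancel_one' cl mu H.inv_closed x(3))
      then show ?thesis
        using x mu[of "inv\<^bsub>H\<^esub> h" "inv\<^bsub>N\<^esub> a" a]
        by (simp add: semidirect_product_def del: h.hom_inv)
    qed
    ultimately show "\<exists>y\<in>carrier (semidirect_product N \<phi> H).
        y \<otimes>\<^bsub>semidirect_product N \<phi> H\<^esub> x = \<one>\<^bsub>semidirect_product N \<phi> H\<^esub>" by blast
  qed (auto simp: semidirect_product_def cl mu comp one N.m_assoc H.m_assoc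
            simp del: h.hom_mult h.hom_one)
qed

abbreviation Z2_Z2 :: "(int \<times> int) monoid" where
  "Z2_Z2 \<equiv> integer_mod_group 2 \<times>\<times> integer_mod_group 2"

text \<open>The automorphism of order 3 sending (1, 0) to (0, 1) and (0, 1) to (1, 1).\<close>

definition Z2_Z2_rotation :: "int \<times> int \<Rightarrow> int \<times> int" where
  "Z2_Z2_rotation = (\<lambda>(a, b)\<in>carrier Z2_Z2. (b, (a + b) mod 2))"

definition Z9_action :: "int \<Rightarrow> int \<times> int \<Rightarrow> int \<times> int" where
  "Z9_action k = Z2_Z2_rotation [^]\<^bsub>AutoGroup Z2_Z2\<^esub> k"

definition Z2_Z2_semidirect_Z9 :: "((int \<times> int) \<times> int) monoid" where
  "Z2_Z2_semidirect_Z9 = semidirect_product Z2_Z2 Z9_action (integer_mod_group 9)"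

lemma carrier_Z2_Z2: "carrier Z2_Z2 = {(0, 0), (0, 1), (1, 0), (1, 1)}"
proof -
  have "{0..<2::int} = {0, 1}" by auto
  then show ?thesis by (auto simp: DirProd_def carrier_integer_mod_group)
qed

lemma Z2_Z2_rotation_in_auto: "Z2_Z2_rotation \<in> carrier (AutoGroup Z2_Z2)"
proof -
  have "Z2_Z2_rotation \<in> hom Z2_Z2 Z2_Z2"
    unfolding hom_def Z2_Z2_rotation_def carrier_Z2_Z2
    by (auto simp: DirProd_def integer_mod_group_def)
  moreover have "bij_betw Z2_Z2_rotation (carrier Z2_Z2) (carrier Z2_Z2)"
    unfolding bij_betw_def inj_on_def Z2_Z2_rotation_def carrier_Z2_Z2 by auto
  moreover have "Z2_Z2_rotation \<in> extensional (carrier Z2_Z2)"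
    by (simp add: Z2_Z2_rotation_def)
  ultimately show ?thesis by (simp add: AutoGroup_def auto_def Bij_def)
qed

lemma group_Z2_Z2: "group Z2_Z2"
  by (simp add: DirProd_group)

lemma ord_Z2_Z2_rotation: "group.ord (AutoGroup Z2_Z2) Z2_Z2_rotation = 3"
proof -
  interpret A: group "AutoGroup Z2_Z2" by (rule group.AutoGroup[OF group_Z2_Z2])
  have "Z2_Z2_rotation (1, 0) = (0, 1)"
    by (simp add: Z2_Z2_rotation_def carrier_Z2_Z2 del: carrier_DirProd)
  then have ne: "Z2_Z2_rotation \<noteq> \<one>\<^bsub>AutoGroup Z2_Z2\<^esub>"
    by (auto simp: AutoGroup_def BijGroup_def carrier_Z2_Z2 simp del: carrier_DirProd
             dest: fun_cong[of _ _ "(1, 0)"])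
  have "Z2_Z2_rotation [^]\<^bsub>AutoGroup Z2_Z2\<^esub> (3::nat) = \<one>\<^bsub>AutoGroup Z2_Z2\<^esub>"
  proof -
    have mult: "f \<otimes>\<^bsub>AutoGroup Z2_Z2\<^esub> g = compose (carrier Z2_Z2) f g"
      if "f \<in> carrier (AutoGroup Z2_Z2)" "g \<in> carrier (AutoGroup Z2_Z2)" for f g
      using that by (simp add: AutoGroup_def BijGroup_def auto_def)
    have "Z2_Z2_rotation [^]\<^bsub>AutoGroup Z2_Z2\<^esub> (3::nat) =
        (Z2_Z2_rotation \<otimes>\<^bsub>AutoGroup Z2_Z2\<^esub> Z2_Z2_rotation) \<otimes>\<^bsub>AutoGroup Z2_Z2\<^esub> Z2_Z2_rotation"
      using Z2_Z2_rotation_in_auto by (simp add: numeral_3_eq_3)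
    also have "\<dots> = compose (carrier Z2_Z2)
        (compose (carrier Z2_Z2) Z2_Z2_rotation Z2_Z2_rotation) Z2_Z2_rotation"
      using A.m_closed[OF Z2_Z2_rotation_in_auto Z2_Z2_rotation_in_auto] Z2_Z2_rotation_in_auto
      by (simp only: mult)
    also have "\<dots> = (\<lambda>x\<in>carrier Z2_Z2. x)"
      unfolding compose_def Z2_Z2_rotation_def carrier_Z2_Z2 by auto
    also have "\<dots> = \<one>\<^bsub>AutoGroup Z2_Z2\<^esub>"
      by (simp add: AutoGroup_def BijGroup_def)
    finally show ?thesis .
  qed
  then have "A.ord Z2_Z2_rotation dvd 3"
    using A.pow_eq_id Z2_Z2_rotation_in_auto by blast
  moreover have "A.ord Z2_Z2_rotation \<noteq> 1"
    using A.ord_eq_1 Z2_Z2_rotation_in_auto ne by blast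
  moreover have "n = 1 \<or> n = 3" if "n dvd 3" for n :: nat
  proof -
    have "n \<le> 3" using that by (simp add: dvd_imp_le)
    then have "n = 0 \<or> n = 1 \<or> n = 2 \<or> n = 3" by linarith
    then show ?thesis using that by auto
  qed
  ultimately show ?thesis by blast
qed

lemma Z9_action_hom: "Z9_action \<in> hom (integer_mod_group 9) (AutoGroup Z2_Z2)"
proof -
  interpret A: group "AutoGroup Z2_Z2" by (rule group.AutoGroup[OF group_Z2_Z2])
  have "Z9_action ((j + k) mod 9) = Z9_action j \<otimes>\<^bsub>AutoGroup Z2_Z2\<^esub> Z9_action k" for j k
  proof -
    have "3 dvd (j + k) mod 9 - (j + k)"
      by presburger
    then have "Z9_action ((j + k) mod 9) = Z9_action (j + k)"
      unfolding Z9_action_def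
      by (subst A.int_pow_eq[OF Z2_Z2_rotation_in_auto])
         (simp add: ord_Z2_Z2_rotation mod_eq_dvd_iff dvd_diff_commute)
    then show ?thesis
      by (simp add: Z9_action_def A.int_pow_mult Z2_Z2_rotation_in_auto)
  qed
  moreover have "Z9_action k \<in> carrier (AutoGroup Z2_Z2)" for k
    by (simp add: Z9_action_def Z2_Z2_rotation_in_auto)
  ultimately show ?thesis
    by (auto simp: hom_def mult_integer_mod_group)
qed

lemma group_Z2_Z2_semidirect_Z9: "group Z2_Z2_semidirect_Z9"
  unfolding Z2_Z2_semidirect_Z9_def
  by (rule semidirect_product_group[OF group_Z2_Z2 _ Z9_action_hom]) simp

end

theory Submission
  imports Defs "HOL-Algebra.Group_Action" "HOL-Algebra.Sylow" "HOL-Algebra.Weak_Morphisms"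
    "HOL-Algebra.Solvable_Groups" "HOL-Number_Theory.Cong"
begin

text \<open>The hypothesis bounds every family of pairwise non-comaximal subgroups, nontrivial and proper, by 14.
  Two subgroups are not comaximal if the product of their orders is not a multiple of the order of the
  group, or if both lie in a common proper subgroup. Most of the proof exhibits 15 such subgroups in
  groups that are to be excluded. The hypothesis passes to quotients and to subgroups, so arguments by
  induction on the order are possible.

  A simple group of composite order is impossible: a nontrivial proper subgroup has at least five
  conjugates, since the group acts faithfully on them, and subgroups of three suitable orders supply 15,
  except for orders \<open>p * q\<close> and \<open>p * q\<^sup>2\<close>, where Sylow counting applies. Hence \<open>G\<close> is
  solvable (\<open>small_comax_solvable\<close>). Let \<open>N\<close> be a minimal normal subgroup.

  If \<open>N\<close> is not of prime order, consider a Sylow subgroup \<open>Q\<close> for a chief factor above the centralizer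
  of \<open>N\<close>. It has \<open>card N\<close> conjugates, which forces \<open>card N\<close> to be 4, 8 or 9, and a closer look excludes
  8 and 9 (\<open>noncyclic_minimal_normal\<close>). So \<open>N\<close> is a Klein four-group and some element \<open>x\<close> rotates its
  three involutions. Counting involutions, their products with elements that centralize \<open>N\<close>, and
  conjugates of the 3-part of \<open>x\<close> shows that the order of \<open>G\<close> is 12 or 36 and that a Sylow 3-subgroup is
  cyclic (\<open>klein_rotation_if_rot\<close>): these are the alternating group and the semidirect product.

  If \<open>N\<close> has prime order \<open>r\<close>, induction applies to the quotient. A supersolvable quotient makes \<open>G\<close>
  supersolvable (\<open>supersolvable_pullback\<close>). Over one of the exceptional groups, an odd \<open>r\<close> leads back to a
  normal Klein group (\<open>klein_rotation_lifts_odd\<close>) or to a normal subgroup of order 2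
  (\<open>quaternion_center_lifts\<close>); for \<open>r = 2\<close> either the Klein group lifts or it becomes the quaternion group
  in the special linear group (\<open>klein_rotation_lifts_two\<close>), which has no further such extension
  (\<open>quaternion_rotation_not_lifts_two\<close>).

  Each exceptional group is carried through as a description by generators and relations. At the end
  the relations are read as a Cayley graph, which determines the group up to isomorphism
  (\<open>cayley_table_iso\<close>).\<close>

section \<open>Conjugation\<close>

definition (in group) conj :: "'a \<Rightarrow> 'a \<Rightarrow> 'a" where
  "conj g h = g \<otimes> h \<otimes> inv g"

context group
begin

lemma conj_closed [simp, intro]: "g \<in> carrier G \<Longrightarrow> h \<in> carrier G \<Longrightarrow> conj g h \<in> carrier G"
  by (simp add: conj_def)

lemma conj_one [simp]: "g \<in> carrier G \<Longrightarrow> conj g \<one> = \<one>"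
  by (simp add: conj_def)

lemma conj_one_left [simp]: "h \<in> carrier G \<Longrightarrow> conj \<one> h = h"
  by (simp add: conj_def)

lemma conj_mult:
  "g \<in> carrier G \<Longrightarrow> h \<in> carrier G \<Longrightarrow> k \<in> carrier G \<Longrightarrow> conj g (h \<otimes> k) = conj g h \<otimes> conj g k"
  by (simp add: conj_def m_assoc inv_solve_left)

lemma conj_mult_left:
  "g \<in> carrier G \<Longrightarrow> h \<in> carrier G \<Longrightarrow> k \<in> carrier G \<Longrightarrow> conj (g \<otimes> h) k = conj g (conj h k)"
  by (simp add: conj_def m_assoc inv_mult_group)

lemma conj_inv_cancel [simp]:
  "g \<in> carrier G \<Longrightarrow> h \<in> carrier G \<Longrightarrow> conj (inv g) (conj g h) = h"
  "g \<in> carrier G \<Longrightarrow> h \<in> carrier G \<Longrightarrow> conj g (conj (inv g) h) = h"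
  by (simp_all add: conj_mult_left[symmetric])

lemma conj_inv: "g \<in> carrier G \<Longrightarrow> h \<in> carrier G \<Longrightarrow> conj g (inv h) = inv (conj g h)"
  by (simp add: conj_def m_assoc inv_mult_group)

lemma conj_pow: "g \<in> carrier G \<Longrightarrow> h \<in> carrier G \<Longrightarrow> conj g (h [^] (n::nat)) = conj g h [^] n"
  by (induction n) (simp_all add: conj_mult)

lemma conj_inj:
  "g \<in> carrier G \<Longrightarrow> h \<in> carrier G \<Longrightarrow> k \<in> carrier G \<Longrightarrow> conj g h = conj g k \<longleftrightarrow> h = k"
  by (metis conj_inv_cancel(1))

lemma conj_fixed_iff:
  "g \<in> carrier G \<Longrightarrow> h \<in> carrier G \<Longrightarrow> conj g h = h \<longleftrightarrow> g \<otimes> h = h \<otimes> g"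
  unfolding conj_def by (metis inv_solve_right m_closed)

lemma conj_swap:
  "g \<in> carrier G \<Longrightarrow> h \<in> carrier G \<Longrightarrow> g \<otimes> h = conj g h \<otimes> g"
  by (simp add: conj_def m_assoc)

lemma conj_fixed_sym:
  "g \<in> carrier G \<Longrightarrow> h \<in> carrier G \<Longrightarrow> conj g h = h \<longleftrightarrow> conj h g = g"
  by (auto simp: conj_fixed_iff)

lemma conj_pow_left_fixed:
  "g \<in> carrier G \<Longrightarrow> h \<in> carrier G \<Longrightarrow> conj g h = h \<Longrightarrow> conj (g [^] (n::nat)) h = h"
  by (induction n) (simp_all add: conj_mult_left)

abbreviation conjs :: "'a \<Rightarrow> 'a set \<Rightarrow> 'a set" where
  "conjs g H \<equiv> conj g ` H"

lemma conjs_mult_left: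
  "g \<in> carrier G \<Longrightarrow> h \<in> carrier G \<Longrightarrow> H \<subseteq> carrier G \<Longrightarrow> conjs (g \<otimes> h) H = conjs g (conjs h H)"
  by (force simp: conj_mult_left image_image)

lemma conjs_one: "H \<subseteq> carrier G \<Longrightarrow> conjs \<one> H = H"
  by (force simp: image_def)

lemma inj_on_conj: "g \<in> carrier G \<Longrightarrow> H \<subseteq> carrier G \<Longrightarrow> inj_on (conj g) H"
  by (rule inj_onI) (metis conj_inj subsetD)

lemma card_conjs [simp]: "g \<in> carrier G \<Longrightarrow> H \<subseteq> carrier G \<Longrightarrow> card (conjs g H) = card H"
  by (simp add: card_image inj_on_conj)

lemma conj_hom: "g \<in> carrier G \<Longrightarrow> conj g \<in> hom G G"
  by (auto simp: hom_def conj_mult)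

lemma subgroup_conjs: "g \<in> carrier G \<Longrightarrow> subgroup H G \<Longrightarrow> subgroup (conjs g H) G"
  by (intro group_hom.subgroup_img_is_subgroup[of G G])
     (auto simp: group_hom_def group_hom_axioms_def conj_hom)

lemma normal_iff_conj:
  "N \<lhd> G \<longleftrightarrow> subgroup N G \<and> (\<forall>g\<in>carrier G. \<forall>n\<in>N. conj g n \<in> N)"
  by (simp add: normal_inv_iff conj_def)

lemma normal_conj_closed: "N \<lhd> G \<Longrightarrow> g \<in> carrier G \<Longrightarrow> n \<in> N \<Longrightarrow> conj g n \<in> N"
  by (simp add: normal_iff_conj)

lemma conjs_fixed_imp_normal:
  assumes "subgroup H G" "\<And>g. g \<in> carrier G \<Longrightarrow> conjs g H = H" shows "H \<lhd> G"
  using assms by (auto simp: normal_iff_conj)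

end

section \<open>Actions of finite groups\<close>

locale finite_group = group G for G (structure) +
  assumes fin [simp]: "finite (carrier G)"

context finite_group
begin

lemma order_pos: "0 < order G"
  by (simp add: order_gt_0_iff_finite)

lemma finite_subgroup: "subgroup H G \<Longrightarrow> finite H"
  using subgroup.subset fin finite_subset by blast

lemma card_subgroup_pos: "subgroup H G \<Longrightarrow> 0 < card H"
  by (rule subgroup.finite_imp_card_positive[OF _ fin])

lemma card_subgroup_dvd: "subgroup H G \<Longrightarrow> card H dvd order G"
  by (metis lagrange dvd_triv_right)

lemma card_subgroup_mono_dvd:
  assumes "subgroup H G" "subgroup K G" "H \<subseteq> K" shows "card H dvd card K"
proof -
  interpret K: group "G\<lparr>carrier := K\<rparr>" by (simp add: assms subgroup_imp_group)
  have "subgroup H (G\<lparr>carrier := K\<rparr>)" using assms subgroup_incl by blast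
  then have "card (rcosets\<^bsub>G\<lparr>carrier := K\<rparr>\<^esub> H) * card H = card K"
    using K.lagrange by (simp add: order_def)
  then show ?thesis by (metis dvd_triv_right)
qed

lemma card_eq_imp_carrier:
  "subgroup H G \<Longrightarrow> card H = order G \<Longrightarrow> H = carrier G"
  by (metis card_subset_eq fin order_def subgroup.subset)

end

text \<open>The actions below, on elements, subgroups and cosets, are given by functions on a whole type; the
  library theory of actions wants them restricted to the set acted on.\<close>

lemma group_action_of_fun:
  assumes "group K"
    and cl: "\<And>g e. g \<in> carrier K \<Longrightarrow> e \<in> E \<Longrightarrow> f g e \<in> E"
    and one: "\<And>e. e \<in> E \<Longrightarrow> f \<one>\<^bsub>K\<^esub> e = e"
    and mult: "\<And>g h e. g \<in> carrier K \<Longrightarrow> h \<in> carrier K \<Longrightarrow> e \<in> E \<Longrightarrow> f (g \<otimes>\<^bsub>K\<^esub> h) e = f g (f h e)"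
  shows "group_action K E (\<lambda>g. restrict (f g) E)"
proof -
  interpret K: group K by fact
  have bij: "bij_betw (f g) E E" if "g \<in> carrier K" for g
  proof (rule bij_betw_byWitness[where f' = "f (inv\<^bsub>K\<^esub> g)"])
    show "\<forall>e\<in>E. f (inv\<^bsub>K\<^esub> g) (f g e) = e" "\<forall>e\<in>E. f g (f (inv\<^bsub>K\<^esub> g) e) = e"
      using that one mult[of "inv\<^bsub>K\<^esub> g" g] mult[of g "inv\<^bsub>K\<^esub> g"] by simp_all
  qed (use that cl in auto)
  have B: "restrict (f g) E \<in> Bij E" if "g \<in> carrier K" for g
    using bij[OF that] by (simp add: Bij_def bij_betw_restrict_eq)
  have "(\<lambda>g. restrict (f g) E) \<in> hom K (BijGroup E)"
    unfolding hom_def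
  proof (intro CollectI conjI ballI)
    show "(\<lambda>g. restrict (f g) E) \<in> carrier K \<rightarrow> carrier (BijGroup E)"
      using B by (auto simp: BijGroup_def)
    fix g h assume gh: "g \<in> carrier K" "h \<in> carrier K"
    have "restrict (f (g \<otimes>\<^bsub>K\<^esub> h)) E = compose E (restrict (f g) E) (restrict (f h) E)"
      by (rule ext) (use gh cl mult in \<open>simp add: compose_def\<close>)
    then show "restrict (f (g \<otimes>\<^bsub>K\<^esub> h)) E = restrict (f g) E \<otimes>\<^bsub>BijGroup E\<^esub> restrict (f h) E"
      using B gh by (simp add: BijGroup_def)
  qed
  then show ?thesis
    unfolding group_action_def group_hom_def group_hom_axioms_def
    using K.is_group group_BijGroup by blast
qed

lemma card_orbit_mult_card_stabilizer:
  assumes "group K"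
    and cl: "\<And>g e. g \<in> carrier K \<Longrightarrow> e \<in> E \<Longrightarrow> f g e \<in> E"
    and one: "\<And>e. e \<in> E \<Longrightarrow> f \<one>\<^bsub>K\<^esub> e = e"
    and mult: "\<And>g h e. g \<in> carrier K \<Longrightarrow> h \<in> carrier K \<Longrightarrow> e \<in> E \<Longrightarrow> f (g \<otimes>\<^bsub>K\<^esub> h) e = f g (f h e)"
    and "e \<in> E"
  shows "card ((\<lambda>g. f g e) ` carrier K) * card {g \<in> carrier K. f g e = e} = order K"
proof -
  interpret group_action K E "\<lambda>g. restrict (f g) E" using assms by (intro group_action_of_fun) auto
  have "orbit K (\<lambda>g. restrict (f g) E) e = (\<lambda>g. f g e) ` carrier K"
    using \<open>e \<in> E\<close> by (auto simp: orbit_def)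
  moreover have "stabilizer K (\<lambda>g. restrict (f g) E) e = {g \<in> carrier K. f g e = e}"
    using \<open>e \<in> E\<close> by (auto simp: stabilizer_def)
  ultimately show ?thesis using orbit_stabilizer_theorem[OF \<open>e \<in> E\<close>] by simp
qed

text \<open>Every orbit of a group of prime power order has prime power length, so modulo the prime only
  the orbits of length 1 count.\<close>

lemma p_group_card_fixed_points:
  assumes "group K" "order K = p ^ n" "prime p" "finite E"
    and cl: "\<And>g e. g \<in> carrier K \<Longrightarrow> e \<in> E \<Longrightarrow> f g e \<in> E"
    and one: "\<And>e. e \<in> E \<Longrightarrow> f \<one>\<^bsub>K\<^esub> e = e"
    and mult: "\<And>g h e. g \<in> carrier K \<Longrightarrow> h \<in> carrier K \<Longrightarrow> e \<in> E \<Longrightarrow> f (g \<otimes>\<^bsub>K\<^esub> h) e = f g (f h e)"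
  shows "[card E = card {e \<in> E. \<forall>g\<in>carrier K. f g e = e}] (mod p)"
proof -
  interpret group_action K E "\<lambda>g. restrict (f g) E" using assms by (intro group_action_of_fun) auto
  interpret K: group K by fact
  let ?\<phi> = "\<lambda>g. restrict (f g) E" and ?F = "{e \<in> E. \<forall>g\<in>carrier K. f g e = e}"
  have orb: "orbit K ?\<phi> e = (\<lambda>g. f g e) ` carrier K" if "e \<in> E" for e
    using that by (auto simp: orbit_def)
  have finK: "finite (carrier K)"
    using assms(2,3) by (metis K.order_gt_0_iff_finite prime_gt_0_nat zero_less_power)
  have self: "e \<in> orbit K ?\<phi> e" if "e \<in> E" for e
    using that one K.one_closed by (force simp: orb)
  have one_orb: "card O' = 1 \<longleftrightarrow> (\<exists>e\<in>?F. O' = {e})" if "O' \<in> orbits K E ?\<phi>" for O'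
  proof -
    obtain e where e: "e \<in> E" "O' = orbit K ?\<phi> e" using \<open>O' \<in> _\<close> by (auto simp: orbits_def)
    have "card O' = 1 \<longleftrightarrow> O' = {e}" using self[OF e(1)] e(2) by (auto simp: card_1_singleton_iff)
    also have "\<dots> \<longleftrightarrow> e \<in> ?F \<and> O' = {e}" using e by (auto simp: orb)
    also have "\<dots> \<longleftrightarrow> (\<exists>e\<in>?F. O' = {e})" using self[OF e(1)] e(2) by auto
    finally show ?thesis .
  qed
  have big: "p dvd card O'" if O': "O' \<in> orbits K E ?\<phi>" "card O' \<noteq> 1" for O'
  proof -
    obtain e where e: "e \<in> E" "O' = orbit K ?\<phi> e" using O' by (auto simp: orbits_def)
    have "card O' dvd p ^ n" using orbit_stabilizer_theorem[OF e(1)] e(2) assms(2) by (metis dvd_triv_left)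
    then obtain k where "card O' = p ^ k" using \<open>prime p\<close> divides_primepow_nat by blast
    then show ?thesis using O'(2) by (cases k) auto
  qed
  have finO: "finite (orbits K E ?\<phi>)" using \<open>finite E\<close> by (simp add: orbits_def)
  have sub: "(\<lambda>e. {e}) ` ?F \<subseteq> orbits K E ?\<phi>"
  proof
    fix O' assume "O' \<in> (\<lambda>e. {e}) ` ?F"
    then obtain e where e: "e \<in> ?F" "O' = {e}" by auto
    have "orbit K ?\<phi> e = {e}" using e K.one_closed by (auto simp: orb)
    then show "O' \<in> orbits K E ?\<phi>" using e by (auto simp: orbits_def)
  qed
  have "card E = (\<Sum>O'\<in>orbits K E ?\<phi>. card O')"
    using disjoint_sum[OF \<open>finite E\<close>, of "\<lambda>_. 1::nat"] by simp
  also have "\<dots> = (\<Sum>O'\<in>(\<lambda>e. {e}) ` ?F. card O') + (\<Sum>O'\<in>orbits K E ?\<phi> - (\<lambda>e. {e}) ` ?F. card O')"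
    using sum.subset_diff[OF sub finO, of card] by simp
  also have "(\<Sum>O'\<in>(\<lambda>e. {e}) ` ?F. card O') = card ?F"
    by (subst sum.reindex) (auto simp: inj_on_def)
  finally have "card E = card ?F + (\<Sum>O'\<in>orbits K E ?\<phi> - (\<lambda>e. {e}) ` ?F. card O')" .
  moreover have "p dvd (\<Sum>O'\<in>orbits K E ?\<phi> - (\<lambda>e. {e}) ` ?F. card O')"
    by (rule dvd_sum) (use big one_orb in blast)
  ultimately show ?thesis by (auto simp: cong_def elim!: dvdE)
qed

context finite_group
begin

lemma subgroup_stabilizer_conj:
  assumes "H \<subseteq> carrier G" shows "subgroup {g \<in> carrier G. conjs g H = H} G"
proof (rule subgroupI)
  fix g assume "g \<in> {g \<in> carrier G. conjs g H = H}"
  then show "inv g \<in> {g \<in> carrier G. conjs g H = H}"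
    using assms conjs_mult_left[of "inv g" g H] by (simp add: conjs_one)
qed (use assms in \<open>auto simp: conjs_mult_left conjs_one intro!: exI[of _ \<one>]\<close>)

definition conj_class :: "'a set \<Rightarrow> 'a set set" where
  "conj_class H = (\<lambda>g. conjs g H) ` carrier G"

lemma card_conj_class_mult:
  assumes "H \<subseteq> carrier G"
  shows "card (conj_class H) * card {g \<in> carrier G. conjs g H = H} = order G"
  unfolding conj_class_def
  by (rule card_orbit_mult_card_stabilizer[where E = "Pow (carrier G)"])
     (use assms in \<open>auto simp: conjs_mult_left conjs_one is_group\<close>)

text \<open>The class of \<open>H\<close> has the index of the normalizer as its length, and \<open>H\<close> lies in its normalizer.\<close>

lemma conj_class_mult_card_dvd:
  assumes "subgroup H G" shows "card (conj_class H) * card H dvd order G"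
proof -
  have sub: "H \<subseteq> carrier G" using assms by (rule subgroup.subset)
  have "H \<subseteq> {g \<in> carrier G. conjs g H = H}"
  proof
    fix h assume h: "h \<in> H"
    have cl: "conj k x \<in> H" if "k \<in> H" "x \<in> H" for k x
      using that assms by (simp add: conj_def subgroup.m_closed subgroup.m_inv_closed)
    have "x \<in> conjs h H" if x: "x \<in> H" for x
    proof (rule image_eqI)
      show "x = conj h (conj (inv h) x)" using h x sub by (simp add: subset_iff)
      show "conj (inv h) x \<in> H" using cl subgroup.m_inv_closed[OF assms h] x by blast
    qed
    then show "h \<in> {g \<in> carrier G. conjs g H = H}" using cl[OF h] h sub by auto
  qed
  then have "card H dvd card {g \<in> carrier G. conjs g H = H}"
    using card_subgroup_mono_dvd[OF assms subgroup_stabilizer_conj[OF sub]] by simp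
  then show ?thesis
    using mult_dvd_mono[OF dvd_refl, of "card H" _ "card (conj_class H)"]
    unfolding card_conj_class_mult[OF sub, symmetric] by blast
qed

lemma conj_class_subgroups: "subgroup H G \<Longrightarrow> K \<in> conj_class H \<Longrightarrow> subgroup K G \<and> card K = card H"
  unfolding conj_class_def using card_conjs[OF _ subgroup.subset] subgroup_conjs by auto

lemma card_conj_class_eq_1:
  assumes "subgroup H G" "card (conj_class H) = 1" shows "H \<lhd> G"
proof (rule conjs_fixed_imp_normal[OF assms(1)])
  fix g assume g: "g \<in> carrier G"
  have "conjs \<one> H = H" using assms(1) by (simp add: conjs_one subgroup.subset)
  then have "H \<in> conj_class H" by (metis conj_class_def image_eqI one_closed)
  moreover have "conjs g H \<in> conj_class H" using g by (simp add: conj_class_def)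
  ultimately show "conjs g H = H" using assms(2) by (metis card_1_singletonE singletonD)
qed

lemma finite_conj_class [simp]: "finite (conj_class H)"
  by (simp add: conj_class_def)

end

section \<open>Cyclic subgroups, products of subgroups and elements of prime order\<close>

context finite_group
begin

abbreviation cyc :: "'a \<Rightarrow> 'a set" where
  "cyc x \<equiv> generate G {x}"

lemma subgroup_cyc: "x \<in> carrier G \<Longrightarrow> subgroup (cyc x) G"
  by (simp add: generate_is_subgroup)

lemma card_cyc: "x \<in> carrier G \<Longrightarrow> card (cyc x) = ord x"
  by (simp add: generate_pow_card)

lemma mem_cyc: "x \<in> carrier G \<Longrightarrow> y \<in> cyc x \<longleftrightarrow> (\<exists>k::nat. y = x [^] k)"
  by (auto simp: generate_pow_on_finite_carrier[OF fin])

lemma cyc_self: "x \<in> cyc x"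
  by (simp add: generate.incl)

lemma cyc_subset: "subgroup H G \<Longrightarrow> x \<in> H \<Longrightarrow> cyc x \<subseteq> H"
  by (simp add: generate_subgroup_incl)

lemma conjs_cyc:
  assumes "g \<in> carrier G" "x \<in> carrier G" shows "conjs g (cyc x) = cyc (conj g x)"
proof -
  have "cyc x = range (\<lambda>k::nat. x [^] k)" if "x \<in> carrier G" for x
    using mem_cyc[OF that] by auto
  then show ?thesis using assms by (simp add: image_image conj_pow)
qed

lemma ord_pos: "x \<in> carrier G \<Longrightarrow> 0 < ord x"
  using card_subgroup_pos[OF subgroup_cyc] by (simp add: card_cyc)

lemma ord_dvd_card: "subgroup H G \<Longrightarrow> x \<in> H \<Longrightarrow> ord x dvd card H"
  using card_subgroup_mono_dvd[OF subgroup_cyc _ cyc_subset, of x H] card_cyc[of x]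
  by (simp add: subgroup.mem_carrier)

lemma pow_card_subgroup:
  assumes "subgroup H G" "x \<in> H" shows "x [^] card H = \<one>"
  using ord_dvd_card[OF assms] pow_eq_id[OF subgroup.mem_carrier[OF assms]] by simp

lemma pow_subgroup_closed: "subgroup H G \<Longrightarrow> x \<in> H \<Longrightarrow> x [^] (k::nat) \<in> H"
  by (induction k) (simp_all add: subgroup.one_closed subgroup.m_closed)

lemma ord_eq_prime:
  assumes "x \<in> carrier G" "prime p" "x [^] p = \<one>" "x \<noteq> \<one>" shows "ord x = p"
proof -
  have "ord x dvd p" using pow_eq_id[OF assms(1)] assms(3) by blast
  then show ?thesis using ord_eq_1[OF assms(1)] assms(2,4) by (auto simp: prime_nat_iff)
qed

lemma coprime_card_Int:
  assumes "subgroup H G" "subgroup K G" "coprime (card H) (card K)" shows "H \<inter> K = {\<one>}"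
proof -
  have "x = \<one>" if "x \<in> H" "x \<in> K" for x
  proof -
    have "ord x dvd 1"
      using ord_dvd_card[OF assms(1) that(1)] ord_dvd_card[OF assms(2) that(2)] assms(3)
      by (meson coprime_common_divisor)
    then show ?thesis using ord_eq_1 subgroup.mem_carrier[OF assms(1) that(1)] by simp
  qed
  moreover have "\<one> \<in> H" "\<one> \<in> K" using assms by (simp_all add: subgroup.one_closed)
  ultimately show ?thesis by blast
qed

text \<open>\<open>H\<close> acts on left cosets of \<open>K\<close>; the orbit of \<open>K\<close> consists of the cosets that make up \<open>H <#> K\<close>, and
  its stabilizer is \<open>H \<inter> K\<close>.\<close>

lemma card_set_mult_Int:
  assumes H: "subgroup H G" and K: "subgroup K G"
  shows "card (H <#> K) * card (H \<inter> K) = card H * card K"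
proof -
  have sub: "H \<subseteq> carrier G" "K \<subseteq> carrier G" using assms by (simp_all add: subgroup.subset)
  interpret HG: group "G\<lparr>carrier := H\<rparr>" by (simp add: H subgroup_imp_group)
  let ?C = "(\<lambda>h. l_coset G h K) ` H"
  have "card ((\<lambda>h. l_coset G h K) ` carrier (G\<lparr>carrier := H\<rparr>)) *
        card {h \<in> carrier (G\<lparr>carrier := H\<rparr>). l_coset G h K = K} = order (G\<lparr>carrier := H\<rparr>)"
  proof (rule card_orbit_mult_card_stabilizer[where E = "Pow (carrier G)" and f = "l_coset G"])
    show "l_coset G g e \<in> Pow (carrier G)"
      if "g \<in> carrier (G\<lparr>carrier := H\<rparr>)" "e \<in> Pow (carrier G)" for g e
      using l_coset_subset_G[of e g] that sub by auto
    show "l_coset G (g \<otimes>\<^bsub>G\<lparr>carrier := H\<rparr>\<^esub> k) e = l_coset G g (l_coset G k e)"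
      if "g \<in> carrier (G\<lparr>carrier := H\<rparr>)" "k \<in> carrier (G\<lparr>carrier := H\<rparr>)" "e \<in> Pow (carrier G)" for g k e
      using lcos_m_assoc[of e g k] that sub by auto
  qed (use sub HG.is_group in \<open>auto simp: lcos_mult_one\<close>)
  moreover have "{h \<in> H. l_coset G h K = K} = H \<inter> K"
  proof -
    have "l_coset G h K = K \<longleftrightarrow> h \<in> K" if "h \<in> H" for h
    proof
      assume "l_coset G h K = K"
      moreover have "h \<otimes> \<one> \<in> l_coset G h K" using subgroup.one_closed[OF K] unfolding l_coset_def by blast
      ultimately show "h \<in> K" using that sub by auto
    next
      assume "h \<in> K" then show "l_coset G h K = K"
        using coset_join3[of h K] K sub by blast
    qed
    then show ?thesis by auto
  qed
  ultimately have 1: "card ?C * card (H \<inter> K) = card H" by (simp add: order_def)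
  have "H <#> K = \<Union> ?C" by (auto simp: set_mult_def l_coset_def)
  moreover have "card (\<Union> ?C) = card ?C * card K"
  proof (subst mult.commute, rule card_partition[symmetric])
    show "finite ?C" using H finite_subgroup by blast
    show "finite (\<Union> ?C)" using sub by (intro finite_subset[OF _ fin]) (auto simp: l_coset_def)
    show "card c = card K" if c: "c \<in> ?C" for c
    proof -
      obtain h where h: "h \<in> H" "c = l_coset G h K" using c by blast
      have "c = (\<lambda>k. h \<otimes> k) ` K" using h by (auto simp: l_coset_def)
      moreover have "inj_on (\<lambda>k. h \<otimes> k) K"
        using h sub by (intro inj_onI) (auto simp: subset_iff)
      ultimately show ?thesis by (simp add: card_image)
    qed
    show "c1 \<inter> c2 = {}" if c: "c1 \<in> ?C" "c2 \<in> ?C" "c1 \<noteq> c2" for c1 c2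
    proof (rule ccontr)
      assume "c1 \<inter> c2 \<noteq> {}"
      then obtain x h1 h2 where x: "x \<in> l_coset G h1 K" "x \<in> l_coset G h2 K" "c1 = l_coset G h1 K" "c2 = l_coset G h2 K"
        "h1 \<in> H" "h2 \<in> H" using c by blast
      then have "l_coset G h1 K = l_coset G x K" "l_coset G h2 K = l_coset G x K"
        using l_repr_independence[OF _ _ K, of x] sub by blast+
      then show False using x c by simp
    qed
  qed
  ultimately have "card (H <#> K) = card ?C * card K" by simp
  then show ?thesis using 1 by (metis mult.assoc mult.commute)
qed

lemma comax_card_mult:
  assumes "subgroup H G" "subgroup K G" "H <#> K = carrier G"
  shows "card H * card K = order G * card (H \<inter> K)"
  using card_set_mult_Int[OF assms(1,2)] assms(3) by (simp add: order_def)

text \<open>This lemma and the next supply the non-comaximal pairs of all counting arguments.\<close>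

lemma not_comax_dvd:
  assumes "subgroup H G" "subgroup K G" "\<not> order G dvd card H * card K"
  shows "H <#> K \<noteq> carrier G"
  using comax_card_mult[OF assms(1,2)] assms(3) by auto

lemma not_comax_within:
  assumes "subgroup M G" "M \<noteq> carrier G" "H \<subseteq> M" "K \<subseteq> M"
  shows "H <#> K \<noteq> carrier G"
proof
  assume *: "H <#> K = carrier G"
  have "H <#> K \<subseteq> M" using assms by (auto simp: set_mult_def intro: subgroup.m_closed)
  then show False using * assms subgroup.subset by blast
qed

lemma set_mult_eq_carrier:
  assumes "subgroup H G" "subgroup K G" "H \<inter> K = {\<one>}" "card H * card K = order G"
  shows "H <#> K = carrier G"
proof -
  have "card (H <#> K) = order G" using card_set_mult_Int[OF assms(1,2)] assms(3,4) by simp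
  moreover have "H <#> K \<subseteq> carrier G"
    using assms(1,2) by (simp add: setmult_subset_G subgroup.subset)
  ultimately show ?thesis by (simp add: card_subset_eq order_def)
qed

lemma Cauchy_subgroup:
  assumes "prime p" "p dvd order G" shows "\<exists>g\<in>carrier G. ord g = p"
proof -
  obtain m where "order G = p ^ 1 * m" using assms(2) by auto
  from sylow_thm[OF assms(1) is_group this fin] obtain H where H: "subgroup H G" "card H = p" by auto
  have "1 < card H" using H prime_gt_1_nat[OF assms(1)] by simp
  then have "\<not> H \<subseteq> {\<one>}" using card_mono[of "{\<one>}" H] by auto
  then obtain g where g: "g \<in> H" "g \<noteq> \<one>" by auto
  have "g [^] p = \<one>" using pow_card_subgroup[OF H(1) g(1)] H(2) by simp
  then show ?thesis using ord_eq_prime[OF _ assms(1)] g subgroup.mem_carrier[OF H(1)] by blast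
qed

lemma Sylow_subgroup:
  assumes "prime p" shows "\<exists>Q. subgroup Q G \<and> card Q = p ^ multiplicity p (order G)"
proof -
  have "p ^ multiplicity p (order G) dvd order G" by (rule multiplicity_dvd)
  then obtain m where "order G = p ^ multiplicity p (order G) * m" by auto
  from sylow_thm[OF assms is_group this fin] show ?thesis .
qed

lemma order_Mod:
  assumes "N \<lhd> G" shows "order (G Mod N) * card N = order G"
  using lagrange[OF normal_imp_subgroup[OF assms]] by (simp add: order_def FactGroup_def)

text \<open>Cauchy's theorem in the quotient, stated without it.\<close>

lemma Cauchy_mod:
  assumes N: "N \<lhd> G" and "prime p" "p dvd order G div card N"
  shows "\<exists>g\<in>carrier G. g \<notin> N \<and> g [^] p \<in> N"
proof -
  interpret N: normal N G by fact
  have Np: "0 < card N" using card_subgroup_pos[OF N.is_subgroup] .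
  have ord: "order (G Mod N) = order G div card N" 
    using order_Mod[OF N] Np div_mult_self_is_m[of "card N" "order (G Mod N)"] by simp
  interpret Q: finite_group "G Mod N"
    by (simp add: finite_group_def finite_group_axioms_def N.factorgroup_is_group carrier_FactGroup)
  obtain C where C: "C \<in> carrier (G Mod N)" "Q.ord C = p"
    using Q.Cauchy_subgroup[OF assms(2)] assms(3) ord by auto
  obtain g where g: "g \<in> carrier G" "C = N #> g" using C by (auto simp: carrier_FactGroup)
  have "N #> g \<noteq> N" using C g Q.ord_id prime_gt_1_nat[OF assms(2)] by auto
  then have "g \<notin> N" using N.rcos_const[OF is_group] by blast
  moreover have "N #> (g [^] p) = N"
    using Q.pow_ord_eq_1[OF C(1)] C(2) g N.FactGroup_pow[OF g(1), of p] by simp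
  then have "g [^] p \<in> N" using rcos_self[OF _ N.is_subgroup, of "g [^] p"] g(1) by simp
  ultimately show ?thesis using g by blast
qed

end

section \<open>Transfer along surjective homomorphisms\<close>

locale surj_hom = G: finite_group G + H: finite_group H for G (structure) and H (structure) +
  fixes h
  assumes hom_h: "h \<in> hom G H" and surj: "h ` carrier G = carrier H"

sublocale surj_hom \<subseteq> group_hom G H h
  by unfold_locales (rule hom_h)

context surj_hom
begin

text \<open>Taking preimages embeds the subgroups of the quotient into those of \<open>G\<close>.\<close>

definition pre :: "'c set \<Rightarrow> 'a set" where
  "pre K = {g \<in> carrier G. h g \<in> K}"

lemma image_pre: "K \<subseteq> carrier H \<Longrightarrow> h ` pre K = K"
  using surj by (auto simp: pre_def)

lemma pre_inj: "K \<subseteq> carrier H \<Longrightarrow> L \<subseteq> carrier H \<Longrightarrow> pre K = pre L \<longleftrightarrow> K = L"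
  by (metis image_pre)

lemma subgroup_pre: "subgroup K H \<Longrightarrow> subgroup (pre K) G"
  unfolding pre_def
  using subgroup.one_closed[of K H] subgroup.m_closed[of K H] subgroup.m_inv_closed[of K H]
  by (intro G.subgroupI) auto

lemma hom_conj: "x \<in> carrier G \<Longrightarrow> y \<in> carrier G \<Longrightarrow> h (G.conj x y) = H.conj (h x) (h y)"
  by (simp add: G.conj_def H.conj_def)

lemma normal_pre: "K \<lhd> H \<Longrightarrow> pre K \<lhd> G"
  by (auto simp: G.normal_iff_conj H.normal_iff_conj subgroup_pre) (auto simp: pre_def hom_conj)

lemma normal_image: 
  assumes "K \<lhd> G" shows "h ` K \<lhd> H"
proof -
  have "subgroup K G" using assms normal_imp_subgroup by blast
  moreover have "H.conj g (h k) \<in> h ` K" if g: "g \<in> carrier H" and k: "k \<in> K" for g k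
  proof -
    obtain g' where g': "g' \<in> carrier G" "g = h g'" using g surj by blast
    have "G.conj g' k \<in> K" using assms G.normal_conj_closed g'(1) k by blast
    then show ?thesis using hom_conj[OF g'(1)] g' k \<open>subgroup K G\<close> by (metis image_eqI subgroup.mem_carrier)
  qed
  ultimately show ?thesis by (auto simp: H.normal_iff_conj subgroup_img_is_subgroup)
qed

lemma order_kernel: "order H * card (kernel G H h) = order G"
proof -
  have "order (G Mod kernel G H h) = order H"
    using FactGroup_iso_set[OF surj] iso_same_order by blast
  then show ?thesis using G.order_Mod[OF normal_kernel] by simp
qed

lemma card_pre:
  assumes "subgroup K H" shows "card (pre K) = card K * card (kernel G H h)"
proof -
  let ?G = "G\<lparr>carrier := pre K\<rparr>" and ?H = "H\<lparr>carrier := K\<rparr>"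
  have sub: "subgroup (pre K) G" by (rule subgroup_pre[OF assms])
  have "finite (pre K)" "finite K" using G.finite_subgroup[OF sub] H.finite_subgroup[OF assms] .
  then interpret S: surj_hom ?G ?H h
    by (auto simp: surj_hom_def surj_hom_axioms_def finite_group_def finite_group_axioms_def
        G.subgroup_imp_group[OF sub] H.subgroup_imp_group[OF assms] hom_def image_pre[OF subgroup.subset[OF assms]])
       (auto simp: pre_def)
  have "kernel ?G ?H h = kernel G H h"
    using assms by (auto simp: kernel_def pre_def subgroup.one_closed)
  then show ?thesis using S.order_kernel by (simp add: order_def)
qed

end

section \<open>The independence hypothesis\<close>

text \<open>The hypothesis on the independence number in the form in which it is applied: a bound for
  every family of pairwise non-comaximal subgroups.\<close>

locale small_comax = finite_group +
  assumes bound: "F \<subseteq> nontrivial_proper_subgroups G \<Longrightarrow>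
    (\<And>H K. H \<in> F \<Longrightarrow> K \<in> F \<Longrightarrow> H \<noteq> K \<Longrightarrow> H <#> K \<noteq> carrier G) \<Longrightarrow> card F \<le> 14"

lemma small_comaxI:
  assumes "group G" "finite (carrier G)" "independence_number (comaximal_subgroup_graph G) \<le> 14"
  shows "small_comax G"
proof -
  interpret finite_group G using assms by (simp add: finite_group_def finite_group_axioms_def)
  have "card F \<le> 14" if F: "F \<subseteq> nontrivial_proper_subgroups G"
    and ne: "\<And>H K. H \<in> F \<Longrightarrow> K \<in> F \<Longrightarrow> H \<noteq> K \<Longrightarrow> H <#>\<^bsub>G\<^esub> K \<noteq> carrier G" for F
  proof -
    let ?I = "{S. S \<subseteq> fst (comaximal_subgroup_graph G) \<and> indep S (snd (comaximal_subgroup_graph G))}"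
    have "nontrivial_proper_subgroups G \<subseteq> Pow (carrier G)"
      by (auto simp: nontrivial_proper_subgroups_def dest: subgroup.subset)
    then have "finite (nontrivial_proper_subgroups G)" using fin by (meson finite_Pow_iff finite_subset)
    moreover have "?I \<subseteq> Pow (nontrivial_proper_subgroups G)"
      by (auto simp: comaximal_subgroup_graph_def)
    ultimately have "finite ?I" by (meson finite_Pow_iff finite_subset)
    moreover have "F \<in> ?I"
      using F ne by (auto simp: comaximal_subgroup_graph_def indep_def doubleton_eq_iff)
    ultimately have "card F \<le> independence_number (comaximal_subgroup_graph G)"
      unfolding independence_number_def by (intro Max_ge) auto
    then show ?thesis using assms(3) by simp
  qed
  then show ?thesis by unfold_locales auto
qed

lemma (in small_comax) card_family_le:
  assumes "\<And>H. H \<in> F \<Longrightarrow> subgroup H G" "\<And>H. H \<in> F \<Longrightarrow> card H \<noteq> 1"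
    and "\<And>H K. H \<in> F \<Longrightarrow> K \<in> F \<Longrightarrow> H <#> K \<noteq> carrier G"
  shows "card F \<le> 14"
proof (rule bound)
  have "carrier G <#> carrier G = carrier G" by (rule set_mult_carrier_idem[OF subgroup_self])
  then show "F \<subseteq> nontrivial_proper_subgroups G"
    using assms by (fastforce simp: nontrivial_proper_subgroups_def)
qed (use assms in simp)

lemma (in small_comax) card_family_dvd_le:
  assumes "\<And>H. H \<in> F \<Longrightarrow> subgroup H G" "\<And>H. H \<in> F \<Longrightarrow> card H \<noteq> 1"
    and "\<And>H K. H \<in> F \<Longrightarrow> K \<in> F \<Longrightarrow> \<not> order G dvd card H * card K"
  shows "card F \<le> 14"
  by (rule card_family_le) (use assms not_comax_dvd in blast)+

text \<open>Preimages of pairwise non-comaximal subgroups are pairwise non-comaximal.\<close>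

lemma (in surj_hom) small_comax_image:
  assumes "small_comax G" shows "small_comax H"
proof -
  interpret small_comax G by fact
  show ?thesis
  proof unfold_locales
    fix F assume F: "F \<subseteq> nontrivial_proper_subgroups H"
      and ne: "\<And>K L. K \<in> F \<Longrightarrow> L \<in> F \<Longrightarrow> K \<noteq> L \<Longrightarrow> K <#>\<^bsub>H\<^esub> L \<noteq> carrier H"
    have sg: "subgroup K H" if "K \<in> F" for K using F that by (auto simp: nontrivial_proper_subgroups_def)
    have inj: "inj_on pre F" using pre_inj sg subgroup.subset by (metis inj_onI)
    have "card (pre ` F) \<le> 14"
    proof (rule bound)
      show "pre ` F \<subseteq> nontrivial_proper_subgroups G"
      proof
        fix P assume "P \<in> pre ` F"
        then obtain K where K: "K \<in> F" "P = pre K" by blast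
        have K2: "subgroup K H" "K \<noteq> {\<one>\<^bsub>H\<^esub>}" "K \<noteq> carrier H"
          using F K by (auto simp: nontrivial_proper_subgroups_def)
        have "h ` P = K" using image_pre[OF subgroup.subset[OF K2(1)]] K by simp
        then show "P \<in> nontrivial_proper_subgroups G"
          using K2 K subgroup_pre surj by (auto simp: nontrivial_proper_subgroups_def)
      qed
      fix P Q assume "P \<in> pre ` F" "Q \<in> pre ` F" "P \<noteq> Q"
      then obtain K L where KL: "K \<in> F" "L \<in> F" "P = pre K" "Q = pre L" "K \<noteq> L" by blast
      show "P <#>\<^bsub>G\<^esub> Q \<noteq> carrier G"
      proof
        assume *: "P <#>\<^bsub>G\<^esub> Q = carrier G"
        have "h ` (P <#>\<^bsub>G\<^esub> Q) = (h ` P) <#>\<^bsub>H\<^esub> (h ` Q)"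
          using set_mult_hom[OF hom_h, of P Q] KL by (auto simp: pre_def)
        then have "K <#>\<^bsub>H\<^esub> L = carrier H"
          using * KL image_pre[OF subgroup.subset[OF sg[OF KL(1)]]] image_pre[OF subgroup.subset[OF sg[OF KL(2)]]]
            surj by simp
        then show False using ne KL by blast
      qed
    qed
    then show "card F \<le> 14" using card_image[OF inj] by simp
  qed
qed

text \<open>Two subgroups of a proper subgroup are never comaximal in the whole group, so here every family
  of subgroups of \<open>M\<close> is bounded.\<close>

lemma (in small_comax) small_comax_subgroup:
  assumes M: "subgroup M G" "M \<noteq> carrier G" shows "small_comax (G\<lparr>carrier := M\<rparr>)"
proof -
  interpret M: group "G\<lparr>carrier := M\<rparr>" using M by (simp add: subgroup_imp_group)
  show ?thesis
  proof unfold_locales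
    show "finite (carrier (G\<lparr>carrier := M\<rparr>))" using M finite_subgroup by simp
    fix F assume F: "F \<subseteq> nontrivial_proper_subgroups (G\<lparr>carrier := M\<rparr>)"
    have 1: "subgroup H G" "H \<subseteq> M" "H \<noteq> {\<one>}" if "H \<in> F" for H
      using F that M incl_subgroup[OF M(1)] subgroup.subset[of H "G\<lparr>carrier := M\<rparr>"]
      by (auto simp: nontrivial_proper_subgroups_def)
    show "card F \<le> 14"
    proof (rule bound)
      show "F \<subseteq> nontrivial_proper_subgroups G"
        using 1 M subgroup.subset[OF M(1)] by (fastforce simp: nontrivial_proper_subgroups_def)
      show "H <#> K \<noteq> carrier G" if "H \<in> F" "K \<in> F" for H K
        using not_comax_within[OF M] 1(2) that by simp
    qed
  qed
qed

section \<open>Isomorphic copies\<close>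

text \<open>Inductions over the order run over groups of natural numbers, so that quotients stay
  within the type.\<close>

lemma (in finite_group) nat_copy:
  "\<exists>(K :: nat monoid) f. finite_group K \<and> f \<in> iso G K"
proof -
  obtain f :: "'a \<Rightarrow> nat" where f: "inj_on f (carrier G)"
    using finite_imp_inj_to_nat_seg[OF fin] by blast
  have "group (image_group f G)" by (rule inj_imp_image_group_is_group[OF f])
  then have "finite_group (image_group f G)"
    by (simp add: finite_group_def finite_group_axioms_def image_group_carrier)
  then show ?thesis using inj_imp_image_group_iso[OF f] by blast
qed

lemma iso_surj_hom: "finite_group G \<Longrightarrow> finite_group K \<Longrightarrow> f \<in> iso G K \<Longrightarrow> surj_hom G K f"
  by (auto simp: surj_hom_def surj_hom_axioms_def iso_def bij_betw_def)

lemma (in finite_group) quotient_nat_copy: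
  assumes N: "N \<lhd> G"
  shows "\<exists>(K :: nat monoid) h. surj_hom G K h \<and> kernel G K h = N"
proof -
  interpret N: normal N G by fact
  interpret Q: finite_group "G Mod N"
    by (simp add: finite_group_def finite_group_axioms_def N.factorgroup_is_group carrier_FactGroup)
  obtain K :: "nat monoid" and f where K: "finite_group K" "f \<in> iso (G Mod N) K"
    using Q.nat_copy by blast
  interpret K: finite_group K by fact
  let ?h = "f \<circ> (\<lambda>g. N #> g)"
  have f: "f \<in> hom (G Mod N) K" "bij_betw f (carrier (G Mod N)) (carrier K)" using K(2) by (auto simp: iso_def)
  have "?h \<in> hom G K" by (rule Group.hom_compose[OF N.r_coset_hom_Mod f(1)])
  moreover have "?h ` carrier G = carrier K"
    using f(2) by (simp add: bij_betw_def carrier_FactGroup image_comp)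
  ultimately have S: "surj_hom G K ?h"
    by (simp add: surj_hom_def surj_hom_axioms_def finite_group_axioms K.finite_group_axioms)
  have f1: "f N = \<one>\<^bsub>K\<^esub>" using hom_one[OF f(1) Q.is_group K.is_group] by simp
  have cN: "N \<in> carrier (G Mod N)" using Q.one_closed by simp
  have "?h g = \<one>\<^bsub>K\<^esub> \<longleftrightarrow> g \<in> N" if g: "g \<in> carrier G" for g
  proof -
    have "N #> g \<in> carrier (G Mod N)" using g by (simp add: carrier_FactGroup)
    then have "?h g = \<one>\<^bsub>K\<^esub> \<longleftrightarrow> N #> g = N"
      using f(2) f1 cN by (metis bij_betw_def comp_apply inj_on_eq_iff)
    also have "\<dots> \<longleftrightarrow> g \<in> N"
      using N.rcos_const[OF is_group] rcos_self[OF g N.is_subgroup] by blast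
    finally show ?thesis .
  qed
  then have "kernel G K ?h = N" using N.subset by (auto simp: kernel_def)
  then show ?thesis using S by blast
qed

section \<open>Simple groups satisfying the hypothesis\<close>

lemma card_Bij:
  assumes "finite E" shows "card (Bij E) = fact (card E)"
proof -
  let ?t = "\<lambda>f x. if x \<in> E then f x else x"
  have "bij_betw ?t (Bij E) {p. p permutes E}"
  proof (rule bij_betw_byWitness[where f' = "\<lambda>p. restrict p E"])
    show "\<forall>f\<in>Bij E. restrict (?t f) E = f"
      by (auto simp: Bij_def extensional_def fun_eq_iff)
    show "\<forall>p\<in>{p. p permutes E}. ?t (restrict p E) = p"
      by (auto simp: fun_eq_iff permutes_def)
    show "?t ` Bij E \<subseteq> {p. p permutes E}"
    proof clarify
      fix f assume "f \<in> Bij E"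
      then have "bij_betw f E E" by (simp add: Bij_def)
      moreover have "bij_betw (?t f) E E \<longleftrightarrow> bij_betw f E E" by (rule bij_betw_cong) simp
      ultimately have "bij_betw (?t f) E E" by blast
      then show "?t f permutes E" by (rule bij_imp_permutes) auto
    qed
    show "(\<lambda>p. restrict p E) ` {p. p permutes E} \<subseteq> Bij E"
      by (auto simp: Bij_def bij_betw_restrict_eq permutes_imp_bij)
  qed
  from bij_betw_same_card[OF this] show ?thesis by (simp add: card_permutations[OF refl assms])
qed

context finite_group
begin

lemma conj_class_conjs:
  assumes "x \<in> carrier G" "H \<subseteq> carrier G" shows "conj_class (conjs x H) = conj_class H"
proof -
  have "conjs g (conjs x H) \<in> conj_class H" if "g \<in> carrier G" for g
    unfolding conj_class_def
    by (rule image_eqI[of _ _ "g \<otimes> x"]) (use conjs_mult_left[of g x H] that assms in simp_all)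
  moreover have "conjs g H \<in> conj_class (conjs x H)" if "g \<in> carrier G" for g
  proof -
    have "conjs g H = conjs (g \<otimes> inv x) (conjs x H)"
      using that assms by (simp add: conjs_mult_left[symmetric] m_assoc)
    then show ?thesis using that assms by (auto simp: conj_class_def)
  qed
  ultimately show ?thesis by (auto simp: conj_class_def)
qed

lemma conjs_in_conj_class:
  assumes "g \<in> carrier G" "K \<in> conj_class H" "H \<subseteq> carrier G" shows "conjs g K \<in> conj_class H"
proof -
  obtain x where x: "x \<in> carrier G" "K = conjs x H" using assms(2) by (auto simp: conj_class_def)
  then have "conjs g K = conjs (g \<otimes> x) H" using conjs_mult_left[OF assms(1) x(1) assms(3)] by simp
  then show ?thesis unfolding conj_class_def by (rule image_eqI) (use assms(1) x(1) in simp)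
qed

text \<open>A simple group acts faithfully on every nontrivial class of conjugate subgroups.\<close>

lemma simple_order_dvd_fact:
  assumes simple: "\<And>N. N \<lhd> G \<Longrightarrow> N = {\<one>} \<or> N = carrier G"
    and H: "subgroup H G" "card (conj_class H) \<noteq> 1"
  shows "order G dvd fact (card (conj_class H))"
proof -
  let ?E = "conj_class H" and ?\<phi> = "\<lambda>g. restrict (conjs g) (conj_class H)"
  have sub: "H \<subseteq> carrier G" using H by (simp add: subgroup.subset)
  have subE: "K \<subseteq> carrier G" if "K \<in> ?E" for K using that sub by (auto simp: conj_class_def)
  interpret A: group_action G ?E ?\<phi>
  proof (rule group_action_of_fun[OF is_group])
    show "conjs g K \<in> ?E" if "g \<in> carrier G" "K \<in> ?E" for g K
      by (rule conjs_in_conj_class[OF that sub])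
    show "conjs \<one> K = K" if "K \<in> ?E" for K by (rule conjs_one[OF subE[OF that]])
    show "conjs (g \<otimes> h) K = conjs g (conjs h K)"
      if "g \<in> carrier G" "h \<in> carrier G" "K \<in> ?E" for g h K
      by (rule conjs_mult_left[OF that(1,2) subE[OF that(3)]])
  qed
  interpret h: group_hom G "BijGroup ?E" ?\<phi> by (rule A.group_hom)
  have "kernel G (BijGroup ?E) ?\<phi> \<noteq> carrier G"
  proof
    assume *: "kernel G (BijGroup ?E) ?\<phi> = carrier G"
    have "H \<in> ?E" using conjs_one[OF sub] by (force simp: conj_class_def)
    have "conjs g H = H" if "g \<in> carrier G" for g
    proof -
      have "?\<phi> g = (\<lambda>x\<in>?E. x)" using that * by (auto simp: kernel_def BijGroup_def)
      then have "?\<phi> g H = H" using \<open>H \<in> ?E\<close> by simp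
      then show ?thesis using \<open>H \<in> ?E\<close> by simp
    qed
    then have "?E = {H}" using one_closed by (auto simp: conj_class_def)
    then show False using H(2) by simp
  qed
  then have "kernel G (BijGroup ?E) ?\<phi> = {\<one>}" using simple h.normal_kernel by blast
  then have "inj_on ?\<phi> (carrier G)" using h.trivial_ker_imp_inj by blast
  then have "card (?\<phi> ` carrier G) = order G" by (simp add: card_image order_def)
  moreover have "card (?\<phi> ` carrier G) dvd order (BijGroup ?E)"
    using group.lagrange[OF group_BijGroup h.img_is_subgroup] by (metis dvd_triv_right)
  ultimately show ?thesis by (simp add: order_def BijGroup_def card_Bij)
qed

lemma subgroup_of_prime_power_order:
  assumes "prime p" "p ^ k dvd order G" shows "\<exists>H. subgroup H G \<and> card H = p ^ k"
  using assms sylow_thm[OF assms(1) is_group _ fin] by (auto elim!: dvdE)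

text \<open>The fixed points of conjugation form the center, and their number is divisible by \<open>p\<close>.\<close>

lemma p_group_center_nontrivial:
  assumes "prime p" "order G = p ^ n" "n \<noteq> 0"
  shows "\<exists>z\<in>carrier G. z \<noteq> \<one> \<and> (\<forall>g\<in>carrier G. conj g z = z)"
proof (rule ccontr)
  assume *: "\<not> ?thesis"
  have "[card (carrier G) = card {e \<in> carrier G. \<forall>g\<in>carrier G. conj g e = e}] (mod p)"
    by (rule p_group_card_fixed_points[OF is_group assms(2,1) fin]) (auto simp: conj_mult_left)
  moreover have "{e \<in> carrier G. \<forall>g\<in>carrier G. conj g e = e} = {\<one>}" using * by auto
  moreover have "[card (carrier G) = 0] (mod p)" using assms by (simp add: cong_0_iff order_def)
  ultimately have "[0 = 1] (mod p)" by (metis One_nat_def card.empty card.insert cong_sym cong_trans empty_iff finite.emptyI)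
  then show False using prime_gt_1_nat[OF assms(1)] by (simp add: cong_def)
qed

end

lemma prime_power_if_unique_prime_divisor:
  fixes n :: nat
  assumes "n > 0" "prime p" "\<And>r. prime r \<Longrightarrow> r dvd n \<Longrightarrow> r = p" shows "\<exists>k. n = p ^ k"
proof -
  obtain k m where m: "n = p ^ k * m" "\<not> p dvd m"
    using multiplicity_decompose'[of n p] assms by (metis mult.commute not_prime_unit gr_implies_not0)
  have "m = 1"
  proof (rule ccontr)
    assume "m \<noteq> 1"
    then obtain r where "prime r" "r dvd m" using prime_factor_nat by blast
    then show False using assms(3)[of r] m by auto
  qed
  then show ?thesis using m by auto
qed

lemma divisors_24:
  fixes n :: nat assumes "n dvd 24" shows "n \<in> {1, 2, 3, 4, 6, 8, 12, 24}"
proof -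
  have "n \<le> 24" "n \<noteq> 0" using assms dvd_imp_le[of n 24] by (auto intro: Nat.gr0I)
  moreover have "{1..24::nat} = {1,2,3,4,5,6,7,8,9,10,11,12,13,14,15,16,17,18,19,20,21,22,23,24}" by code_simp
  ultimately have "n \<in> {1,2,3,4,5,6,7,8,9,10,11,12,13,14,15,16,17,18,19,20,21,22,23,24}" by fastforce
  then show ?thesis by (elim insertE emptyE) (use assms in simp_all)
qed

text \<open>Three classes of five conjugates each exceed the bound.\<close>

lemma (in small_comax) three_conj_classes:
  assumes sub: "subgroup A G" "subgroup B G" "subgroup C G"
    and big: "5 \<le> card (conj_class A)" "5 \<le> card (conj_class B)" "5 \<le> card (conj_class C)"
    and ne: "card A \<noteq> card B" "card A \<noteq> card C" "card B \<noteq> card C" "card A \<noteq> 1" "card B \<noteq> 1" "card C \<noteq> 1"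
    and nd: "\<And>a b. a \<in> {card A, card B, card C} \<Longrightarrow> b \<in> {card A, card B, card C} \<Longrightarrow> \<not> order G dvd a * b"
  shows False
proof -
  let ?F = "conj_class A \<union> conj_class B \<union> conj_class C"
  have sA: "\<And>K. K \<in> conj_class A \<Longrightarrow> subgroup K G \<and> card K = card A"
    and sB: "\<And>K. K \<in> conj_class B \<Longrightarrow> subgroup K G \<and> card K = card B"
    and sC: "\<And>K. K \<in> conj_class C \<Longrightarrow> subgroup K G \<and> card K = card C"
    using conj_class_subgroups sub by blast+
  have "card ?F \<le> 14"
  proof (rule card_family_dvd_le)
    show "subgroup H G" "card H \<noteq> 1" if "H \<in> ?F" for H using that sA sB sC ne by auto
    show "\<not> order G dvd card H * card K" if "H \<in> ?F" "K \<in> ?F" for H K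
    proof (rule nd)
      show "card H \<in> {card A, card B, card C}" "card K \<in> {card A, card B, card C}"
        using that sA sB sC by blast+
    qed
  qed
  moreover have "card ?F = card (conj_class A) + card (conj_class B) + card (conj_class C)"
    using sA sB sC ne by (subst card_Un_disjoint | force)+
  ultimately show False using big by linarith
qed

locale simple_small_comax = small_comax +
  assumes simple: "N \<lhd> G \<Longrightarrow> N = {\<one>} \<or> N = carrier G"
    and order_not_1: "order G \<noteq> 1" and order_not_prime: "\<not> prime (order G)"
begin

lemma card_conj_class_not_1:
  assumes "subgroup H G" "card H \<noteq> 1" "card H \<noteq> order G" shows "card (conj_class H) \<noteq> 1"
proof
  assume "card (conj_class H) = 1"
  then have "H \<lhd> G" by (rule card_conj_class_eq_1[OF assms(1)])
  then have "H = {\<one>} \<or> H = carrier G" by (rule simple)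
  then show False using assms by (auto simp: order_def)
qed

lemma order_not_prime_power:
  assumes "prime p" shows "order G \<noteq> p ^ n"
proof
  assume o: "order G = p ^ n"
  have n: "n \<noteq> 0" using o order_not_1 by (metis power_0)
  let ?Z = "{z \<in> carrier G. \<forall>g\<in>carrier G. conj g z = z}"
  have "?Z \<lhd> G"
    unfolding normal_iff_conj by (auto intro!: subgroupI simp: conj_inv conj_mult)
  moreover have "?Z \<noteq> {\<one>}" using p_group_center_nontrivial[OF assms o n] by blast
  ultimately have Z: "?Z = carrier G" using simple by blast
  obtain g where g: "g \<in> carrier G" "ord g = p"
    using Cauchy_subgroup[OF assms] o n by (metis dvd_power neq0_conv)
  have "cyc g \<lhd> G"
    unfolding normal_iff_conj
  proof (intro conjI ballI)
    show "conj x n \<in> cyc g" if "x \<in> carrier G" "n \<in> cyc g" for x n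
    proof -
      have "n \<in> ?Z" using Z that(2) subgroup.subset[OF subgroup_cyc[OF g(1)]] by blast
      then show ?thesis using that by simp
    qed
  qed (rule subgroup_cyc[OF g(1)])
  moreover have "card (cyc g) = p" using g card_cyc by simp
  moreover have "card (cyc g) \<noteq> card {\<one>}"
    using prime_gt_1_nat[OF assms] \<open>card (cyc g) = p\<close> by simp
  ultimately have "cyc g = carrier G" using simple[of "cyc g"] by metis
  then have "order G = p" using \<open>card (cyc g) = p\<close> by (simp add: order_def)
  then show False using order_not_prime assms by simp
qed

text \<open>With fewer than five conjugates, the order would divide \<open>fact 4\<close>. A simple group of such an order
  would have order 6, 12 or 24, but then its Sylow subgroups have too few conjugates for the
  faithful action on them.\<close>

lemma card_conj_class_ge_5:
  assumes H: "subgroup H G" "card H \<noteq> 1" "card H \<noteq> order G" shows "5 \<le> card (conj_class H)"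
proof (rule ccontr)
  assume "\<not> 5 \<le> card (conj_class H)"
  then have "(fact (card (conj_class H)) :: nat) dvd fact 4" by (intro fact_dvd) simp
  then have "order G dvd fact 4"
    using simple_order_dvd_fact[OF simple H(1) card_conj_class_not_1[OF H]] dvd_trans by blast
  then have d24: "order G dvd 24" by (simp add: fact_numeral)
  then have "order G \<le> 24" by (rule dvd_imp_le) simp
  have no2: "order G \<noteq> 2 ^ n" for n using order_not_prime_power[of 2 n] by simp
  have no3: "order G \<noteq> 3" using order_not_prime by auto
  have "order G \<in> {6, 12, 24}"
    using divisors_24[OF d24] no3 no2[of 0] no2[of 1] no2[of 2] no2[of 3] by auto
  then have "order G = 2 ^ 1 * 3 \<or> order G = 2 ^ 2 * 3 \<or> order G = 2 ^ 3 * 3" by auto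
  then obtain a where a: "order G = 2 ^ a * 3" "1 \<le> a"
    using that[of 1] that[of 2] that[of 3] by auto
  have cls: "card (conj_class K) dvd m \<and> card (conj_class K) \<noteq> 1"
    if "subgroup K G" "order G = card K * m" "m \<noteq> 1" "card K \<noteq> 1" for K m
  proof
    have "card (conj_class K) * card K dvd m * card K"
      using conj_class_mult_card_dvd[OF that(1)] that(2) by (simp add: mult.commute)
    then show "card (conj_class K) dvd m" using card_subgroup_pos[OF that(1)] by simp
    show "card (conj_class K) \<noteq> 1" using card_conj_class_not_1[OF that(1,4)] that order_pos by auto
  qed
  have prime_card: "order G dvd fact r"
    if "subgroup K G" "order G = card K * r" "prime r" "card K \<noteq> 1" for K and r :: nat
  proof -
    have "card (conj_class K) = r"
      using cls[OF that(1,2) _ that(4)] that(3) by (auto simp: prime_nat_iff)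
    then show ?thesis using simple_order_dvd_fact[OF simple that(1)] that(3) not_prime_1 by metis
  qed
  obtain K where K: "subgroup K G" "card K = 2 ^ a"
    using subgroup_of_prime_power_order[of 2 a] a by auto
  have "order G dvd fact 3" using prime_card[OF K(1), of 3] K a by auto
  then have "order G \<le> 6" by (intro dvd_imp_le) (simp_all add: fact_numeral)
  then have "2 ^ a \<le> (2::nat) ^ 1" using a by simp
  then have "a = 1" using a(2) power_le_imp_le_exp[of 2 a 1] by simp
  then have o6: "order G = 3 * 2" using a by simp
  obtain L where L: "subgroup L G" "card L = 3" using subgroup_of_prime_power_order[of 3 1] o6 by auto
  have "order G dvd fact 2" using prime_card[OF L(1), of 2] L o6 by auto
  then show False using o6 by (simp add: fact_numeral)
qed

lemma prime_subgroup:
  assumes "prime p" "p ^ k dvd order G" "k \<noteq> 0"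
  obtains A where "subgroup A G" "card A = p ^ k" "5 \<le> card (conj_class A)"
proof -
  obtain A where A: "subgroup A G" "card A = p ^ k" using subgroup_of_prime_power_order assms by blast
  have "card A \<noteq> 1" using A assms(3) prime_gt_1_nat[OF assms(1)] by (simp add: power_eq_1_iff)
  moreover have "card A \<noteq> order G" using order_not_prime_power[OF assms(1), of k] A by simp
  ultimately show thesis using that A card_conj_class_ge_5 by blast
qed

text \<open>Counting the conjugates of Sylow subgroups leaves \<open>q = 3\<close> and nine Sylow \<open>p\<close>-subgroups with
  \<open>p > 3\<close>. One of them acts on the nine and fixes at most itself, so \<open>p\<close> divides 8 or 9.\<close>

lemma two_primes_False_aux:
  assumes pq: "prime p" "prime q" "p \<noteq> q" and o: "order G = p * q ^ b" "b = 1 \<or> b = 2"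
  shows False
proof -
  have pos: "0 < p" "0 < q" "1 < p" "1 < q" using pq prime_gt_0_nat prime_gt_1_nat by auto
  obtain Q where Q: "subgroup Q G" "card Q = q ^ b" "5 \<le> card (conj_class Q)"
    by (rule prime_subgroup[OF pq(2), of b]) (use o in auto)
  have "card (conj_class Q) dvd p" using conj_class_mult_card_dvd[OF Q(1)] Q(2) o pos by simp
  then have "card (conj_class Q) = p" using Q(3) pq(1) by (auto simp: prime_nat_iff)
  then have "order G dvd fact p" using simple_order_dvd_fact[OF simple Q(1)] pos(3) by simp
  then have "p * q ^ b dvd p * fact (p - 1)" using o pos by (simp add: fact_reduce)
  then have "q ^ b dvd fact (p - 1)" using pos by simp
  then have "q dvd fact (p - 1)" using o(2) by (metis dvd_power dvd_trans zero_less_one zero_less_numeral)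
  then have "q < p" using pq pos prime_dvd_fact_iff[OF pq(2), of "p - 1"] by simp
  have "coprime p q" using pq primes_coprime by blast
  obtain P where P: "subgroup P G" "card P = p ^ 1" "5 \<le> card (conj_class P)"
    using prime_subgroup[OF pq(1), of 1] o by auto
  have "card (conj_class P) dvd q ^ b" using conj_class_mult_card_dvd[OF P(1)] P(2) o pos by simp
  then obtain j where j: "card (conj_class P) = q ^ j" "j \<le> b" using divides_primepow_nat[OF pq(2)] by blast
  have "order G dvd fact (card (conj_class P))" using simple_order_dvd_fact[OF simple P(1)] P(3) by auto
  then have "p dvd fact (q ^ j)" using o j by (metis dvd_mult_left)
  then have "p \<le> q ^ j" using prime_dvd_fact_iff[OF pq(1)] by simp
  then have "j = 2" "b = 2" using \<open>q < p\<close> o(2) j(2) pos by (auto simp: le_Suc_eq numeral_2_eq_2)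
  have "card (conj_class P) \<le> 14"
  proof (rule card_family_dvd_le)
    show "subgroup H G" "card H \<noteq> 1" if "H \<in> conj_class P" for H
      using conj_class_subgroups[OF P(1) that] P(2) pos by auto
    fix H K assume "H \<in> conj_class P" "K \<in> conj_class P"
    then have "card H = p" "card K = p" using conj_class_subgroups[OF P(1)] P(2) by auto
    moreover have "\<not> q dvd p * p" using pq by (metis prime_dvd_mult_iff primes_dvd_imp_eq)
    moreover have "q dvd order G" using o \<open>b = 2\<close> by simp
    ultimately show "\<not> order G dvd card H * card K" using dvd_trans by metis
  qed
  then have "q ^ 2 \<le> 14" "5 \<le> q ^ 2" using j P(3) \<open>j = 2\<close> by auto
  then have "q = 3"
  proof -
    have "q < 4"
    proof (rule ccontr)
      assume "\<not> q < 4"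
      then show False using \<open>q ^ 2 \<le> 14\<close> power_mono[of 4 q 2] by simp
    qed
    then have "q = 2 \<or> q = 3" using pos by auto
    then show ?thesis using \<open>5 \<le> q ^ 2\<close> by auto
  qed
  then have nine: "card (conj_class P) = 9" and o9: "order G = p * 9" using j o \<open>j = 2\<close> \<open>b = 2\<close> by auto
  have subP: "P \<subseteq> carrier G" using P(1) by (rule subgroup.subset)
  \<comment> \<open>A conjugate of \<open>P\<close> is its own normalizer, so \<open>P\<close> normalizes none of the others.\<close>
  have fixP: "K = P" if K: "K \<in> conj_class P" "\<forall>g\<in>P. conjs g K = K" for K
  proof -
    obtain x where x: "x \<in> carrier G" "K = conjs x P" using K by (auto simp: conj_class_def)
    have sK: "subgroup K G" "card K = p" using conj_class_subgroups[OF P(1) K(1)] P(2) by auto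
    have subK: "K \<subseteq> carrier G" using sK(1) by (rule subgroup.subset)
    let ?S = "{g \<in> carrier G. conjs g K = K}"
    have "9 * card ?S = p * 9"
      using card_conj_class_mult[OF subK] conj_class_conjs[OF x(1) subP] x(2) nine o9 by simp
    then have cS: "card ?S = p" by simp
    have "finite ?S" by simp
    have "P \<subseteq> ?S" using K subP by auto
    then have "P = ?S" using card_subset_eq[OF \<open>finite ?S\<close>] P(2) cS by simp
    moreover have "K \<subseteq> ?S"
    proof
      fix k assume k: "k \<in> K"
      have "conjs k K \<subseteq> K"
        using k sK(1) by (auto simp: conj_def intro!: subgroup.m_closed subgroup.m_inv_closed)
      then have "conjs k K = K"
        by (rule card_subset_eq[OF finite_subgroup[OF sK(1)]]) (use k subK in \<open>simp add: subsetD\<close>)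
      then show "k \<in> ?S" using k subK by auto
    qed
    then have "K = ?S" using card_subset_eq[OF \<open>finite ?S\<close>] sK(2) cS by simp
    ultimately show ?thesis by simp
  qed
  let ?P = "G\<lparr>carrier := P\<rparr>"
  have "[card (conj_class P) = card {K \<in> conj_class P. \<forall>g\<in>carrier ?P. conjs g K = K}] (mod p)"
  proof (rule p_group_card_fixed_points[where n = 1])
    show "group ?P" using P(1) by (simp add: subgroup_imp_group)
    show "order ?P = p ^ 1" using P(2) by (simp add: order_def)
    show "conjs g K \<in> conj_class P" if "g \<in> carrier ?P" "K \<in> conj_class P" for g K
      using conjs_in_conj_class[OF _ that(2) subP] that(1) subP by auto
    show "conjs \<one>\<^bsub>?P\<^esub> K = K" if "K \<in> conj_class P" for K
      using conjs_one conj_class_subgroups[OF P(1) that] subgroup.subset by auto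
    show "conjs (g \<otimes>\<^bsub>?P\<^esub> h) K = conjs g (conjs h K)"
      if "g \<in> carrier ?P" "h \<in> carrier ?P" "K \<in> conj_class P" for g h K
      using that conjs_mult_left[of g h K] conj_class_subgroups[OF P(1) that(3)] subP
      by (auto simp: subgroup.subset subsetD)
  qed (use pq in auto)
  then have c9: "[9 = card {K \<in> conj_class P. \<forall>g\<in>carrier ?P. conjs g K = K}] (mod p)"
    using nine by simp
  have "card {K \<in> conj_class P. \<forall>g\<in>carrier ?P. conjs g K = K} \<le> 1"
    using card_mono[of "{P}" "{K \<in> conj_class P. \<forall>g\<in>carrier ?P. conjs g K = K}"] fixP by auto
  then have "card {K \<in> conj_class P. \<forall>g\<in>carrier ?P. conjs g K = K} = 0 \<or>
      card {K \<in> conj_class P. \<forall>g\<in>carrier ?P. conjs g K = K} = 1" by linarith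
  then have "[9 = (0::nat)] (mod p) \<or> [9 = (1::nat)] (mod p)"
    by (elim disjE) (use c9 in \<open>simp_all only: simp_thms\<close>)
  then have "p dvd 9 \<or> p dvd 8" 
    using cong_0_iff[of "9::nat" p] cong_altdef_nat[where a = 9 and b = 1 and m = p] by auto
  then have "p dvd 3 ^ 2 \<or> p dvd 2 ^ 3" by simp
  then have "p dvd 3 \<or> p dvd 2" using prime_dvd_power[OF pq(1)] by metis
  then have "p \<le> 3" using dvd_imp_le[of p 3] dvd_imp_le[of p 2] by auto
  then show False using \<open>q < p\<close> \<open>q = 3\<close> by simp
qed

text \<open>With three prime divisors, the subgroups of these three orders form three large classes. With two,
  orders \<open>p\<close>, \<open>q\<close> and \<open>p ^ a\<close> do when both exponents exceed 1, and orders \<open>p\<close>, \<open>q\<close> and \<open>q\<^sup>2\<close> do when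
  the order is \<open>p * q ^ b\<close> with \<open>b \<ge> 3\<close>. The remaining orders are excluded by the previous lemma.\<close>

lemma False: False
proof -
  obtain p where p: "prime p" "p dvd order G" using order_not_1 prime_factor_nat by blast
  obtain q where q: "prime q" "q dvd order G" "q \<noteq> p"
    using prime_power_if_unique_prime_divisor[OF order_pos p(1)] order_not_prime_power[OF p(1)] by blast
  note gt = prime_gt_1_nat[OF p(1)] prime_gt_1_nat[OF q(1)]
  obtain P where P: "subgroup P G" "card P = p ^ 1" "5 \<le> card (conj_class P)"
    using prime_subgroup[OF p(1), of 1] p by auto
  obtain Q where Q: "subgroup Q G" "card Q = q ^ 1" "5 \<le> card (conj_class Q)"
    using prime_subgroup[OF q(1), of 1] q by auto
  have no_third: "r = p \<or> r = q" if r: "prime r" "r dvd order G" for r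
  proof (rule ccontr)
    assume ne: "\<not> ?thesis"
    obtain R where R: "subgroup R G" "card R = r ^ 1" "5 \<le> card (conj_class R)"
      using prime_subgroup[OF r(1), of 1] r by auto
    have nd: "\<not> order G dvd a * b" if s: "prime s" "s dvd order G" "\<not> s dvd a" "\<not> s dvd b" for s a b
      using s by (metis dvd_trans prime_dvd_mult_iff)
    note pd = primes_dvd_imp_eq[OF p(1) q(1)] primes_dvd_imp_eq[OF p(1) r(1)] primes_dvd_imp_eq[OF q(1) p(1)]
      primes_dvd_imp_eq[OF q(1) r(1)] primes_dvd_imp_eq[OF r(1) p(1)] primes_dvd_imp_eq[OF r(1) q(1)]
    show False
    proof (rule three_conj_classes[OF P(1) Q(1) R(1) P(3) Q(3) R(3)])
      fix a b assume ab: "a \<in> {card P, card Q, card R}" "b \<in> {card P, card Q, card R}"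
      have "\<exists>s\<in>{p, q, r}. \<not> s dvd a \<and> \<not> s dvd b"
        using ab P(2) Q(2) R(2) pd ne q(3) by auto
      then show "\<not> order G dvd a * b" using nd p q r by blast
    qed (use P(2) Q(2) R(2) ne q(3) gt prime_gt_1_nat[OF r(1)] in auto)
  qed
  obtain a m where m: "order G = p ^ a * m" "\<not> p dvd m"
    using multiplicity_decompose'[of "order G" p] p order_pos by (metis mult.commute not_prime_unit gr_implies_not0)
  have "m > 0" using m order_pos by (cases m) auto
  moreover have "r = q" if "prime r" "r dvd m" for r using no_third[OF that(1)] that m by auto
  ultimately obtain b where b: "m = q ^ b"
    using prime_power_if_unique_prime_divisor[OF _ q(1), of m] by blast
  have o: "order G = p ^ a * q ^ b" using m b by simp
  have npq: "\<not> p dvd q" "\<not> q dvd p" using p q primes_dvd_imp_eq by auto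
  have "a \<noteq> 0" using p(2) m by (cases "a = 0") auto
  have "b \<noteq> 0" using q(2) o npq(2) prime_dvd_power[OF q(1), of p a] by (cases "b = 0") auto
  \<comment> \<open>The case that one of the exponents is 1, stated so that it applies to either prime.\<close>
  have caseA: False
    if pq: "prime p'" "prime q'" "p' \<noteq> q'" and o': "order G = p' ^ 1 * q' ^ b'" "b' \<noteq> 0" for p' q' b'
  proof (cases "b' \<le> 2")
    case True
    then show False using two_primes_False_aux[OF pq, of b'] o' by (auto simp: le_Suc_eq numeral_2_eq_2)
  next
    case False
    then have b3: "b' = 3 + (b' - 3)" by simp
    have q3: "q' ^ 3 dvd order G" using o' b3 by (metis dvd_mult dvd_triv_left power_add)
    note gt' = prime_gt_1_nat[OF pq(1)] prime_gt_1_nat[OF pq(2)]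
    have npq': "\<not> q' dvd p'" "\<not> p' dvd q'" using pq primes_dvd_imp_eq by auto
    have q2: "q' ^ 2 dvd order G" using dvd_trans[OF le_imp_power_dvd[of 2 3 q'] q3] by simp
    have p1: "p' dvd order G" "q' dvd order G" using o' by auto
    obtain A where A: "subgroup A G" "card A = p' ^ 1" "5 \<le> card (conj_class A)"
      using prime_subgroup[OF pq(1), of 1] p1 by auto
    obtain B where B: "subgroup B G" "card B = q' ^ 1" "5 \<le> card (conj_class B)"
      using prime_subgroup[OF pq(2), of 1] p1 by auto
    obtain C where C: "subgroup C G" "card C = q' ^ 2" "5 \<le> card (conj_class C)"
      using prime_subgroup[OF pq(2), of 2] q2 by auto
    have np: "\<not> p' dvd q' ^ k" for k using npq' pq prime_dvd_power by blast
    have ncp: "coprime (q' ^ 3) p'" using pq by (simp add: primes_coprime)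
    have nq1: "\<not> q' ^ 3 dvd p' * y" if "\<not> q' ^ 3 dvd y" for y
      using that ncp by (simp add: coprime_dvd_mult_right_iff)
    have nqk: "\<not> q' ^ 3 dvd q' ^ k" if "k < 3" for k
      using that gt' by (simp add: power_dvd_imp_le[of q' 3 k] dvd_power_iff_le)
    have nq0: "\<not> q' ^ 3 dvd p'" using nq1[of 1] nqk[of 0] by simp
    show False
    proof (rule three_conj_classes[OF A(1) B(1) C(1) A(3) B(3) C(3)])
      fix x y assume xy: "x \<in> {card A, card B, card C}" "y \<in> {card A, card B, card C}"
      show "\<not> order G dvd x * y"
      proof (cases "x = p' \<or> y = p'")
        case True
        then obtain z where z: "x * y = p' * z" "z = p' \<or> z = q' ^ 1 \<or> z = q' ^ 2"
          using xy A(2) B(2) C(2) that[of "if x = p' then y else x"]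
          by (auto simp: mult.commute split: if_splits)
        then have "\<not> q' ^ 3 dvd x * y" using nq1 nq0 nqk[of 1] nqk[of 2] by auto
        then show ?thesis using q3 dvd_trans by blast
      next
        case False
        then have "x = q' ^ 1 \<or> x = q' ^ 2" "y = q' ^ 1 \<or> y = q' ^ 2"
          using xy A(2) B(2) C(2) by auto
        then have "\<not> p' dvd x * y" using np pq(1) by (metis prime_dvd_mult_iff)
        then show ?thesis using p1 dvd_trans by blast
      qed
    next
      show "card A \<noteq> card C" using A(2) C(2) np[of 2] by (metis dvd_refl power_one_right)
      show "card B \<noteq> card C" using B(2) C(2) gt' by (simp add: power2_eq_square)
      show "card C \<noteq> 1" using C(2) gt' by (simp add: power2_eq_square)
    qed (use A(2) B(2) pq gt' in auto)
  qed
  show False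
  proof (cases "a = 1 \<or> b = 1")
    case True
    then show False using caseA[of p q b] caseA[of q p a] o p q \<open>a \<noteq> 0\<close> \<open>b \<noteq> 0\<close>
      by (auto simp: mult.commute)
  next
    case False
    then have ab: "2 \<le> a" "2 \<le> b" using \<open>a \<noteq> 0\<close> \<open>b \<noteq> 0\<close> by auto
    obtain C where C: "subgroup C G" "card C = p ^ a" "5 \<le> card (conj_class C)"
      using prime_subgroup[OF p(1), of a] o \<open>a \<noteq> 0\<close> by auto
    have q2: "q ^ 2 dvd order G" and p2: "p ^ 2 dvd order G"
      using o ab le_imp_power_dvd[of 2 b q] le_imp_power_dvd[of 2 a p] by (simp_all add: dvd_mult dvd_mult2)
    have nqp: "\<not> q dvd p ^ k" for k using npq q(1) prime_dvd_power by blast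
    have nqq: "\<not> q ^ 2 dvd p ^ k * q" for k
    proof
      assume "q ^ 2 dvd p ^ k * q"
      then have "q * q dvd p ^ k * q" by (simp add: power2_eq_square)
      then show False using nqp gt by simp
    qed
    have npqq: "\<not> p dvd q * q" using npq p(1) prime_dvd_mult_iff by blast
    show False
    proof (rule three_conj_classes[OF P(1) Q(1) C(1) P(3) Q(3) C(3)])
      fix x y assume xy: "x \<in> {card P, card Q, card C}" "y \<in> {card P, card Q, card C}"
      have *: "z = q \<or> (\<exists>k. z = p ^ k)" if "z \<in> {card P, card Q, card C}" for z
        using that P(2) Q(2) C(2) by (metis insertE singletonD power_one_right)
      note x = *[OF xy(1)] and y = *[OF xy(2)]
      consider "x = q" "y = q" | k l where "x = p ^ k" "y = p ^ l" | k where "x * y = p ^ k * q"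
        using x y by (metis mult.commute)
      then show "\<not> order G dvd x * y"
      proof cases
        case 1 then show ?thesis using npqq p dvd_trans by blast
      next
        case 2 then show ?thesis using nqp q dvd_trans power_add by metis
      next
        case 3 then show ?thesis using nqq q2 dvd_trans by metis
      qed
    next
      show "card P \<noteq> card C" using P(2) C(2) ab gt power_inject_exp[of p 1 a] by auto
      show "card Q \<noteq> card C" using Q(2) C(2) nqp[of a] by (metis dvd_refl power_one_right)
      show "card C \<noteq> 1" using C(2) gt \<open>a \<noteq> 0\<close> by (simp add: power_eq_1_iff)
    qed (use P(2) Q(2) q gt in auto)
  qed
qed

end

section \<open>Solvability and chief factors\<close>

lemma (in group) inv_mult_cancel [simp]:
  "x \<in> carrier G \<Longrightarrow> y \<in> carrier G \<Longrightarrow> inv x \<otimes> (x \<otimes> y) = y"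
  "x \<in> carrier G \<Longrightarrow> y \<in> carrier G \<Longrightarrow> x \<otimes> (inv x \<otimes> y) = y"
  by (simp_all add: m_assoc[symmetric])

lemma (in finite_group) prime_order_imp_solvable:
  assumes "prime (order G)" shows "solvable G"
proof -
  obtain g where g: "g \<in> carrier G" "ord g = order G" using Cauchy_subgroup[OF assms] by auto
  have cyc: "cyc g = carrier G"
    by (rule card_eq_imp_carrier[OF subgroup_cyc[OF g(1)]]) (use g card_cyc in simp)
  have comm: "x \<otimes> y = y \<otimes> x" if xy: "x \<in> carrier G" "y \<in> carrier G" for x y
  proof -
    obtain i j :: nat where "x = g [^] i" "y = g [^] j" using xy mem_cyc[OF g(1)] cyc by blast
    then show ?thesis using g(1) by (simp add: nat_pow_mult add.commute)
  qed
  interpret comm_group G by (rule group_comm_groupI) (rule comm)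
  have "(derived G ^^ 1) (carrier G) = {\<one>}" using derived_eq_singleton[of "carrier G"] by simp
  then show ?thesis using solvable_iff_trivial_derived_seq by blast
qed

text \<open>A proper nontrivial normal subgroup and its quotient are smaller and inherit the hypothesis;
  without one, the group is simple and its order is 1 or prime.\<close>

theorem small_comax_solvable:
  fixes G :: "nat monoid" assumes "small_comax G" shows "solvable G"
  using assms
proof (induction "order G" arbitrary: G rule: less_induct)
  case less
  interpret small_comax G by fact
  show ?case
  proof (cases "\<exists>N. N \<lhd> G \<and> N \<noteq> {\<one>\<^bsub>G\<^esub>} \<and> N \<noteq> carrier G")
    case True
    then obtain N where N: "N \<lhd> G" "N \<noteq> {\<one>\<^bsub>G\<^esub>}" "N \<noteq> carrier G" by blast
    have sN: "subgroup N G" using N(1) by (rule normal_imp_subgroup)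
    let ?M = "G\<lparr>carrier := N\<rparr>"
    obtain K :: "nat monoid" and h where K: "surj_hom G K h" "kernel G K h = N"
      using quotient_nat_copy[OF N(1)] by blast
    interpret h: surj_hom G K h by fact
    have M: "small_comax ?M" by (rule small_comax_subgroup[OF sN N(3)])
    have "card N \<noteq> order G" using card_eq_imp_carrier[OF sN] N(3) by blast
    moreover have "card N \<le> order G" using card_subgroup_dvd[OF sN] order_pos by (rule dvd_imp_le)
    ultimately have "order ?M < order G" by (simp add: order_def)
    then have solM: "solvable ?M" using less.hyps M by blast
    have "card N \<noteq> 1" using N(2) subgroup.one_closed[OF sN] by (auto simp: card_1_singleton_iff)
    then have "1 < card N" using card_subgroup_pos[OF sN] by simp
    moreover have "order K * card N = order G" using h.order_kernel K(2) by simp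
    ultimately have "order K < order G" 
      using h.H.order_pos mult_strict_left_mono[of 1 "card N" "order K"] by simp
    then have solK: "solvable K" using less.hyps h.small_comax_image[OF less.prems] by blast
    show ?thesis
    proof (rule solvable_condition[OF _ _ h.surj _ solM solK])
      show "group_hom ?M G id"
        using subgroup_imp_group[OF sN] subgroup.subset[OF sN]
        by (auto simp: group_hom_def group_hom_axioms_def is_group hom_def)
      show "group_hom G K h" by (rule h.group_hom_axioms)
      show "kernel G K h \<subseteq> id ` carrier ?M" using K(2) by simp
    qed
  next
    case False
    consider "order G = 1" | "prime (order G)" | "order G \<noteq> 1" "\<not> prime (order G)" by blast
    then show ?thesis
    proof cases
      case 1
      then have "carrier G = {\<one>\<^bsub>G\<^esub>}" using order_one_triv_iff by simp
      then show ?thesis by (simp add: solvable_def solvable_seq.unity)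
    next
      case 2 then show ?thesis by (rule prime_order_imp_solvable)
    next
      case 3
      interpret simple_small_comax G by unfold_locales (use False 3 in auto)
      show ?thesis using False by blast
    qed
  qed
qed

context finite_group
begin

text \<open>In a solvable group a minimal normal subgroup is abelian, since its derived subgroup is normal in
  the whole group, and of prime exponent, since the elements of order dividing a prime form a
  normal subgroup.\<close>

lemma minimal_normal_subgroup:
  assumes sol: "solvable G" and "order G \<noteq> 1"
  obtains N q where "N \<lhd> G" "N \<noteq> {\<one>}" "prime q" "\<And>u. u \<in> N \<Longrightarrow> u [^] (q::nat) = \<one>"
    "\<And>u v. u \<in> N \<Longrightarrow> v \<in> N \<Longrightarrow> u \<otimes> v = v \<otimes> u"
    "\<And>B. B \<lhd> G \<Longrightarrow> B \<subseteq> N \<Longrightarrow> B = {\<one>} \<or> B = N"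
proof -
  let ?S = "{N. N \<lhd> G \<and> N \<noteq> {\<one>}}"
  have "?S \<subseteq> Pow (carrier G)" using normal_imp_subgroup subgroup.subset by blast
  then have "finite ?S" by (meson fin finite_Pow_iff finite_subset)
  moreover have "carrier G \<in> ?S" using assms(2) normal_self order_one_triv_iff by auto
  ultimately obtain N where N: "N \<in> ?S" and min: "\<forall>B\<in>?S. B \<subseteq> N \<longrightarrow> N = B"
    using finite_has_minimal[of ?S] by blast
  have minN: "B = {\<one>} \<or> B = N" if "B \<lhd> G" "B \<subseteq> N" for B using min that by blast
  have sN: "subgroup N G" using N normal_imp_subgroup by blast
  have subN: "N \<subseteq> carrier G" using sN by (rule subgroup.subset)
  have "derived G N \<noteq> N"
  proof
    assume *: "derived G N = N"
    obtain n where "(derived G ^^ n) N = {\<one>}"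
      using solvable_imp_trivial_derived_seq[OF solvable_subgroup[OF sN sol]] by blast
    moreover have "(derived G ^^ n) N = N" by (induction n) (simp_all add: *)
    ultimately show False using N by simp
  qed
  then have der: "derived G N = {\<one>}"
    using minN[OF derived_is_normal derived_incl[OF subset_refl sN]] N by blast
  have comm: "u \<otimes> v = v \<otimes> u" if "u \<in> N" "v \<in> N" for u v
  proof -
    have "u \<otimes> v \<otimes> inv u \<otimes> inv v \<in> derived G N"
      unfolding derived_def by (rule generate.incl) (use that in blast)
    then have e: "u \<otimes> v \<otimes> inv u \<otimes> inv v = \<one>" using der by simp
    have c: "u \<in> carrier G" "v \<in> carrier G" using that subN by auto
    have "u \<otimes> v = (u \<otimes> v \<otimes> inv u \<otimes> inv v) \<otimes> (v \<otimes> u)" using c by (simp add: m_assoc)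
    then show ?thesis using e c by simp
  qed
  have "card N \<noteq> 1" using N subgroup.one_closed[OF sN] by (auto simp: card_1_singleton_iff)
  then obtain q where q: "prime q" "q dvd card N" using prime_factor_nat by blast
  let ?M = "G\<lparr>carrier := N\<rparr>"
  interpret M: finite_group ?M
    using subgroup_imp_group[OF sN] finite_subgroup[OF sN]
    by (simp add: finite_group_def finite_group_axioms_def)
  obtain w where w: "w \<in> carrier ?M" "M.ord w = q"
    using M.Cauchy_subgroup[OF q(1)] q(2) by (auto simp: order_def)
  have wq: "w [^] q = \<one>" using M.pow_ord_eq_1[OF w(1)] w(2) by (simp add: nat_pow_def)
  have w1: "w \<noteq> \<one>" using M.ord_id w q(1) by auto
  let ?W = "{u \<in> N. u [^] q = \<one>}"
  have "?W \<lhd> G"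
    unfolding normal_iff_conj
  proof (intro conjI ballI)
    show "subgroup ?W G"
      using sN subN comm
      by (intro subgroupI)
         (auto simp: subgroup.one_closed subgroup.m_closed subgroup.m_inv_closed pow_mult_distrib
            subsetD nat_pow_inv intro!: exI[of _ \<one>])
    show "conj g n \<in> ?W" if "g \<in> carrier G" "n \<in> ?W" for g n
      using that N normal_conj_closed subN conj_pow[of g n q] by (auto simp: subsetD)
  qed
  moreover have "?W \<noteq> {\<one>}" using w w1 wq by auto
  ultimately have "?W = N" using minN by blast
  then show thesis using that[OF _ _ q(1)] N comm minN by blast
qed

text \<open>A minimal normal subgroup of the quotient by \<open>C\<close>, pulled back: \<open>A\<close> is elementary abelian modulo \<open>C\<close>.\<close>

lemma chief_factor:
  assumes sol: "solvable G" and C: "C \<lhd> G" "C \<noteq> carrier G"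
  obtains A q where "A \<lhd> G" "C \<subseteq> A" "C \<noteq> A" "prime q" "\<And>u. u \<in> A \<Longrightarrow> u [^] (q::nat) \<in> C"
    "\<And>u v. u \<in> A \<Longrightarrow> v \<in> A \<Longrightarrow> conj u v \<otimes> inv v \<in> C"
    "\<And>B. B \<lhd> G \<Longrightarrow> C \<subseteq> B \<Longrightarrow> B \<subseteq> A \<Longrightarrow> B = C \<or> B = A"
proof -
  obtain K :: "nat monoid" and h where K: "surj_hom G K h" "kernel G K h = C"
    using quotient_nat_copy[OF C(1)] by blast
  interpret h: surj_hom G K h by fact
  have sC: "subgroup C G" using C(1) by (rule normal_imp_subgroup)
  have ker: "h g = \<one>\<^bsub>K\<^esub> \<longleftrightarrow> g \<in> C" if "g \<in> carrier G" for g
    using K(2) that by (auto simp: kernel_def)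
  have oK: "order K \<noteq> 1"
  proof
    assume "order K = 1"
    then have "order G = card C" using h.order_kernel K(2) by simp
    then show False using card_eq_imp_carrier[OF sC] C(2) by simp
  qed
  obtain N q where N: "N \<lhd> K" "N \<noteq> {\<one>\<^bsub>K\<^esub>}" "prime q"
    and pw: "\<And>u. u \<in> N \<Longrightarrow> u [^]\<^bsub>K\<^esub> (q::nat) = \<one>\<^bsub>K\<^esub>"
    and comm: "\<And>u v. u \<in> N \<Longrightarrow> v \<in> N \<Longrightarrow> u \<otimes>\<^bsub>K\<^esub> v = v \<otimes>\<^bsub>K\<^esub> u"
    and min: "\<And>B. B \<lhd> K \<Longrightarrow> B \<subseteq> N \<Longrightarrow> B = {\<one>\<^bsub>K\<^esub>} \<or> B = N"
    by (rule h.H.minimal_normal_subgroup[OF h.surj_hom_imp_solvable[OF h.surj sol] oK]) (rule that, assumption+)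
  have sN: "subgroup N K" using N(1) by (rule normal_imp_subgroup)
  have subN: "N \<subseteq> carrier K" using sN by (rule subgroup.subset)
  show thesis
  proof (rule that[of "h.pre N" q])
    show "h.pre N \<lhd> G" by (rule h.normal_pre[OF N(1)])
    have hC: "h c = \<one>\<^bsub>K\<^esub>" if "c \<in> C" for c using ker[of c] that subgroup.mem_carrier[OF sC that] by simp
    show "C \<subseteq> h.pre N"
      using subgroup.subset[OF sC] subgroup.one_closed[OF sN] by (auto simp: h.pre_def hC)
    have C1: "h.pre {\<one>\<^bsub>K\<^esub>} = C" using ker subgroup.subset[OF sC] hC by (auto simp: h.pre_def)
    then show "C \<noteq> h.pre N" using h.pre_inj[OF _ subN, of "{\<one>\<^bsub>K\<^esub>}"] N(2) by auto
    show "u [^] q \<in> C" if "u \<in> h.pre N" for u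
      using that pw ker[of "u [^] q"] by (auto simp: h.pre_def h.hom_nat_pow)
    show "conj u v \<otimes> inv v \<in> C" if "u \<in> h.pre N" "v \<in> h.pre N" for u v
    proof -
      have c: "u \<in> carrier G" "v \<in> carrier G" "h u \<in> N" "h v \<in> N" using that by (auto simp: h.pre_def)
      then have "h (conj u v) = h v"
        using comm[OF c(3,4)] subN by (simp add: h.hom_conj h.H.conj_fixed_iff subsetD)
      then show ?thesis using ker[of "conj u v \<otimes> inv v"] c by simp
    qed
    show "B = C \<or> B = h.pre N" if "B \<lhd> G" "C \<subseteq> B" "B \<subseteq> h.pre N" for B
    proof -
      have sB: "subgroup B G" using that(1) by (rule normal_imp_subgroup)
      have "h ` B \<subseteq> N" using that(3) by (auto simp: h.pre_def)
      then have "h ` B = {\<one>\<^bsub>K\<^esub>} \<or> h ` B = N" using min[OF h.normal_image[OF that(1)]] by blast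
      moreover have "h.pre (h ` B) = B"
      proof
        show "h.pre (h ` B) \<subseteq> B"
        proof
          fix g assume "g \<in> h.pre (h ` B)"
          then obtain b where b: "g \<in> carrier G" "b \<in> B" "h g = h b" by (auto simp: h.pre_def)
          have bc: "b \<in> carrier G" using b(2) sB by (simp add: subgroup.mem_carrier)
          have "g \<otimes> inv b \<in> C" using ker[of "g \<otimes> inv b"] b bc by simp
          then have "g \<otimes> inv b \<otimes> b \<in> B" using that(2) b(2) subgroup.m_closed[OF sB] by blast
          then show "g \<in> B" using b(1) bc by (simp add: m_assoc)
        qed
        show "B \<subseteq> h.pre (h ` B)" using subgroup.subset[OF sB] by (auto simp: h.pre_def)
      qed
      ultimately show ?thesis using C1 by metis
    qed
  qed (rule N(3))
qed

lemma Cauchy_in_subgroup: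
  assumes H: "subgroup H G" and "prime r" "r dvd card H"
  obtains w where "w \<in> H" "w [^] r = \<one>" "w \<noteq> \<one>"
proof -
  let ?M = "G\<lparr>carrier := H\<rparr>"
  interpret M: finite_group ?M
    using subgroup_imp_group[OF H] finite_subgroup[OF H]
    by (simp add: finite_group_def finite_group_axioms_def)
  obtain w where w: "w \<in> carrier ?M" "M.ord w = r"
    using M.Cauchy_subgroup[OF assms(2)] assms(3) by (auto simp: order_def)
  have "w [^] r = \<one>" using M.pow_ord_eq_1[OF w(1)] w(2) by (simp add: nat_pow_def)
  moreover have "w \<noteq> \<one>" using M.ord_id w assms(2) by auto
  ultimately show thesis using that w(1) by simp
qed

lemma pow_coprime_eq_one:
  assumes "w \<in> carrier G" "w [^] (r::nat) = \<one>" "w [^] (q::nat) = \<one>" "coprime r q" shows "w = \<one>"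
proof -
  have "ord w dvd r" "ord w dvd q" using assms pow_eq_id by auto
  then have "ord w dvd 1" using assms(4) by (meson coprime_common_divisor)
  then show ?thesis using ord_eq_1[OF assms(1)] by simp
qed

text \<open>The commutator of \<open>u\<close> and \<open>n\<close> lies in \<open>Q\<close>, because \<open>n\<close> normalizes \<open>Q\<close>, and in \<open>N\<close>, because \<open>N\<close>
  is normal. Together with the next lemma this shows that a subgroup \<open>Q\<close> that meets \<open>N\<close> trivially and
  centralizes no nontrivial element of \<open>N\<close> has \<open>card N\<close> conjugates under \<open>N\<close>.\<close>

lemma normalizing_imp_centralizing:
  assumes N: "N \<lhd> G" and Q: "subgroup Q G" "N \<inter> Q \<subseteq> {\<one>}"
    and n: "n \<in> N" "conjs n Q = Q" and u: "u \<in> Q"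
  shows "conj u n = n"
proof -
  have sN: "subgroup N G" using N by (rule normal_imp_subgroup)
  have c: "n \<in> carrier G" "u \<in> carrier G"
    using n u subgroup.mem_carrier[OF sN] subgroup.mem_carrier[OF Q(1)] by auto
  have "conj n u \<in> Q" using n(2) u by blast
  then have "conj n u \<otimes> inv u \<in> Q"
    using u subgroup.m_closed[OF Q(1)] subgroup.m_inv_closed[OF Q(1)] by blast
  moreover have "conj n u \<otimes> inv u = n \<otimes> conj u (inv n)" using c by (simp add: conj_def m_assoc)
  moreover have "n \<otimes> conj u (inv n) \<in> N"
    using normal_conj_closed[OF N c(2)] n(1) subgroup.m_closed[OF sN] subgroup.m_inv_closed[OF sN] by simp
  ultimately have "conj n u \<otimes> inv u = \<one>" using Q(2) by auto
  then have "conj n u = u" using c by (simp add: inv_solve_right')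
  then show ?thesis using conj_fixed_sym[OF c] by simp
qed

lemma inj_on_conjs:
  assumes Q: "subgroup Q G" and M: "subgroup M G" "\<And>m. m \<in> M \<Longrightarrow> conjs m Q = Q \<Longrightarrow> m = \<one>"
  shows "inj_on (\<lambda>m. conjs m Q) M"
proof (rule inj_onI)
  fix x y assume xy: "x \<in> M" "y \<in> M" "conjs x Q = conjs y Q"
  have c: "x \<in> carrier G" "y \<in> carrier G" "Q \<subseteq> carrier G"
    using xy subgroup.mem_carrier[OF M(1)] subgroup.subset[OF Q] by auto
  have "conjs (inv y \<otimes> x) Q = conjs (inv y) (conjs y Q)"
    using c xy(3) by (simp add: conjs_mult_left)
  also have "\<dots> = Q" using c by (simp add: conjs_mult_left[symmetric] conjs_one)
  finally have "inv y \<otimes> x = \<one>"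
    by (intro M(2) subgroup.m_closed[OF M(1)] subgroup.m_inv_closed[OF M(1)] xy)
  then show "x = y" using c by (metis inv_equality inv_inv inv_closed)
qed

end

section \<open>Rotations of a Klein four-group\<close>

text \<open>Conjugation by \<open>x\<close> permutes the involutions of the Klein four-group generated by \<open>a\<close> and \<open>b\<close>
  cyclically: from \<open>a\<close> to \<open>b\<close>, to \<open>a \<otimes> b\<close> and back to \<open>a\<close>.\<close>

definition (in group) rot :: "'a \<Rightarrow> 'a \<Rightarrow> 'a \<Rightarrow> bool" where
  "rot a b x \<longleftrightarrow> a \<in> carrier G \<and> b \<in> carrier G \<and> x \<in> carrier G \<and> a \<noteq> \<one> \<and> a \<otimes> a = \<one> \<and> b \<otimes> b = \<one> \<and>
     a \<otimes> b = b \<otimes> a \<and> conj x a = b \<and> conj x b = a \<otimes> b"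

context finite_group
begin

text \<open>By Bezout, \<open>g\<close> is a product of powers of \<open>g [^] r\<close> and \<open>g [^] q\<close>.\<close>

lemma mem_normal_if_coprime_powers:
  assumes C: "subgroup C G" and g: "g \<in> carrier G" "g [^] (r::nat) \<in> C" "g [^] (q::nat) \<in> C"
    and "coprime r q" "q \<noteq> 0"
  shows "g \<in> C"
proof (cases "q = 1")
  case True then show ?thesis using g by simp
next
  case False
  have "r \<noteq> 0" using \<open>coprime r q\<close> False by (cases "r = 0") auto
  from bezout_nat[OF this, of q] obtain s t where st: "r * s = q * t + 1"
    using \<open>coprime r q\<close> by auto
  have "(g [^] r) [^] s = (g [^] q) [^] t \<otimes> g"
    using g(1) st by (simp add: nat_pow_pow)
  moreover have "(g [^] r) [^] s \<in> C" "(g [^] q) [^] t \<in> C" using pow_subgroup_closed[OF C] g by blast+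
  ultimately have "inv ((g [^] q) [^] t) \<otimes> ((g [^] q) [^] t \<otimes> g) \<in> C"
    using subgroup.m_closed[OF C] subgroup.m_inv_closed[OF C] by metis
  then show ?thesis using g(1) by simp
qed

lemma cyc_involution:
  assumes "u \<in> carrier G" "u \<otimes> u = \<one>" shows "cyc u = {\<one>, u}"
proof -
  have "u [^] (k::nat) \<in> {\<one>, u}" for k
    by (induction k) (use assms in auto)
  moreover have "u [^] (0::nat) = \<one>" "u [^] (1::nat) = u" using assms by simp_all
  ultimately have "y \<in> cyc u \<longleftrightarrow> y \<in> {\<one>, u}" for y
    unfolding mem_cyc[OF assms(1)] by (metis insertCI insertE singletonD)
  then show ?thesis by blast
qed

lemma exponent_two_commute:
  assumes "subgroup N G" "\<And>u. u \<in> N \<Longrightarrow> u \<otimes> u = \<one>" "u \<in> N" "v \<in> N"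
  shows "u \<otimes> v = v \<otimes> u"
proof -
  have c: "u \<in> carrier G" "v \<in> carrier G" using assms(3,4) subgroup.mem_carrier[OF assms(1)] by auto
  have i: "inv u = u" "inv v = v" "inv (u \<otimes> v) = u \<otimes> v"
    using assms c subgroup.m_closed[OF assms(1)] by (auto intro!: inv_equality)
  then show ?thesis using c by (simp add: inv_mult_group)
qed

lemma four_elements:
  assumes N: "subgroup N G" "card N = 4" and ex: "\<And>u. u \<in> N \<Longrightarrow> u \<otimes> u = \<one>"
    and ab: "a \<in> N" "b \<in> N" "a \<noteq> \<one>" "b \<noteq> \<one>" "a \<noteq> b"
  shows "N = {\<one>, a, b, a \<otimes> b}"
proof -
  have c: "a \<in> carrier G" "b \<in> carrier G" using ab subgroup.mem_carrier[OF N(1)] by auto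
  have "a \<otimes> b \<noteq> \<one>" using ex[OF ab(1)] c ab(5) by (metis l_cancel_one' inv_equality inv_unique' r_inv_ex inv_comm inv_inv)
  moreover have "a \<otimes> b \<noteq> a" "a \<otimes> b \<noteq> b" using c ab by auto
  ultimately have "card {\<one>, a, b, a \<otimes> b} = 4" using ab by auto
  moreover have "{\<one>, a, b, a \<otimes> b} \<subseteq> N"
    using ab subgroup.one_closed[OF N(1)] subgroup.m_closed[OF N(1)] by auto
  ultimately show ?thesis using card_subset_eq[OF finite_subgroup[OF N(1)]] N(2) by metis
qed

text \<open>An element of odd order acting nontrivially permutes the three involutions cyclically: if it
  fixed one of them, its square would centralize the Klein group.\<close>

lemma rot_if_odd:
  assumes N: "N \<lhd> G" "card N = 4" and ex: "\<And>u. u \<in> N \<Longrightarrow> u \<otimes> u = \<one>"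
    and x: "x \<in> carrier G" "odd (ord x)" "n0 \<in> N" "conj x n0 \<noteq> n0"
    and a: "a \<in> N" "a \<noteq> \<one>"
  shows "rot a (conj x a) x" "N = {\<one>, a, conj x a, a \<otimes> conj x a}"
proof -
  have sN: "subgroup N G" using N(1) by (rule normal_imp_subgroup)
  have comm: "u \<otimes> v = v \<otimes> u" if "u \<in> N" "v \<in> N" for u v
    by (rule exponent_two_commute[OF sN _ that]) (rule ex)
  have four: "N = {\<one>, u, v, u \<otimes> v}" if "u \<in> N" "v \<in> N" "u \<noteq> \<one>" "v \<noteq> \<one>" "u \<noteq> v" for u v
    by (rule four_elements[OF sN N(2) _ that]) (rule ex)
  have subN: "u \<in> carrier G" if "u \<in> N" for u using subgroup.mem_carrier[OF sN that] .
  have clN: "conj x u \<in> N" if "u \<in> N" for u using normal_conj_closed[OF N(1) x(1) that] .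
  have nofix: "conj x w \<noteq> w" if w: "w \<in> N" "w \<noteq> \<one>" for w
  proof
    assume fx: "conj x w = w"
    have sq: "conj (x [^] (2::nat)) n = n" if n: "n \<in> N" for n
    proof (cases "n = \<one> \<or> n = w")
      case True then show ?thesis using fx x(1) w subN by (auto simp: numeral_2_eq_2 conj_mult_left)
    next
      case False
      then have Nn: "N = {\<one>, n, w, n \<otimes> w}" using four[of n w] n w by auto
      have "conj x n \<noteq> \<one>" "conj x n \<noteq> w" 
        using conj_inj[OF x(1), of n \<one>] conj_inj[OF x(1), of n w] False n w subN fx x(1) by auto
      then have "conj x n = n \<or> conj x n = n \<otimes> w" using clN[OF n] Nn by auto
      then have "conj x (conj x n) = n"
        using fx x(1) subN[OF n] subN[OF w(1)] ex[OF w(1)] by (auto simp: conj_mult m_assoc)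
      then show ?thesis using x(1) subN[OF n] by (simp add: numeral_2_eq_2 conj_mult_left)
    qed
    obtain k where k: "ord x = 2 * k + 1" using x(2) by (auto elim: oddE)
    have "x = (x [^] (2::nat)) [^] (k + 1)"
    proof -
      have e: "2 * (k + 1) = Suc (ord x)" using k by simp
      have "(x [^] (2::nat)) [^] (k + 1) = x [^] ord x \<otimes> x"
        unfolding nat_pow_pow[OF x(1)] e by simp
      then show ?thesis using x(1) by simp
    qed
    then have "conj x n0 = n0"
      using conj_pow_left_fixed[of "x [^] (2::nat)" n0 "k + 1"] sq[OF x(3)] x(1) subN[OF x(3)] by simp
    then show False using x(4) by blast
  qed
  let ?b = "conj x a"
  have b: "?b \<in> N" "?b \<noteq> a" "?b \<noteq> \<one>"
    using clN[OF a(1)] nofix[OF a] conj_inj[OF x(1), of a \<one>] a subN x(1) by auto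
  show NN: "N = {\<one>, a, ?b, a \<otimes> ?b}" using four[of a ?b] a b by auto
  have ca: "a \<in> carrier G" "?b \<in> carrier G" using a b subN by auto
  have "conj x ?b \<noteq> \<one>" using conj_inj[OF x(1) ca(2), of \<one>] b x(1) by simp
  moreover have "conj x ?b \<noteq> ?b" using nofix b by blast
  moreover have "conj x ?b \<noteq> a"
  proof
    assume *: "conj x ?b = a"
    have "conj x (a \<otimes> ?b) = a \<otimes> ?b" using * comm[OF b(1) a(1)] ca x(1) by (simp add: conj_mult)
    moreover have "a \<otimes> ?b \<in> N" using NN by blast
    moreover have "a \<otimes> ?b \<noteq> \<one>"
    proof
      assume "a \<otimes> ?b = \<one>"
      then have "inv a = ?b" using ca comm[OF a(1) b(1)] by (intro inv_equality) auto
      moreover have "inv a = a" using ex[OF a(1)] ca by (intro inv_equality) auto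
      ultimately show False using b(2) by simp
    qed
    ultimately show False using nofix by blast
  qed
  ultimately have "conj x ?b = a \<otimes> ?b" using clN[OF b(1)] NN by blast
  then show "rot a ?b x"
    using a ca x(1) ex[OF a(1)] ex[OF b(1)] comm[OF a(1) b(1)] by (simp add: rot_def)
qed

end

section \<open>Noncyclic minimal normal subgroups\<close>

text \<open>A Sylow \<open>q\<close>-subgroup \<open>Q\<close> of \<open>A\<close> maps onto the \<open>q\<close>-group that \<open>A\<close> is modulo \<open>C\<close>.\<close>

lemma (in finite_group) Sylow_supplement:
  assumes A: "subgroup A G" and C: "C \<lhd> G" "C \<subseteq> A" and "prime q"
    and pw: "\<And>u. u \<in> A \<Longrightarrow> u [^] q \<in> C"
  obtains Q m where "subgroup Q G" "Q \<subseteq> A" "card Q = q ^ m" "Q <#> C = A"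
proof -
  let ?A = "G\<lparr>carrier := A\<rparr>"
  interpret A: finite_group ?A
    using subgroup_imp_group[OF A] finite_subgroup[OF A]
    by (simp add: finite_group_def finite_group_axioms_def)
  have sC: "subgroup C G" using C(1) by (rule normal_imp_subgroup)
  have CA: "C \<lhd> ?A" using normal_restrict_supergroup[OF A C] .
  have cC: "0 < card C" using card_subgroup_pos[OF sC] .
  have "card C dvd card A" by (rule card_subgroup_mono_dvd[OF sC A C(2)])
  then obtain i where i: "card A = card C * i" by auto
  have "0 < i" using i card_subgroup_pos[OF A] by (cases i) auto
  moreover have "r = q" if r: "prime r" "r dvd i" for r
  proof (rule ccontr)
    assume "r \<noteq> q"
    then have cop: "coprime r q" using r(1) \<open>prime q\<close> by (simp add: primes_coprime)
    have "r dvd order ?A div card C" using r i cC by (simp add: order_def)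
    then obtain g where g: "g \<in> A" "g \<notin> C" "g [^] r \<in> C"
      using A.Cauchy_mod[OF CA r(1)] by (auto simp: nat_pow_def)
    have "g \<in> C"
      using mem_normal_if_coprime_powers[OF sC _ g(3) pw[OF g(1)] cop] g(1) A \<open>prime q\<close>
        subgroup.mem_carrier[OF A g(1)] by (cases "q = 0") auto
    then show False using g(2) by blast
  qed
  ultimately obtain t where t: "i = q ^ t" using prime_power_if_unique_prime_divisor[OF _ \<open>prime q\<close>] by blast
  obtain Q where Q: "subgroup Q ?A" "card Q = q ^ multiplicity q (card A)"
    using A.Sylow_subgroup[OF \<open>prime q\<close>] by (auto simp: order_def)
  have sQ: "subgroup Q G" using incl_subgroup[OF A Q(1)] .
  have QA: "Q \<subseteq> A" using subgroup.subset[OF Q(1)] by simp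
  have sI: "subgroup (Q \<inter> C) G" using subgroups_Inter_pair[OF sQ sC] .
  have "card (Q \<inter> C) dvd q ^ multiplicity q (card A)"
    using card_subgroup_mono_dvd[OF sI sQ] Q(2) by auto
  then obtain j where j: "card (Q \<inter> C) = q ^ j" using divides_primepow_nat[OF \<open>prime q\<close>] by blast
  have "q ^ j dvd card C" using card_subgroup_mono_dvd[OF sI sC] j by auto
  then have jle: "j \<le> multiplicity q (card C)"
    using cC \<open>prime q\<close> by (intro multiplicity_geI) (auto simp: prime_elem_not_unit)
  have mA: "multiplicity q (card A) = multiplicity q (card C) + t"
    using i t cC \<open>prime q\<close> by (simp add: prime_elem_multiplicity_mult_distrib)
  have q0: "0 < q" using \<open>prime q\<close> prime_gt_0_nat by blast
  have "card (Q <#> C) * q ^ j = q ^ multiplicity q (card A) * card C"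
    using card_set_mult_Int[OF sQ sC] j Q(2) by simp
  also have "\<dots> = q ^ j * (q ^ (multiplicity q (card C) - j) * q ^ t * card C)"
    using mA jle by (simp add: power_add[symmetric] mult.assoc[symmetric])
  finally have "card (Q <#> C) = q ^ (multiplicity q (card C) - j) * (card C * q ^ t)"
    using q0 by (simp add: ac_simps)
  then have "card A \<le> card (Q <#> C)" using i t q0 by simp
  moreover have "Q <#> C \<subseteq> A"
    using QA C(2) subgroup.m_closed[OF A] by (auto simp: set_mult_def)
  ultimately have "Q <#> C = A" using card_seteq finite_subgroup[OF A] by blast
  then show thesis using that[OF sQ QA Q(2)] by blast
qed

text \<open>Let \<open>N\<close> be the minimal normal subgroup and \<open>A\<close> a chief factor above its centralizer. A Sylow
  subgroup \<open>Q\<close> supplementing the centralizer in \<open>A\<close> centralizes no nontrivial element of \<open>N\<close> and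
  therefore has \<open>card N\<close> conjugates. The hypothesis leaves \<open>card N\<close> equal to 4, 8 or 9. Together with the
  subgroups of \<open>N\<close> there are too many for 8, and also for 9 if \<open>A\<close> is proper; otherwise \<open>G\<close> acts on
  \<open>N\<close> by inversion, against minimality.\<close>

lemma (in small_comax) noncyclic_minimal_normal:
  assumes sol: "solvable G" and N: "N \<lhd> G" "N \<noteq> {\<one>}" and p: "prime p"
    and pw: "\<And>u. u \<in> N \<Longrightarrow> u [^] (p::nat) = \<one>"
    and comm: "\<And>u v. u \<in> N \<Longrightarrow> v \<in> N \<Longrightarrow> u \<otimes> v = v \<otimes> u"
    and min: "\<And>B. B \<lhd> G \<Longrightarrow> B \<subseteq> N \<Longrightarrow> B = {\<one>} \<or> B = N"
    and np: "\<not> prime (card N)"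
  obtains a b x where "rot a b x" "N = {\<one>, a, b, a \<otimes> b}"
proof -
  have sN: "subgroup N G" using N(1) by (rule normal_imp_subgroup)
  have subN: "u \<in> carrier G" if "u \<in> N" for u using subgroup.mem_carrier[OF sN that] .
  have oneN: "\<one> \<in> N" using sN by (rule subgroup.one_closed)
  have cN0: "0 < card N" using card_subgroup_pos[OF sN] .
  have "r = p" if r: "prime r" "r dvd card N" for r
  proof (rule ccontr)
    assume "r \<noteq> p"
    then have "coprime r p" using r p by (simp add: primes_coprime)
    obtain w where w: "w \<in> N" "w [^] r = \<one>" "w \<noteq> \<one>" by (rule Cauchy_in_subgroup[OF sN r])
    show False using pow_coprime_eq_one[OF subN[OF w(1)] w(2) pw[OF w(1)] \<open>coprime r p\<close>] w(3) by simp
  qed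
  then obtain k where k: "card N = p ^ k"
    using prime_power_if_unique_prime_divisor[OF cN0 p] by blast
  have "card N \<noteq> 1" using N(2) oneN by (auto simp: card_1_singleton_iff)
  then have k2: "2 \<le> k" using k np p by (cases k; cases "k = 1") auto
  \<comment> \<open>Otherwise the cyclic subgroup of \<open>u\<close> would be normal, hence equal to \<open>N\<close>, and \<open>card N\<close> prime.\<close>
  have noinv: "\<exists>g\<in>carrier G. conj g u \<notin> cyc u" if u: "u \<in> N" "u \<noteq> \<one>" for u
  proof (rule ccontr)
    assume "\<not> ?thesis"
    then have *: "conj g u \<in> cyc u" if "g \<in> carrier G" for g using that by blast
    have uc: "u \<in> carrier G" using u subN by blast
    have "cyc u \<lhd> G"
      unfolding normal_iff_conj
    proof (intro conjI ballI)
      show "conj g n \<in> cyc u" if "g \<in> carrier G" "n \<in> cyc u" for g n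
        using conjs_cyc[OF that(1) uc] cyc_subset[OF subgroup_cyc[OF uc] *[OF that(1)]] that(2) by blast
    qed (rule subgroup_cyc[OF uc])
    moreover have "cyc u \<subseteq> N" by (rule cyc_subset[OF sN u(1)])
    ultimately have "cyc u = N" using min cyc_self u(2) by blast
    then have "card N = ord u" using card_cyc[OF uc] by simp
    also have "\<dots> = p" by (rule ord_eq_prime[OF uc p pw[OF u(1)] u(2)])
    finally show False using np p by simp
  qed
  define C where "C = {g \<in> carrier G. \<forall>n\<in>N. conj g n = n}"
  have CN: "conj g n = n" if "g \<in> C" "n \<in> N" for g n using that by (auto simp: C_def)
  have clN: "conj g n \<in> N" if "g \<in> carrier G" "n \<in> N" for g n using normal_conj_closed[OF N(1) that] .
  have sC: "subgroup C G"
  proof (rule subgroupI)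
    show "C \<subseteq> carrier G" by (auto simp: C_def)
    have "\<one> \<in> C" using subN by (auto simp: C_def)
    then show "C \<noteq> {}" by blast
    show "inv g \<in> C" if g: "g \<in> C" for g
    proof -
      have gc: "g \<in> carrier G" using g by (auto simp: C_def)
      have "conj (inv g) n = n" if "n \<in> N" for n
        using CN[OF g that] conj_inv_cancel(1)[OF gc subN[OF that]] by simp
      then show ?thesis using gc by (auto simp: C_def)
    qed
    show "g \<otimes> h \<in> C" if "g \<in> C" "h \<in> C" for g h
      using that subN by (auto simp: C_def conj_mult_left)
  qed
  have nC: "C \<lhd> G"
    unfolding normal_iff_conj
  proof (intro conjI ballI sC)
    fix g c assume g: "g \<in> carrier G" and c: "c \<in> C"
    have cc: "c \<in> carrier G" using c by (auto simp: C_def)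
    have "conj (conj g c) n = n" if n: "n \<in> N" for n
    proof -
      have "conj (conj g c) n = conj g (conj c (conj (inv g) n))"
        using g cc subN[OF n] by (simp add: conj_def m_assoc inv_mult_group)
      also have "conj c (conj (inv g) n) = conj (inv g) n"
        using CN[OF c] clN[OF _ n] g by simp
      finally show ?thesis using g subN[OF n] by simp
    qed
    then show "conj g c \<in> C" using g cc by (auto simp: C_def)
  qed
  obtain n1 where n1: "n1 \<in> N" "n1 \<noteq> \<one>" using N(2) oneN by blast
  have "C \<noteq> carrier G" using noinv[OF n1] CN n1 cyc_self by fastforce
  obtain A q where A: "A \<lhd> G" "C \<subseteq> A" "C \<noteq> A" and q: "prime q"
    and pwA: "\<And>u. u \<in> A \<Longrightarrow> u [^] (q::nat) \<in> C"
    and cmA: "\<And>u v. u \<in> A \<Longrightarrow> v \<in> A \<Longrightarrow> conj u v \<otimes> inv v \<in> C"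
    by (rule chief_factor[OF sol nC \<open>C \<noteq> carrier G\<close>]) (rule that, assumption+)
  have sA: "subgroup A G" using A(1) by (rule normal_imp_subgroup)
  have subA: "u \<in> carrier G" if "u \<in> A" for u using subgroup.mem_carrier[OF sA that] .
  \<comment> \<open>Minimality of \<open>N\<close>: an invariant set of fixed points is everything or trivial.\<close>
  have fixed_normal: "(\<forall>n\<in>N. \<forall>u\<in>U. conj u n = n) \<or> (\<forall>n\<in>N. (\<forall>u\<in>U. conj u n = n) \<longrightarrow> n = \<one>)"
    if U: "U \<subseteq> carrier G"
      and inv: "\<And>g n u. g \<in> carrier G \<Longrightarrow> n \<in> N \<Longrightarrow> \<forall>u\<in>U. conj u n = n \<Longrightarrow> u \<in> U \<Longrightarrow> conj u (conj g n) = conj g n"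
    for U
  proof -
    let ?D = "{n \<in> N. \<forall>u\<in>U. conj u n = n}"
    have "subgroup ?D G"
    proof (rule subgroupI)
      show "?D \<subseteq> carrier G" using subN by blast
      have "\<one> \<in> ?D" using oneN U by auto
      then show "?D \<noteq> {}" by blast
      show "inv n \<in> ?D" if "n \<in> ?D" for n
        using that U subN sN subgroup.m_inv_closed by (auto simp: conj_inv subsetD)
      show "n \<otimes> n' \<in> ?D" if "n \<in> ?D" "n' \<in> ?D" for n n'
        using that U subN sN subgroup.m_closed by (auto simp: conj_mult subsetD)
    qed
    moreover have "conj g n \<in> ?D" if "g \<in> carrier G" "n \<in> ?D" for g n using that inv clN by auto
    ultimately have "?D \<lhd> G" by (auto simp: normal_iff_conj)
    then have "?D = {\<one>} \<or> ?D = N" using min by blast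
    then show ?thesis by blast
  qed
  have CNA: "n = \<one>" if "n \<in> N" "\<And>u. u \<in> A \<Longrightarrow> conj u n = n" for n
  proof -
    have "(\<forall>n\<in>N. \<forall>u\<in>A. conj u n = n) \<or> (\<forall>n\<in>N. (\<forall>u\<in>A. conj u n = n) \<longrightarrow> n = \<one>)"
    proof (rule fixed_normal)
      show "A \<subseteq> carrier G" using subA by blast
      fix g n u assume g: "g \<in> carrier G" and n: "n \<in> N" and f: "\<forall>u\<in>A. conj u n = n" and u: "u \<in> A"
      have "conj (inv g) u \<in> A" using normal_conj_closed[OF A(1)] g u by simp
      then have "conj g (conj (conj (inv g) u) n) = conj g n" using f by simp
      moreover have "conj g (conj (conj (inv g) u) n) = conj u (conj g n)"
        using g subA[OF u] subN[OF n] by (simp add: conj_def m_assoc inv_mult_group)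
      ultimately show "conj u (conj g n) = conj g n" by simp
    qed
    moreover have "\<not> (\<forall>n\<in>N. \<forall>u\<in>A. conj u n = n)"
    proof
      assume "\<forall>n\<in>N. \<forall>u\<in>A. conj u n = n"
      then have "A \<subseteq> C" using subA by (auto simp: C_def)
      then show False using A by blast
    qed
    ultimately show ?thesis using that by blast
  qed
  obtain Q m where Q: "subgroup Q G" "Q \<subseteq> A" "card Q = q ^ m" "Q <#> C = A"
    by (rule Sylow_supplement[OF sA nC A(2) q pwA])
  have subQ: "u \<in> carrier G" if "u \<in> Q" for u using subgroup.mem_carrier[OF Q(1) that] .
  have CNQ: "n = \<one>" if n: "n \<in> N" "\<And>u. u \<in> Q \<Longrightarrow> conj u n = n" for n
  proof (rule CNA[OF n(1)])
    fix u assume "u \<in> A"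
    then obtain v c where v: "v \<in> Q" "c \<in> C" "u = v \<otimes> c" using Q(4) by (auto simp: set_mult_def)
    have "c \<in> carrier G" using v(2) by (auto simp: C_def)
    then show "conj u n = n" using v n CN[OF v(2) n(1)] subQ[OF v(1)] subN[OF n(1)] by (simp add: conj_mult_left)
  qed
  have "\<exists>n\<in>N. \<exists>u\<in>Q. conj u n \<noteq> n" using CNQ n1 by blast
  then obtain x n0 where x: "x \<in> Q" "n0 \<in> N" "conj x n0 \<noteq> n0" by blast
  have "m \<noteq> 0"
  proof
    assume "m = 0"
    then have "card Q = 1" using Q(3) by simp
    then have "Q = {\<one>}" using subgroup.one_closed[OF Q(1)] by (auto simp: card_1_singleton_iff)
    then show False using x subN by auto
  qed
  let ?Q = "G\<lparr>carrier := Q\<rparr>"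
  have "[card N = card {n \<in> N. \<forall>u\<in>carrier ?Q. conj u n = n}] (mod q)"
  proof (rule p_group_card_fixed_points[where n = m])
    show "group ?Q" by (rule subgroup_imp_group[OF Q(1)])
    show "order ?Q = q ^ m" using Q(3) by (simp add: order_def)
    show "finite N" by (rule finite_subgroup[OF sN])
    show "conj u n \<in> N" if "u \<in> carrier ?Q" "n \<in> N" for u n
      using clN[of u n] subQ[of u] that by simp
    show "conj \<one>\<^bsub>?Q\<^esub> n = n" if "n \<in> N" for n using subN[OF that] by simp
    show "conj (u \<otimes>\<^bsub>?Q\<^esub> v) n = conj u (conj v n)"
      if "u \<in> carrier ?Q" "v \<in> carrier ?Q" "n \<in> N" for u v n
      using subQ that subN by (simp add: conj_mult_left)
  qed (rule q)
  moreover have "{n \<in> N. \<forall>u\<in>carrier ?Q. conj u n = n} = {\<one>}"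
  proof (intro equalityI subsetI)
    fix n assume "n \<in> {n \<in> N. \<forall>u\<in>carrier ?Q. conj u n = n}"
    then show "n \<in> {\<one>}" using CNQ[of n] by simp
  next
    fix n assume "n \<in> {\<one>}"
    then show "n \<in> {n \<in> N. \<forall>u\<in>carrier ?Q. conj u n = n}" using oneN subQ by simp
  qed
  \<comment> \<open>\<open>Q\<close> acts on \<open>N\<close> with only the trivial fixed point.\<close>
  ultimately have cong: "[p ^ k = 1] (mod q)" using k by simp
  have pk1: "1 \<le> p ^ k" using prime_gt_0_nat[OF p] by simp
  have qdvd: "q dvd p ^ k - 1" using cong cong_altdef_nat[OF pk1, of q] by blast
  have "p \<noteq> q"
  proof
    assume "p = q"
    then have "q dvd p ^ k" using k2 by simp
    then have "q dvd 1" using qdvd pk1 by (metis dvd_diffD1)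
    then show False using q by simp
  qed
  have npq: "\<not> p dvd q ^ j" for j using p q \<open>p \<noteq> q\<close> prime_dvd_power primes_dvd_imp_eq by blast
  have "coprime (card N) (card Q)" using k Q(3) p q \<open>p \<noteq> q\<close> by (simp add: primes_coprime)
  then have NQ: "N \<inter> Q = {\<one>}" by (rule coprime_card_Int[OF sN Q(1)])
  let ?K = "(\<lambda>n. conjs n Q) ` N"
  have "inj_on (\<lambda>n. conjs n Q) N"
  proof (rule inj_on_conjs[OF Q(1) sN])
    show "n = \<one>" if "n \<in> N" "conjs n Q = Q" for n
      using CNQ[OF that(1)] normalizing_imp_centralizing[OF N(1) Q(1) _ that] NQ by blast
  qed
  then have cK: "card ?K = p ^ k" using k by (simp add: card_image)
  have K: "subgroup H G" "card H = q ^ m" if H: "H \<in> ?K" for H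
  proof -
    obtain n where n: "n \<in> N" "H = conjs n Q" using H by blast
    show "subgroup H G" "card H = q ^ m"
      using n subN[OF n(1)] Q subgroup_conjs subgroup.subset[OF Q(1)] by auto
  qed
  have qm1: "q ^ m \<noteq> 1" using \<open>m \<noteq> 0\<close> q by (metis nat_power_eq_Suc_0_iff not_prime_1 One_nat_def)
  have pN: "p ^ k dvd order G" using card_subgroup_dvd[OF sN] k by simp
  have "p ^ 2 dvd order G" using pN k2 le_imp_power_dvd dvd_trans by blast
  have "p dvd order G" using \<open>p ^ 2 dvd order G\<close> by (metis dvd_trans dvd_triv_left power2_eq_square)
  have "card ?K \<le> 14"
  proof (rule card_family_dvd_le)
    show "subgroup H G" "card H \<noteq> 1" if "H \<in> ?K" for H using K[OF that] qm1 by auto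
    show "\<not> order G dvd card H * card L" if "H \<in> ?K" "L \<in> ?K" for H L
    proof
      assume "order G dvd card H * card L"
      then have "p dvd q ^ (m + m)" using K[OF that(1)] K[OF that(2)] \<open>p dvd order G\<close>
        by (metis dvd_trans power_add)
      then show False using npq by blast
    qed
  qed
  then have le14: "p ^ k \<le> 14" using cK by simp
  let ?I = "cyc ` (N - {\<one>})"
  have I: "subgroup H G" "card H = p" "H \<subseteq> N" if H: "H \<in> ?I" for H
  proof -
    obtain u where u: "u \<in> N" "u \<noteq> \<one>" "H = cyc u" using H by blast
    show "subgroup H G" using subgroup_cyc[OF subN[OF u(1)]] u(3) by simp
    show "H \<subseteq> N" using cyc_subset[OF sN u(1)] u(3) by simp
    show "card H = p" using card_cyc[OF subN[OF u(1)]] ord_eq_prime[OF subN[OF u(1)] p pw[OF u(1)] u(2)] u(3) by simp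
  qed
  have disj: "?I \<inter> ?K = {}"
  proof (rule ccontr)
    assume "?I \<inter> ?K \<noteq> {}"
    then obtain H where "H \<in> ?I" "H \<in> ?K" by blast
    then have "p = q ^ m" using I(2) K(2) by metis
    then show False using npq[of m] by simp
  qed
  have cIK: "card H = p \<or> card H = q ^ m" if "H \<in> ?I \<union> ?K" for H using that I(2) K(2) by blast
  have sIK: "subgroup H G" if "H \<in> ?I \<union> ?K" for H using that I(1) K(1) by blast
  have p1: "p \<noteq> 1" using p by auto
  have nIK: "card H \<noteq> 1" if "H \<in> ?I \<union> ?K" for H using cIK[OF that] p1 qm1 by auto
  have finIK: "finite ?I" "finite ?K" using finite_subgroup[OF sN] by simp_all
  have p2: "2 \<le> p" using p by (rule prime_ge_2_nat)
  have "p ^ 2 \<le> 14" 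
    by (rule le_trans[OF power_increasing[OF k2] le14]) (use p2 in simp)
  have "p < 4"
  proof (rule ccontr)
    assume "\<not> p < 4" then show False using \<open>p ^ 2 \<le> 14\<close> power_mono[of 4 p 2] by simp
  qed
  have "k < 4"
  proof (rule ccontr)
    assume "\<not> k < 4"
    then have "p ^ 4 \<le> 14" 
      by (intro le_trans[OF power_increasing[of 4 k p] le14]) (use p2 in simp_all)
    moreover have "2 ^ 4 \<le> p ^ 4" using p2 by (intro power_mono) auto
    ultimately show False by simp
  qed
  have "p = 2 \<or> p = 3" "k = 2 \<or> k = 3" using p2 \<open>p < 4\<close> k2 \<open>k < 4\<close> by auto
  then consider "p = 2" "k = 2" | "p = 2" "k = 3" | "p = 3" "k = 2" using le14 by auto
  then show thesis
  proof cases
    case 1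
    then have "q dvd 3" using qdvd by simp
    then have "q = 3" using primes_dvd_imp_eq[OF q, of 3] by simp
    then have "odd (card Q)" using Q(3) by simp
    then have odd: "odd (ord x)" using ord_dvd_card[OF Q(1) x(1)] by (meson dvd_trans)
    have ex: "u \<otimes> u = \<one>" if "u \<in> N" for u
      using pw[OF that] subN[OF that] 1 by (simp add: numeral_2_eq_2)
    have c4: "card N = 4" using k 1 by simp
    show thesis
      using rot_if_odd[OF N(1) c4 ex subQ[OF x(1)] odd x(2,3) n1] that by blast
  next
    case 2
    then have "q dvd 7" using qdvd by simp
    then have "q = 7" using primes_dvd_imp_eq[OF q, of 7] by simp
    have ex: "u \<otimes> u = \<one>" if "u \<in> N" for u
      using pw[OF that] subN[OF that] 2 by (simp add: numeral_2_eq_2)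
    have cy: "cyc u = {\<one>, u}" if "u \<in> N" for u using cyc_involution[OF subN[OF that] ex[OF that]] .
    have "inj_on cyc (N - {\<one>})" by (rule inj_onI) (use cy in auto)
    then have cI: "card ?I = 7" using k 2 oneN by (simp add: card_image)
    have "card (?I \<union> ?K) \<le> 14"
    proof (rule card_family_dvd_le)
      show "subgroup H G" "card H \<noteq> 1" if "H \<in> ?I \<union> ?K" for H
        using sIK[OF that] nIK[OF that] .
      have odd7: "odd ((7::nat) ^ j)" for j by simp
      have n8: "\<not> 8 dvd (2::nat) * 2" "\<not> 8 dvd 2 * (7::nat) ^ m" "\<not> 8 dvd (7::nat) ^ m * 2"
        "\<not> 8 dvd (7::nat) ^ m * 7 ^ m"
      proof -
        have n4: "\<not> 4 dvd (7::nat) ^ m" using dvd_trans[of 2 4 "(7::nat) ^ m"] odd7[of m] by auto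
        have "\<not> 2 * 4 dvd 2 * (7::nat) ^ m" using n4 by (simp only: nat_mult_dvd_cancel_disj) simp
        then show "\<not> 8 dvd 2 * (7::nat) ^ m" by simp
        then show "\<not> 8 dvd (7::nat) ^ m * 2" by (simp add: mult.commute)
        have "odd ((7::nat) ^ m * 7 ^ m)" by simp
        then show "\<not> 8 dvd (7::nat) ^ m * 7 ^ m" using dvd_trans[of 2 8 "(7::nat) ^ m * 7 ^ m"] by auto
      qed simp
      show "\<not> order G dvd card H * card L" if "H \<in> ?I \<union> ?K" "L \<in> ?I \<union> ?K" for H L
      proof -
        have o: "card H = 2 \<or> card H = 7 ^ m" "card L = 2 \<or> card L = 7 ^ m"
          using cIK[OF that(1)] cIK[OF that(2)] \<open>q = 7\<close> 2 by simp_all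
        have "\<not> 8 dvd card H * card L"
          using o by (elim disjE) (simp_all only: n8 not_False_eq_True)
        moreover have "8 dvd order G" using pN 2 by simp
        ultimately show ?thesis using dvd_trans by blast
      qed
    qed
    then have "card ?I + card ?K \<le> 14" using card_Un_disjoint[OF finIK disj] by simp
    then show thesis using cI cK 2 by simp
  next
    case 3
    then have "q dvd 2 ^ 3" using qdvd by simp
    then have "q = 2" using prime_dvd_power[OF q] primes_dvd_imp_eq[OF q two_is_prime_nat] by metis
    show thesis
    proof (cases "A = carrier G")
      case False
      \<comment> \<open>Nine conjugates of \<open>Q\<close>, four subgroups of order 3, \<open>N\<close> and \<open>A\<close> lie in the proper subgroup \<open>A\<close>.\<close>
      have "N - {\<one>} \<subseteq> (\<Union>H\<in>?I. H - {\<one>})" using cyc_self by auto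
      then have "card (N - {\<one>}) \<le> card (\<Union>H\<in>?I. H - {\<one>})"
        using finIK(1) finite_subgroup[OF I(1)] by (intro card_mono) auto
      also have "\<dots> \<le> (\<Sum>H\<in>?I. card (H - {\<one>}))" by (rule card_UN_le[OF finIK(1)])
      also have "\<dots> \<le> (\<Sum>H\<in>?I. 2)"
      proof (rule sum_mono)
        fix H assume H: "H \<in> ?I"
        show "card (H - {\<one>}) \<le> 2" using I[OF H] subgroup.one_closed[OF I(1)[OF H]] 3 by simp
      qed
      finally have "8 \<le> 2 * card ?I" using k 3 oneN by simp
      then have cI: "4 \<le> card ?I" by simp
      have NA: "N \<subseteq> A"
      proof -
        have "conj u v = v" if "u \<in> N" "v \<in> N" for u v
          using comm[OF that] subN that by (simp add: conj_fixed_iff)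
        then have "N \<subseteq> C" using subN by (auto simp: C_def)
        then show ?thesis using A(2) by blast
      qed
      have KA: "H \<subseteq> A" if "H \<in> ?K" for H
        using that Q(2) NA normal_conj_closed[OF A(1)] subN by auto
      have dA: "2 dvd card A" "9 dvd card A"
        using card_subgroup_mono_dvd[OF Q(1) sA Q(2)] card_subgroup_mono_dvd[OF sN sA NA] Q(3) k 3
          \<open>q = 2\<close> \<open>m \<noteq> 0\<close> by (auto dest: dvd_trans[of 2 "(2::nat) ^ m"])
      have c9: "card N = 9" using k 3 by simp
      have n3: "\<not> 3 dvd (2::nat) ^ m" using npq[of m] 3 \<open>q = 2\<close> by simp
      have cardA: "card A \<noteq> 3" "card A \<noteq> 9" "card A \<noteq> 1" "card A \<noteq> 2 ^ m" using dA n3 dvd_trans[of 3 9 "(2::nat) ^ m"] by auto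
      have "y \<noteq> 3 \<and> y \<noteq> 9" if "\<not> 3 dvd y" for y :: nat using that by auto
      from this[OF n3] have cards: "(2::nat) ^ m \<noteq> 3" "(2::nat) ^ m \<noteq> 9" by blast+
      have "card (?I \<union> ?K \<union> {N, A}) \<le> 14"
      proof (rule card_family_le)
        show "subgroup H G" if H: "H \<in> ?I \<union> ?K \<union> {N, A}" for H
        proof -
          consider "H \<in> ?I \<union> ?K" | "H = N" | "H = A" using H by blast
          then show ?thesis using sIK sN sA by cases simp_all
        qed
        show "card H \<noteq> 1" if H: "H \<in> ?I \<union> ?K \<union> {N, A}" for H
        proof -
          consider "H \<in> ?I \<union> ?K" | "H = N" | "H = A" using H by blast
          then show ?thesis using nIK c9 cardA by cases simp_all
        qed
        have within: "H \<subseteq> A" if "H \<in> ?I \<union> ?K \<union> {N, A}" for H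
          using that I(3)[of H] KA[of H] NA by blast
        show "H <#> L \<noteq> carrier G" if "H \<in> ?I \<union> ?K \<union> {N, A}" "L \<in> ?I \<union> ?K \<union> {N, A}" for H L
          by (rule not_comax_within[OF sA False within[OF that(1)] within[OF that(2)]])
      qed
      moreover have "card (?I \<union> ?K \<union> {N, A}) = card ?I + card ?K + 2"
      proof -
        have cIK: "card H = 3 \<or> card H = 2 ^ m" if "H \<in> ?I \<union> ?K" for H
          using cIK[OF that] 3 \<open>q = 2\<close> by simp
        have "N \<notin> ?I \<union> ?K" "A \<notin> ?I \<union> ?K" "N \<noteq> A" using cIK[of N] cIK[of A] cards cardA c9 by fastforce+
        then have "card ((?I \<union> ?K) \<union> {N, A}) = card (?I \<union> ?K) + card {N, A}"
          using finIK by (intro card_Un_disjoint) auto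
        also have "card {N, A} = 2" using \<open>N \<noteq> A\<close> by simp
        finally show ?thesis using card_Un_disjoint[OF finIK disj] by simp
      qed
      ultimately show thesis using cI cK 3 by simp
    next
      case True
      \<comment> \<open>Here every element of \<open>G\<close> centralizes \<open>N\<close> or inverts it, so every cyclic subgroup of \<open>N\<close> is normal.\<close>
      have inv: "conj g n = n \<or> conj g n = inv n" if g: "g \<in> carrier G" and n: "n \<in> N" for g n
      proof (cases "g \<in> C")
        case True then show ?thesis using CN n by blast
      next
        case gC: False
        have "(\<forall>n\<in>N. \<forall>u\<in>{g}. conj u n = n) \<or> (\<forall>n\<in>N. (\<forall>u\<in>{g}. conj u n = n) \<longrightarrow> n = \<one>)"
        proof (rule fixed_normal)
          fix g' n u assume g': "g' \<in> carrier G" and n: "n \<in> N" and f: "\<forall>u\<in>{g}. conj u n = n" and u: "u \<in> {g}"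
          let ?d = "conj g g' \<otimes> inv g'"
          have d: "?d \<in> C" using cmA True g g' by simp
          have "conj g (conj g' n) = conj (?d \<otimes> g') (conj g n)"
            using g g' subN[OF n] by (simp add: conj_def m_assoc inv_mult_group)
          also have "\<dots> = conj ?d (conj g' n)" using f g g' subN[OF n] by (simp add: conj_mult_left)
          also have "\<dots> = conj g' n" using CN[OF d] clN[OF g' n] by simp
          finally show "conj u (conj g' n) = conj g' n" using u by simp
        qed (use g in simp)
        moreover have "\<not> (\<forall>n\<in>N. conj g n = n)" using gC g by (auto simp: C_def)
        ultimately have fpf: "w = \<one>" if "w \<in> N" "conj g w = w" for w using that by blast
        have cg: "conj g n \<in> N" using clN[OF g n] .
        have "g [^] (2::nat) \<in> C" using pwA True g \<open>q = 2\<close> by simp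
        then have "conj (g [^] (2::nat)) n = n" using CN n by blast
        then have "conj g (conj g n) = n" using g subN[OF n] by (simp add: numeral_2_eq_2 conj_mult_left)
        then have "conj g (conj g n \<otimes> n) = n \<otimes> conj g n"
          using g subN[OF n] by (simp add: conj_mult)
        then have "conj g n \<otimes> n = \<one>"
          using comm[OF cg n] subgroup.m_closed[OF sN cg n] by (intro fpf) simp_all
        then show ?thesis using inv_equality g subN[OF n] by simp
      qed
      have "n1 \<in> cyc n1" "inv n1 \<in> cyc n1"
        using cyc_self subgroup.m_inv_closed[OF subgroup_cyc[OF subN[OF n1(1)]]] by blast+
      moreover obtain g where g: "g \<in> carrier G" "conj g n1 \<notin> cyc n1" using noinv[OF n1] by blast
      ultimately show thesis using inv[OF g(1) n1(1)] by auto
    qed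
  qed
qed

section \<open>A normal Klein four-group rotated by an element of 3-power order\<close>

text \<open>Families of subgroups of different orders are disjoint; this is how families are counted.\<close>

lemma card_Un_sizes:
  assumes "finite A" "finite B" "\<And>H K. H \<in> A \<Longrightarrow> K \<in> B \<Longrightarrow> card H \<noteq> card K"
  shows "card (A \<union> B) = card A + card B"
  by (rule card_Un_disjoint[OF assms(1,2)]) (use assms(3) in blast)

text \<open>If the order is divisible by \<open>2 ^ e\<close> and by 3, subgroups of odd order together with subgroups whose
  order is divisible by neither are pairwise non-comaximal: a product of two such orders misses
  \<open>2 ^ e\<close> or 3.\<close>

lemma (in small_comax) card_family_2_3_le:
  assumes "2 ^ e dvd order G" "3 dvd order G" "e \<noteq> 0"
    and "\<And>H. H \<in> F \<Longrightarrow> subgroup H G" "\<And>H. H \<in> F \<Longrightarrow> card H \<noteq> 1"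
    and ty: "\<And>H. H \<in> F \<Longrightarrow> \<not> 3 dvd card H \<and> \<not> 2 ^ e dvd card H \<or> odd (card H)"
  shows "card F \<le> 14"
proof (rule card_family_dvd_le)
  show "subgroup H G" "card H \<noteq> 1" if "H \<in> F" for H using assms(4,5) that by simp_all
  fix H K assume HK: "H \<in> F" "K \<in> F"
  have cop: "\<not> 2 ^ e dvd s * t" if "\<not> 2 ^ e dvd s" "odd t" for s t :: nat
    using that by (simp add: coprime_dvd_mult_left_iff)
  consider "\<not> 3 dvd card H" "\<not> 3 dvd card K" | "\<not> 2 ^ e dvd card H" "odd (card K)"
    | "\<not> 2 ^ e dvd card K" "odd (card H)" | "odd (card H)" "odd (card K)"
    using ty[OF HK(1)] ty[OF HK(2)] by blast
  then have "\<not> (2 ^ e dvd card H * card K \<and> 3 dvd card H * card K)"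
  proof cases
    case 1
    have "prime (3::nat)" by simp
    then show ?thesis using 1 prime_dvd_mult_iff[of 3 "card H" "card K"] by blast
  next
    case 2 then show ?thesis using cop by blast
  next
    case 3 then show ?thesis using cop[of "card K" "card H"] by (simp add: mult.commute)
  next
    case 4
    have "2 dvd (2::nat) ^ e" using \<open>e \<noteq> 0\<close> by simp
    then have "\<not> 2 ^ e dvd card H * card K" using 4 dvd_trans[of 2 "2 ^ e" "card H * card K"] by auto
    then show ?thesis by blast
  qed
  then show "\<not> order G dvd card H * card K" using assms(1,2) dvd_trans by blast
qed

lemma (in finite_group) ord_involution_mult:
  assumes u: "u \<in> carrier G" "ord u = 2" and v: "v \<in> carrier G" "odd (ord v)" and c: "conj v u = u"
  shows "ord (u \<otimes> v) = 2 * ord v"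
    and "z \<in> cyc (u \<otimes> v) \<Longrightarrow> z \<otimes> z = \<one> \<Longrightarrow> z = \<one> \<or> z = u"
    and "z \<in> cyc (u \<otimes> v) \<Longrightarrow> z [^] ord v = \<one> \<Longrightarrow> z \<in> cyc v"
proof -
  have uv: "u \<otimes> v = v \<otimes> u" using c conj_fixed_iff[OF v(1) u(1)] by simp
  have pw: "(u \<otimes> v) [^] n = u [^] n \<otimes> v [^] n" for n :: nat
    using pow_mult_distrib[OF uv u(1) v(1)] .
  have un: "u [^] n = \<one> \<longleftrightarrow> even n" for n :: nat using pow_eq_id[OF u(1), of n] u(2) by simp
  have vn: "v [^] (2 * n) = \<one> \<longleftrightarrow> v [^] n = \<one>" for n :: nat
    using pow_eq_id[OF v(1)] v(2) by (simp add: coprime_dvd_mult_right_iff)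
  have u2: "u [^] n \<otimes> u [^] n = \<one>" for n :: nat
    using un[of "n + n"] u(1) by (simp add: nat_pow_mult)
  have sq: "v [^] n = \<one>" if "u [^] n \<otimes> v [^] n = w" "w \<otimes> w = \<one>" for n :: nat and w
  proof -
    have "(u \<otimes> v) [^] (n + n) = w \<otimes> w" using that(1) pw[of n] u(1) v(1) by (simp add: nat_pow_mult[symmetric])
    then have "v [^] (n + n) = \<one>"
      using that(2) pw[of "n + n"] un[of "n + n"] v(1) by simp
    then show ?thesis using vn[of n] by (simp add: mult_2)
  qed
  have "(u \<otimes> v) [^] n = \<one> \<longleftrightarrow> 2 * ord v dvd n" for n :: nat
  proof
    assume "(u \<otimes> v) [^] n = \<one>"
    then have 1: "u [^] n \<otimes> v [^] n = \<one>" using pw by simp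
    then have "v [^] n = \<one>" using sq by simp
    moreover have "even n" using 1 \<open>v [^] n = \<one>\<close> u(1) un[of n] by simp
    ultimately show "2 * ord v dvd n" using pow_eq_id[OF v(1)] v(2) by (simp add: divides_mult)
  next
    assume "2 * ord v dvd n"
    then have "2 dvd n" "ord v dvd n" by (auto dest: dvd_mult_left dvd_mult_right)
    then have "u [^] n = \<one>" "v [^] n = \<one>" using un[of n] pow_eq_id[OF v(1)] by simp_all
    then show "(u \<otimes> v) [^] n = \<one>" using pw[of n] by simp
  qed
  then show "ord (u \<otimes> v) = 2 * ord v" using ord_unique u(1) v(1) by simp
  {
    assume "z \<in> cyc (u \<otimes> v)" "z \<otimes> z = \<one>"
    then obtain n :: nat where n: "z = u [^] n \<otimes> v [^] n" using mem_cyc[of "u \<otimes> v" z] u(1) v(1) pw by auto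
    then have "v [^] n = \<one>" using sq[of n z] \<open>z \<otimes> z = \<one>\<close> by simp
    then have "z = u [^] n" using n u(1) by simp
    moreover have "u [^] n \<in> cyc u" using mem_cyc[OF u(1)] by blast
    moreover have "cyc u = {\<one>, u}" using cyc_involution[OF u(1)] u2[of 1] u(1) by simp
    ultimately show "z = \<one> \<or> z = u" by simp
  }
  {
    assume "z \<in> cyc (u \<otimes> v)" "z [^] ord v = \<one>"
    then obtain n :: nat where n: "z = (u \<otimes> v) [^] n" using mem_cyc[of "u \<otimes> v" z] u(1) v(1) by auto
    then have "(u \<otimes> v) [^] (n * ord v) = \<one>" using \<open>z [^] ord v = \<one>\<close> u(1) v(1) by (simp add: nat_pow_pow)
    then have "u [^] (n * ord v) = \<one>"
      using pw[of "n * ord v"] pow_eq_id[OF v(1), of "n * ord v"] u(1) by simp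
    then have "even n" using un v(2) by simp
    then have "u [^] n = \<one>" using un by simp
    then have "z = v [^] n" using n pw v(1) by simp
    then show "z \<in> cyc v" using mem_cyc[OF v(1)] by blast
  }
qed

text \<open>In the cyclic group generated by \<open>u \<otimes> v\<close>, the element \<open>u\<close> is the only involution, and \<open>v\<close> generates
  the elements of order dividing \<open>ord v\<close>.\<close>

lemma (in finite_group) cyc_involution_mult_inj:
  assumes u: "u \<in> carrier G" "ord u = 2" and v: "v \<in> carrier G" "odd (ord v)" "conj v u = u"
    and u': "u' \<in> carrier G" "ord u' = 2" and v': "v' \<in> carrier G" "ord v' = ord v" "conj v' u' = u'"
    and eq: "cyc (u \<otimes> v) = cyc (u' \<otimes> v')"
  shows "u = u'" "cyc v = cyc v'"
proof -
  note 1 = ord_involution_mult[OF u v(1,2,3)]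
  have uv: "u' \<otimes> v' = v' \<otimes> u'" using v'(3) conj_fixed_iff[OF v'(1) u'(1)] by simp
  have pw: "(u' \<otimes> v') [^] n = u' [^] n \<otimes> v' [^] n" for n :: nat
    using pow_mult_distrib[OF uv u'(1) v'(1)] .
  have un: "u' [^] n = \<one> \<longleftrightarrow> even n" for n :: nat using pow_eq_id[OF u'(1), of n] u'(2) by simp
  have vs: "v' [^] ord v = \<one>" using pow_eq_id[OF v'(1)] v'(2) by simp
  have mem: "(u' \<otimes> v') [^] n \<in> cyc (u \<otimes> v)" for n :: nat
    using eq mem_cyc[of "u' \<otimes> v'"] u'(1) v'(1) by auto
  obtain k where k: "ord v = 2 * k + 1" using v(2) by (auto elim: oddE)
  have "u' [^] ord v = u'" using un[of "2 * k"] u'(1) k by simp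
  then have "(u' \<otimes> v') [^] ord v = u'" using pw[of "ord v"] vs u'(1) by simp
  then have "u' \<in> cyc (u \<otimes> v)" using mem[of "ord v"] by simp
  moreover have "u' \<otimes> u' = \<one>" using un[of 2] u'(1) by (simp add: numeral_2_eq_2)
  moreover have "u' \<noteq> \<one>" using u' ord_id by auto
  ultimately show "u = u'" using 1(2) by blast
  have "u' [^] (2 * (k + 1)) = \<one>" unfolding un by simp
  moreover have "v' [^] (2 * (k + 1)) = v'"
  proof -
    have e: "2 * (k + 1) = Suc (ord v)" using k by simp
    show ?thesis unfolding e using vs v'(1) by simp
  qed
  ultimately have "v' \<in> cyc (u \<otimes> v)" using pw[of "2 * (k + 1)"] mem[of "2 * (k + 1)"] v'(1) by simp
  then have "v' \<in> cyc v" using 1(3) vs by blast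
  then have "cyc v' \<subseteq> cyc v" using cyc_subset[OF subgroup_cyc[OF v(1)]] by blast
  then have "cyc v' = cyc v"
    using card_subset_eq[OF finite_subgroup[OF subgroup_cyc[OF v(1)]]] card_cyc v v' by simp
  then show "cyc v = cyc v'" by simp
qed

context group
begin

lemma rotD:
  assumes "rot a b x"
  shows "a \<in> carrier G" "b \<in> carrier G" "x \<in> carrier G" "a \<noteq> \<one>" "a \<otimes> a = \<one>" "b \<otimes> b = \<one>"
    "a \<otimes> b = b \<otimes> a" "conj x a = b" "conj x b = a \<otimes> b"
  using assms by (auto simp: rot_def)

lemma rot_calc:
  assumes r: "rot a b x"
  shows "b \<noteq> \<one>" "a \<noteq> b" "a \<otimes> b \<noteq> \<one>" "a \<otimes> b \<noteq> a" "a \<otimes> b \<noteq> b"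
    "a \<otimes> (a \<otimes> b) = b" "b \<otimes> (a \<otimes> b) = a" "a \<otimes> b \<otimes> a = b" "a \<otimes> b \<otimes> b = a" "a \<otimes> b \<otimes> (a \<otimes> b) = \<one>"
    "conj x (a \<otimes> b) = a" "inv a = a" "inv b = b" "inv (a \<otimes> b) = a \<otimes> b" "b \<otimes> a = a \<otimes> b"
    "b \<otimes> (b \<otimes> a) = a"
proof -
  note D = rotD[OF r]
  show "b \<noteq> \<one>" using D conj_inj[OF D(3,1), of \<one>] by auto
  show "a \<noteq> b" using D \<open>b \<noteq> \<one>\<close> conj_inj[OF D(3,2), of \<one>] by auto
  show i: "inv a = a" "inv b = b" using D by (auto intro!: inv_equality)
  show "a \<otimes> b \<noteq> \<one>" using \<open>a \<noteq> b\<close> i D(1,2) inv_equality[of a b] by auto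
  show "a \<otimes> b \<noteq> a" "a \<otimes> b \<noteq> b" using D \<open>b \<noteq> \<one>\<close> by auto
  show 1: "a \<otimes> (a \<otimes> b) = b" using D(1-6) by (simp add: m_assoc[symmetric])
  show ba: "b \<otimes> a = a \<otimes> b" using D(7) by simp
  show 2: "b \<otimes> (b \<otimes> a) = a" using D(1-6) by (simp add: m_assoc[symmetric])
  show 3: "b \<otimes> (a \<otimes> b) = a" using 2 ba by simp
  show "a \<otimes> b \<otimes> a = b" using 1 ba D(1-6) by (simp add: m_assoc)
  show 4: "a \<otimes> b \<otimes> b = a" using D(1-6) by (simp add: m_assoc)
  show 5: "a \<otimes> b \<otimes> (a \<otimes> b) = \<one>" using 3 D(1-6) by (simp add: m_assoc)
  show "conj x (a \<otimes> b) = a" using D(1-6,8,9) 3 by (simp add: conj_mult)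
  show "inv (a \<otimes> b) = a \<otimes> b" using 5 D(1,2) by (auto intro!: inv_equality)
qed

lemma rot_next:
  assumes r: "rot a b x" shows "rot b (a \<otimes> b) x"
  using rotD(1-6,8,9)[OF r] rot_calc(1-14)[OF r] unfolding rot_def by (intro conjI) simp_all

lemma rot_subgroup:
  assumes r: "rot a b x" shows "subgroup {\<one>, a, b, a \<otimes> b} G"
  using rotD(1-6)[OF r] rot_calc[OF r] by (intro subgroupI) auto

lemma rot_cube:
  assumes r: "rot a b x"
  shows "conj (x [^] (3 * j::nat)) a = a" "conj (x [^] (3 * j)) b = b"
proof -
  note D = rotD[OF r] and E = rot_calc[OF r]
  have x3: "x [^] (3::nat) = x \<otimes> (x \<otimes> x)" using D by (simp add: numeral_3_eq_3 m_assoc)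
  have "conj (x [^] (3::nat)) a = a" "conj (x [^] (3::nat)) b = b"
    unfolding x3 using D(1-3,8,9) E by (simp_all add: conj_mult_left conj_mult)
  then show "conj (x [^] (3 * j)) a = a" "conj (x [^] (3 * j)) b = b"
    using conj_pow_left_fixed[of "x [^] (3::nat)"] D by (simp_all add: nat_pow_pow)
qed

end

text \<open>Passing to a power of the rotating element makes its order a power of 3.\<close>

lemma (in finite_group) rot_3_part:
  assumes r: "rot a b x" obtains y k where "rot a b y" "ord y = 3 ^ k"
proof -
  note D = rotD[OF r] and E = rot_calc[OF r]
  have "ord x \<noteq> 0" using ord_pos[OF D(3)] by simp
  obtain m where m: "ord x = 3 ^ multiplicity 3 (ord x) * m" "\<not> 3 dvd m"
    by (rule multiplicity_decompose'[OF \<open>ord x \<noteq> 0\<close>, of 3]) simp_all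
  define k where "k = multiplicity 3 (ord x)"
  note m = m[folded k_def]
  define e where "e = (if m mod 3 = 1 then m else 2 * m)"
  have "e mod 3 = 1" using m(2) by (simp add: e_def) presburger
  then obtain j where j: "e = 3 * j + 1" by (metis mult_div_mod_eq)
  have y: "x [^] e = x [^] (3 * j) \<otimes> x" using j D(3) by simp
  have "conj (x [^] e) a = b" "conj (x [^] e) b = a \<otimes> b"
    unfolding y using D(1-3,8,9) rot_cube[OF r, of j] by (simp_all add: conj_mult_left conj_mult)
  then have "rot a b (x [^] e)" using D(1-7) unfolding rot_def by (intro conjI) simp_all
  moreover have "(x [^] e) [^] (3 ^ k :: nat) = \<one>"
  proof -
    have "ord x dvd e * 3 ^ k" using m(1) by (auto simp: e_def mult.commute)
    then show ?thesis using D(3) by (simp add: nat_pow_pow pow_eq_id)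
  qed
  then have "ord (x [^] e) dvd 3 ^ k" using pow_eq_id[of "x [^] e"] D(3) by blast
  then obtain i where "ord (x [^] e) = 3 ^ i" using divides_primepow_nat[of 3] by auto
  ultimately show thesis using that by blast
qed

locale rot_comax = small_comax +
  fixes a b x k
  assumes rot: "rot a b x" and ordx: "ord x = 3 ^ k"
    and nN: "{\<one>, a, b, a \<otimes> b} \<lhd> G"
begin

abbreviation N where "N \<equiv> {\<one>, a, b, a \<otimes> b}"
abbreviation X where "X \<equiv> cyc x"
abbreviation XS where "XS \<equiv> (\<lambda>n. conjs n X) ` N"
abbreviation I2 where "I2 \<equiv> {cyc a, cyc b, cyc (a \<otimes> b)}"

lemmas D = rotD(1-6,8,9)[OF rot] and E = rot_calc[OF rot]

lemma sN: "subgroup N G" using nN by (rule normal_imp_subgroup)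

lemma Nc: "n \<in> N \<Longrightarrow> n \<in> carrier G" using D by auto

lemma cardN: "card N = 4" using D E by simp

lemma sX: "subgroup X G" using subgroup_cyc D by blast

lemma k0: "k \<noteq> 0"
proof
  assume "k = 0"
  then have "x = \<one>" using ordx ord_eq_1[OF D(3)] by simp
  then show False using D E by simp
qed

lemma cardX: "card X = 3 ^ k" using card_cyc[OF D(3)] ordx by simp

lemma order4: "4 dvd order G" using card_subgroup_dvd[OF sN] cardN by simp

lemma order3: "3 dvd order G"
  using dvd_trans[OF dvd_power[of k 3] card_subgroup_dvd[OF sX, unfolded cardX]] k0 by blast

lemma involutions: "n \<in> N \<Longrightarrow> n \<otimes> n = \<one>" using D E by auto

lemma ordN: "n \<in> N \<Longrightarrow> n \<noteq> \<one> \<Longrightarrow> ord n = 2"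
  using ord_eq_prime[OF Nc two_is_prime_nat] involutions Nc by (simp add: numeral_2_eq_2)

lemma commN: "n \<in> N \<Longrightarrow> m \<in> N \<Longrightarrow> n \<otimes> m = m \<otimes> n" using D E by auto

lemma fpf: "n \<in> N \<Longrightarrow> conj x n = n \<Longrightarrow> n = \<one>" using D E by auto

text \<open>If \<open>n\<close> in \<open>N\<close> normalizes \<open>T\<close>, it centralizes \<open>T\<close> and is therefore trivial.\<close>

lemma inj_conjs_N:
  assumes T: "subgroup T G" "odd (card T)" and t: "t \<in> T" "\<And>n. n \<in> N \<Longrightarrow> conj t n = n \<Longrightarrow> n = \<one>"
  shows "inj_on (\<lambda>n. conjs n T) N" "card ((\<lambda>n. conjs n T) ` N) = 4"
proof -
  have "coprime (card N) (card T)"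
  proof -
    have "coprime (2 ^ 2) (card T)" using T(2) by (simp only: coprime_power_left_iff) simp
    then show ?thesis using cardN by simp
  qed
  then have "N \<inter> T = {\<one>}" by (rule coprime_card_Int[OF sN T(1)])
  then have NT: "N \<inter> T \<subseteq> {\<one>}" by simp
  show i: "inj_on (\<lambda>n. conjs n T) N"
  proof (rule inj_on_conjs[OF T(1) sN])
    fix n assume n: "n \<in> N" "conjs n T = T"
    show "n = \<one>" by (rule t(2)[OF n(1) normalizing_imp_centralizing[OF nN T(1) NT n t(1)]])
  qed
  show "card ((\<lambda>n. conjs n T) ` N) = 4" using card_image[OF i] cardN by simp
qed

lemma card_conjs_N: "subgroup T G \<Longrightarrow> H \<in> (\<lambda>n. conjs n T) ` N \<Longrightarrow> subgroup H G \<and> card H = card T"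
proof -
  assume T: "subgroup T G" and "H \<in> (\<lambda>n. conjs n T) ` N"
  then obtain n where n: "n \<in> N" "H = conjs n T" by blast
  show "subgroup H G \<and> card H = card T"
    unfolding n(2) using subgroup_conjs[OF Nc[OF n(1)] T] card_conjs[OF Nc[OF n(1)] subgroup.subset[OF T]] by simp
qed

lemma oddX: "odd (card X)" using cardX by simp

lemma cardXS: "card XS = 4"
  using inj_conjs_N(2)[OF sX oddX cyc_self] fpf by simp

lemma XS: "H \<in> XS \<Longrightarrow> subgroup H G" "H \<in> XS \<Longrightarrow> card H = 3 ^ k"
  using card_conjs_N[OF sX] unfolding cardX by blast+

lemma cyc_N: "n \<in> N \<Longrightarrow> cyc n = {\<one>, n}"
  using cyc_involution[OF Nc involutions] .

lemma I2: "H \<in> I2 \<Longrightarrow> subgroup H G" "H \<in> I2 \<Longrightarrow> card H = 2"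
proof -
  assume "H \<in> I2"
  then obtain n where n: "n \<in> N" "n \<noteq> \<one>" "H = cyc n" using D E by blast
  then show "subgroup H G" "card H = 2" using subgroup_cyc card_cyc Nc ordN by auto
qed

lemma cardI2: "card I2 = 3"
proof -
  have "cyc a = {\<one>, a}" "cyc b = {\<one>, b}" "cyc (a \<otimes> b) = {\<one>, a \<otimes> b}" using cyc_N by simp_all
  then show ?thesis using D(4) E(1-5) by (auto simp: doubleton_eq_iff)
qed

lemma pow3_neq: "(3::nat) ^ k \<noteq> 1" "\<not> 2 dvd (3::nat) ^ k"
  using k0 by (simp_all add: nat_power_eq_Suc_0_iff)

end

context group
begin

lemma normalized_set_mult_subgroup:
  assumes sR: "subgroup R G" and X: "subgroup X G" and R: "\<And>u r. u \<in> X \<Longrightarrow> r \<in> R \<Longrightarrow> conj u r \<in> R"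
  shows "subgroup (X <#> R) G"
proof (rule subgroupI)
  note c = subgroup.mem_carrier[OF X] subgroup.mem_carrier[OF sR]
  show "X <#> R \<subseteq> carrier G" using c by (auto simp: set_mult_def)
  show "X <#> R \<noteq> {}" using subgroup.one_closed[OF X] subgroup.one_closed[OF sR] by (auto simp: set_mult_def)
  fix g assume "g \<in> X <#> R"
  then obtain u r where g: "u \<in> X" "r \<in> R" "g = u \<otimes> r" by (auto simp: set_mult_def)
  have "inv g = inv u \<otimes> conj u (inv r)" using g c by (simp add: conj_def m_assoc inv_mult_group)
  moreover have "conj u (inv r) \<in> R"
    by (rule R[OF g(1) subgroup.m_inv_closed[OF sR g(2)]])
  ultimately show "inv g \<in> X <#> R" using subgroup.m_inv_closed[OF X g(1)] by (auto simp: set_mult_def)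
  fix h assume "h \<in> X <#> R"
  then obtain u' r' where h: "u' \<in> X" "r' \<in> R" "h = u' \<otimes> r'" by (auto simp: set_mult_def)
  have "g \<otimes> h = (u \<otimes> u') \<otimes> (conj (inv u') r \<otimes> r')"
    using g h c by (simp add: conj_def m_assoc inv_mult_group)
  moreover have "conj (inv u') r \<otimes> r' \<in> R"
    by (rule subgroup.m_closed[OF sR R[OF subgroup.m_inv_closed[OF X h(1)] g(2)] h(2)])
  ultimately show "g \<otimes> h \<in> X <#> R" using subgroup.m_closed[OF X g(1) h(1)] by (auto simp: set_mult_def)
qed

lemma normal_set_mult_subgroup:
  assumes R: "R \<lhd> G" and X: "subgroup X G" shows "subgroup (X <#> R) G"
  by (rule normalized_set_mult_subgroup[OF normal_imp_subgroup[OF R] X])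
     (rule normal_conj_closed[OF R subgroup.mem_carrier[OF X]])

lemma klein_subgroup:
  assumes "u \<in> carrier G" "v \<in> carrier G" "u \<otimes> u = \<one>" "v \<otimes> v = \<one>" "u \<otimes> v = v \<otimes> u"
  shows "subgroup {\<one>, u, v, u \<otimes> v} G"
proof -
  have i: "inv u = u" "inv v = v" using assms by (auto intro!: inv_equality)
  have 1: "u \<otimes> (u \<otimes> v) = v" using assms(1-4) by (simp add: m_assoc[symmetric])
  have 2: "v \<otimes> (v \<otimes> u) = u" using assms(1-4) by (simp add: m_assoc[symmetric])
  have vu: "v \<otimes> u = u \<otimes> v" using assms(5) by simp
  have 3: "v \<otimes> (u \<otimes> v) = u" using 2 vu by simp
  have 4: "u \<otimes> v \<otimes> v = u" using assms(1-4) by (simp add: m_assoc)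
  have 5: "u \<otimes> v \<otimes> u = v" using 1 vu assms(1-4) by (simp add: m_assoc)
  have 6: "u \<otimes> v \<otimes> (u \<otimes> v) = \<one>" using 3 assms(1-4) by (simp add: m_assoc)
  have "inv (u \<otimes> v) = u \<otimes> v" using 6 assms(1,2) by (auto intro!: inv_equality)
  then show ?thesis using assms(1-4) i 1 vu 3 4 5 6 by (intro subgroupI) auto
qed

lemma conj_conj:
  "g \<in> carrier G \<Longrightarrow> s \<in> carrier G \<Longrightarrow> n \<in> carrier G \<Longrightarrow> conj (conj g s) (conj g n) = conj g (conj s n)"
  by (simp add: conj_def m_assoc inv_mult_group)

end

definition (in group) nsub :: "nat \<Rightarrow> nat" where
  "nsub s = card {H. subgroup H G \<and> card H = s}"

lemma (in finite_group) finite_subgroups: "finite {H. subgroup H G \<and> P H}"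
proof (rule finite_subset)
  show "{H. subgroup H G \<and> P H} \<subseteq> Pow (carrier G)" using subgroup.subset by blast
qed simp

lemma (in finite_group) nsub_ge:
  assumes "\<And>H. H \<in> A \<Longrightarrow> subgroup H G \<and> card H = s" shows "card A \<le> nsub s"
  unfolding nsub_def by (rule card_mono[OF finite_subgroups]) (use assms in blast)

lemma (in small_comax) sum_nsub_2_3_le:
  assumes "2 ^ e dvd order G" "3 dvd order G" "e \<noteq> 0" "finite S"
    and S: "\<And>s. s \<in> S \<Longrightarrow> s \<noteq> 1 \<and> (\<not> 3 dvd s \<and> \<not> 2 ^ e dvd s \<or> odd s)"
  shows "(\<Sum>s\<in>S. nsub s) \<le> 14"
proof -
  let ?A = "\<lambda>s. {H. subgroup H G \<and> card H = s}"
  have "card (\<Union>s\<in>S. ?A s) = (\<Sum>s\<in>S. nsub s)"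
    unfolding nsub_def by (rule card_UN_disjoint) (use assms(4) finite_subgroups in auto)
  moreover have "card (\<Union>s\<in>S. ?A s) \<le> 14"
    by (rule card_family_2_3_le[OF assms(1-3)]) (use S in auto)
  ultimately show ?thesis by simp
qed

lemma (in finite_group) cyc_involutions:
  assumes "finite I" "\<And>u. u \<in> I \<Longrightarrow> u \<in> carrier G \<and> u \<noteq> \<one> \<and> u \<otimes> u = \<one>"
  shows "card (cyc ` I) = card I" "H \<in> cyc ` I \<Longrightarrow> subgroup H G \<and> card H = 2"
proof -
  have cy: "cyc u = {\<one>, u}" if "u \<in> I" for u using cyc_involution assms(2)[OF that] by blast
  have "inj_on cyc I"
    using cy assms(2) by (intro inj_onI) (metis doubleton_eq_iff)
  then show "card (cyc ` I) = card I" by (rule card_image)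
  assume "H \<in> cyc ` I"
  then obtain u where u: "u \<in> I" "H = cyc u" by blast
  have "subgroup (cyc u) G" using assms(2)[OF u(1)] subgroup_cyc by blast
  moreover have "card (cyc u) = 2" unfolding cy[OF u(1)] using assms(2)[OF u(1)] by auto
  ultimately show "subgroup H G \<and> card H = 2" using u(2) by simp
qed

context rot_comax
begin

lemma cardN1: "card (N - {\<one>}) = 3"
proof -
  have "card (N - {\<one>}) = card N - 1" by (rule card_Diff_singleton) simp
  then show ?thesis unfolding cardN by simp
qed

lemma fixes_N: "y \<in> carrier G \<Longrightarrow> conj y a = a \<Longrightarrow> conj y b = b \<Longrightarrow> n \<in> N \<Longrightarrow> conj y n = n"
  using D by (auto simp: conj_mult)

text \<open>For an element \<open>y\<close> of odd order that centralizes \<open>N\<close>, these are three cyclic groups of order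
  \<open>2 * ord y\<close>.\<close>

abbreviation Ext where "Ext y \<equiv> (\<lambda>n. cyc (n \<otimes> y)) ` (N - {\<one>})"

lemma Ext:
  assumes y: "y \<in> carrier G" "odd (ord y)" "conj y a = a" "conj y b = b"
  shows "card (Ext y) = 3" "H \<in> Ext y \<Longrightarrow> subgroup H G \<and> card H = 2 * ord y"
proof -
  have fx: "conj y n = n" if "n \<in> N" for n by (rule fixes_N[OF y(1,3,4) that])
  have "inj_on (\<lambda>n. cyc (n \<otimes> y)) (N - {\<one>})"
  proof (rule inj_onI)
    fix n m assume n: "n \<in> N - {\<one>}" and m: "m \<in> N - {\<one>}" and e: "cyc (n \<otimes> y) = cyc (m \<otimes> y)"
    have nm: "n \<in> N" "n \<noteq> \<one>" "m \<in> N" "m \<noteq> \<one>" using n m by blast+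
    show "n = m"
      by (rule cyc_involution_mult_inj(1)[OF Nc[OF nm(1)] ordN[OF nm(1,2)] y(1,2) fx[OF nm(1)]
            Nc[OF nm(3)] ordN[OF nm(3,4)] y(1) refl fx[OF nm(3)] e])
  qed
  then show "card (Ext y) = 3" using cardN1 by (simp only: card_image)
  assume "H \<in> Ext y"
  then obtain n where n: "n \<in> N" "n \<noteq> \<one>" "H = cyc (n \<otimes> y)" by blast
  show "subgroup H G \<and> card H = 2 * ord y"
    using ord_involution_mult(1)[OF Nc[OF n(1)] ordN[OF n(1,2)] y(1,2) fx[OF n(1)]] n(3)
      subgroup_cyc[of "n \<otimes> y"] card_cyc[of "n \<otimes> y"] Nc[OF n(1)] y(1) by simp
qed

lemma Ext_disjoint:
  assumes y: "y \<in> carrier G" "odd (ord y)" "conj y a = a" "conj y b = b"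
    and z: "z \<in> carrier G" "ord z = ord y" "conj z a = a" "conj z b = b" and ne: "cyc y \<noteq> cyc z"
  shows "Ext y \<inter> Ext z = {}"
proof (rule ccontr)
  assume "Ext y \<inter> Ext z \<noteq> {}"
  then obtain n m where n: "n \<in> N - {\<one>}" and m: "m \<in> N - {\<one>}" and e: "cyc (n \<otimes> y) = cyc (m \<otimes> z)"
    by blast
  have nm: "n \<in> N" "n \<noteq> \<one>" "m \<in> N" "m \<noteq> \<one>" using n m by blast+
  have "cyc y = cyc z"
    by (rule cyc_involution_mult_inj(2)[OF Nc[OF nm(1)] ordN[OF nm(1,2)] y(1,2) fixes_N[OF y(1,3,4) nm(1)]
          Nc[OF nm(3)] ordN[OF nm(3,4)] z(1,2) fixes_N[OF z(1,3,4) nm(3)] e])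
  then show False using ne by blast
qed

text \<open>An element of odd order that does not centralize \<open>N\<close> permutes the three involutions cyclically, so its
  order is divisible by 3.\<close>

lemma prime_ge_5_centralizes:
  assumes y: "y \<in> carrier G" "ord y = r" and r: "prime r" "5 \<le> r"
  shows "conj y a = a" "conj y b = b"
proof -
  let ?E = "N - {\<one>}" and ?Y = "G\<lparr>carrier := cyc y\<rparr>"
  let ?F = "{n \<in> ?E. \<forall>g\<in>carrier ?Y. conj g n = n}"
  have sY: "subgroup (cyc y) G" by (rule subgroup_cyc[OF y(1)])
  have c: "g \<in> carrier G" if "g \<in> cyc y" for g by (rule subgroup.mem_carrier[OF sY that])
  have "[card ?E = card ?F] (mod r)"
  proof (rule p_group_card_fixed_points[where n = 1])
    show "group ?Y" by (rule subgroup_imp_group[OF sY])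
    show "order ?Y = r ^ 1" using card_cyc[OF y(1)] y(2) by (simp add: order_def)
    show "finite ?E" by simp
    show "conj g n \<in> ?E" if "g \<in> carrier ?Y" "n \<in> ?E" for g n
    proof -
      have g: "g \<in> carrier G" using c that(1) by simp
      have "conj g n \<in> N" using normal_conj_closed[OF nN g] that(2) by blast
      moreover have "conj g n \<noteq> \<one>" using conj_inj[OF g Nc one_closed, of n] g that(2) by simp
      ultimately show ?thesis by blast
    qed
    show "conj \<one>\<^bsub>?Y\<^esub> n = n" if "n \<in> ?E" for n using Nc[of n] that by simp
    show "conj (g \<otimes>\<^bsub>?Y\<^esub> h) n = conj g (conj h n)"
      if "g \<in> carrier ?Y" "h \<in> carrier ?Y" "n \<in> ?E" for g h n
      using c that Nc[of n] by (simp add: conj_mult_left)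
  qed (rule r(1))
  moreover note cE = cardN1
  moreover have "card ?F \<le> 3" using card_mono[of ?E ?F] cE by auto
  ultimately have "card ?F = 3" using r(2) by (simp add: cong_def)
  then have cF: "card ?F = card ?E" unfolding cE .
  have "finite ?E" by simp
  moreover have "?F \<subseteq> ?E" by blast
  ultimately have FE: "?F = ?E" using cF by (rule card_subset_eq)
  have "conj y n = n" if n: "n \<in> ?E" for n
  proof -
    have "n \<in> ?F" using FE n by blast
    then show ?thesis using cyc_self[of y] by simp
  qed
  then show "conj y a = a" "conj y b = b" using D(4) E(1) by simp_all
qed

lemma nsub_2: "3 \<le> nsub 2"
  unfolding cardI2[symmetric] by (rule nsub_ge) (use I2 in blast)

lemma nsub_X: "4 \<le> nsub (3 ^ k)"
  unfolding cardXS[symmetric] by (rule nsub_ge) (use XS in blast)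

text \<open>Let \<open>R\<close> have prime order \<open>r \<ge> 5\<close>. It centralizes \<open>N\<close>, which gives three cyclic subgroups of order
  \<open>2 * r\<close>. If \<open>R\<close> is not normal, a second conjugate makes the family of three subgroups of order 2,
  two of order \<open>r\<close>, six of order \<open>2 * r\<close> and four conjugates of \<open>X\<close>. If \<open>R\<close> is normal, the family is
  three of order 2, \<open>R\<close>, three of order \<open>2 * r\<close>, four conjugates of \<open>X\<close> and the four products of these
  with \<open>R\<close>. Both have 15 members.\<close>

lemma prime_divisors_order:
  assumes r: "prime r" "r dvd order G" shows "r = 2 \<or> r = 3"
proof (rule ccontr)
  assume ne: "\<not> ?thesis"
  have "r \<noteq> 4" using r(1) by auto
  then have r5: "5 \<le> r" using ne prime_ge_2_nat[OF r(1)] by auto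
  have oddr: "odd r" using ne r(1) primes_dvd_imp_eq two_is_prime_nat by blast
  have r3: "\<not> 3 dvd r" using ne r(1) primes_dvd_imp_eq[of 3 r] by auto
  have r3k: "coprime r (3 ^ k)" using ne r(1) primes_coprime[of r 3] by simp
  have n32: "\<not> 3 dvd 2 * r" using r3 by presburger
  have n42: "\<not> 4 dvd 2 * r" using oddr by presburger
  obtain y where y: "y \<in> carrier G" "ord y = r" using Cauchy_subgroup[OF r] by blast
  note cy = prime_ge_5_centralizes[OF y r(1) r5]
  have oy: "odd (ord y)" using y oddr by simp
  note Exty = Ext[OF y(1) oy cy, unfolded y(2)]
  have sy: "subgroup (cyc y) G" "card (cyc y) = r" using subgroup_cyc card_cyc y by auto
  have r3k': "r \<noteq> 3 ^ k" using r3 pow3_neq k0 dvd_power[of k "3::nat"] by auto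
  note n2 = nsub_2 and nX = nsub_X
  have finN: "finite N" by simp
  have "3 dvd (3::nat) ^ k" using k0 by simp
  define t where "t = (3::nat) ^ k"
  have t: "odd t" "t \<noteq> 1" "t \<noteq> r" "t \<noteq> 0" using pow3_neq r3k' by (auto simp: t_def)
  have otr: "odd (t * r)" using t oddr by simp
  have distinct: "2 \<notin> {r, 2 * r, t, t * r}" "r \<notin> {2 * r, t, t * r}" "2 * r \<notin> {t, t * r}" "t \<notin> {t * r}"
  proof -
    have "2 \<noteq> t * r" "2 * r \<noteq> t * r" using otr by (metis dvd_refl, metis dvd_triv_left)
    moreover have "2 \<noteq> t" "2 * r \<noteq> t" using t(1) by auto
    moreover have "r \<noteq> t * r" "t \<noteq> t * r" using t r5 by auto
    ultimately show "2 \<notin> {r, 2 * r, t, t * r}" "r \<notin> {2 * r, t, t * r}" "2 * r \<notin> {t, t * r}" "t \<notin> {t * r}"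
      using t(3) r5 by auto
  qed
  have sum4: "(\<Sum>s\<in>{2, r, 2 * r, t}. nsub s) = nsub 2 + nsub r + nsub (2 * r) + nsub t"
    using distinct by simp
  have sum5: "(\<Sum>s\<in>{2, r, 2 * r, t, t * r}. nsub s) = nsub 2 + nsub r + nsub (2 * r) + nsub t + nsub (t * r)"
    using distinct by simp
  have adm2: "(2::nat) \<noteq> 1 \<and> (\<not> 3 dvd (2::nat) \<and> \<not> 2 ^ 2 dvd (2::nat) \<or> odd (2::nat))" by simp
  have admr: "r \<noteq> 1 \<and> (\<not> 3 dvd r \<and> \<not> 2 ^ 2 dvd r \<or> odd r)" using oddr r5 by simp
  have adm2r: "2 * r \<noteq> 1 \<and> (\<not> 3 dvd 2 * r \<and> \<not> 2 ^ 2 dvd 2 * r \<or> odd (2 * r))" using n32 n42 by simp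
  have admX: "(3::nat) ^ k \<noteq> 1 \<and> (\<not> 3 dvd (3::nat) ^ k \<and> \<not> 2 ^ 2 dvd (3::nat) ^ k \<or> odd ((3::nat) ^ k))"
    using pow3_neq by blast
  have admXr: "3 ^ k * r \<noteq> 1 \<and> (\<not> 3 dvd 3 ^ k * r \<and> \<not> 2 ^ 2 dvd 3 ^ k * r \<or> odd (3 ^ k * r))"
    using oddr r5 by simp
  show False
  proof (cases "\<exists>g\<in>carrier G. conjs g (cyc y) \<noteq> cyc y")
    case True
    then obtain g where g: "g \<in> carrier G" "conjs g (cyc y) \<noteq> cyc y" by blast
    define z where "z = conj g y"
    have z: "z \<in> carrier G" using g y by (simp add: z_def)
    have cz: "cyc z = conjs g (cyc y)" using conjs_cyc[OF g(1) y(1)] by (simp add: z_def)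
    have "card (cyc z) = r" using cz sy(2) card_conjs[OF g(1) subgroup.subset[OF sy(1)]] by simp
    then have oz: "ord z = r" using card_cyc[OF z] by simp
    note zz = prime_ge_5_centralizes[OF z oz r(1) r5]
    have oz': "odd (ord z)" using oz oddr by simp
    note Extz = Ext[OF z oz' zz, unfolded oz]
    have ne: "cyc y \<noteq> cyc z" using g(2) cz by simp
    have disj: "Ext y \<inter> Ext z = {}" by (rule Ext_disjoint[OF y(1) oy cy z _ zz ne]) (simp add: oz y(2))
    have sz: "subgroup (cyc z) G" "card (cyc z) = r" using subgroup_cyc card_cyc z oz by auto
    have "card {cyc y, cyc z} \<le> nsub r" by (rule nsub_ge) (use sy sz in blast)
    then have "2 \<le> nsub r" using ne by simp
    moreover have "6 \<le> nsub (2 * r)"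
    proof -
      have "card (Ext y \<union> Ext z) = 6"
        unfolding card_Un_disjoint[OF finite_imageI finite_imageI disj, OF finite_Diff finite_Diff, OF finN finN]
          Exty(1) Extz(1) by simp
      moreover have "card (Ext y \<union> Ext z) \<le> nsub (2 * r)"
        by (rule nsub_ge) (use Exty(2) Extz(2) in blast)
      ultimately show ?thesis by simp
    qed
    moreover have "(\<Sum>s\<in>{2, r, 2 * r, 3 ^ k}. nsub s) \<le> 14"
    proof (rule sum_nsub_2_3_le[where e = 2])
      fix s assume "s \<in> {2, r, 2 * r, 3 ^ k}"
      then show "s \<noteq> 1 \<and> (\<not> 3 dvd s \<and> \<not> 2 ^ 2 dvd s \<or> odd s)"
        using adm2 admr adm2r admX by (elim insertE emptyE) (simp_all only: simp_thms)
    qed (use order4 order3 in simp_all)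
    ultimately show False using n2 nX sum4 sum5 unfolding t_def by simp
  next
    case False
    then have nR: "cyc y \<lhd> G" by (intro conjs_fixed_imp_normal[OF sy(1)]) blast
    let ?T = "X <#> cyc y"
    have sT: "subgroup ?T G" by (rule normal_set_mult_subgroup[OF nR sX])
    have "X \<inter> cyc y = {\<one>}"
      by (rule coprime_card_Int[OF sX sy(1)]) (use cardX sy(2) r3k in \<open>simp add: coprime_commute\<close>)
    then have cT: "card ?T = 3 ^ k * r" using card_set_mult_Int[OF sX sy(1)] cardX sy(2) by simp
    have oT: "odd (card ?T)" using cT oddr by simp
    have xT: "x \<in> ?T" 
      unfolding set_mult_def using cyc_self[of x] subgroup.one_closed[OF sy(1)] D(3) by force
    have cTS: "card ((\<lambda>n. conjs n ?T) ` N) = 4" by (rule inj_conjs_N(2)[OF sT oT xT fpf])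
    have TS: "subgroup H G \<and> card H = 3 ^ k * r" if "H \<in> (\<lambda>n. conjs n ?T) ` N" for H
      using card_conjs_N[OF sT that] cT by simp
    have "card {cyc y} \<le> nsub r" by (rule nsub_ge) (use sy in blast)
    then have "1 \<le> nsub r" by simp
    moreover have "3 \<le> nsub (2 * r)" unfolding Exty(1)[symmetric] by (rule nsub_ge) (rule Exty(2))
    moreover have "4 \<le> nsub (3 ^ k * r)" unfolding cTS[symmetric] by (rule nsub_ge) (rule TS)
    moreover have "(\<Sum>s\<in>{2, r, 2 * r, 3 ^ k, 3 ^ k * r}. nsub s) \<le> 14"
    proof (rule sum_nsub_2_3_le[where e = 2])
      fix s assume "s \<in> {2, r, 2 * r, 3 ^ k, 3 ^ k * r}"
      then show "s \<noteq> 1 \<and> (\<not> 3 dvd s \<and> \<not> 2 ^ 2 dvd s \<or> odd s)"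
        using adm2 admr adm2r admX admXr by (elim insertE emptyE) (simp_all only: simp_thms)
    qed (use order4 order3 in simp_all)
    ultimately show False using n2 nX sum4 sum5 unfolding t_def by simp
  qed
qed

end

context rot_comax
begin

lemma sum_nsub_2_4_X:
  assumes "8 dvd order G"
  shows "nsub 2 + nsub 4 + nsub (3 ^ k) \<le> 14"
proof -
  have "(\<Sum>s\<in>{2, 4, 3 ^ k}. nsub s) \<le> 14"
    by (rule sum_nsub_2_3_le[where e = 3]) (use assms order3 pow3_neq in auto)
  moreover have "2 \<noteq> (3::nat) ^ k" "4 \<noteq> (3::nat) ^ k"
    using pow3_neq(2) by (metis even_numeral, metis even_numeral)
  ultimately show ?thesis by simp
qed

text \<open>Three cases show that \<open>N\<close> is a Sylow 2-subgroup: an element \<open>s\<close> outside \<open>N\<close> with square in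
  \<open>N\<close> either centralizes \<open>N\<close> and is an involution, or centralizes \<open>N\<close> and has order 4, or acts on
  \<open>N\<close> as a transposition.\<close>

text \<open>Seven involutions and four Klein groups, besides the four conjugates of \<open>X\<close>.\<close>

lemma no_centralizing_involution:
  assumes o8: "8 dvd order G"
    and s: "s \<in> carrier G" "s \<notin> N" "s \<otimes> s = \<one>" "conj s a = a" "conj s b = b"
  shows False
proof -
  have cs: "n \<otimes> s = s \<otimes> n" if "n \<in> N" for n
    using fixes_N[OF s(1,4,5) that] conj_fixed_iff[OF s(1) Nc[OF that]] by simp
  have s1: "s \<noteq> \<one>" using s(2) by auto
  have nsN: "n \<otimes> s \<notin> N" if n: "n \<in> N" for n
  proof
    assume "n \<otimes> s \<in> N"
    then have "n \<otimes> (n \<otimes> s) \<in> N" using subgroup.m_closed[OF sN n] by blast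
    moreover have "n \<otimes> (n \<otimes> s) = s" using involutions[OF n] Nc[OF n] s(1) by (simp add: m_assoc[symmetric])
    ultimately show False using s(2) by simp
  qed
  let ?I = "(N - {\<one>}) \<union> (\<lambda>n. n \<otimes> s) ` N"
  have inv: "u \<in> carrier G \<and> u \<noteq> \<one> \<and> u \<otimes> u = \<one>" if u: "u \<in> ?I" for u
  proof -
    have "?thesis" if "u \<in> N" "u \<noteq> \<one>" using that Nc involutions by blast
    moreover have "?thesis" if "u = n \<otimes> s" "n \<in> N" for n
    proof -
      have "u \<noteq> \<one>" using nsN[OF that(2)] that(1) by auto
      moreover have "u \<otimes> u = n \<otimes> (s \<otimes> n) \<otimes> s" using that Nc s(1) by (simp add: m_assoc)
      then have "u \<otimes> u = (n \<otimes> n) \<otimes> (s \<otimes> s)"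
        unfolding cs[OF that(2), symmetric] using Nc[OF that(2)] s(1) by (simp add: m_assoc)
      ultimately show ?thesis using that Nc[OF that(2)] involutions[OF that(2)] s(1,3) by simp
    qed
    ultimately show ?thesis using u by blast
  qed
  have "inj_on (\<lambda>n. n \<otimes> s) N"
  proof (rule inj_onI)
    fix m n assume "m \<in> N" "n \<in> N" and e: "m \<otimes> s = n \<otimes> s"
    then have "m \<in> carrier G" "n \<in> carrier G" using Nc by blast+
    then show "m = n" using e s(1) by simp
  qed
  then have "card ((\<lambda>n. n \<otimes> s) ` N) = 4" unfolding cardN[symmetric] by (rule card_image)
  moreover have "(N - {\<one>}) \<inter> (\<lambda>n. n \<otimes> s) ` N = {}"
  proof (rule ccontr)
    assume "\<not> ?thesis"
    then obtain m where m: "m \<in> N - {\<one>}" "m \<in> (\<lambda>n. n \<otimes> s) ` N" by auto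
    from m(2) obtain n where n: "n \<in> N" "m = n \<otimes> s" by (rule imageE)
    show False using nsN[OF n(1)] DiffD1[OF m(1)] unfolding n(2) by (rule notE)
  qed
  ultimately have "card ?I = 7" using cardN1 by (subst card_Un_disjoint) simp_all
  moreover have fI: "finite ?I" by simp
  ultimately have "card (cyc ` ?I) = 7" using cyc_involutions(1)[OF fI inv] by simp
  moreover have "card (cyc ` ?I) \<le> nsub 2"
    by (rule nsub_ge) (rule cyc_involutions(2)[OF fI inv])
  ultimately have n2: "7 \<le> nsub 2" by simp
  let ?V = "\<lambda>n. {\<one>, n, s, n \<otimes> s}"
  have V: "subgroup (?V n) G \<and> card (?V n) = 4" if n: "n \<in> N - {\<one>}" for n
  proof -
    have nN: "n \<in> N" "n \<noteq> \<one>" using n by blast+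
    have "subgroup (?V n) G"
      by (rule klein_subgroup[OF Nc[OF nN(1)] s(1) involutions[OF nN(1)] s(3) cs[OF nN(1)]])
    moreover have "n \<otimes> s \<noteq> \<one>" "n \<otimes> s \<noteq> n" "n \<otimes> s \<noteq> s" "n \<noteq> s"
      using nsN[OF nN(1)] nN s Nc[OF nN(1)] by auto
    ultimately show ?thesis using nN(2) s1 by auto
  qed
  have "inj_on ?V (N - {\<one>})"
  proof (rule inj_onI)
    fix n m assume n: "n \<in> N - {\<one>}" and m: "m \<in> N - {\<one>}" and e: "?V n = ?V m"
    have "n \<in> ?V m" using e by blast
    then show "n = m" using n m s(2) nsN[of m] by blast
  qed
  then have c3: "card (?V ` (N - {\<one>})) = 3" using cardN1 by (simp only: card_image)
  have NV: "N \<notin> ?V ` (N - {\<one>})" using s(2) by blast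
  have "finite (?V ` (N - {\<one>}))" by (rule finite_imageI) simp
  from card_insert_disjoint[OF this NV] c3 have "card (insert N (?V ` (N - {\<one>}))) = 4" by linarith
  moreover have "card (insert N (?V ` (N - {\<one>}))) \<le> nsub 4"
    by (rule nsub_ge) (use V sN cardN in blast)
  ultimately have n4: "4 \<le> nsub 4" by simp
  show False using n2 n4 nsub_X sum_nsub_2_4_X[OF o8] by simp
qed

text \<open>Three involutions, \<open>N\<close> and three cyclic subgroups of order 4, besides eight conjugates of \<open>X\<close>.\<close>

lemma no_centralizing_order_4:
  assumes o8: "8 dvd order G"
    and s: "s \<in> carrier G" "s \<notin> N" "s \<otimes> s \<in> N" "s \<otimes> s \<noteq> \<one>" "conj s a = a" "conj s b = b"
  shows False
proof -
  let ?z = "s \<otimes> s"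
  have z: "?z \<in> carrier G" "?z \<otimes> ?z = \<one>" using s(1) involutions[OF s(3)] by simp_all
  have s4: "s [^] (4::nat) = \<one>" using z s(1) by (simp add: numeral_eq_Suc m_assoc)
  have s2: "s [^] (2::nat) = ?z" using s(1) by (simp add: numeral_2_eq_2)
  have "ord s dvd 4" using s4 pow_eq_id[OF s(1)] by blast
  moreover have "\<not> ord s dvd 2" using s2 s(4) pow_eq_id[OF s(1), of 2] by simp
  ultimately have os: "ord s = 4"
  proof -
    have "ord s \<le> 4" using \<open>ord s dvd 4\<close> by (rule dvd_imp_le) simp
    then have "ord s = 0 \<or> ord s = 1 \<or> ord s = 2 \<or> ord s = 3 \<or> ord s = 4" by linarith
    then show ?thesis using \<open>ord s dvd 4\<close> \<open>\<not> ord s dvd 2\<close> by auto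
  qed
  have sq: "u \<otimes> u = \<one> \<or> u \<otimes> u = ?z" if u: "u \<in> cyc s" for u
  proof -
    obtain j :: nat where j: "u = s [^] j" using u mem_cyc[OF s(1)] by blast
    have "u \<otimes> u = ?z [^] j"
      unfolding j s2[symmetric] using s(1) by (simp add: nat_pow_pow nat_pow_mult mult_2)
    moreover have "?z [^] j \<in> {\<one>, ?z}" by (induction j) (use z in auto)
    ultimately show ?thesis by simp
  qed
  \<comment> \<open>The conjugates of \<open>s\<close> under \<open>x\<close> square to the three different involutions of \<open>N\<close>.\<close>
  let ?s1 = "conj x s" and ?s2 = "conj x (conj x s)"
  have c1: "?s1 \<in> carrier G" "?s2 \<in> carrier G" using s(1) D(3) by simp_all
  have z1: "?s1 \<otimes> ?s1 = conj x ?z" "?s2 \<otimes> ?s2 = conj x (conj x ?z)"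
    using s(1) D(3) by (simp_all add: conj_mult)
  have zN: "?z = a \<or> ?z = b \<or> ?z = a \<otimes> b" using s(3,4) by blast
  then have dist: "conj x ?z \<noteq> ?z" "conj x (conj x ?z) \<noteq> ?z" "conj x (conj x ?z) \<noteq> conj x ?z"
    "conj x ?z \<noteq> \<one>" "conj x (conj x ?z) \<noteq> \<one>"
    using D E by auto
  have o1: "card (cyc u) = 4 \<and> subgroup (cyc u) G" if "u \<in> {s, ?s1, ?s2}" for u
  proof -
    have "card (cyc s) = 4" "subgroup (cyc s) G" using card_cyc[OF s(1)] os subgroup_cyc[OF s(1)] by simp_all
    moreover have "cyc ?s1 = conjs x (cyc s)" "cyc ?s2 = conjs x (cyc ?s1)"
      using conjs_cyc[OF D(3)] s(1) c1 by simp_all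
    ultimately show ?thesis
      using that subgroup_cyc c1 card_conjs[OF D(3) subgroup.subset[OF subgroup_cyc[OF s(1)]]]
        card_conjs[OF D(3) subgroup.subset[OF subgroup_cyc[OF c1(1)]]] by auto
  qed
  have ne: "cyc s \<noteq> cyc ?s1" "cyc s \<noteq> cyc ?s2" "cyc ?s1 \<noteq> cyc ?s2"
  proof -
    show "cyc s \<noteq> cyc ?s1" using sq[of ?s1] cyc_self[of ?s1] z1 dist by auto
    show "cyc s \<noteq> cyc ?s2" using sq[of ?s2] cyc_self[of ?s2] z1 dist by auto
    show "cyc ?s1 \<noteq> cyc ?s2"
    proof
      assume "cyc ?s1 = cyc ?s2"
      moreover have "cyc s = conjs (inv x) (cyc ?s1)" "cyc ?s1 = conjs (inv x) (cyc ?s2)"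
        using conjs_cyc[of "inv x" ?s1] conjs_cyc[of "inv x" ?s2] D(3) s(1) c1 by simp_all
      ultimately have "cyc s = cyc ?s1" by simp
      then show False using \<open>cyc s \<noteq> cyc ?s1\<close> by simp
    qed
  qed
  have "N \<noteq> cyc u" if "u \<in> {s, ?s1, ?s2}" for u
  proof
    assume "N = cyc u"
    then have "u \<in> N" using cyc_self[of u] by blast
    then have "u \<otimes> u = \<one>" by (rule involutions)
    then show False using that z1 dist s(4) by auto
  qed
  then have "card {N, cyc s, cyc ?s1, cyc ?s2} = 4" using ne by simp
  moreover have "card {N, cyc s, cyc ?s1, cyc ?s2} \<le> nsub 4"
    by (rule nsub_ge) (use o1 sN cardN in blast)
  ultimately have n4: "4 \<le> nsub 4" by simp
  \<comment> \<open>\<open>M\<close> has order 8 and no nontrivial element of it normalizes \<open>X\<close>.\<close>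
  let ?M = "cyc s <#> N"
  have sM: "subgroup ?M G" by (rule normal_set_mult_subgroup[OF nN subgroup_cyc[OF s(1)]])
  have "cyc s \<inter> N = {\<one>, ?z}"
  proof
    show "{\<one>, ?z} \<subseteq> cyc s \<inter> N"
      using s(3) subgroup.one_closed[OF subgroup_cyc[OF s(1)]] subgroup.m_closed[OF subgroup_cyc[OF s(1)] cyc_self cyc_self]
      by auto
    show "cyc s \<inter> N \<subseteq> {\<one>, ?z}"
    proof
      fix u assume u: "u \<in> cyc s \<inter> N"
      obtain j :: nat where j: "u = s [^] j" using u mem_cyc[OF s(1)] by blast
      show "u \<in> {\<one>, ?z}"
      proof (cases "even j")
        case True
        then obtain i where i: "j = 2 * i" by auto
        have "u = ?z [^] i" unfolding j i s2[symmetric] using s(1) by (simp add: nat_pow_pow)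
        moreover have "?z [^] i \<in> {\<one>, ?z}" by (induction i) (use z in auto)
        ultimately show ?thesis by simp
      next
        case False
        then obtain i where i: "j = 2 * i + 1" by (auto elim: oddE)
        have e: "u = ?z [^] i \<otimes> s"
          unfolding j i s2[symmetric] using s(1) by (simp add: nat_pow_pow)
        have "?z [^] i \<in> N" by (rule pow_subgroup_closed[OF sN s(3)])
        then have "inv (?z [^] i) \<otimes> u \<in> N"
          by (rule subgroup.m_closed[OF sN subgroup.m_inv_closed[OF sN] IntD2[OF u]])
        then show ?thesis using e z(1) s(1,2) by simp
      qed
    qed
  qed
  then have "card ?M * 2 = 4 * 4"
    using card_set_mult_Int[OF subgroup_cyc[OF s(1)] sN] o1[of s] cardN s(4) by simp
  then have c8: "card ?M = 8" by simp
  have "inj_on (\<lambda>g. conjs g X) ?M"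
  proof (rule inj_on_conjs[OF sX sM])
    fix g assume g: "g \<in> ?M" "conjs g X = X"
    have gc: "g \<in> carrier G" by (rule subgroup.mem_carrier[OF sM g(1)])
    have NX: "N \<inter> X \<subseteq> {\<one>}"
    proof -
      have "coprime (card N) (card X)" 
        unfolding cardN cardX using coprime_power_left_iff[of "2::nat" 2 "3 ^ k"] by simp
      then show ?thesis using coprime_card_Int[OF sN sX] by simp
    qed
    have inN: "n = \<one>" if "n \<in> N" "conjs n X = X" for n
      using fpf[OF that(1)] normalizing_imp_centralizing[OF nN sX NX that cyc_self] by blast
    obtain u n where un: "u \<in> cyc s" "n \<in> N" "g = u \<otimes> n" using g(1) by (auto simp: set_mult_def)
    have uc: "u \<in> carrier G" by (rule subgroup.mem_carrier[OF subgroup_cyc[OF s(1)] un(1)])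
    obtain j :: nat where j: "u = s [^] j" using un(1) mem_cyc[OF s(1)] by blast
    have "conj u n = n"
      unfolding j using conj_pow_left_fixed[OF s(1) Nc[OF un(2)] fixes_N[OF s(1,5,6) un(2)]] .
    then have "u \<otimes> n = n \<otimes> u" using conj_fixed_iff[OF uc Nc[OF un(2)]] by simp
    then have "g \<otimes> g = (u \<otimes> u) \<otimes> (n \<otimes> n)" using un(3) uc Nc[OF un(2)] by (metis m_assoc m_closed)
    then have gg: "g \<otimes> g = u \<otimes> u" using involutions[OF un(2)] uc by simp
    have "g \<otimes> g = \<one>"
    proof (rule inN)
      show "g \<otimes> g \<in> N" using gg sq[OF un(1)] s(3) by auto
      show "conjs (g \<otimes> g) X = X" using conjs_mult_left[OF gc gc subgroup.subset[OF sX]] g(2) by simp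
    qed
    then have uu: "u \<otimes> u = \<one>" using gg by simp
    have "u \<in> N"
    proof (cases "even j")
      case True
      then obtain i where i: "j = 2 * i" by auto
      have "u = ?z [^] i" unfolding j i s2[symmetric] using s(1) by (simp add: nat_pow_pow)
      then show ?thesis using pow_subgroup_closed[OF sN s(3)] by simp
    next
      case False
      then obtain i where i: "j = 2 * i + 1" by (auto elim: oddE)
      have "s [^] (2 * j) = \<one>" using uu s(1) unfolding j by (simp add: nat_pow_mult mult_2)
      then have "4 dvd 2 * j" using pow_eq_id[OF s(1)] os by simp
      then show ?thesis using i by presburger
    qed
    then have "g \<in> N" using un subgroup.m_closed[OF sN] by simp
    then show "g = \<one>" using inN g(2) by blast
  qed
  then have "card ((\<lambda>g. conjs g X) ` ?M) = 8" using c8 by (simp only: card_image)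
  moreover have "card ((\<lambda>g. conjs g X) ` ?M) \<le> nsub (3 ^ k)"
  proof (rule nsub_ge)
    fix H assume "H \<in> (\<lambda>g. conjs g X) ` ?M"
    then obtain g where g: "g \<in> ?M" "H = conjs g X" by blast
    have gc: "g \<in> carrier G" by (rule subgroup.mem_carrier[OF sM g(1)])
    show "subgroup H G \<and> card H = 3 ^ k"
      unfolding g(2) using subgroup_conjs[OF gc sX] card_conjs[OF gc subgroup.subset[OF sX]] cardX by simp
  qed
  ultimately have nX: "8 \<le> nsub (3 ^ k)" by simp
  show False using n4 nX nsub_2 sum_nsub_2_4_X[OF o8] by simp
qed

text \<open>Conjugating by \<open>x\<close> yields six involutions outside \<open>N\<close>. With the three in \<open>N\<close>, the two subgroups of
  order 4 given by \<open>N\<close> and \<open>s \<otimes> b\<close>, and the four conjugates of \<open>X\<close>, these make 15.\<close>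

lemma no_transposition_involution:
  assumes o8: "8 dvd order G"
    and s: "s \<in> carrier G" "s \<notin> N" "s \<otimes> s = \<one>" "conj s a = a" "conj s b = a \<otimes> b"
  shows False
proof -
  have sab: "conj s (a \<otimes> b) = b" using s D E by (simp add: conj_mult)
  define s1 where "s1 = conj x s"
  define s2 where "s2 = conj x s1"
  have c: "s1 \<in> carrier G" "s2 \<in> carrier G" using s(1) D(3) by (simp_all add: s1_def s2_def)
  have ab: "a \<otimes> b \<in> carrier G" using D by simp
  have f1: "conj s1 b = b" "conj s1 (a \<otimes> b) = a" "conj s1 a = a \<otimes> b"
    using conj_conj[OF D(3) s(1) D(1)] conj_conj[OF D(3) s(1) D(2)] conj_conj[OF D(3) s(1) ab]
      s sab D(7,8) E(11) by (simp_all add: s1_def)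
  have f2: "conj s2 (a \<otimes> b) = a \<otimes> b" "conj s2 a = b" "conj s2 b = a"
    using conj_conj[OF D(3) c(1) D(1)] conj_conj[OF D(3) c(1) D(2)] conj_conj[OF D(3) c(1) ab]
      f1 D(7,8) E(11) by (simp_all add: s2_def)
  have comm: "m \<otimes> n = n \<otimes> m" if "conj m n = n" "m \<in> carrier G" "n \<in> carrier G" for m n
    using that conj_fixed_iff by blast
  have q1: "s1 \<otimes> s1 = \<one>" using s(1,3) D(3) conj_mult[of x s s] by (simp add: s1_def)
  have q2: "s2 \<otimes> s2 = \<one>" using c(1) q1 D(3) conj_mult[of x s1 s1] by (simp add: s2_def)
  have sqm: "(m \<otimes> n) \<otimes> (m \<otimes> n) = \<one>"
    if "conj m n = n" "m \<in> carrier G" "n \<in> carrier G" "m \<otimes> m = \<one>" "n \<otimes> n = \<one>" for m n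
  proof -
    have "(m \<otimes> n) \<otimes> (m \<otimes> n) = m \<otimes> (n \<otimes> m) \<otimes> n" using that(2,3) by (simp add: m_assoc)
    also have "\<dots> = (m \<otimes> m) \<otimes> (n \<otimes> n)"
      unfolding comm[OF that(1-3), symmetric] using that(2,3) by (simp add: m_assoc)
    finally show ?thesis using that by simp
  qed
  have fm: "conj (m \<otimes> n) w = conj m w" if "n \<in> N" "w \<in> N" "m \<in> carrier G" for m n w
  proof -
    have "conj n w = w" using commN[OF that(1,2)] conj_fixed_iff[OF Nc[OF that(1)] Nc[OF that(2)]] by simp
    then show ?thesis using that Nc by (simp add: conj_mult_left)
  qed
  \<comment> \<open>The four classes below are told apart by the action on \<open>a\<close> and \<open>b\<close>.\<close>
  let ?S = "{s, s \<otimes> a}" and ?S1 = "{s1, s1 \<otimes> b}" and ?S2 = "{s2, s2 \<otimes> (a \<otimes> b)}"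
  have act0: "conj v a = a \<and> conj v b = a \<otimes> b" if "v \<in> ?S" for v using that fm[of a] s by auto
  have act1: "conj v a = a \<otimes> b \<and> conj v b = b" if "v \<in> ?S1" for v using that fm[of b] f1 c by auto
  have act2: "conj v a = b \<and> conj v b = a" if "v \<in> ?S2" for v using that fm[of "a \<otimes> b"] f2 c by auto
  have actN: "conj v a = a \<and> conj v b = b" if "v \<in> N" for v
    using commN[OF that, of a] commN[OF that, of b] conj_fixed_iff[OF Nc[OF that]] D by simp
  let ?I = "((N - {\<one>}) \<union> ?S) \<union> (?S1 \<union> ?S2)"
  have inv: "u \<in> carrier G \<and> u \<noteq> \<one> \<and> u \<otimes> u = \<one>" if u: "u \<in> ?I" for u
  proof -
    have "(s \<otimes> a) \<otimes> (s \<otimes> a) = \<one>" by (rule sqm[OF s(4,1) D(1) s(3) D(5)])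
    then have 11: "u \<in> carrier G \<and> u \<otimes> u = \<one>" if "u \<in> ?S" using that s(1,3) D(1) by auto
    have "(s1 \<otimes> b) \<otimes> (s1 \<otimes> b) = \<one>" by (rule sqm[OF f1(1) c(1) D(2) q1 D(6)])
    then have 12: "u \<in> carrier G \<and> u \<otimes> u = \<one>" if "u \<in> ?S1" using that c(1) q1 D(2) by auto
    have "(s2 \<otimes> (a \<otimes> b)) \<otimes> (s2 \<otimes> (a \<otimes> b)) = \<one>" by (rule sqm[OF f2(1) c(2) ab q2 E(10)])
    then have 13: "u \<in> carrier G \<and> u \<otimes> u = \<one>" if "u \<in> ?S2" using that c(2) q2 ab by auto
    have 14: "u \<in> carrier G \<and> u \<otimes> u = \<one>" if "u \<in> N" using Nc[OF that] involutions[OF that] by simp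
    have 1: "u \<in> carrier G \<and> u \<otimes> u = \<one>" using u 11 12 13 14 by blast
    have "\<not> (conj u a = a \<and> conj u b = b)" if "u \<notin> N"
    proof -
      have "u \<in> ?S \<or> u \<in> ?S1 \<or> u \<in> ?S2" using u that by blast
      then show ?thesis
      proof (elim disjE)
        assume "u \<in> ?S" from act0[OF this] show ?thesis using E(5) by simp
      next
        assume "u \<in> ?S1" from act1[OF this] show ?thesis using E(4) by simp
      next
        assume "u \<in> ?S2" from act2[OF this] show ?thesis using E(2) by simp
      qed
    qed
    then have "u \<noteq> \<one>" if "u \<notin> N" using that by blast
    moreover have "u \<noteq> \<one>" if "u \<in> N"
    proof
      assume "u = \<one>"
      then have "\<one> \<in> ?S \<or> \<one> \<in> ?S1 \<or> \<one> \<in> ?S2" using u by blast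
      moreover have "conj \<one> a = a" "conj \<one> b = b" using D by simp_all
      ultimately show False using act0[of \<one>] act1[of \<one>] act2[of \<one>] E(2,4,5) by metis
    qed
    ultimately show ?thesis using 1 by blast
  qed
  have ne: "s \<otimes> a \<noteq> s" "s1 \<otimes> b \<noteq> s1" "s2 \<otimes> (a \<otimes> b) \<noteq> s2" using s(1) c D E by simp_all
  have dj: "A \<inter> B = {}" if "\<And>v. v \<in> A \<Longrightarrow> (conj v a, conj v b) \<in> P" "\<And>v. v \<in> B \<Longrightarrow> (conj v a, conj v b) \<notin> P"
    for A B P using that by blast
  have d1: "(N - {\<one>}) \<inter> ?S = {}"
  proof (rule dj[where P = "{(a, b)}"])
    show "(conj v a, conj v b) \<in> {(a, b)}" if "v \<in> N - {\<one>}" for v using actN[OF DiffD1[OF that]] by simp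
    show "(conj v a, conj v b) \<notin> {(a, b)}" if "v \<in> ?S" for v using act0[OF that] E(5) by simp
  qed
  have d2: "?S1 \<inter> ?S2 = {}"
  proof (rule dj[where P = "{(a \<otimes> b, b)}"])
    show "(conj v a, conj v b) \<in> {(a \<otimes> b, b)}" if "v \<in> ?S1" for v using act1[OF that] by simp
    show "(conj v a, conj v b) \<notin> {(a \<otimes> b, b)}" if "v \<in> ?S2" for v using act2[OF that] E(2) by simp
  qed
  have d3: "((N - {\<one>}) \<union> ?S) \<inter> (?S1 \<union> ?S2) = {}"
  proof (rule dj[where P = "{(a, b), (a, a \<otimes> b)}"])
    fix v
    show "(conj v a, conj v b) \<in> {(a, b), (a, a \<otimes> b)}" if "v \<in> (N - {\<one>}) \<union> ?S"
      using that
    proof (rule UnE)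
      assume "v \<in> N - {\<one>}" from actN[OF DiffD1[OF this]] show ?thesis by simp
    next
      assume "v \<in> ?S" from act0[OF this] show ?thesis by simp
    qed
    show "(conj v a, conj v b) \<notin> {(a, b), (a, a \<otimes> b)}" if "v \<in> ?S1 \<union> ?S2"
      using that
    proof (rule UnE)
      assume "v \<in> ?S1" from act1[OF this] show ?thesis using E(4) by simp
    next
      assume "v \<in> ?S2" from act2[OF this] show ?thesis using E(2) by simp
    qed
  qed
  have "card ((N - {\<one>}) \<union> ?S) = 5" using card_Un_disjoint[OF _ _ d1] cardN1 ne by simp
  moreover have "card (?S1 \<union> ?S2) = 4" using card_Un_disjoint[OF _ _ d2] ne by simp
  ultimately have "card ?I = 9" using card_Un_disjoint[OF _ _ d3] by simp
  moreover have fI: "finite ?I" by simp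
  ultimately have "card (cyc ` ?I) = 9" using cyc_involutions(1)[OF fI inv] by simp
  moreover have "card (cyc ` ?I) \<le> nsub 2"
    by (rule nsub_ge) (rule cyc_involutions(2)[OF fI inv])
  ultimately have n2: "9 \<le> nsub 2" by simp
  let ?t = "s \<otimes> b"
  have tc: "?t \<in> carrier G" using s(1) D by simp
  have tt: "?t \<otimes> ?t = a"
  proof -
    have "s \<otimes> b = (a \<otimes> b) \<otimes> s" using conj_swap[OF s(1) D(2)] s(5) by simp
    then have "?t \<otimes> ?t = (a \<otimes> b) \<otimes> (s \<otimes> s) \<otimes> b" using s(1) D(1,2) by (simp add: m_assoc)
    then show ?thesis using s(3) D(1,2) E by simp
  qed
  have "ord ?t dvd 4"
  proof -
    have "?t [^] (4::nat) = (?t \<otimes> ?t) \<otimes> (?t \<otimes> ?t)" using tc by (simp add: numeral_eq_Suc m_assoc)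
    then have "?t [^] (4::nat) = \<one>" unfolding tt using D by simp
    then show ?thesis using pow_eq_id[OF tc] by blast
  qed
  moreover have "\<not> ord ?t dvd 2" 
    using tt D(4) pow_eq_id[OF tc, of 2] tc by (simp add: numeral_2_eq_2)
  ultimately have ot: "ord ?t = 4"
  proof -
    have "ord ?t \<le> 4" using \<open>ord ?t dvd 4\<close> by (rule dvd_imp_le) simp
    then have "ord ?t = 0 \<or> ord ?t = 1 \<or> ord ?t = 2 \<or> ord ?t = 3 \<or> ord ?t = 4" by linarith
    then show ?thesis using \<open>ord ?t dvd 4\<close> \<open>\<not> ord ?t dvd 2\<close> by auto
  qed
  have "?t \<notin> N" using tt involutions[of ?t] D(4) by auto
  then have "N \<noteq> cyc ?t" using cyc_self[of ?t] by blast
  then have "card {N, cyc ?t} = 2" by simp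
  moreover have "card {N, cyc ?t} \<le> nsub 4"
    by (rule nsub_ge) (use sN cardN subgroup_cyc[OF tc] card_cyc[OF tc] ot in auto)
  ultimately show False using n2 nsub_X sum_nsub_2_4_X[OF o8] by simp
qed

text \<open>If \<open>s\<close> is not an involution, its square is the involution \<open>a\<close> that it fixes, and \<open>s \<otimes> b\<close> is an
  involution acting in the same way.\<close>

lemma no_transposition:
  assumes o8: "8 dvd order G"
    and s: "s \<in> carrier G" "s \<notin> N" "s \<otimes> s \<in> N" "conj s a = a" "conj s b = a \<otimes> b"
  shows False
proof -
  have "conj s (s \<otimes> s) = s \<otimes> s" using s(1) by (simp add: conj_def m_assoc)
  moreover have "conj s (a \<otimes> b) = b" using s D E by (simp add: conj_mult)
  ultimately have "s \<otimes> s = \<one> \<or> s \<otimes> s = a" using s(3,5) E by fastforce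
  then show False
  proof
    assume "s \<otimes> s = \<one>"
    then show False using no_transposition_involution[OF o8 s(1,2) _ s(4,5)] by blast
  next
    assume ss: "s \<otimes> s = a"
    let ?t = "s \<otimes> b"
    have bb: "conj b a = a" "conj b b = b" using commN[of b a] D conj_fixed_iff by auto
    have "s \<otimes> b = (a \<otimes> b) \<otimes> s" using conj_swap[OF s(1) D(2)] s(5) by simp
    then have "?t \<otimes> ?t = (a \<otimes> b) \<otimes> (s \<otimes> s) \<otimes> b" using s(1) D(1,2) by (simp add: m_assoc)
    then have "?t \<otimes> ?t = \<one>" unfolding ss using D E by (simp add: m_assoc)
    moreover have "?t \<notin> N"
    proof
      assume "?t \<in> N"
      then have "?t \<otimes> b \<in> N" using subgroup.m_closed[OF sN] by simp
      then show False using s D by (simp add: m_assoc)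
    qed
    moreover have "conj ?t a = a" "conj ?t b = a \<otimes> b" using s D bb by (simp_all add: conj_mult_left)
    ultimately show False using no_transposition_involution[OF o8, of ?t] s(1) D by simp
  qed
qed

lemma next_rot_comax: "rot_comax G b (a \<otimes> b) x k"
proof -
  have "{\<one>, b, a \<otimes> b, b \<otimes> (a \<otimes> b)} = N" using E(7) by auto
  then show ?thesis
    using rot_next[OF rot] ordx nN small_comax_axioms
    unfolding rot_comax_def rot_comax_axioms_def by simp
qed

text \<open>The case distinction concerns the involutions fixed by \<open>s\<close>; since \<open>x\<close> rotates them, it may be assumed
  to fix \<open>a\<close>.\<close>

lemma not_8_dvd_order: "\<not> 8 dvd order G"
proof
  assume o8: "8 dvd order G"
  then have "2 dvd order G div card N" unfolding cardN by (auto elim!: dvdE)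
  then obtain s where s: "s \<in> carrier G" "s \<notin> N" "s [^] (2::nat) \<in> N"
    using Cauchy_mod[OF nN two_is_prime_nat] by blast
  have ss: "s \<otimes> s \<in> N" using s(1,3) by (simp add: numeral_2_eq_2)
  have s2: "conj s (conj s n) = n" if "n \<in> N" for n
  proof -
    have "conj (s \<otimes> s) n = n" using commN[OF ss that] conj_fixed_iff[OF Nc[OF ss] Nc[OF that]] by simp
    then show ?thesis using s(1) Nc[OF that] by (simp add: conj_mult_left)
  qed
  have cl: "conj s n \<in> N" "conj s n \<noteq> \<one>" if "n \<in> N" "n \<noteq> \<one>" for n
    using normal_conj_closed[OF nN s(1) that(1)] conj_inj[OF s(1) Nc[OF that(1)] one_closed] that(2) s(1) by auto
  have ca: "conj s a = a \<or> conj s a = b \<or> conj s a = a \<otimes> b" using cl[of a] D(4) by simp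
  have cb: "conj s b = a \<or> conj s b = b \<or> conj s b = a \<otimes> b" using cl[of b] E(1) by simp
  interpret R2: rot_comax G b "a \<otimes> b" x k by (rule next_rot_comax)
  interpret R3: rot_comax G "a \<otimes> b" "b \<otimes> (a \<otimes> b)" x k by (rule R2.next_rot_comax)
  have N2: "{\<one>, b, a \<otimes> b, b \<otimes> (a \<otimes> b)} = N" using E(7) by auto
  have N3: "{\<one>, a \<otimes> b, b \<otimes> (a \<otimes> b), a \<otimes> b \<otimes> (b \<otimes> (a \<otimes> b))} = N" using E by auto
  show False
  proof (cases "conj s a = a")
    case True
    then have "conj s b \<noteq> a" using conj_inj[OF s(1) D(1,2)] E(2) by auto
    then consider "conj s b = b" | "conj s b = a \<otimes> b" using cb by blast
    then show False
    proof cases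
      case 1
      then show False
        using no_centralizing_involution[OF o8 s(1,2) _ True 1] no_centralizing_order_4[OF o8 s(1,2) ss _ True 1]
        by blast
    next
      case 2
      then show False using no_transposition[OF o8 s(1,2) ss True] by blast
    qed
  next
    case False
    then consider "conj s a = b" | "conj s a = a \<otimes> b" using ca by blast
    then show False
    proof cases
      case 1
      then have "conj s b = a" using s2[of a] by simp
      then have "conj s (a \<otimes> b) = a \<otimes> b" using 1 s(1) D E by (simp add: conj_mult)
      then show False using R3.no_transposition[OF o8 s(1)] s(2) ss 1 E(7,8) unfolding N3 by simp
    next
      case 2
      then have "conj s (a \<otimes> b) = a" using s2[of a] by simp
      then have "conj s a \<otimes> conj s b = a" using s(1) D by (simp add: conj_mult)
      then have "conj s b = (a \<otimes> b) \<otimes> a" using 2 s(1) D E(6-10)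
        by (metis Nc E(10) inv_mult_cancel(1) E(14) conj_closed insertCI)
      then have "conj s b = b" using E(8) by simp
      then show False
        using R2.no_transposition[OF o8 s(1)] s(2) ss \<open>conj s (a \<otimes> b) = a\<close> E(7) unfolding N2 by simp
    qed
  qed
qed

lemma order_2_3: obtains m where "order G = 4 * 3 ^ m" "m \<noteq> 0"
proof -
  obtain j where j: "order G = 4 * j" using order4 by auto
  have j0: "0 < j" using j order_pos by (cases j) auto
  have "r = 3" if r: "prime r" "r dvd j" for r
  proof -
    have "r \<noteq> 2" using r(2) j not_8_dvd_order by auto
    then show ?thesis using prime_divisors_order[OF r(1)] r(2) j by auto
  qed
  then obtain m where m: "j = 3 ^ m" using prime_power_if_unique_prime_divisor[OF j0, of 3] by auto
  have "m \<noteq> 0" using order3 j m by (cases m) auto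
  then show thesis using that j m by simp
qed

text \<open>A noncyclic Sylow 3-subgroup contains three subgroups acting nontrivially on \<open>N\<close>; each has
  four conjugates under \<open>N\<close>, which makes 15 subgroups together with the involutions.\<close>

lemma cyclic_Sylow_3:
  assumes o: "order G = 4 * 3 ^ m" "m \<noteq> 0"
  obtains y where "y \<in> carrier G" "ord y = 3 ^ m" "conj y a \<noteq> a"
proof -
  have sn: "\<exists>Q. subgroup Q G \<and> card Q = 3 ^ m"
    by (rule subgroup_of_prime_power_order) (use o in simp_all)
  then obtain Q where Q: "subgroup Q G" "card Q = 3 ^ m" by blast
  have Qc: "u \<in> carrier G" if "u \<in> Q" for u by (rule subgroup.mem_carrier[OF Q(1) that])
  have NQ: "N \<inter> Q = {\<one>}"
  proof (rule coprime_card_Int[OF sN Q(1)])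
    have "coprime ((2::nat) ^ 2) (3 ^ m)"
      by (simp only: coprime_power_left_iff coprime_power_right_iff) simp
    then show "coprime (card N) (card Q)" unfolding cardN Q(2) by simp
  qed
  have nf: "n = \<one>" if y: "y \<in> Q" "conj y a \<noteq> a" and n: "n \<in> N" "conj y n = n" for y n
  proof (rule ccontr)
    assume "n \<noteq> \<one>"
    have oy: "odd (ord y)" using dvd_trans[of 2 "ord y" "3 ^ m"] ord_dvd_card[OF Q(1) y(1)] Q(2) by auto
    have r: "rot n (conj y n) y"
      by (rule rot_if_odd(1)[OF nN cardN involutions Qc[OF y(1)] oy _ y(2) n(1) \<open>n \<noteq> \<one>\<close>]) simp_all
    then have "n \<noteq> conj y n" by (rule rot_calc(2))
    then show False using n(2) by simp
  qed
  have ex: "\<exists>y\<in>Q. conj y a \<noteq> a"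
  proof (rule ccontr)
    assume *: "\<not> ?thesis"
    have "N <#> Q = carrier G"
      by (rule set_mult_eq_carrier[OF sN Q(1) NQ]) (simp only: cardN Q(2) o(1))
    then have "x \<in> N <#> Q" using D(3) by (simp only:)
    then obtain n u where nu: "n \<in> N" "u \<in> Q" "x = n \<otimes> u" unfolding set_mult_def by blast
    have "conj n a = a" using commN[OF nu(1), of a] conj_fixed_iff[OF Nc[OF nu(1)] D(1)] by simp
    then have "conj x a = a" using * nu Nc[OF nu(1)] Qc D(1) by (simp add: conj_mult_left)
    then show False using D E by simp
  qed
  have "\<exists>y\<in>Q. cyc y = Q"
  proof (rule ccontr)
    assume noncyc: "\<not> ?thesis"
    obtain y where y: "y \<in> Q" "conj y a \<noteq> a" using ex by blast
    have yQ: "cyc y \<subseteq> Q" by (rule cyc_subset[OF Q(1) y(1)])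
    then obtain z where z: "z \<in> Q" "z \<notin> cyc y" using noncyc y(1) by blast
    \<comment> \<open>If \<open>z\<close> centralizes \<open>a\<close>, then \<open>y \<otimes> z\<close> does not.\<close>
    obtain w where w: "w \<in> Q" "w \<notin> cyc y" "conj w a \<noteq> a"
    proof (cases "conj z a = a")
      case False then show thesis using that z by blast
    next
      case True
      have "conj (y \<otimes> z) a \<noteq> a" using True y Qc z D(1) by (simp add: conj_mult_left)
      moreover have "y \<otimes> z \<notin> cyc y"
      proof
        assume "y \<otimes> z \<in> cyc y"
        then have "inv y \<otimes> (y \<otimes> z) \<in> cyc y"
          by (rule subgroup.m_closed[OF subgroup_cyc[OF Qc[OF y(1)]]
              subgroup.m_inv_closed[OF subgroup_cyc[OF Qc[OF y(1)]] cyc_self]])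
        then show False using z Qc y(1) by simp
      qed
      moreover have "y \<otimes> z \<in> Q" by (rule subgroup.m_closed[OF Q(1) y(1) z(1)])
      ultimately show thesis using that by blast
    qed
    have T: "subgroup T G \<and> T \<subseteq> Q \<and> (\<exists>t\<in>T. conj t a \<noteq> a)" if "T \<in> {cyc y, cyc w, Q}" for T
      using that subgroup_cyc[OF Qc[OF y(1)]] subgroup_cyc[OF Qc[OF w(1)]] Q(1) yQ cyc_subset[OF Q(1) w(1)]
        cyc_self y w by blast
    have ne: "cyc y \<noteq> cyc w" "cyc y \<noteq> Q" "cyc w \<noteq> Q" using w cyc_self[of w] noncyc y(1) w(1) by blast+
    let ?c = "\<lambda>(T, n). conjs n T"
    let ?D = "{cyc y, cyc w, Q} \<times> N"
    have TN: "inj_on (\<lambda>n. conjs n T) N" if TT: "T \<in> {cyc y, cyc w, Q}" for T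
    proof -
      obtain t where t: "subgroup T G" "T \<subseteq> Q" "t \<in> T" "conj t a \<noteq> a" using T[OF TT] by blast
      have "card T dvd 3 ^ m" using card_subgroup_mono_dvd[OF t(1) Q(1) t(2)] Q(2) by simp
      then have "odd (card T)" using dvd_trans[of 2 "card T" "3 ^ m"] by auto
      then show ?thesis
        by (rule inj_conjs_N(1)[OF t(1) _ t(3)]) (rule nf[OF _ t(4)], use t in auto)
    qed
    have inj: "inj_on ?c ?D"
    proof (rule inj_onI)
      fix p q assume p: "p \<in> ?D" and q: "q \<in> ?D" and e: "?c p = ?c q"
      obtain T n where Tn: "p = (T, n)" "T \<in> {cyc y, cyc w, Q}" "n \<in> N" using p by blast
      obtain U l where Ul: "q = (U, l)" "U \<in> {cyc y, cyc w, Q}" "l \<in> N" using q by blast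
      have e': "conjs n T = conjs l U" using e Tn Ul by simp
      have sub: "T' \<subseteq> U'"
        if h: "T' \<in> {cyc y, cyc w, Q}" "U' \<in> {cyc y, cyc w, Q}" "n' \<in> N" "l' \<in> N" "conjs n' T' = conjs l' U'"
        for T' U' n' l'
      proof
        fix t assume t: "t \<in> T'"
        obtain u where u: "u \<in> U'" "conj n' t = conj l' u" using h(5) t by (metis imageE imageI)
        have tu: "t \<in> Q" "u \<in> Q" using T[OF h(1)] T[OF h(2)] t u(1) by blast+
        have c: "t \<in> carrier G" "u \<in> carrier G" "n' \<in> carrier G" "l' \<in> carrier G"
          using Qc[OF tu(1)] Qc[OF tu(2)] Nc[OF h(3)] Nc[OF h(4)] by simp_all
        \<comment> \<open>\<open>Q\<close> maps injectively into the quotient by \<open>N\<close>, where conjugation by elements of \<open>N\<close> is trivial.\<close>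
        have "inv t \<otimes> u \<in> Q" by (rule subgroup.m_closed[OF Q(1) subgroup.m_inv_closed[OF Q(1) tu(1)] tu(2)])
        moreover have "inv t \<otimes> u \<in> N"
        proof -
          define g where "g = inv l' \<otimes> n'"
          have g: "g \<in> N" unfolding g_def
            by (rule subgroup.m_closed[OF sN subgroup.m_inv_closed[OF sN h(4)] h(3)])
          have gc: "g \<in> carrier G" by (rule Nc[OF g])
          have "conj g t = conj (inv l') (conj l' u)" unfolding g_def using c u(2) by (simp add: conj_mult_left)
          then have "u = conj g t" using c by simp
          then have "inv t \<otimes> u = conj (inv t) g \<otimes> inv g" using c gc by (simp add: conj_def m_assoc)
          moreover have "conj (inv t) g \<in> N" using normal_conj_closed[OF nN _ g] c by simp
          ultimately show ?thesis
            using subgroup.m_closed[OF sN _ subgroup.m_inv_closed[OF sN g]] by simp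
        qed
        ultimately have "inv t \<otimes> u = \<one>" using NQ by blast
        from inv_equality[OF this c(2) inv_closed[OF c(1)]] have "inv u = inv t" .
        then have "t = u" using c inv_inv by metis
        then show "t \<in> U'" using u(1) by simp
      qed
      have TU: "T = U" using sub[OF Tn(2) Ul(2) Tn(3) Ul(3) e'] sub[OF Ul(2) Tn(2) Ul(3) Tn(3) e'[symmetric]] by blast
      have "n = l" using inj_onD[OF TN[OF Tn(2)]] e' TU Tn(3) Ul(3) by blast
      then show "p = q" using TU Tn Ul by simp
    qed
    have "card ?D = 12" using ne by (simp only: card_cartesian_product cardN) simp
    then have "card (?c ` ?D) = 12" using card_image[OF inj] by simp
    let ?F = "?c ` ?D \<union> I2"
    have cm: "subgroup H G \<and> odd (card H) \<and> card H \<noteq> 1" if H: "H \<in> ?c ` ?D" for H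
    proof -
      obtain T n where Tn: "H = conjs n T" "T \<in> {cyc y, cyc w, Q}" "n \<in> N" using H by blast
      obtain t where t: "subgroup T G" "T \<subseteq> Q" "t \<in> T" "conj t a \<noteq> a" using T[OF Tn(2)] by blast
      have "card T dvd 3 ^ m" using card_subgroup_mono_dvd[OF t(1) Q(1) t(2)] Q(2) by simp
      then have "odd (card T)" using dvd_trans[of 2 "card T" "3 ^ m"] by auto
      moreover have "card T \<noteq> 1"
      proof
        assume "card T = 1"
        then have "t = \<one>" using t(3) subgroup.one_closed[OF t(1)] by (auto simp: card_1_singleton_iff)
        then show False using t(4) D(1) by simp
      qed
      moreover have "subgroup H G" "card H = card T"
        unfolding Tn(1) using subgroup_conjs[OF Nc[OF Tn(3)] t(1)] card_conjs[OF Nc[OF Tn(3)] subgroup.subset[OF t(1)]]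
        by simp_all
      ultimately show ?thesis by simp
    qed
    have "card ?F \<le> 14"
    proof (rule card_family_2_3_le[where e = 2])
      show "2 ^ 2 dvd order G" using order4 by simp
      show "3 dvd order G" by (rule order3)
      show "(2::nat) \<noteq> 0" by simp
      show "subgroup H G" if "H \<in> ?F" for H using that cm[of H] I2(1)[of H] by blast
      show "card H \<noteq> 1" if H: "H \<in> ?F" for H
      proof (cases "H \<in> I2")
        case True then show ?thesis using I2(2)[OF True] by simp
      next
        case False then show ?thesis using H cm[of H] by blast
      qed
      show "\<not> 3 dvd card H \<and> \<not> 2 ^ 2 dvd card H \<or> odd (card H)" if H: "H \<in> ?F" for H
      proof (cases "H \<in> I2")
        case True then show ?thesis using I2(2)[OF True] by simp
      next
        case False then show ?thesis using H cm[of H] by blast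
      qed
    qed
    moreover have "card ?F = card (?c ` ?D) + card I2"
    proof (rule card_Un_sizes)
      show "finite (?c ` ?D)" "finite I2" by simp_all
      fix H K assume H: "H \<in> ?c ` ?D" and K: "K \<in> I2"
      show "card H \<noteq> card K" using cm[OF H] I2(2)[OF K] by auto
    qed
    ultimately show False using \<open>card (?c ` ?D) = 12\<close> cardI2 by linarith
  qed
  then obtain y where y: "y \<in> Q" "cyc y = Q" by blast
  have yc: "y \<in> carrier G" by (rule Qc[OF y(1)])
  have "ord y = 3 ^ m" using card_cyc[OF yc] y(2) Q(2) by simp
  moreover have "conj y a \<noteq> a"
  proof
    assume *: "conj y a = a"
    obtain u where u: "u \<in> Q" "conj u a \<noteq> a" using ex by blast
    then obtain j :: nat where "u = y [^] j" using y(2) mem_cyc[OF yc] by blast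
    then show False using u(2) conj_pow_left_fixed[OF yc D(1) *] by simp
  qed
  ultimately show thesis using that yc by blast
qed

end

text \<open>For a rotation of order at least 27, the subgroups of orders 3 and 9 that it generates centralize
  \<open>N\<close>. With the three involutions and the six cyclic groups of orders 6 and 18 they lie in the proper
  centralizer of \<open>N\<close>; with the four conjugates of \<open>X\<close> these are 15 subgroups.\<close>

lemma (in rot_comax) rotation_order_le_9:
  assumes o: "order G = 4 * 3 ^ k" shows "k \<le> 2"
proof (rule ccontr)
  assume "\<not> k \<le> 2"
  then obtain i where i: "k = i + 3" by (metis add.commute le_Suc_ex not_less_eq_eq numeral_2_eq_2 numeral_3_eq_3)
  define y where "y = x [^] (3 ^ (i + 2) :: nat)"
  define z where "z = x [^] (3 ^ (i + 1) :: nat)"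
  have c: "y \<in> carrier G" "z \<in> carrier G" using D by (simp_all add: y_def z_def)
  have "3 ^ (i + 2) dvd ord x" "3 ^ (i + 1) dvd ord x"
    unfolding ordx i by (rule le_imp_power_dvd, simp)+
  then have "ord y = 3 ^ k div 3 ^ (i + 2)" "ord z = 3 ^ k div 3 ^ (i + 1)"
    unfolding y_def z_def ordx[symmetric] using ord_pow[OF D(3)] by simp_all
  moreover have "(3::nat) ^ k = 3 * 3 ^ (i + 2)" "(3::nat) ^ k = 9 * 3 ^ (i + 1)" using i by (simp_all add: power_add)
  ultimately have oyz: "ord y = 3" "ord z = 9" by simp_all
  have fy: "conj y a = a" "conj y b = b" and fz: "conj z a = a" "conj z b = b"
    using rot_cube[OF rot, of "3 ^ (i + 1)"] rot_cube[OF rot, of "3 ^ i"] by (simp_all add: y_def z_def)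
  let ?C = "{g \<in> carrier G. conj g a = a \<and> conj g b = b}"
  have sC: "subgroup ?C G"
  proof (rule subgroupI)
    fix g assume g: "g \<in> ?C"
    then have "conj (inv g) a = a" "conj (inv g) b = b"
      using conj_inv_cancel(1)[of g a] conj_inv_cancel(1)[of g b] D by auto
    then show "inv g \<in> ?C" using g by simp
  qed (use D in \<open>auto simp: conj_mult_left intro!: exI[of _ \<one>]\<close>)
  have "?C \<noteq> carrier G"
  proof
    assume "?C = carrier G"
    then have "x \<in> ?C" using D(3) by blast
    then have "conj x a = a" by blast
    then show False using D(7) E(2) by simp
  qed
  have NC: "n \<in> ?C" if "n \<in> N" for n
    using commN[OF that, of a] commN[OF that, of b] conj_fixed_iff[OF Nc[OF that]] D Nc[OF that] by simp
  let ?A = "I2 \<union> ({cyc y, cyc z} \<union> (Ext y \<union> Ext z))"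
  have oy: "odd (ord y)" "odd (ord z)" using oyz by simp_all
  note Ey = Ext[OF c(1) oy(1) fy, unfolded oyz] and Ez = Ext[OF c(2) oy(2) fz, unfolded oyz]
  have sy: "subgroup (cyc y) G" "card (cyc y) = 3" "subgroup (cyc z) G" "card (cyc z) = 9"
    using subgroup_cyc card_cyc c oyz by auto
  have AC: "H \<subseteq> ?C" if H: "H \<in> ?A" for H
  proof -
    consider n where "n \<in> N" "H = cyc n" | "H = cyc y" | "H = cyc z"
      | n where "n \<in> N" "H = cyc (n \<otimes> y)" | n where "n \<in> N" "H = cyc (n \<otimes> z)"
      using H by blast
    then show ?thesis
    proof cases
      case 1 then show ?thesis using cyc_subset[OF sC NC] by blast
    next
      case 2 then show ?thesis using cyc_subset[OF sC, of y] c fy by simp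
    next
      case 3 then show ?thesis using cyc_subset[OF sC, of z] c fz by simp
    next
      case 4
      have "y \<in> ?C" using c fy by simp
      then show ?thesis using cyc_subset[OF sC subgroup.m_closed[OF sC NC[OF 4(1)]]] 4(2) by blast
    next
      case 5
      have "z \<in> ?C" using c fz by simp
      then show ?thesis using cyc_subset[OF sC subgroup.m_closed[OF sC NC[OF 5(1)]]] 5(2) by blast
    qed
  qed
  have A: "subgroup H G \<and> card H \<in> {2, 3, 9, 6, 18}" if H: "H \<in> ?A" for H
  proof -
    consider "H \<in> I2" | "H = cyc y" | "H = cyc z" | "H \<in> Ext y" | "H \<in> Ext z" using H by blast
    then show ?thesis
    proof cases
      case 1 show ?thesis using I2(1)[OF 1] I2(2)[OF 1] by simp
    next
      case 2 then show ?thesis using sy by simp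
    next
      case 3 then show ?thesis using sy by simp
    next
      case 4 then show ?thesis using Ey(2)[OF 4] by simp
    next
      case 5 then show ?thesis using Ez(2)[OF 5] by simp
    qed
  qed
  have nd: "\<not> order G dvd d * 3 ^ k" if "d \<in> {2, 3, 9, 6, 18}" for d
    unfolding o using that by auto
  have "card (?A \<union> XS) \<le> 14"
  proof (rule card_family_le)
    show "subgroup H G" if "H \<in> ?A \<union> XS" for H
      by (rule UnE[OF that]) (use A[of H] XS(1)[of H] in blast)+
    show "card H \<noteq> 1" if H: "H \<in> ?A \<union> XS" for H
    proof (cases "H \<in> XS")
      case True then show ?thesis using XS(2)[OF True] pow3_neq by simp
    next
      case False then show ?thesis using A[of H] H by fastforce
    qed
    show "H <#> K \<noteq> carrier G" if HK: "H \<in> ?A \<union> XS" "K \<in> ?A \<union> XS" for H K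
    proof -
      have hA: "H \<in> ?A \<or> H \<in> XS" by (rule Un_iff[THEN iffD1, OF HK(1)])
      have kA: "K \<in> ?A \<or> K \<in> XS" by (rule Un_iff[THEN iffD1, OF HK(2)])
      from hA kA show ?thesis
      proof (elim disjE)
        assume h: "H \<in> ?A" "K \<in> ?A"
        show ?thesis by (rule not_comax_within[OF sC \<open>?C \<noteq> carrier G\<close> AC[OF h(1)] AC[OF h(2)]])
      next
        assume h: "H \<in> ?A" "K \<in> XS"
        have "\<not> order G dvd card H * card K" using A[OF h(1)] XS(2)[OF h(2)] nd[of "card H"] by metis
        then show ?thesis using not_comax_dvd[of H K] A[OF h(1)] XS(1)[OF h(2)] by blast
      next
        assume h: "H \<in> XS" "K \<in> ?A"
        have "\<not> order G dvd card H * card K" using A[OF h(2)] XS(2)[OF h(1)] nd[of "card K"] by (metis mult.commute)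
        then show ?thesis using not_comax_dvd[of H K] A[OF h(2)] XS(1)[OF h(1)] by blast
      next
        assume h: "H \<in> XS" "K \<in> XS"
        have "\<not> 2 dvd (3::nat) ^ k * 3 ^ k" by simp
        moreover have "2 dvd order G" using o by simp
        ultimately have "\<not> order G dvd card H * card K" unfolding XS(2)[OF h(1)] XS(2)[OF h(2)] using dvd_trans by blast
        then show ?thesis using not_comax_dvd[of H K] XS(1)[OF h(1)] XS(1)[OF h(2)] by blast
      qed
    qed
  qed
  moreover have "card (?A \<union> XS) = 15"
  proof -
    have cI: "card H = 2" if "H \<in> I2" for H by (rule I2(2)[OF that])
    have "cyc y \<noteq> cyc z" using sy by auto
    then have 1: "card {cyc y, cyc z} = 2" by simp
    have 2: "card (Ext y \<union> Ext z) = 6"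
      using card_Un_sizes[of "Ext y" "Ext z"] Ey Ez by simp
    have 3: "card ({cyc y, cyc z} \<union> (Ext y \<union> Ext z)) = 8"
    proof -
      have "card ({cyc y, cyc z} \<union> (Ext y \<union> Ext z)) = card {cyc y, cyc z} + card (Ext y \<union> Ext z)"
      proof (rule card_Un_sizes)
        fix H K assume H: "H \<in> {cyc y, cyc z}" and K: "K \<in> Ext y \<union> Ext z"
        have "card H = 3 \<or> card H = 9" using H sy by blast
        moreover have "card K = 6 \<or> card K = 18" using K Ey(2)[of K] Ez(2)[of K] by auto
        ultimately show "card H \<noteq> card K" by auto
      qed simp_all
      then show ?thesis using 1 2 by simp
    qed
    have 4: "card ?A = 11"
    proof -
      have "card ?A = card I2 + card ({cyc y, cyc z} \<union> (Ext y \<union> Ext z))"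
      proof (rule card_Un_sizes)
        fix H K assume H: "H \<in> I2" and K: "K \<in> {cyc y, cyc z} \<union> (Ext y \<union> Ext z)"
        have "card K = 3 \<or> card K = 9 \<or> card K = 6 \<or> card K = 18" using K Ey(2)[of K] Ez(2)[of K] sy by auto
        then show "card H \<noteq> card K" using cI[OF H] by auto
      qed simp_all
      then show ?thesis using cardI2 3 by simp
    qed
    have "(27::nat) \<le> 3 ^ k" using i by (simp add: power_add)
    have "card (?A \<union> XS) = card ?A + card XS"
    proof (rule card_Un_sizes)
      fix H K assume H: "H \<in> ?A" and K: "K \<in> XS"
      have "card H \<le> 18" using A[OF H] by auto
      then show "card H \<noteq> card K" using XS(2)[OF K] \<open>27 \<le> 3 ^ k\<close> by simp
    qed simp_all
    then show ?thesis using 4 cardXS by simp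
  qed
  ultimately show False by simp
qed

section \<open>Descriptions of the exceptional groups by generators\<close>

text \<open>The predicate describes the alternating group for \<open>m = 1\<close> and the semidirect product with the
  cyclic group of order 9 for \<open>m = 2\<close>.\<close>

definition (in group) klein_rotation :: "nat \<Rightarrow> bool" where
  "klein_rotation m \<longleftrightarrow>
     (\<exists>a b x. rot a b x \<and> {\<one>, a, b, a \<otimes> b} \<lhd> G \<and> ord x = 3 ^ m \<and> order G = 4 * 3 ^ m)"

text \<open>The elements \<open>a\<close> and \<open>b\<close> generate a quaternion group, which \<open>x\<close> rotates; for order 24 this
  describes the special linear group.\<close>

definition (in group) quat_rot :: "'a \<Rightarrow> 'a \<Rightarrow> 'a \<Rightarrow> bool" where
  "quat_rot a b x \<longleftrightarrow> a \<in> carrier G \<and> b \<in> carrier G \<and> x \<in> carrier G \<and> a \<otimes> a \<noteq> \<one> \<and>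
     b \<otimes> b = a \<otimes> a \<and> (a \<otimes> a) \<otimes> (a \<otimes> a) = \<one> \<and> b \<otimes> a = a \<otimes> b \<otimes> (a \<otimes> a) \<and>
     conj x a = b \<and> conj x b = a \<otimes> b \<and> x [^] (3::nat) = \<one>"

definition (in group) quaternion_rotation :: bool where
  "quaternion_rotation \<longleftrightarrow> (\<exists>a b x. quat_rot a b x \<and> order G = 24)"

text \<open>The order is \<open>4 * 3 ^ m\<close> and a Sylow 3-subgroup is cyclic and acts nontrivially. A generator of it can
  replace \<open>x\<close>, and then \<open>m \<le> 2\<close>.\<close>

theorem (in small_comax) klein_rotation_if_rot:
  assumes r: "rot a b x" and n: "{\<one>, a, b, a \<otimes> b} \<lhd> G"
  shows "klein_rotation 1 \<or> klein_rotation 2"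
proof -
  obtain y k where y: "rot a b y" "ord y = 3 ^ k" by (rule rot_3_part[OF r])
  interpret R: rot_comax G a b y k 
    by (intro rot_comax.intro rot_comax_axioms.intro small_comax_axioms y n)
  obtain m where m: "order G = 4 * 3 ^ m" "m \<noteq> 0" by (rule R.order_2_3)
  obtain u where u: "u \<in> carrier G" "ord u = 3 ^ m" "conj u a \<noteq> a" by (rule R.cyclic_Sylow_3[OF m])
  have odd: "odd (ord u)" using u(2) by simp
  have r2: "rot a (conj u a) u" "{\<one>, a, b, a \<otimes> b} = {\<one>, a, conj u a, a \<otimes> conj u a}"
    by (rule rot_if_odd[OF n R.cardN R.involutions u(1) odd _ u(3) _ R.D(4)], simp_all)+
  interpret S: rot_comax G a "conj u a" u m
    by (intro rot_comax.intro rot_comax_axioms.intro small_comax_axioms r2(1) u(2)) (use n r2(2) in simp)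
  have "m \<le> 2" by (rule S.rotation_order_le_9[OF m(1)])
  then have "m = 1 \<or> m = 2" using m(2) by auto
  moreover have "klein_rotation m" unfolding klein_rotation_def using r2(1) S.nN u(2) m(1) by blast
  ultimately show ?thesis by blast
qed

section \<open>Extensions of the exceptional groups by a kernel of prime order\<close>

context finite_group
begin

text \<open>The product of the cyclic groups of order 4 generated by \<open>b\<close> and \<open>a\<close>, which share their involution, is
  the quaternion group.\<close>

lemma quat_subgroup:
  assumes q: "a \<in> carrier G" "b \<in> carrier G" "a \<otimes> a \<noteq> \<one>" "b \<otimes> b = a \<otimes> a"
    "(a \<otimes> a) \<otimes> (a \<otimes> a) = \<one>" "b \<otimes> a = a \<otimes> b \<otimes> (a \<otimes> a)"
  shows "subgroup (cyc b <#> cyc a) G" "card (cyc b <#> cyc a) = 8"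
proof -
  let ?z = "a \<otimes> a"
  have zc: "?z \<in> carrier G" using q(1) by simp
  have ord4: "ord u = 4" if u: "u \<in> carrier G" "u \<otimes> u = ?z" for u
  proof -
    have u2: "u [^] (2::nat) = ?z" using u by (simp add: numeral_2_eq_2)
    have "u [^] (4::nat) = (u [^] (2::nat)) [^] (2::nat)" using u(1) by (simp add: nat_pow_pow)
    also have "\<dots> = \<one>" unfolding u2 using q(5) zc by (simp add: numeral_2_eq_2)
    finally have "ord u dvd 4" using pow_eq_id[OF u(1)] by blast
    moreover have "\<not> ord u dvd 2" using u2 q(3) pow_eq_id[OF u(1), of 2] by simp
    moreover have "ord u \<le> 4" using \<open>ord u dvd 4\<close> by (rule dvd_imp_le) simp
    then have "ord u = 0 \<or> ord u = 1 \<or> ord u = 2 \<or> ord u = 3 \<or> ord u = 4" by linarith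
    ultimately show ?thesis by auto
  qed
  have za: "?z \<otimes> a = a \<otimes> ?z" using q(1) by (simp add: m_assoc)
  have zb: "?z \<otimes> b = b \<otimes> ?z" using q(2) q(4)[symmetric] by (simp add: m_assoc)
  have cba: "conj b a = a \<otimes> ?z"
  proof -
    have "b \<otimes> a = a \<otimes> ?z \<otimes> b" using q(6) zb q(1,2) zc by (simp add: m_assoc)
    then have "conj b a = a \<otimes> ?z \<otimes> b \<otimes> inv b" by (simp add: conj_def)
    then show ?thesis using q(1,2) by (simp add: m_assoc)
  qed
  have sa: "subgroup (cyc a) G" and sb: "subgroup (cyc b) G" using subgroup_cyc q by blast+
  have aa: "a \<in> cyc a" by (rule cyc_self)
  have "conj b a \<in> cyc a" unfolding cba
    by (rule subgroup.m_closed[OF sa aa subgroup.m_closed[OF sa aa aa]])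
  then have "cyc (conj b a) \<subseteq> cyc a" by (rule cyc_subset[OF sa])
  then have nb: "conj b r \<in> cyc a" if "r \<in> cyc a" for r
    using conjs_cyc[OF q(2,1)] that by blast
  have nbj: "conj (b [^] (j::nat)) r \<in> cyc a" if r: "r \<in> cyc a" for j r
    using r
  proof (induction j arbitrary: r)
    case 0 then show ?case using subgroup.mem_carrier[OF sa] by simp
  next
    case (Suc j)
    have rc: "r \<in> carrier G" by (rule subgroup.mem_carrier[OF sa Suc.prems])
    show ?case using Suc.IH[OF nb[OF Suc.prems]] rc q(2) by (simp add: conj_mult_left)
  qed
  show sg: "subgroup (cyc b <#> cyc a) G"
  proof (rule normalized_set_mult_subgroup[OF sa sb])
    fix u r assume u: "u \<in> cyc b" and r: "r \<in> cyc a"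
    obtain j :: nat where "u = b [^] j" using u mem_cyc[OF q(2)] by blast
    then show "conj u r \<in> cyc a" using nbj[OF r] by simp
  qed
  have "cyc b \<inter> cyc a = {\<one>, ?z}"
  proof
    have "b \<otimes> b \<in> cyc b" by (rule subgroup.m_closed[OF sb cyc_self cyc_self])
    moreover have "?z \<in> cyc a" by (rule subgroup.m_closed[OF sa aa aa])
    ultimately show "{\<one>, ?z} \<subseteq> cyc b \<inter> cyc a"
      using q(4) subgroup.one_closed[OF sa] subgroup.one_closed[OF sb] by simp
    show "cyc b \<inter> cyc a \<subseteq> {\<one>, ?z}"
    proof
      fix u assume u: "u \<in> cyc b \<inter> cyc a"
      then have uc: "u \<in> carrier G" using subgroup.mem_carrier[OF sa] by blast
      obtain j :: nat where j: "u = b [^] j" using u mem_cyc[OF q(2)] by blast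
      obtain i :: nat where i: "u = a [^] i" using u mem_cyc[OF q(1)] by blast
      have zp: "?z [^] n \<in> {\<one>, ?z}" for n :: nat by (induction n) (use q(5) zc in auto)
      show "u \<in> {\<one>, ?z}"
      proof (cases "even j")
        case True
        then obtain n where n: "j = 2 * n" by auto
        have "u = (b [^] (2::nat)) [^] n" unfolding j n using q(2) by (simp add: nat_pow_pow)
        then have "u = ?z [^] n" using q(2,4) by (simp add: numeral_2_eq_2)
        then show ?thesis using zp by simp
      next
        case False
        then obtain n where n: "j = 2 * n + 1" by (auto elim: oddE)
        have "u = (b [^] (2::nat)) [^] n \<otimes> b" unfolding j n using q(2) by (simp add: nat_pow_pow)
        then have un: "u = ?z [^] n \<otimes> b" using q(2,4) by (simp add: numeral_2_eq_2)
        have zna: "conj (?z [^] n) a = a"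
          using conj_pow_left_fixed[OF zc q(1)] za conj_fixed_iff[OF zc q(1)] by blast
        have zn: "?z [^] n \<in> carrier G" using zc by simp
        have "conj u a = a" unfolding i
          using conj_pow_left_fixed[OF q(1,1)] conj_fixed_iff[OF q(1,1)] by blast
        moreover have "conj u a = conj (?z [^] n) a \<otimes> conj (?z [^] n) ?z"
          unfolding un using cba zn q(1,2) zc by (simp add: conj_mult_left conj_mult)
        moreover have "conj (?z [^] n) ?z = ?z"
          using zna zn q(1) by (simp add: conj_mult)
        ultimately have "a = a \<otimes> ?z" using zna by simp
        then have "?z = \<one>" using q(1) zc by simp
        then show ?thesis using q(3) by simp
      qed
    qed
  qed
  then have "card (cyc b <#> cyc a) * 2 = 4 * 4"
    using card_set_mult_Int[OF sb sa] card_cyc[OF q(1)] card_cyc[OF q(2)] ord4[OF q(1)] ord4[OF q(2,4)] q(3) by simp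
  then show "card (cyc b <#> cyc a) = 8" by simp
qed

text \<open>The Klein group and the cyclic group of order \<open>3 ^ m\<close> have coprime orders with product \<open>order G\<close>.\<close>

lemma klein_rotation_generates:
  assumes r: "rot a b x" and o: "ord x = 3 ^ m" "order G = 4 * 3 ^ m"
    and S: "subgroup S G" "a \<in> S" "b \<in> S" "x \<in> S"
  shows "S = carrier G"
proof -
  have "{\<one>, a, b, a \<otimes> b} \<subseteq> S" using S subgroup.one_closed[OF S(1)] subgroup.m_closed[OF S(1)] by simp
  moreover have "card {\<one>, a, b, a \<otimes> b} = 4" using rotD[OF r] rot_calc[OF r] by simp
  ultimately have "4 dvd card S" using card_subgroup_mono_dvd[OF rot_subgroup[OF r] S(1)] by simp
  moreover have "3 ^ m dvd card S" using ord_dvd_card[OF S(1,4)] o(1) by simp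
  moreover have "coprime (4::nat) (3 ^ m)" 
  proof -
    have "coprime ((2::nat) ^ 2) (3 ^ m)" by (simp only: coprime_power_left_iff coprime_power_right_iff) simp
    then show ?thesis by simp
  qed
  ultimately have "order G dvd card S" unfolding o(2) by (simp add: divides_mult)
  then have "order G = card S" using card_subgroup_dvd[OF S(1)] by (simp add: dvd_antisym)
  then show ?thesis using card_eq_imp_carrier[OF S(1)] by simp
qed

lemma quaternion_rotation_generates:
  assumes q: "quat_rot a b x" and o: "order G = 24"
    and S: "subgroup S G" "a \<in> S" "b \<in> S" "x \<in> S"
  shows "S = carrier G"
proof -
  note Q = q[unfolded quat_rot_def]
  have Q1: "a \<in> carrier G" "b \<in> carrier G" "a \<otimes> a \<noteq> \<one>" "b \<otimes> b = a \<otimes> a"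
    "(a \<otimes> a) \<otimes> (a \<otimes> a) = \<one>" "b \<otimes> a = a \<otimes> b \<otimes> (a \<otimes> a)" using Q by blast+
  have "cyc b <#> cyc a \<subseteq> S"
    using cyc_subset[OF S(1,2)] cyc_subset[OF S(1,3)] subgroup.m_closed[OF S(1)] by (fastforce simp: set_mult_def)
  then have 8: "8 dvd card S" using card_subgroup_mono_dvd[OF quat_subgroup(1)[OF Q1] S(1)] quat_subgroup(2)[OF Q1] by simp
  have "x \<noteq> \<one>"
  proof
    assume "x = \<one>"
    moreover have "conj x a = b" "conj x b = a \<otimes> b" using Q by blast+
    ultimately have "b = a \<otimes> b" using Q1(1,2) by simp
    then have "a = \<one>" using Q1(1,2) by simp
    then show False using Q1(3) by simp
  qed
  then have "ord x = 3" using ord_eq_prime[of x 3] Q by simp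
  then have "3 dvd card S" using ord_dvd_card[OF S(1,4)] by simp
  moreover have "coprime (8::nat) 3" using coprime_power_left_iff[of "2::nat" 3 3] by simp
  ultimately have "8 * 3 dvd card S" using divides_mult[OF 8] by blast
  then have "order G dvd card S" unfolding o by simp
  then have "order G = card S" using card_subgroup_dvd[OF S(1)] by (simp add: dvd_antisym)
  then show ?thesis using card_eq_imp_carrier[OF S(1)] by simp
qed

lemma subgroup_centralizer: "z \<in> carrier G \<Longrightarrow> subgroup {g \<in> carrier G. conj g z = z} G"
proof (rule subgroupI)
  fix g assume "z \<in> carrier G" and g: "g \<in> {g \<in> carrier G. conj g z = z}"
  then show "inv g \<in> {g \<in> carrier G. conj g z = z}" using conj_inv_cancel(1)[of g z] by auto
qed (auto simp: conj_mult_left intro!: exI[of _ \<one>])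

end

locale prime_kernel = small_comax G + surj_hom G H h for G (structure) and H (structure) and h +
  fixes r :: nat
  assumes prime_r: "prime r" and card_kernel: "card (kernel G H h) = r"
begin

abbreviation K where "K \<equiv> kernel G H h"

lemma nK: "K \<lhd> G" by (rule normal_kernel)

lemma sK: "subgroup K G" using nK by (rule normal_imp_subgroup)

lemma Kc: "n \<in> K \<Longrightarrow> n \<in> carrier G" by (rule subgroup.mem_carrier[OF sK])

lemma Kh: "n \<in> K \<Longrightarrow> h n = \<one>\<^bsub>H\<^esub>" by (simp add: kernel_def)

lemma KI: "g \<in> carrier G \<Longrightarrow> h g = \<one>\<^bsub>H\<^esub> \<Longrightarrow> g \<in> K" by (simp add: kernel_def)

lemma same_image:
  assumes "g \<in> carrier G" "g' \<in> carrier G" "h g = h g'" obtains n where "n \<in> K" "g = g' \<otimes> n"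
proof -
  have "inv g' \<otimes> g \<in> K" by (rule KI) (use assms in simp_all)
  moreover have "g = g' \<otimes> (inv g' \<otimes> g)" using assms by simp
  ultimately show thesis using that by blast
qed

lemma lift:
  assumes "y \<in> carrier H" obtains g where "g \<in> carrier G" "h g = y"
  using surj assms by (metis imageE)

lemma order_G: "order G = r * order H"
  using order_kernel card_kernel by (simp add: mult.commute)

lemma pow_r: "n \<in> K \<Longrightarrow> n [^] r = \<one>"
  using pow_card_subgroup[OF sK] card_kernel by simp

lemma kernel_cyclic: obtains n0 where "n0 \<in> K" "\<And>n. n \<in> K \<Longrightarrow> \<exists>i::nat. n = n0 [^] i"
proof -
  obtain n0 where n0: "n0 \<in> K" "n0 [^] r = \<one>" "n0 \<noteq> \<one>"
    by (rule Cauchy_in_subgroup[OF sK prime_r]) (use card_kernel in auto)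
  have "ord n0 = r" by (rule ord_eq_prime[OF Kc[OF n0(1)] prime_r n0(2,3)])
  then have "cyc n0 = K"
    using card_subset_eq[OF finite_subgroup[OF sK] cyc_subset[OF sK n0(1)]] card_cyc[OF Kc[OF n0(1)]] card_kernel by simp
  then show thesis using that n0(1) mem_cyc[OF Kc[OF n0(1)]] by blast
qed

lemma kernel_commute: "n \<in> K \<Longrightarrow> m \<in> K \<Longrightarrow> conj m n = n"
proof -
  assume nm: "n \<in> K" "m \<in> K"
  obtain n0 where n0: "n0 \<in> K" "\<And>n. n \<in> K \<Longrightarrow> \<exists>i::nat. n = n0 [^] i" by (rule kernel_cyclic) blast
  obtain i j :: nat where "n = n0 [^] i" "m = n0 [^] j" using n0(2) nm by blast
  then show ?thesis using conj_fixed_iff[OF Kc[OF nm(2)] Kc[OF nm(1)]] Kc[OF n0(1)]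
    by (simp add: nat_pow_mult add.commute)
qed

text \<open>The automorphism group of a cyclic group is abelian.\<close>

lemma conj_kernel_commute:
  assumes g: "g \<in> carrier G" "g' \<in> carrier G" "n \<in> K"
  shows "conj g (conj g' n) = conj g' (conj g n)"
proof -
  obtain n0 where n0: "n0 \<in> K" "\<And>n. n \<in> K \<Longrightarrow> \<exists>i::nat. n = n0 [^] i" by (rule kernel_cyclic) blast
  have c: "n0 \<in> carrier G" by (rule Kc[OF n0(1)])
  obtain i :: nat where i: "conj g n0 = n0 [^] i" using n0 normal_conj_closed[OF nK g(1)] by blast
  obtain j :: nat where j: "conj g' n0 = n0 [^] j" using n0 normal_conj_closed[OF nK g(2)] by blast
  obtain l :: nat where l: "n = n0 [^] l" using n0(2) g(3) by blast
  show ?thesis unfolding l using g(1,2) c i j by (simp add: conj_pow nat_pow_pow mult.commute mult.left_commute)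
qed

text \<open>The group acts on the cyclic kernel through an abelian group, where \<open>x\<close> cannot move anything. There
  \<open>a\<close>, \<open>b\<close> and \<open>a \<otimes> b\<close>, which \<open>x\<close> rotates modulo the kernel, act alike; so they act trivially.\<close>

lemma centralizes_kernel:
  assumes c: "a \<in> carrier G" "b \<in> carrier G" "x \<in> carrier G"
    and e: "h b = h (conj x a)" "h (a \<otimes> b) = h (conj x b)" and n: "n \<in> K"
  shows "conj a n = n" "conj b n = n"
proof -
  have ix: "inv x \<in> carrier G" using c(3) by simp
  have cK: "conj g n \<in> K" if "g \<in> carrier G" "n \<in> K" for g n by (rule normal_conj_closed[OF nK that])
  have same: "conj g n = conj u n"
    if g: "g \<in> carrier G" "u \<in> carrier G" "h g = h (conj x u)" "n \<in> K" for g u n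
  proof -
    obtain k where k: "k \<in> K" "g = conj x u \<otimes> k" using same_image[OF g(1) _ g(3)] c(3) g(2) by auto
    have "conj g n = conj (conj x u) (conj k n)" using k c(3) g(2) Kc g(4) by (simp add: conj_mult_left)
    also have "\<dots> = conj (conj x u) n" using kernel_commute[OF g(4) k(1)] by simp
    also have "\<dots> = conj x (conj u (conj (inv x) n))"
      using c(3) g(2) Kc[OF g(4)] by (simp add: conj_def m_assoc inv_mult_group)
    also have "\<dots> = conj u (conj x (conj (inv x) n))"
      using conj_kernel_commute[OF c(3) g(2)] cK[OF ix g(4)] by simp
    finally show ?thesis using c(3) Kc[OF g(4)] by simp
  qed
  have ab: "conj a (conj b n) = conj b n" if "n \<in> K" for n
    using same[OF _ c(2) e(2) that] c Kc[OF that] by (simp add: conj_mult_left)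
  have a: "conj a n = n" if n: "n \<in> K" for n
  proof -
    have "conj (inv b) n \<in> K" using cK n c(2) by simp
    from ab[OF this] show ?thesis using c(2) Kc[OF n] by simp
  qed
  show "conj a n = n" by (rule a[OF n])
  show "conj b n = n" using same[OF c(2,1) e(1) n] a[OF n] by simp
qed

lemma lift_generates:
  assumes S: "subgroup S G" "K \<subseteq> S" and gen: "h ` S = carrier H" shows "S = carrier G"
proof
  show "S \<subseteq> carrier G" using S(1) by (rule subgroup.subset)
  show "carrier G \<subseteq> S"
  proof
    fix g assume g: "g \<in> carrier G"
    then obtain s where s: "s \<in> S" "h g = h s" using gen by (metis hom_closed imageE)
    obtain n where n: "n \<in> K" "g = s \<otimes> n" by (rule same_image[OF g subgroup.mem_carrier[OF S(1) s(1)] s(2)])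
    show "g \<in> S" unfolding n(2) by (rule subgroup.m_closed[OF S(1) s(1) subsetD[OF S(2) n(1)]])
  qed
qed

end

locale odd_kernel = prime_kernel +
  assumes odd_r: "odd r"
begin

lemma square_one_kernel:
  assumes n: "n \<in> K" "n \<otimes> n = \<one>" shows "n = \<one>"
proof -
  have "coprime (2::nat) r" using odd_r by simp
  moreover have "n [^] (2::nat) = \<one>" using n Kc by (simp add: numeral_2_eq_2)
  ultimately show ?thesis using pow_coprime_eq_one[OF Kc[OF n(1)] _ pow_r[OF n(1)]] by blast
qed

text \<open>An odd \<open>r\<close> satisfies \<open>r\<^sup>2 = 1\<close> modulo 4, so the power with exponent \<open>r\<^sup>2\<close> is a lift of the same element.
  If a power of \<open>g\<close> lies in the kernel, the same power of the new lift is trivial.\<close>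

lemma lift_2_power:
  assumes g: "g \<in> carrier G" "h g [^]\<^bsub>H\<^esub> (4::nat) = \<one>\<^bsub>H\<^esub>"
  obtains g' where "g' \<in> carrier G" "h g' = h g" "g' [^] (4::nat) = \<one>"
    "h g \<otimes>\<^bsub>H\<^esub> h g = \<one>\<^bsub>H\<^esub> \<Longrightarrow> g' \<otimes> g' = \<one>"
proof -
  have "\<exists>j. r * r = 4 * j + 1"
  proof -
    obtain i where "r = 2 * i + 1" using odd_r by (auto elim: oddE)
    then have "r * r = 4 * (i * i + i) + 1" by (simp add: algebra_simps)
    then show ?thesis by blast
  qed
  then obtain j where j: "r * r = 4 * j + 1" by blast
  let ?g = "g [^] (r * r)"
  have hc: "h g \<in> carrier H" using g(1) by simp
  have "h ?g = h g [^]\<^bsub>H\<^esub> (4 * j + 1)" unfolding j using g(1) by (simp only: hom_nat_pow)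
  also have "\<dots> = (h g [^]\<^bsub>H\<^esub> (4::nat)) [^]\<^bsub>H\<^esub> j \<otimes>\<^bsub>H\<^esub> h g"
    using hc by (simp add: H.nat_pow_pow)
  finally have hg: "h ?g = h g" using g(2) hc by simp
  have kill: "?g [^] (n::nat) = \<one>" if "g [^] n \<in> K" for n
  proof -
    have "?g [^] n = (g [^] n) [^] (r * r)" using g(1) by (simp add: nat_pow_pow mult.commute)
    also have "\<dots> = ((g [^] n) [^] r) [^] r" using g(1) by (simp add: nat_pow_pow mult.assoc)
    finally show ?thesis using pow_r[OF that] by simp
  qed
  show thesis
  proof (rule that[of ?g])
    show "?g \<in> carrier G" using g(1) by simp
    show "h ?g = h g" by (rule hg)
    show "?g [^] (4::nat) = \<one>" by (rule kill, rule KI) (use g in \<open>simp_all add: hom_nat_pow\<close>)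
    show "?g \<otimes> ?g = \<one>" if "h g \<otimes>\<^bsub>H\<^esub> h g = \<one>\<^bsub>H\<^esub>"
    proof -
      have "g [^] (2::nat) \<in> K" by (rule KI) (use g(1) that in \<open>simp_all add: numeral_2_eq_2\<close>)
      from kill[OF this] show ?thesis using g(1) by (simp add: numeral_2_eq_2)
    qed
  qed
qed

text \<open>Lift \<open>a\<close> to an involution and conjugate it by a lift of \<open>x\<close>. All relations hold up to elements of
  the kernel, which \<open>a\<close> and \<open>b\<close> centralize; as these are quotients of commuting involutions and
  the kernel has odd order, the relations hold exactly. So \<open>G\<close> contains a rotated normal Klein group,
  to which the previous classification applies.\<close>

lemma klein_rotation_lifts_odd:
  assumes kr: "group.klein_rotation H m" shows "klein_rotation 1 \<or> klein_rotation 2"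
proof -
  obtain a' b' x' where R: "H.rot a' b' x'" and nN: "{\<one>\<^bsub>H\<^esub>, a', b', a' \<otimes>\<^bsub>H\<^esub> b'} \<lhd> H"
    using kr unfolding H.klein_rotation_def by blast
  note RD = H.rotD[OF R] and RE = H.rot_calc[OF R]
  obtain a0 where a0: "a0 \<in> carrier G" "h a0 = a'" by (rule lift[OF RD(1)])
  obtain x where x: "x \<in> carrier G" "h x = x'" by (rule lift[OF RD(3)])
  have "h a0 [^]\<^bsub>H\<^esub> (4::nat) = \<one>\<^bsub>H\<^esub>" unfolding a0(2) using RD(1,5) by (simp add: numeral_eq_Suc H.m_assoc)
  from lift_2_power[OF a0(1) this] obtain a where a: "a \<in> carrier G" "h a = a'" "a \<otimes> a = \<one>"
    using a0(2) RD(5) by metis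
  define b where "b = conj x a"
  define c where "c = conj x b"
  have bc: "b \<in> carrier G" "c \<in> carrier G" using a x by (simp_all add: b_def c_def)
  have hb: "h b = b'" using hom_conj[OF x(1) a(1)] a x RD(8) by (simp add: b_def)
  have hc: "h c = a' \<otimes>\<^bsub>H\<^esub> b'" using hom_conj[OF x(1) bc(1)] hb x RD(9) by (simp add: c_def)
  have sqb: "b \<otimes> b = \<one>" using conj_mult[OF x(1) a(1) a(1)] a(3) x(1) by (simp add: b_def)
  have sqc: "c \<otimes> c = \<one>" using conj_mult[OF x(1) bc(1) bc(1)] sqb x(1) by (simp add: c_def)
  note sq = sqb sqc
  have cent: "conj a n = n" "conj b n = n" if "n \<in> K" for n
    using centralizes_kernel[OF a(1) bc(1) x(1) _ _ that] hb hc a bc by (simp_all add: b_def[symmetric] c_def[symmetric])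
  have ncomm: "n \<otimes> g = g \<otimes> n" if "conj g n = n" "g \<in> carrier G" "n \<in> K" for g n
    using that conj_fixed_iff Kc by metis
  \<comment> \<open>Elements of the kernel that are quotients of commuting involutions are trivial.\<close>
  have inv_mod: "k = \<one>" if "u \<otimes> k = v" "u \<in> carrier G" "k \<in> K" "conj u k = k" "u \<otimes> u = \<one>" "v \<otimes> v = \<one>" for u v k
  proof -
    have kc: "k \<in> carrier G" by (rule Kc[OF that(3)])
    have "v \<otimes> v = u \<otimes> (k \<otimes> u) \<otimes> k" using that(1)[symmetric] that(2) kc by (simp add: m_assoc)
    also have "\<dots> = (u \<otimes> u) \<otimes> (k \<otimes> k)" unfolding ncomm[OF that(4,2,3)] using that(2) kc by (simp add: m_assoc)
    finally have "k \<otimes> k = \<one>" using that(5,6) kc by simp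
    then show ?thesis using square_one_kernel that(3) by blast
  qed
  have "h (conj a b) = h b"
    using hom_conj[OF a(1) bc(1)] a(2) hb RD(1,2,7) H.conj_fixed_iff by simp
  then obtain k where k: "k \<in> K" "conj a b = b \<otimes> k" using same_image[of "conj a b" b] a(1) bc(1) by auto
  have "conj a b \<otimes> conj a b = \<one>" using conj_mult[OF a(1) bc(1) bc(1)] sq(1) a(1) by simp
  then have "k = \<one>" using inv_mod[OF k(2)[symmetric] bc(1) k(1) cent(2)[OF k(1)] sq(1)] by blast
  then have "conj a b = b" using k(2) bc(1) by simp
  then have ab: "a \<otimes> b = b \<otimes> a" using conj_fixed_iff[OF a(1) bc(1)] by simp
  have abq: "(a \<otimes> b) \<otimes> (a \<otimes> b) = \<one>"
  proof -
    have "(a \<otimes> b) \<otimes> (a \<otimes> b) = a \<otimes> (b \<otimes> a) \<otimes> b" using a(1) bc(1) by (simp add: m_assoc)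
    also have "\<dots> = (a \<otimes> a) \<otimes> (b \<otimes> b)" unfolding ab[symmetric] using a(1) bc(1) by (simp add: m_assoc)
    finally show ?thesis using a(3) sq(1) by simp
  qed
  have cab: "conj (a \<otimes> b) n = n" if "n \<in> K" for n
    using cent[OF that] a(1) bc(1) Kc[OF that] by (simp add: conj_mult_left)
  have abc: "a \<otimes> b \<in> carrier G" using a(1) bc(1) by simp
  have hab: "h (a \<otimes> b) = a' \<otimes>\<^bsub>H\<^esub> b'" using a bc hb by simp
  obtain k2 where k2: "k2 \<in> K" "c = a \<otimes> b \<otimes> k2" using same_image[of c "a \<otimes> b"] bc(2) abc hc hab by auto
  have "k2 = \<one>" by (rule inv_mod[OF k2(2)[symmetric] abc k2(1) cab[OF k2(1)] abq sq(2)])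
  then have c: "c = a \<otimes> b" using k2(2) abc by simp
  have a1: "a \<noteq> \<one>" using a(2) RD(4) by auto
  have r: "rot a b x" using a(1) bc(1) x(1) a1 a(3) sq(1) ab c by (simp add: rot_def b_def[symmetric] c_def[symmetric])
  have "{\<one>, a, b, a \<otimes> b} \<lhd> G"
    unfolding normal_iff_conj
  proof (intro conjI ballI)
    show "subgroup {\<one>, a, b, a \<otimes> b} G" by (rule rot_subgroup[OF r])
    fix g u assume g: "g \<in> carrier G" and u: "u \<in> {\<one>, a, b, a \<otimes> b}"
    have uu: "u \<in> carrier G" "u \<otimes> u = \<one>" using u a bc sq abq by auto
    have "h u \<in> {\<one>\<^bsub>H\<^esub>, a', b', a' \<otimes>\<^bsub>H\<^esub> b'}" using u a hb hab by auto
    then have "h (conj g u) \<in> {\<one>\<^bsub>H\<^esub>, a', b', a' \<otimes>\<^bsub>H\<^esub> b'}"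
      using H.normal_conj_closed[OF nN, of "h g"] hom_conj[OF g uu(1)] g by simp
    then have "\<exists>v\<in>{\<one>, a, b, a \<otimes> b}. h (conj g u) = h v" using a hb hab by auto
    then obtain v where v: "v \<in> {\<one>, a, b, a \<otimes> b}" "h (conj g u) = h v" by blast
    have vv: "v \<in> carrier G" "v \<otimes> v = \<one>" using v(1) a bc sq abq by auto
    obtain n where n: "n \<in> K" "conj g u = v \<otimes> n" using same_image[of "conj g u" v] g uu vv v(2) by auto
    have "conj v n = n" using v(1) cent[OF n(1)] cab[OF n(1)] Kc[OF n(1)] by auto
    moreover have "conj g u \<otimes> conj g u = \<one>" using conj_mult[OF g uu(1,1)] uu(2) g by simp
    ultimately have "n = \<one>" using inv_mod[OF n(2)[symmetric] vv(1) n(1) _ vv(2)] by blast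
    then show "conj g u \<in> {\<one>, a, b, a \<otimes> b}" using n(2) v(1) vv(1) by simp
  qed
  then show ?thesis by (rule klein_rotation_if_rot[OF r])
qed

text \<open>The square of a lift of \<open>a\<close> of order 4 is a central involution: it is centralized by the kernel and by
  lifts of generators of the quotient.\<close>

lemma quaternion_center_lifts:
  assumes qr: "group.quaternion_rotation H"
  obtains z where "z \<in> carrier G" "z \<noteq> \<one>" "z \<otimes> z = \<one>" "{\<one>, z} \<lhd> G"
proof -
  obtain a' b' x' where R: "H.quat_rot a' b' x'" and o24: "order H = 24"
    using qr unfolding H.quaternion_rotation_def by blast
  note Q = R[unfolded H.quat_rot_def]
  have Qc: "a' \<in> carrier H" "b' \<in> carrier H" "x' \<in> carrier H" using Q by blast+
  obtain a0 where a0: "a0 \<in> carrier G" "h a0 = a'" by (rule lift[OF Qc(1)])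
  obtain x where x: "x \<in> carrier G" "h x = x'" by (rule lift[OF Qc(3)])
  have "h a0 [^]\<^bsub>H\<^esub> (4::nat) = (a' \<otimes>\<^bsub>H\<^esub> a') \<otimes>\<^bsub>H\<^esub> (a' \<otimes>\<^bsub>H\<^esub> a')"
    unfolding a0(2) using Qc(1) by (simp add: numeral_eq_Suc H.m_assoc)
  then have "h a0 [^]\<^bsub>H\<^esub> (4::nat) = \<one>\<^bsub>H\<^esub>" using Q by simp
  from lift_2_power[OF a0(1) this] obtain a where a: "a \<in> carrier G" "h a = a'" "a [^] (4::nat) = \<one>"
    using a0(2) by metis
  define b where "b = conj x a"
  have bc: "b \<in> carrier G" using a x by (simp add: b_def)
  have hb: "h b = b'" using hom_conj[OF x(1) a(1)] a x Q by (simp add: b_def)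
  have hc: "h (conj x b) = h (a \<otimes> b)" using hom_conj[OF x(1) bc] hb a bc x Q by simp
  have cent: "conj a n = n" "conj b n = n" if "n \<in> K" for n
    using centralizes_kernel[OF a(1) bc x(1) _ _ that] hc by (simp_all add: b_def[symmetric])
  let ?z = "a \<otimes> a"
  have zc: "?z \<in> carrier G" using a(1) by simp
  have zz: "?z \<otimes> ?z = \<one>" using a(1,3) by (simp add: numeral_eq_Suc m_assoc)
  have z1: "?z \<noteq> \<one>"
  proof
    assume "?z = \<one>"
    then have "h ?z = \<one>\<^bsub>H\<^esub>" by simp
    then show False using a Q by simp
  qed
  have bb: "b \<otimes> b = conj x ?z" using conj_mult[OF x(1) a(1,1)] by (simp add: b_def)
  have "h (conj x ?z) = h ?z" unfolding bb[symmetric] using a bc hb Q by simp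
  then obtain k where k: "k \<in> K" "conj x ?z = ?z \<otimes> k" using same_image[of "conj x ?z" ?z] x(1) zc by auto
  have kc: "k \<in> carrier G" by (rule Kc[OF k(1)])
  have czk: "conj ?z n = n" if "n \<in> K" for n
    using cent(1)[OF that] a(1) Kc[OF that] by (simp add: conj_mult_left)
  then have zk: "k \<otimes> ?z = ?z \<otimes> k" using conj_fixed_iff[OF zc kc] k(1) by simp
  have "conj x ?z \<otimes> conj x ?z = \<one>" using conj_mult[OF x(1) zc zc] zz x(1) by simp
  moreover have "conj x ?z \<otimes> conj x ?z = ?z \<otimes> (k \<otimes> ?z) \<otimes> k" unfolding k(2) using zc kc by (simp only: m_assoc m_closed)
  moreover have "?z \<otimes> (k \<otimes> ?z) \<otimes> k = (?z \<otimes> ?z) \<otimes> (k \<otimes> k)" unfolding zk using zc kc by (simp only: m_assoc m_closed)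
  ultimately have "k \<otimes> k = \<one>" using zz kc by simp
  then have "k = \<one>" using square_one_kernel k(1) by blast
  then have xz: "conj x ?z = ?z" using k(2) zc by simp
  have az: "conj a ?z = ?z" using a(1) by (simp add: conj_def m_assoc)
  have bz: "conj b ?z = ?z" using bb xz bc conj_fixed_iff[OF bc zc] by (metis m_assoc)
  let ?S = "{g \<in> carrier G. conj g ?z = ?z}"
  have sS: "subgroup ?S G" by (rule subgroup_centralizer[OF zc])
  have KS: "K \<subseteq> ?S"
  proof
    fix n assume n: "n \<in> K"
    have "conj n ?z = ?z" using czk[OF n] conj_fixed_sym[OF zc Kc[OF n]] by simp
    then show "n \<in> ?S" using Kc[OF n] by simp
  qed
  have "h ` ?S = carrier H"
  proof (rule H.quaternion_rotation_generates[OF R o24])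
    show "subgroup (h ` ?S) H" by (rule subgroup_img_is_subgroup[OF sS])
    show "a' \<in> h ` ?S" by (rule image_eqI[of _ _ a]) (use a az in simp_all)
    show "b' \<in> h ` ?S" by (rule image_eqI[of _ _ b]) (use bc hb bz in simp_all)
    show "x' \<in> h ` ?S" by (rule image_eqI[of _ _ x]) (use x xz in simp_all)
  qed
  then have S: "?S = carrier G" by (rule lift_generates[OF sS KS])
  have "{\<one>, ?z} \<lhd> G"
    unfolding normal_iff_conj
  proof (intro conjI ballI)
    have "cyc ?z = {\<one>, ?z}" by (rule cyc_involution[OF zc zz])
    then show "subgroup {\<one>, ?z} G" using subgroup_cyc[OF zc] by simp
    show "conj g n \<in> {\<one>, ?z}" if "g \<in> carrier G" "n \<in> {\<one>, ?z}" for g n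
      using that S by auto
  qed
  then show thesis by (rule that[OF zc z1 zz])
qed

end

section \<open>Kernels of order 2\<close>

locale two_kernel = prime_kernel + assumes r2: "r = 2"
begin

text \<open>A normal subgroup of order 2 is central.\<close>

lemma kernel_two:
  obtains z where "K = {\<one>, z}" "z \<noteq> \<one>" "z \<in> carrier G" "z \<otimes> z = \<one>"
    "\<And>g. g \<in> carrier G \<Longrightarrow> conj g z = z" "\<And>g. g \<in> carrier G \<Longrightarrow> z \<otimes> g = g \<otimes> z"
    "h z = \<one>\<^bsub>H\<^esub>" "z \<in> K"
proof -
  have c2: "card K = 2" using card_kernel r2 by simp
  obtain u v where uv: "K = {u, v}" "u \<noteq> v" using c2 by (auto simp: card_2_iff)
  have 1: "\<one> \<in> K" using sK by (rule subgroup.one_closed)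
  define z where "z = (if u = \<one> then v else u)"
  have z: "K = {\<one>, z}" "z \<noteq> \<one>" using uv 1 by (auto simp: z_def)
  have zK: "z \<in> K" using z by blast
  have zc: "z \<in> carrier G" by (rule Kc[OF zK])
  have zz: "z \<otimes> z = \<one>" using pow_r[OF zK] r2 zc by (simp add: numeral_2_eq_2)
  have cz: "conj g z = z" if g: "g \<in> carrier G" for g
  proof -
    have "conj g z \<in> {\<one>, z}" using normal_conj_closed[OF nK g zK] z(1) by simp
    moreover have "conj g z \<noteq> \<one>" using conj_inj[OF g zc Kc[OF 1]] z(2) g by simp
    ultimately show ?thesis by simp
  qed
  have czz: "z \<otimes> g = g \<otimes> z" if "g \<in> carrier G" for g
    using cz[OF that] conj_fixed_iff[OF that zc] by simp
  show thesis
    by (rule that[OF z zc zz]) (fact cz, fact czz, rule Kh[OF zK], rule zK)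
qed

text \<open>Either lift of an element of odd order \<open>n\<close> has \<open>n\<close>-th power in \<open>{\<one>, z}\<close>, and exactly one has a trivial
  one.\<close>

lemma lift_3_power:
  assumes x0: "x0 \<in> carrier G" "h x0 [^]\<^bsub>H\<^esub> (n::nat) = \<one>\<^bsub>H\<^esub>" "odd n"
  obtains x where "x \<in> carrier G" "h x = h x0" "x [^] n = \<one>"
proof -
  obtain z where z: "K = {\<one>, z}" "z \<noteq> \<one>" "z \<in> carrier G" "z \<otimes> z = \<one>"
    and czz: "\<And>g. g \<in> carrier G \<Longrightarrow> z \<otimes> g = g \<otimes> z" and hz: "h z = \<one>\<^bsub>H\<^esub>"
    by (rule kernel_two) blast
  have "x0 [^] n \<in> K" by (rule KI) (use x0 in \<open>simp_all add: hom_nat_pow\<close>)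
  then consider "x0 [^] n = \<one>" | "x0 [^] n = z" using z(1) by blast
  then show thesis
  proof cases
    case 1 then show ?thesis using that x0(1) by blast
  next
    case 2
    obtain j where j: "n = 2 * j + 1" using x0(3) by (auto elim: oddE)
    have "z [^] (2::nat) = \<one>" using z(3,4) by (simp add: numeral_2_eq_2)
    then have "(z [^] (2::nat)) [^] j = \<one>" by simp
    then have "z [^] (2 * j) = \<one>" using z(3) by (simp add: nat_pow_pow)
    then have "z [^] n = z" unfolding j using z(3) by simp
    then have "(x0 \<otimes> z) [^] n = \<one>"
      using pow_mult_distrib[OF czz[OF x0(1), symmetric] x0(1) z(3), of n] 2 z(4) by simp
    moreover have "h (x0 \<otimes> z) = h x0" using x0(1) z(3) hz by simp
    ultimately show ?thesis using that[of "x0 \<otimes> z"] x0(1) z(3) by simp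
  qed
qed

text \<open>The preimages of eleven subgroups of the quotient and four further subgroups of order 9, which
  map isomorphically, are too many.\<close>

lemma no_quaternion_over_order_9:
  assumes R: "H.rot a' b' x'" and nN: "{\<one>\<^bsub>H\<^esub>, a', b', a' \<otimes>\<^bsub>H\<^esub> b'} \<lhd> H"
    and o: "H.ord x' = 9" "order H = 36"
    and x: "x \<in> carrier G" "h x = x'" "x [^] (9::nat) = \<one>"
  shows False
proof -
  have sH: "small_comax H" by (rule small_comax_image[OF small_comax_axioms])
  interpret R: rot_comax H a' b' x' 2
    by (intro rot_comax.intro rot_comax_axioms.intro sH R nN) (use o in simp)
  let ?y = "x' [^]\<^bsub>H\<^esub> (3::nat)"
  have yc: "?y \<in> carrier H" using R.D(3) by simp
  have oy: "H.ord ?y = 3" using H.ord_pow[OF R.D(3), of 3] o(1) by simp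
  have fy: "H.conj ?y a' = a'" "H.conj ?y b' = b'" using H.rot_cube[OF R, of 1] by simp_all
  have oddy: "odd (H.ord ?y)" using oy by simp
  note Ey = R.Ext[OF yc oddy fy, unfolded oy]
  let ?C = "{g \<in> carrier H. H.conj g a' = a'} \<inter> {g \<in> carrier H. H.conj g b' = b'}"
  have sC: "subgroup ?C H"
    by (rule H.subgroups_Inter_pair) (rule H.subgroup_centralizer[OF R.D(1)], rule H.subgroup_centralizer[OF R.D(2)])
  have neC: "?C \<noteq> carrier H"
  proof
    assume "?C = carrier H"
    then have "x' \<in> ?C" using R.D(3) by blast
    then have "H.conj x' a' = a'" by blast
    then show False using R.D(7) R.E(2) by simp
  qed
  have NC: "n \<in> ?C" if "n \<in> R.N" for n
    using R.commN[OF that, of a'] R.commN[OF that, of b'] H.conj_fixed_iff[OF R.Nc[OF that]] R.D(1,2) R.Nc[OF that] by simp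
  have yC: "?y \<in> ?C" using yc fy by simp
  let ?A = "R.I2 \<union> ({H.cyc ?y} \<union> R.Ext ?y)"
  have sy: "subgroup (H.cyc ?y) H" "card (H.cyc ?y) = 3" using H.subgroup_cyc H.card_cyc yc oy by auto
  have AC: "P \<subseteq> ?C" if P: "P \<in> ?A" for P
  proof -
    consider n where "n \<in> R.N" "P = H.cyc n" | "P = H.cyc ?y" | n where "n \<in> R.N" "P = H.cyc (n \<otimes>\<^bsub>H\<^esub> ?y)"
      using P by blast
    then show ?thesis
    proof cases
      case 1 then show ?thesis using H.cyc_subset[OF sC NC[OF 1(1)]] by (simp only:)
    next
      case 2 then show ?thesis using H.cyc_subset[OF sC yC] by (simp only:)
    next
      case 3
      show ?thesis unfolding 3(2) by (rule H.cyc_subset[OF sC subgroup.m_closed[OF sC NC[OF 3(1)] yC]])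
    qed
  qed
  have A: "subgroup P H \<and> card P \<in> {2, 3, 6}" if P: "P \<in> ?A" for P
  proof -
    consider "P \<in> R.I2" | "P = H.cyc ?y" | "P \<in> R.Ext ?y" using P by blast
    then show ?thesis
    proof cases
      case 1 show ?thesis using R.I2(1)[OF 1] R.I2(2)[OF 1] by simp
    next
      case 2 then show ?thesis using sy by simp
    next
      case 3 then show ?thesis using Ey(2)[OF 3] by simp
    qed
  qed
  have XS9: "card P = 9" if "P \<in> R.XS" for P using R.XS(2)[OF that] by simp
  let ?B = "?A \<union> R.XS"
  have B: "subgroup P H" if P: "P \<in> ?B" for P
    by (rule UnE[OF P]) (use A[of P] R.XS(1)[of P] in blast)+
  have nc: "P <#>\<^bsub>H\<^esub> Q \<noteq> carrier H" if PQ: "P \<in> ?B" "Q \<in> ?B" for P Q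
  proof -
    have nd: "\<not> order H dvd d * 9" "\<not> order H dvd 9 * d" if "d \<in> {2, 3, 6, 9}" for d
      unfolding o(2) using that by auto
    have p: "P \<in> ?A \<or> P \<in> R.XS" by (rule Un_iff[THEN iffD1, OF PQ(1)])
    have q: "Q \<in> ?A \<or> Q \<in> R.XS" by (rule Un_iff[THEN iffD1, OF PQ(2)])
    from p q show ?thesis
    proof (elim disjE)
      assume h: "P \<in> ?A" "Q \<in> ?A"
      show ?thesis by (rule H.not_comax_within[OF sC neC AC[OF h(1)] AC[OF h(2)]])
    next
      assume h: "P \<in> ?A" "Q \<in> R.XS"
      have "\<not> order H dvd card P * card Q" unfolding XS9[OF h(2)] using nd(1)[of "card P"] A[OF h(1)] by blast
      then show ?thesis by (rule H.not_comax_dvd[OF B[OF PQ(1)] B[OF PQ(2)]])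
    next
      assume h: "P \<in> R.XS" "Q \<in> ?A"
      have "\<not> order H dvd card P * card Q" unfolding XS9[OF h(1)] using nd(2)[of "card Q"] A[OF h(2)] by blast
      then show ?thesis by (rule H.not_comax_dvd[OF B[OF PQ(1)] B[OF PQ(2)]])
    next
      assume h: "P \<in> R.XS" "Q \<in> R.XS"
      have "\<not> order H dvd card P * card Q" unfolding XS9[OF h(1)] XS9[OF h(2)] using nd(1)[of 9] by blast
      then show ?thesis by (rule H.not_comax_dvd[OF B[OF PQ(1)] B[OF PQ(2)]])
    qed
  qed
  have cB: "card ?B = 11"
  proof -
    have "card ({H.cyc ?y} \<union> R.Ext ?y) = card {H.cyc ?y} + card (R.Ext ?y)"
    proof (rule card_Un_sizes)
      fix P Q assume P: "P \<in> {H.cyc ?y}" and Q: "Q \<in> R.Ext ?y"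
      have "card P = 3" using P sy(2) by blast
      then show "card P \<noteq> card Q" using Ey(2)[OF Q] by simp
    qed simp_all
    then have 1: "card ({H.cyc ?y} \<union> R.Ext ?y) = 4" using Ey(1) by simp
    have "card ?A = card R.I2 + card ({H.cyc ?y} \<union> R.Ext ?y)"
    proof (rule card_Un_sizes)
      fix P Q assume P: "P \<in> R.I2" and Q: "Q \<in> {H.cyc ?y} \<union> R.Ext ?y"
      have "card Q = 3 \<or> card Q = 6" using Q Ey(2)[of Q] sy(2) by auto
      then show "card P \<noteq> card Q" using R.I2(2)[OF P] by auto
    qed simp_all
    then have 2: "card ?A = 7" using R.cardI2 1 by simp
    have "card ?B = card ?A + card R.XS"
    proof (rule card_Un_sizes)
      fix P Q assume P: "P \<in> ?A" and Q: "Q \<in> R.XS"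
      show "card P \<noteq> card Q" using A[OF P] XS9[OF Q] by auto
    qed simp_all
    then show ?thesis using 2 R.cardXS by simp
  qed
  have c2: "card K = 2" using card_kernel r2 by simp
  define L where "L = (\<lambda>n. SOME g. g \<in> carrier G \<and> h g = n)"
  have L: "L n \<in> carrier G" "h (L n) = n" if "n \<in> R.N" for n
  proof -
    have "\<exists>g. g \<in> carrier G \<and> h g = n" by (rule lift[OF R.Nc[OF that]]) blast
    then have "L n \<in> carrier G \<and> h (L n) = n" unfolding L_def by (rule someI_ex)
    then show "L n \<in> carrier G" "h (L n) = n" by blast+
  qed
  have ox: "ord x = 9"
  proof (rule dvd_antisym)
    show "ord x dvd 9" using pow_eq_id[OF x(1)] x(3) by blast
    have "x' [^]\<^bsub>H\<^esub> ord x = h (x [^] ord x)" using x(1,2) by (simp only: hom_nat_pow)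
    then have "x' [^]\<^bsub>H\<^esub> ord x = \<one>\<^bsub>H\<^esub>" using x(1) by simp
    then show "9 dvd ord x" using H.pow_eq_id[OF R.D(3)] o(1) by simp
  qed
  have sX: "subgroup (cyc x) G" "card (cyc x) = 9" using subgroup_cyc[OF x(1)] card_cyc[OF x(1)] ox by simp_all
  have hX: "h ` cyc x = R.X"
  proof -
    have "cyc x = range (\<lambda>k::nat. x [^] k)" using mem_cyc[OF x(1)] by auto
    moreover have "R.X = range (\<lambda>k::nat. x' [^]\<^bsub>H\<^esub> k)" using H.mem_cyc[OF R.D(3)] by auto
    ultimately show ?thesis using x(1,2) by (simp add: image_image hom_nat_pow)
  qed
  let ?T = "(\<lambda>n. conjs (L n) (cyc x)) ` R.N"
  have hT: "h ` conjs (L n) (cyc x) = H.conjs n R.X" if n: "n \<in> R.N" for n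
  proof -
    have "h (conj (L n) u) = H.conj n (h u)" if "u \<in> cyc x" for u
      using hom_conj[OF L(1)[OF n] subgroup.mem_carrier[OF sX(1) that]] L(2)[OF n] by simp
    then have "(\<lambda>u. h (conj (L n) u)) ` cyc x = (\<lambda>u. H.conj n (h u)) ` cyc x"
      by (rule image_cong[OF refl])
    then have "h ` conjs (L n) (cyc x) = H.conj n ` (h ` cyc x)" unfolding image_image .
    then show ?thesis using hX by simp
  qed
  have "(\<lambda>P. h ` P) ` ?T = R.XS"
    unfolding image_image by (rule image_cong[OF refl]) (rule hT[unfolded image_image])
  then have cT: "4 \<le> card ?T" using card_image_le[of ?T "\<lambda>P. h ` P"] R.cardXS by simp
  have T: "subgroup P G \<and> card P = 9 \<and> h ` P \<in> ?B" if P: "P \<in> ?T" for P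
  proof -
    obtain n where n: "n \<in> R.N" "P = conjs (L n) (cyc x)" using P by (rule imageE)
    have "h ` P \<in> R.XS" unfolding n(2) hT[OF n(1)] by (rule imageI[OF n(1)])
    then show ?thesis
      unfolding n(2) using subgroup_conjs[OF L(1)[OF n(1)] sX(1)]
        card_conjs[OF L(1)[OF n(1)] subgroup.subset[OF sX(1)]] sX(2)
      by (intro conjI UnI2) (simp_all only:)
  qed
  have P: "subgroup P G \<and> even (card P) \<and> card P \<noteq> 0 \<and> h ` P \<in> ?B" if P: "P \<in> pre ` ?B" for P
  proof -
    obtain Q where Q: "Q \<in> ?B" "P = pre Q" using P by (rule imageE)
    have "card P = card Q * 2" unfolding Q(2) card_pre[OF B[OF Q(1)]] c2 ..
    moreover have "card Q \<noteq> 0" using H.card_subgroup_pos[OF B[OF Q(1)]] by simp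
    moreover have "h ` P = Q" unfolding Q(2) by (rule image_pre[OF subgroup.subset[OF B[OF Q(1)]]])
    ultimately show ?thesis using subgroup_pre[OF B[OF Q(1)]] Q by simp
  qed
  let ?F = "pre ` ?B \<union> ?T"
  have F: "subgroup U G \<and> card U \<noteq> 1 \<and> h ` U \<in> ?B" if U: "U \<in> ?F" for U
    using U
  proof (rule UnE)
    assume "U \<in> pre ` ?B" from P[OF this] show ?thesis by auto
  next
    assume "U \<in> ?T" from T[OF this] show ?thesis by simp
  qed
  have "card ?F \<le> 14"
  proof (rule card_family_le)
    show "subgroup U G" "card U \<noteq> 1" if "U \<in> ?F" for U using F[OF that] by blast+
    show "U <#> V \<noteq> carrier G" if UV: "U \<in> ?F" "V \<in> ?F" for U V
    proof
      assume *: "U <#> V = carrier G"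
      have "h ` (U <#> V) = (h ` U) <#>\<^bsub>H\<^esub> (h ` V)"
        by (rule set_mult_hom[OF hom_h subgroup.subset[OF F[OF UV(1), THEN conjunct1]]
            subgroup.subset[OF F[OF UV(2), THEN conjunct1]]])
      then have "(h ` U) <#>\<^bsub>H\<^esub> (h ` V) = carrier H" using * surj by simp
      then show False
        by (rule nc[OF F[OF UV(1), THEN conjunct2, THEN conjunct2] F[OF UV(2), THEN conjunct2, THEN conjunct2], THEN notE])
    qed
  qed
  moreover have "card ?F = card (pre ` ?B) + card ?T"
  proof (rule card_Un_sizes)
    fix U V assume U: "U \<in> pre ` ?B" and V: "V \<in> ?T"
    show "card U \<noteq> card V" using P[OF U] T[OF V] by auto
  qed simp_all
  moreover have "card (pre ` ?B) = card ?B"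
  proof (rule card_image, rule inj_onI)
    fix P Q assume PQ: "P \<in> ?B" "Q \<in> ?B" "pre P = pre Q"
    show "P = Q" using pre_inj[OF subgroup.subset[OF B[OF PQ(1)]] subgroup.subset[OF B[OF PQ(2)]]] PQ(3) by blast
  qed
  ultimately show False using cB cT by simp
qed

text \<open>Lift \<open>x\<close> to an element of the same order, and \<open>a\<close> so that \<open>x\<close> rotates \<open>a\<close>, \<open>b\<close> and \<open>a \<otimes> b\<close>. If \<open>a\<close> is an
  involution, the Klein group lifts. Otherwise \<open>a\<close> and \<open>b\<close> generate a quaternion group, and the order of
  \<open>x\<close> is 3 because order 9 is excluded by the preceding count.\<close>

lemma klein_rotation_lifts_two:
  assumes kr: "group.klein_rotation H m" and m: "m = 1 \<or> m = 2"
  shows "klein_rotation 1 \<or> klein_rotation 2 \<or> quaternion_rotation"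
proof -
  obtain a' b' x' where R: "H.rot a' b' x'" and nN: "{\<one>\<^bsub>H\<^esub>, a', b', a' \<otimes>\<^bsub>H\<^esub> b'} \<lhd> H"
    and ox: "H.ord x' = 3 ^ m" and oH: "order H = 4 * 3 ^ m"
    using kr unfolding H.klein_rotation_def by blast
  note RD = H.rotD[OF R] and RE = H.rot_calc[OF R]
  obtain z where z: "K = {\<one>, z}" "z \<noteq> \<one>" "z \<in> carrier G" "z \<otimes> z = \<one>"
    and czc: "\<And>g. g \<in> carrier G \<Longrightarrow> conj g z = z" and czz: "\<And>g. g \<in> carrier G \<Longrightarrow> z \<otimes> g = g \<otimes> z"
    and hz: "h z = \<one>\<^bsub>H\<^esub>" and zK: "z \<in> K"
    by (rule kernel_two) blast
  have zl: "z \<otimes> (g \<otimes> u) = g \<otimes> (z \<otimes> u)" if "g \<in> carrier G" "u \<in> carrier G" for g u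
    using czz[OF that(1)] that z(3) by (simp add: m_assoc[symmetric])
  obtain x0 where x0: "x0 \<in> carrier G" "h x0 = x'" by (rule lift[OF RD(3)])
  have "h x0 [^]\<^bsub>H\<^esub> ((3::nat) ^ m) = \<one>\<^bsub>H\<^esub>" using x0(2) ox RD(3) H.pow_eq_id by simp
  then obtain x where x: "x \<in> carrier G" "h x = h x0" "x [^] ((3::nat) ^ m) = \<one>"
    by (rule lift_3_power[OF x0(1)]) simp
  note x = x(1) x(2)[unfolded x0(2)] x(3)
  obtain a0 where a0: "a0 \<in> carrier G" "h a0 = a'" by (rule lift[OF RD(1)])
  \<comment> \<open>Of the two lifts of \<open>a'\<close> one satisfies the last relation exactly.\<close>
  have "\<exists>a\<in>carrier G. h a = a' \<and> conj x (conj x a) = a \<otimes> conj x a"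
  proof -
    let ?b0 = "conj x a0"
    have b0: "?b0 \<in> carrier G" "h ?b0 = b'" using x a0 hom_conj[OF x(1) a0(1)] RD(8) by simp_all
    have "h (conj x ?b0) = h (a0 \<otimes> ?b0)" using hom_conj[OF x(1) b0(1)] b0 x a0 RD(9) by simp
    then obtain k where k: "k \<in> K" "conj x ?b0 = a0 \<otimes> ?b0 \<otimes> k"
      using same_image[of "conj x ?b0" "a0 \<otimes> ?b0"] x(1) b0(1) a0(1) by auto
    show ?thesis
    proof (cases "k = \<one>")
      case True then show ?thesis using k(2) a0 b0(1) by auto
    next
      case False
      then have kz: "k = z" using k(1) z(1) by blast
      let ?a = "a0 \<otimes> z"
      have ca: "conj x ?a = ?b0 \<otimes> z" using conj_mult[OF x(1) a0(1) z(3)] czc[OF x(1)] by simp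
      have "conj x (conj x ?a) = a0 \<otimes> ?b0 \<otimes> z \<otimes> z"
        unfolding ca using conj_mult[OF x(1) b0(1) z(3)] czc[OF x(1)] k(2) kz by simp
      moreover have "?a \<otimes> (?b0 \<otimes> z) = a0 \<otimes> ?b0 \<otimes> z \<otimes> z"
        using a0(1) b0(1) z(3) czz[OF b0(1)] zl[OF b0(1) z(3)] by (simp add: m_assoc)
      ultimately have "conj x (conj x ?a) = ?a \<otimes> conj x ?a" using ca by simp
      moreover have "h ?a = a'" using a0 z(3) hz RD(1) by simp
      ultimately show ?thesis using a0(1) z(3) by blast
    qed
  qed
  then obtain a where a: "a \<in> carrier G" "h a = a'" "conj x (conj x a) = a \<otimes> conj x a" by blast
  define b where "b = conj x a"
  have b: "b \<in> carrier G" "conj x b = a \<otimes> b" "h b = b'"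
    using a x hom_conj[OF x(1) a(1)] RD(8) by (simp_all add: b_def)
  have ab: "a \<otimes> b \<in> carrier G" using a(1) b(1) by simp
  have "a \<otimes> a \<in> K" by (rule KI) (use a RD(5) in simp_all)
  then consider "a \<otimes> a = \<one>" | "a \<otimes> a = z" using z(1) by blast
  then show ?thesis
  proof cases
    case 1
    have bb: "b \<otimes> b = \<one>" using conj_mult[OF x(1) a(1,1)] 1 x(1) by (simp add: b_def)
    have abab: "(a \<otimes> b) \<otimes> (a \<otimes> b) = \<one>" using conj_mult[OF x(1) b(1,1)] bb x(1) b(2) by simp
    have "inv (a \<otimes> b) = a \<otimes> b" "inv a = a" "inv b = b"
      using inv_equality[OF abab ab ab] inv_equality[OF 1 a(1,1)] inv_equality[OF bb b(1,1)] by blast+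
    then have comm: "a \<otimes> b = b \<otimes> a" using inv_mult_group[OF a(1) b(1)] by simp
    have "a \<noteq> \<one>" using a(2) RD(4) by auto
    then have r: "rot a b x"
      using a(1) b(1,2) x(1) 1 bb comm by (simp add: rot_def b_def[symmetric])
    let ?N = "{\<one>, a, b, a \<otimes> b}"
    have sN: "subgroup ?N G" by (rule rot_subgroup[OF r])
    note D = rotD[OF r] and E = rot_calc[OF r]
    let ?S = "{g \<in> carrier G. conjs g ?N = ?N}"
    have sS: "subgroup ?S G" by (rule subgroup_stabilizer_conj[OF subgroup.subset[OF sN]])
    have fixS: "g \<in> ?S" if "g \<in> carrier G" "conj g a = a" "conj g b = b" for g
      using that D(1,2) by (simp add: conj_mult)
    have zS: "z \<in> ?S" by (rule fixS) (use z(3) czz a(1) b(1) conj_fixed_iff in simp_all)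
    have KS: "K \<subseteq> ?S" unfolding z(1) by (intro insert_subsetI empty_subsetI zS subgroup.one_closed[OF sS])
    have aS: "a \<in> ?S" by (rule fixS) (use a(1) b(1) comm conj_fixed_iff in simp_all)
    have bS: "b \<in> ?S" by (rule fixS) (use a(1) b(1) comm conj_fixed_iff in simp_all)
    have "conjs x ?N = {\<one>, b, a \<otimes> b, a}" using D(3,8,9) E(11) by simp
    then have xS: "x \<in> ?S" using D(3) by auto
    have "h ` ?S = carrier H"
    proof (rule H.klein_rotation_generates[OF R ox oH])
      show "subgroup (h ` ?S) H" by (rule subgroup_img_is_subgroup[OF sS])
      show "a' \<in> h ` ?S" by (rule image_eqI[OF _ aS]) (use a in simp)
      show "b' \<in> h ` ?S" by (rule image_eqI[OF _ bS]) (use b in simp)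
      show "x' \<in> h ` ?S" by (rule image_eqI[OF _ xS]) (use x in simp)
    qed
    then have "?S = carrier G" by (rule lift_generates[OF sS KS])
    then have "?N \<lhd> G" by (intro conjs_fixed_imp_normal[OF sN]) blast
    then show ?thesis using klein_rotation_if_rot[OF r] by blast
  next
    case 2
    have bb: "b \<otimes> b = z" using conj_mult[OF x(1) a(1,1)] 2 x(1) czc by (simp add: b_def)
    have abab: "(a \<otimes> b) \<otimes> (a \<otimes> b) = z" using conj_mult[OF x(1) b(1,1)] bb x(1) czc b(2) by simp
    have "(a \<otimes> z) \<otimes> a = (a \<otimes> a) \<otimes> z" using a(1) z(3) czz[OF a(1)] by (simp add: m_assoc)
    then have ia: "inv a = a \<otimes> z" using inv_equality[of "a \<otimes> z" a] 2 z(3,4) a(1) by simp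
    have "(b \<otimes> z) \<otimes> b = (b \<otimes> b) \<otimes> z" using b(1) z(3) czz[OF b(1)] by (simp add: m_assoc)
    then have ib: "inv b = b \<otimes> z" using inv_equality[of "b \<otimes> z" b] bb z(3,4) b(1) by simp
    have "b \<otimes> a = inv a \<otimes> ((a \<otimes> b) \<otimes> (a \<otimes> b)) \<otimes> inv b" using a(1) b(1) by (simp add: m_assoc)
    also have "\<dots> = (a \<otimes> z) \<otimes> z \<otimes> (b \<otimes> z)" unfolding abab ia ib ..
    also have "\<dots> = a \<otimes> (z \<otimes> z) \<otimes> (b \<otimes> z)" using a(1) z(3) b(1) by (simp add: m_assoc)
    finally have ba: "b \<otimes> a = a \<otimes> b \<otimes> z" using z(3,4) a(1) b(1) by (simp add: m_assoc)
    show ?thesis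
    proof (cases "m = 1")
      case True
      have "quat_rot a b x"
        using a(1) b x 2 z bb ba True by (simp add: quat_rot_def b_def[symmetric])
      moreover have "order G = 24" using order_G r2 oH True by simp
      ultimately show ?thesis unfolding quaternion_rotation_def by blast
    next
      case False
      then have "m = 2" using m by simp
      then show ?thesis using no_quaternion_over_order_9[OF R nN _ _ x(1,2)] ox oH x(3) by simp
    qed
  qed
qed

text \<open>The preimage of the center would be a central Klein four-group. There are at least four subgroups
  of order 3; multiplying each by the three central involutions gives twelve of order 6.\<close>

lemma quaternion_rotation_not_lifts_two:
  assumes qr: "group.quaternion_rotation H" shows False
proof -
  obtain a' b' x' where R: "H.quat_rot a' b' x'" and o24: "order H = 24"
    using qr unfolding H.quaternion_rotation_def by blast
  note Q = R[unfolded H.quat_rot_def]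
  have Qc: "a' \<in> carrier H" "b' \<in> carrier H" "x' \<in> carrier H" using Q by blast+
  have Qe: "a' \<otimes>\<^bsub>H\<^esub> a' \<noteq> \<one>\<^bsub>H\<^esub>" "b' \<otimes>\<^bsub>H\<^esub> b' = a' \<otimes>\<^bsub>H\<^esub> a'"
    "(a' \<otimes>\<^bsub>H\<^esub> a') \<otimes>\<^bsub>H\<^esub> (a' \<otimes>\<^bsub>H\<^esub> a') = \<one>\<^bsub>H\<^esub>" "b' \<otimes>\<^bsub>H\<^esub> a' = a' \<otimes>\<^bsub>H\<^esub> b' \<otimes>\<^bsub>H\<^esub> (a' \<otimes>\<^bsub>H\<^esub> a')"
    "H.conj x' a' = b'" "H.conj x' b' = a' \<otimes>\<^bsub>H\<^esub> b'" "x' [^]\<^bsub>H\<^esub> (3::nat) = \<one>\<^bsub>H\<^esub>" using Q by blast+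
  have o48: "order G = 48" using order_G r2 o24 by simp
  obtain z where z: "K = {\<one>, z}" "z \<noteq> \<one>" "z \<in> carrier G" "z \<otimes> z = \<one>"
    and czc: "\<And>g. g \<in> carrier G \<Longrightarrow> conj g z = z" and czz: "\<And>g. g \<in> carrier G \<Longrightarrow> z \<otimes> g = g \<otimes> z"
    and hz: "h z = \<one>\<^bsub>H\<^esub>" and zK: "z \<in> K"
    by (rule kernel_two) blast
  have Kcent: "conj g k = k" "k \<otimes> k = \<one>" "k \<in> carrier G" "conj k g = g" if "k \<in> K" "g \<in> carrier G" for k g
  proof -
    have "k = \<one> \<or> k = z" using that(1) z(1) by blast
    then show 1: "conj g k = k" and "k \<otimes> k = \<one>" and 2: "k \<in> carrier G"
      using czc[OF that(2)] z(3,4) that(2) by auto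
    show "conj k g = g" using 1 conj_fixed_sym[OF that(2) 2] by simp
  qed
  obtain x0 where x0: "x0 \<in> carrier G" "h x0 = x'" by (rule lift[OF Qc(3)])
  have "h x0 [^]\<^bsub>H\<^esub> (3::nat) = \<one>\<^bsub>H\<^esub>" "odd (3::nat)" using x0(2) Qe(7) by simp_all
  from lift_3_power[OF x0(1) this] obtain x where x: "x \<in> carrier G" "h x = x'" "x [^] (3::nat) = \<one>"
    using x0(2) by metis
  obtain a where a: "a \<in> carrier G" "h a = a'" by (rule lift[OF Qc(1)])
  define b where "b = conj x a"
  define c where "c = conj x b"
  have bc: "b \<in> carrier G" "c \<in> carrier G" using a x by (simp_all add: b_def c_def)
  have hb: "h b = b'" using hom_conj[OF x(1) a(1)] a x Qe(5) by (simp add: b_def)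
  have hc: "h c = h (a \<otimes> b)" using hom_conj[OF x(1) bc(1)] hb a bc x Qe(6) by (simp add: c_def)
  obtain e where e: "e \<in> K" "c = a \<otimes> b \<otimes> e" using same_image[OF bc(2) _ hc] a(1) bc(1) by auto
  \<comment> \<open>A lift of the central involution of the quotient; it is shown to be central of order 2.\<close>
  define w where "w = a \<otimes> a"
  have wc: "w \<in> carrier G" using a(1) by (simp add: w_def)
  have hw: "h w = a' \<otimes>\<^bsub>H\<^esub> a'" using a by (simp add: w_def)
  have wK: "w \<notin> K" using Kh[of w] hw Qe(1) by auto
  have bw: "b \<otimes> b = conj x w" using conj_mult[OF x(1) a(1,1)] by (simp add: b_def w_def)
  have "h (conj x w) = h w" unfolding bw[symmetric] using bc(1) hb hw Qe(2) by simp
  then obtain k where k: "k \<in> K" "conj x w = w \<otimes> k" using same_image[of "conj x w" w] x(1) wc by auto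
  have kc: "k \<in> carrier G" by (rule Kc[OF k(1)])
  have xw: "conj x w = w"
  proof -
    have "conj (x [^] (3::nat)) w = conj x (conj x (conj x w))"
      using x(1) wc by (simp add: numeral_3_eq_3 conj_mult_left)
    also have "\<dots> = w \<otimes> k \<otimes> k \<otimes> k"
      unfolding k(2) using x(1) wc kc k(2) Kcent(1)[OF k(1) x(1)] by (simp add: conj_mult)
    also have "\<dots> = w \<otimes> k" using Kcent(2)[OF k(1) x(1)] wc kc by (simp add: m_assoc)
    finally have "w = w \<otimes> k" using x(3) wc by simp
    then show ?thesis using k(2) by simp
  qed
  have aw: "conj a w = w" using a(1) by (simp add: w_def conj_def m_assoc)
  have bw': "conj b w = w" using bw xw bc(1) wc conj_fixed_iff[OF bc(1) wc] by (metis m_assoc)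
  have gen: "S = carrier G" if S: "subgroup S G" "K \<subseteq> S" "a \<in> S" "b \<in> S" "x \<in> S" for S
  proof (rule lift_generates[OF S(1,2)], rule H.quaternion_rotation_generates[OF R o24])
    show "subgroup (h ` S) H" by (rule subgroup_img_is_subgroup[OF S(1)])
    show "a' \<in> h ` S" by (rule image_eqI[OF _ S(3)]) (use a in simp)
    show "b' \<in> h ` S" by (rule image_eqI[OF _ S(4)]) (use hb in simp)
    show "x' \<in> h ` S" by (rule image_eqI[OF _ S(5)]) (use x in simp)
  qed
  have "{g \<in> carrier G. conj g w = w} = carrier G"
  proof (rule gen[OF subgroup_centralizer[OF wc]])
    show "K \<subseteq> {g \<in> carrier G. conj g w = w}" using Kcent(3,4)[OF _ wc] by blast
  qed (use a(1) bc(1) x(1) aw bw' xw in simp_all)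
  then have cw: "conj g w = w" if "g \<in> carrier G" for g using that by blast
  have ww: "w \<otimes> w = \<one>"
  proof -
    have "h (b \<otimes> a) = h (a \<otimes> b \<otimes> w)" using a bc(1) hb hw wc Qe(4) by simp
    then obtain l where l: "l \<in> K" "b \<otimes> a = a \<otimes> b \<otimes> w \<otimes> l"
      using same_image[of "b \<otimes> a" "a \<otimes> b \<otimes> w"] a(1) bc(1) wc by auto
    have lc: "l \<in> carrier G" by (rule Kc[OF l(1)])
    have lb: "b \<otimes> l = l \<otimes> b" using Kcent(1)[OF l(1) bc(1)] conj_fixed_iff[OF bc(1) lc] by simp
    have wb: "b \<otimes> w = w \<otimes> b" using bw' conj_fixed_iff[OF bc(1) wc] by simp
    have "a \<otimes> b \<otimes> w \<otimes> l = a \<otimes> (b \<otimes> w) \<otimes> l" using a(1) bc(1) wc lc by (simp add: m_assoc)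
    also have "\<dots> = a \<otimes> w \<otimes> (b \<otimes> l)" unfolding wb using a(1) bc(1) wc lc by (simp add: m_assoc)
    also have "\<dots> = a \<otimes> w \<otimes> l \<otimes> b" unfolding lb using a(1) bc(1) wc lc by (simp add: m_assoc)
    finally have "conj b a = a \<otimes> w \<otimes> l" using l(2) a(1) bc(1) wc lc by (simp add: conj_def m_assoc)
    then have "conj b w = (a \<otimes> w \<otimes> l) \<otimes> (a \<otimes> w \<otimes> l)"
      using conj_mult[OF bc(1) a(1,1)] by (simp add: w_def)
    also have "\<dots> = a \<otimes> w \<otimes> (l \<otimes> (a \<otimes> w)) \<otimes> l" using a(1) wc lc by (simp add: m_assoc)
    also have "l \<otimes> (a \<otimes> w) = (a \<otimes> w) \<otimes> l"
      using Kcent(4)[OF l(1), of "a \<otimes> w"] conj_fixed_iff[OF lc, of "a \<otimes> w"] a(1) wc by simp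
    also have "a \<otimes> w \<otimes> ((a \<otimes> w) \<otimes> l) \<otimes> l = a \<otimes> (w \<otimes> a) \<otimes> w \<otimes> (l \<otimes> l)" using a(1) wc lc by (simp add: m_assoc)
    also have "w \<otimes> a = a \<otimes> w" using aw conj_fixed_iff[OF a(1) wc] by simp
    also have "a \<otimes> (a \<otimes> w) \<otimes> w \<otimes> (l \<otimes> l) = w \<otimes> (w \<otimes> w)"
      using Kcent(2)[OF l(1) a(1)] a(1) wc by (simp add: m_assoc w_def)
    finally have "w = w \<otimes> (w \<otimes> w)" using bw' by simp
    then show ?thesis using wc by simp
  qed
  let ?X = "cyc x"
  have x1: "x \<noteq> \<one>"
  proof
    assume "x = \<one>"
    then have "x' = \<one>\<^bsub>H\<^esub>" using x(2) by simp
    then have "b' = a'" "a' \<otimes>\<^bsub>H\<^esub> b' = b'" using Qe(5,6) Qc by simp_all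
    then show False using Qe(1) Qc by simp
  qed
  have ox: "ord x = 3" by (rule ord_eq_prime[OF x(1) _ x(3) x1]) simp
  have sX: "subgroup ?X G" "card ?X = 3" using subgroup_cyc[OF x(1)] card_cyc[OF x(1)] ox by simp_all
  have subX: "?X \<subseteq> carrier G" by (rule subgroup.subset[OF sX(1)])
  let ?C = "conj_class ?X"
  have "card ?C * 3 dvd 48" using conj_class_mult_card_dvd[OF sX(1)] sX(2) o48 by simp
  then have d16: "card ?C dvd 16" using nat_mult_dvd_cancel_disj[of 3 "card ?C" 16] by (simp add: mult.commute)
  have XC: "?X \<in> ?C" unfolding conj_class_def by (rule image_eqI[of _ _ \<one>]) (simp_all add: conjs_one[OF subX])
  \<comment> \<open>With at most two conjugates, every conjugate of \<open>x\<close> would normalize \<open>X\<close>. As \<open>a\<close> and \<open>b\<close> are products of such conjugates and central elements, \<open>X\<close> would be normal.\<close>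
  have "3 \<le> card ?C"
  proof (rule ccontr)
    assume "\<not> 3 \<le> card ?C"
    then have small2: "card ?C \<le> 2" by simp
    let ?S = "{g \<in> carrier G. conjs g ?X = ?X}"
    have sS: "subgroup ?S G" by (rule subgroup_stabilizer_conj[OF subX])
    have xX: "conjs x ?X = ?X" using conjs_cyc[OF x(1,1)] x(1) conj_fixed_iff[OF x(1,1)] by simp
    have fx: "conjs x Y = Y" if Y: "Y \<in> ?C" for Y
    proof (cases "Y = ?X")
      case True then show ?thesis using xX by simp
    next
      case False
      have subY: "Y \<subseteq> carrier G" using conj_class_subgroups[OF sX(1) Y] subgroup.subset by blast
      have Y': "conjs x Y \<in> ?C" by (rule conjs_in_conj_class[OF x(1) Y subX])
      show ?thesis
      proof (rule ccontr)
        assume ne: "conjs x Y \<noteq> Y"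
        have "conjs x Y \<noteq> ?X"
        proof
          assume "conjs x Y = ?X"
          then have "conjs (inv x) (conjs x Y) = conjs (inv x) (conjs x ?X)" using xX by simp
          then have "conjs (inv x \<otimes> x) Y = conjs (inv x \<otimes> x) ?X"
            using conjs_mult_left[of "inv x" x Y] conjs_mult_left[of "inv x" x ?X] x(1) subY subX by simp
          then show False using False x(1) conjs_one[OF subY] conjs_one[OF subX] by simp
        qed
        then have "card {?X, Y, conjs x Y} = 3" using ne False by auto
        moreover have "card {?X, Y, conjs x Y} \<le> card ?C"
          using XC Y Y' by (intro card_mono) auto
        ultimately show False using small2 by simp
      qed
    qed
    have tS: "conj t x \<in> ?S" if t: "t \<in> carrier G" for t
    proof -
      let ?Y = "conjs (inv t) ?X"
      have subY: "?Y \<subseteq> carrier G" using t subX by auto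
      have "?Y \<in> ?C" unfolding conj_class_def using t by blast
      then have "conjs x ?Y = ?Y" by (rule fx)
      then have "conjs t (conjs x ?Y) = conjs t ?Y" by simp
      moreover have "conjs t ?Y = ?X" using conjs_mult_left[of t "inv t" ?X] t subX conjs_one[OF subX] by simp
      moreover have "conjs (conj t x) ?X = conjs t (conjs x ?Y)"
      proof -
        have "conj t x = t \<otimes> (x \<otimes> inv t)" using t x(1) by (simp add: conj_def m_assoc)
        then show ?thesis
          using conjs_mult_left[of t "x \<otimes> inv t" ?X] conjs_mult_left[of x "inv t" ?X] t x(1) subX by simp
      qed
      ultimately show ?thesis using t x(1) by simp
    qed
    have q: "a \<otimes> inv b = conj a x \<otimes> inv x"
      using a(1) x(1) by (simp add: b_def conj_def m_assoc inv_mult_group)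
    have q2: "conj x (a \<otimes> inv b) = inv a \<otimes> inv e"
    proof -
      have ec: "e \<in> carrier G" by (rule Kc[OF e(1)])
      have ecc: "inv e = e" using inv_equality[OF Kcent(2)[OF e(1) a(1)] ec ec] .
      have "conj x (a \<otimes> inv b) = b \<otimes> inv c" using conj_mult[OF x(1) a(1)] conj_inv[OF x(1) bc(1)] bc(1) by (simp add: b_def[symmetric] c_def[symmetric])
      also have "inv c = e \<otimes> (inv b \<otimes> inv a)" unfolding e(2) using a(1) bc(1) ec ecc by (simp add: inv_mult_group)
      also have "\<dots> = inv b \<otimes> inv a \<otimes> e"
        using Kcent(4)[OF e(1), of "inv b \<otimes> inv a"] conj_fixed_iff[OF ec, of "inv b \<otimes> inv a"] a(1) bc(1) by simp
      finally show ?thesis using a(1) bc(1) ec ecc by (simp add: m_assoc)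
    qed
    have xS: "x \<in> ?S" using x(1) xX by simp
    have KS: "K \<subseteq> ?S"
    proof
      fix l assume l: "l \<in> K"
      have "conj l u = u" if "u \<in> ?X" for u using Kcent(4)[OF l] that subX by blast
      then have "conjs l ?X = ?X" by force
      then show "l \<in> ?S" using Kc[OF l] by simp
    qed
    have memS: "conj x s \<in> T" if "subgroup T G" "x \<in> T" "s \<in> T" for s T
      unfolding conj_def using that subgroup.m_closed[OF that(1)] subgroup.m_inv_closed[OF that(1)] by simp
    have abS: "a \<otimes> inv b \<in> ?S" unfolding q
      by (rule subgroup.m_closed[OF sS tS[OF a(1)] subgroup.m_inv_closed[OF sS xS]])
    have "inv a \<otimes> inv e \<in> ?S" using memS[OF sS xS abS] q2 by simp
    from subgroup.m_inv_closed[OF sS this] have "e \<otimes> a \<in> ?S"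
      using a(1) Kc[OF e(1)] by (simp add: inv_mult_group)
    moreover have "inv e \<in> ?S" using subgroup.m_inv_closed[OF sS] KS e(1) by blast
    ultimately have "inv e \<otimes> (e \<otimes> a) \<in> ?S" using subgroup.m_closed[OF sS] by blast
    then have aS: "a \<in> ?S" using a(1) Kc[OF e(1)] by simp
    have bS: "b \<in> ?S" unfolding b_def by (rule memS[OF sS xS aS])
    have "?S = carrier G" by (rule gen[OF sS KS aS bS xS])
    then have nX: "?X \<lhd> G" by (intro conjs_fixed_imp_normal[OF sX(1)]) blast
    have xX': "x \<in> ?X" by (rule cyc_self)
    have "a \<otimes> inv b \<in> ?X" unfolding q
      by (rule subgroup.m_closed[OF sX(1) normal_conj_closed[OF nX a(1) xX'] subgroup.m_inv_closed[OF sX(1) xX']])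
    then have uX: "inv a \<otimes> inv e \<in> ?X" using normal_conj_closed[OF nX x(1)] q2 by metis
    have "h ((inv a \<otimes> inv e) [^] (3::nat)) = \<one>\<^bsub>H\<^esub>" using pow_card_subgroup[OF sX(1) uX] sX(2) by simp
    then have "inv\<^bsub>H\<^esub> a' [^]\<^bsub>H\<^esub> (3::nat) = \<one>\<^bsub>H\<^esub>" using a Kc[OF e(1)] Kh[OF e(1)] Qc(1) by (simp add: hom_nat_pow)
    then have a3: "a' [^]\<^bsub>H\<^esub> (3::nat) = \<one>\<^bsub>H\<^esub>" using H.nat_pow_inv[OF Qc(1), of 3] Qc(1) by simp
    have "a' [^]\<^bsub>H\<^esub> (4::nat) = \<one>\<^bsub>H\<^esub>" using Qe(3) Qc(1) by (simp add: numeral_eq_Suc H.m_assoc)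
    moreover have "coprime (3::nat) 4" using coprime_power_right_iff[of "3::nat" 2 2] by simp
    ultimately have "a' = \<one>\<^bsub>H\<^esub>" using H.pow_coprime_eq_one[OF Qc(1) a3] by blast
    then show False using Qe(1) by simp
  qed
  moreover have "card ?C \<noteq> 3" using d16 by auto
  ultimately have C4: "4 \<le> card ?C" by simp
  have C3: "subgroup Y G \<and> card Y = 3" if "Y \<in> ?C" for Y using conj_class_subgroups[OF sX(1) that] sX(2) by simp
  define f where "f = (\<lambda>Y. SOME v. v \<in> carrier G \<and> Y = cyc v)"
  have f: "f Y \<in> carrier G" "Y = cyc (f Y)" "ord (f Y) = 3" if Y: "Y \<in> ?C" for Y
  proof -
    obtain t where t: "t \<in> carrier G" "Y = conjs t ?X" using Y by (auto simp: conj_class_def)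
    have "conj t x \<in> carrier G \<and> Y = cyc (conj t x)" using t x(1) conjs_cyc by simp
    then have "f Y \<in> carrier G \<and> Y = cyc (f Y)" unfolding f_def by (rule someI)
    then show 1: "f Y \<in> carrier G" and 2: "Y = cyc (f Y)" by blast+
    show "ord (f Y) = 3" using card_cyc[OF 1] 2 C3[OF Y] by simp
  qed
  let ?W = "{z, w, w \<otimes> z}"
  have W: "u \<in> carrier G \<and> ord u = 2 \<and> (\<forall>g\<in>carrier G. conj g u = u)" if u: "u \<in> ?W" for u
  proof -
    have wz: "(w \<otimes> z) \<otimes> (w \<otimes> z) = \<one>"
    proof -
      have "(w \<otimes> z) \<otimes> (w \<otimes> z) = w \<otimes> (z \<otimes> w) \<otimes> z" using wc z(3) by (simp add: m_assoc)
      also have "\<dots> = (w \<otimes> w) \<otimes> (z \<otimes> z)" unfolding czz[OF wc] using wc z(3) by (simp add: m_assoc)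
      finally show ?thesis using ww z(4) by simp
    qed
    have "w \<noteq> \<one>" using wK subgroup.one_closed[OF sK] by blast
    moreover have "w \<otimes> z \<noteq> \<one>"
    proof
      assume "w \<otimes> z = \<one>"
      then have "w = inv z" using inv_equality wc z(3) by simp
      then show False using wK subgroup.m_inv_closed[OF sK zK] by simp
    qed
    moreover have u': "u = z \<or> u = w \<or> u = w \<otimes> z" using u by (simp only: insert_iff empty_iff simp_thms)
    moreover have "w \<otimes> z \<in> carrier G" using wc z(3) by simp
    ultimately have "u \<in> carrier G" "u \<otimes> u = \<one>" "u \<noteq> \<one>"
      using z(2-4) wc ww wz by (elim disjE; simp only:; fail)+
    then have "u [^] (2::nat) = \<one>" by (simp add: numeral_2_eq_2)
    then have "ord u = 2"
      using ord_eq_prime[OF \<open>u \<in> carrier G\<close> two_is_prime_nat] \<open>u \<noteq> \<one>\<close> by blast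
    moreover have "conj g u = u" if "g \<in> carrier G" for g
      using u' czc[OF that] cw[OF that] conj_mult[OF that wc z(3)] by (elim disjE) simp_all
    ultimately show ?thesis using \<open>u \<in> carrier G\<close> by blast
  qed
  have cW: "card ?W = 3"
  proof -
    have "z \<noteq> w" using wK zK by auto
    moreover have "z \<noteq> w \<otimes> z"
    proof
      assume "z = w \<otimes> z"
      then have "w = \<one>" using wc z(3) by simp
      then show False using wK subgroup.one_closed[OF sK] by simp
    qed
    moreover have "w \<noteq> w \<otimes> z" using wc z(2,3) by simp
    ultimately show ?thesis by simp
  qed
  have "card ?C \<le> nsub 3" by (rule nsub_ge) (rule C3)
  moreover have "3 * card ?C \<le> nsub 6"
  proof -
    let ?g = "\<lambda>(u, Y). cyc (u \<otimes> f Y)"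
    have "inj_on ?g (?W \<times> ?C)"
    proof (rule inj_onI)
      fix p q assume p: "p \<in> ?W \<times> ?C" and q: "q \<in> ?W \<times> ?C" and e: "?g p = ?g q"
      obtain u Y where p': "p = (u, Y)" "u \<in> ?W" "Y \<in> ?C" using p by (rule SigmaE)
      obtain v Z where q': "q = (v, Z)" "v \<in> ?W" "Z \<in> ?C" using q by (rule SigmaE)
      have e': "cyc (u \<otimes> f Y) = cyc (v \<otimes> f Z)" using e p' q' by simp
      have oY: "odd (ord (f Y))" "ord (f Z) = ord (f Y)" using f(3)[OF p'(3)] f(3)[OF q'(3)] by simp_all
      have u: "u \<in> carrier G" "ord u = 2" "conj (f Y) u = u" and v: "v \<in> carrier G" "ord v = 2" "conj (f Z) v = v"
        using W[OF p'(2)] W[OF q'(2)] f(1)[OF p'(3)] f(1)[OF q'(3)] by blast+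
      note 1 = cyc_involution_mult_inj[OF u(1,2) f(1)[OF p'(3)] oY(1) u(3) v(1,2) f(1)[OF q'(3)] oY(2) v(3) e']
      have "Y = Z" using 1(2) f(2)[OF p'(3)] f(2)[OF q'(3)] by simp
      then show "p = q" using 1(1) p'(1) q'(1) by simp
    qed
    then have "card (?g ` (?W \<times> ?C)) = card ?W * card ?C" by (simp only: card_image card_cartesian_product)
    then have "card (?g ` (?W \<times> ?C)) = 3 * card ?C" unfolding cW .
    moreover have "card (?g ` (?W \<times> ?C)) \<le> nsub 6"
    proof (rule nsub_ge)
      fix P assume "P \<in> ?g ` (?W \<times> ?C)"
      then obtain p where p: "P = ?g p" "p \<in> ?W \<times> ?C" by (rule imageE)
      obtain u Y where uY: "p = (u, Y)" "u \<in> ?W" "Y \<in> ?C" using p(2) by (rule SigmaE)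
      have u: "u \<in> carrier G" "ord u = 2" "conj (f Y) u = u"
        using W[OF uY(2)] f(1)[OF uY(3)] by blast+
      have P: "P = cyc (u \<otimes> f Y)" using p(1) uY(1) by simp
      have uf: "u \<otimes> f Y \<in> carrier G" using u(1) f(1)[OF uY(3)] by simp
      have "ord (u \<otimes> f Y) = 6"
        using ord_involution_mult(1)[OF u(1,2) f(1)[OF uY(3)] _ u(3)] f(3)[OF uY(3)] by simp
      then show "subgroup P G \<and> card P = 6" unfolding P using subgroup_cyc[OF uf] card_cyc[OF uf] by simp
    qed
    ultimately show ?thesis by simp
  qed
  moreover have "nsub 3 + nsub 6 \<le> 14"
  proof -
    let ?F = "{P. subgroup P G \<and> card P = 3} \<union> {P. subgroup P G \<and> card P = 6}"
    have "card ?F = nsub 3 + nsub 6"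
      unfolding nsub_def by (rule card_Un_disjoint[OF finite_subgroups finite_subgroups]) auto
    moreover have "card ?F \<le> 14"
      by (rule card_family_dvd_le) (use o48 in auto)
    ultimately show ?thesis by simp
  qed
  ultimately show False using C4 by simp
qed

end

section \<open>Supersolvability of extensions of cyclic groups\<close>

text \<open>Cyclicity of a factor in terms of elements of \<open>G\<close>, which can be transferred along homomorphisms.\<close>

lemma (in group) cyclic_section_iff:
  assumes L: "subgroup L G" and K: "K \<lhd> G" "K \<subseteq> L"
  shows "cyclic_group (G\<lparr>carrier := L\<rparr> Mod K) \<longleftrightarrow> (\<exists>g\<in>L. \<forall>y\<in>L. \<exists>i::int. y \<in> K #> g [^] i)"
proof -
  let ?L = "G\<lparr>carrier := L\<rparr>"
  have sK: "subgroup K G" using K(1) by (rule normal_imp_subgroup)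
  interpret N: normal K ?L by (rule normal_restrict_supergroup[OF L K])
  interpret Q: group "?L Mod K" by (rule N.factorgroup_is_group)
  have Lc: "y \<in> carrier G" if "y \<in> L" for y by (rule subgroup.mem_carrier[OF L that])
  have co: "K #>\<^bsub>?L\<^esub> y = K #> y" for y by (simp add: r_coset_def)
  have po: "g [^]\<^bsub>?L\<^esub> i = g [^] i" if "g \<in> L" for g and i :: int
    using int_pow_consistent[OF L that] by simp
  have ca: "carrier (?L Mod K) = (\<lambda>y. K #> y) ` L" by (simp add: carrier_FactGroup co)
  have qp: "(K #> g) [^]\<^bsub>?L Mod K\<^esub> i = K #> g [^] i" if "g \<in> L" for g and i :: int
    using N.FactGroup_int_pow[of g i] that by (simp add: co po)
  have gp: "g [^] i \<in> L" if "g \<in> L" for g and i :: int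
    using subgroup_int_pow_closed[OF L that] .
  show ?thesis
  proof
    assume "cyclic_group (?L Mod K)"
    then obtain X where X: "X \<in> carrier (?L Mod K)"
      "carrier (?L Mod K) = range (\<lambda>i::int. X [^]\<^bsub>?L Mod K\<^esub> i)" using Q.cyclic_group by blast
    obtain g where g: "g \<in> L" "X = K #> g" using X(1) unfolding ca by blast
    have "\<exists>i::int. y \<in> K #> g [^] i" if y: "y \<in> L" for y
    proof -
      have "K #> y \<in> range (\<lambda>i::int. X [^]\<^bsub>?L Mod K\<^esub> i)" unfolding X(2)[symmetric] ca using y by blast
      then obtain i :: int where "K #> y = K #> g [^] i" using g qp by auto
      then show ?thesis using rcos_self[OF Lc[OF y] sK] by blast
    qed
    then show "\<exists>g\<in>L. \<forall>y\<in>L. \<exists>i::int. y \<in> K #> g [^] i" using g(1) by blast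
  next
    assume "\<exists>g\<in>L. \<forall>y\<in>L. \<exists>i::int. y \<in> K #> g [^] i"
    then obtain g where g: "g \<in> L" and y: "\<And>y. y \<in> L \<Longrightarrow> \<exists>i::int. y \<in> K #> g [^] i" by blast
    have "(\<lambda>y. K #> y) ` L = range (\<lambda>i::int. (K #> g) [^]\<^bsub>?L Mod K\<^esub> i)"
    proof (intro equalityI subsetI)
      fix X assume "X \<in> (\<lambda>y. K #> y) ` L"
      then obtain u where u: "u \<in> L" "X = K #> u" by blast
      obtain i :: int where i: "u \<in> K #> g [^] i" using y[OF u(1)] by blast
      have "K #> g [^] i = K #> u" by (rule repr_independence[OF i Lc[OF gp[OF g]] sK])
      then show "X \<in> range (\<lambda>i::int. (K #> g) [^]\<^bsub>?L Mod K\<^esub> i)" using u(2) qp[OF g] by auto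
    next
      fix X assume "X \<in> range (\<lambda>i::int. (K #> g) [^]\<^bsub>?L Mod K\<^esub> i)"
      then show "X \<in> (\<lambda>y. K #> y) ` L" using qp[OF g] gp[OF g] by auto
    qed
    then show "cyclic_group (?L Mod K)" unfolding Q.cyclic_group ca using g by blast
  qed
qed

text \<open>The preimage of the series of \<open>H\<close>, extended by the trivial subgroup at the bottom.\<close>

lemma (in surj_hom) supersolvable_pullback:
  assumes n0: "n0 \<in> kernel G H h" "\<And>n. n \<in> kernel G H h \<Longrightarrow> \<exists>i::nat. n = n0 [^] i"
    and ss: "supersolvable H"
  shows "supersolvable G"
proof -
  obtain n :: nat and N where NN: "N 0 = {\<one>\<^bsub>H\<^esub>} \<and> N n = carrier H \<and> (\<forall>i\<le>n. N i \<lhd> H) \<and>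
      (\<forall>i<n. N i \<subseteq> N (Suc i) \<and> cyclic_group (H\<lparr>carrier := N (Suc i)\<rparr> Mod N i))"
    using ss unfolding supersolvable_def by (elim exE) (rule that)
  have N: "N 0 = {\<one>\<^bsub>H\<^esub>}" "N n = carrier H" "\<And>i. i \<le> n \<Longrightarrow> N i \<lhd> H"
    "\<And>i. i < n \<Longrightarrow> N i \<subseteq> N (Suc i)" "\<And>i. i < n \<Longrightarrow> cyclic_group (H\<lparr>carrier := N (Suc i)\<rparr> Mod N i)"
    using NN by simp_all
  define M where "M = (\<lambda>i. case i of 0 \<Rightarrow> {\<one>} | Suc j \<Rightarrow> pre (N j))"
  have M: "M 0 = {\<one>}" "M (Suc j) = pre (N j)" for j by (simp_all add: M_def)
  have nM: "M i \<lhd> G" if "i \<le> Suc n" for i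
  proof (cases i)
    case 0 then show ?thesis using M(1) G.one_is_normal by simp
  next
    case (Suc j) then show ?thesis using normal_pre N(3)[of j] that M(2) by simp
  qed
  have sM: "subgroup (M i) G" if "i \<le> Suc n" for i using nM[OF that] by (rule normal_imp_subgroup)
  have "M i \<subseteq> M (Suc i) \<and> cyclic_group (G\<lparr>carrier := M (Suc i)\<rparr> Mod M i)" if i: "i < Suc n" for i
  proof
    show sub: "M i \<subseteq> M (Suc i)"
    proof (cases i)
      case 0
      have "\<one> \<in> M (Suc 0)" by (rule subgroup.one_closed[OF sM]) simp
      then show ?thesis unfolding 0 M(1) by blast
    next
      case (Suc j) then show ?thesis unfolding Suc M pre_def using N(4)[of j] i Suc by auto
    qed
    have "\<exists>g\<in>M (Suc i). \<forall>y\<in>M (Suc i). \<exists>k::int. y \<in> M i #> g [^] k"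
    proof (cases i)
      case 0
      have e: "M (Suc 0) = kernel G H h" unfolding M N(1) pre_def kernel_def by auto
      show ?thesis unfolding 0 e M(1)
      proof (rule bexI[OF _ n0(1)], rule ballI)
        fix y assume y: "y \<in> kernel G H h"
        obtain k :: nat where k: "y = n0 [^] k" using n0(2)[OF y] by blast
        have "n0 \<in> carrier G" using n0(1) by (simp add: kernel_def)
        then have "y \<in> {\<one>} #> n0 [^] int k" unfolding k by (simp add: r_coset_def int_pow_int)
        then show "\<exists>k::int. y \<in> {\<one>} #> n0 [^] k" ..
      qed
    next
      case (Suc j)
      have j: "j < n" using i Suc by simp
      have sN: "subgroup (N (Suc j)) H" "subgroup (N j) H"
        using N(3)[of "Suc j"] N(3)[of j] j normal_imp_subgroup by simp_all
      have nj: "N j \<lhd> H" using N(3)[of j] j by simp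
      obtain g' where g': "g' \<in> N (Suc j)" "\<And>y. y \<in> N (Suc j) \<Longrightarrow> \<exists>k::int. y \<in> N j #>\<^bsub>H\<^esub> g' [^]\<^bsub>H\<^esub> k"
        using N(5)[OF j] unfolding H.cyclic_section_iff[OF sN(1) nj N(4)[OF j]] by blast
      have "g' \<in> h ` carrier G" unfolding surj by (rule subgroup.mem_carrier[OF sN(1) g'(1)])
      then obtain g where g: "g \<in> carrier G" "h g = g'" by blast
      have "\<exists>k::int. y \<in> pre (N j) #> g [^] k" if y: "y \<in> pre (N (Suc j))" for y
      proof -
        have yc: "y \<in> carrier G" "h y \<in> N (Suc j)" using y by (simp_all add: pre_def)
        obtain k :: int where "h y \<in> N j #>\<^bsub>H\<^esub> g' [^]\<^bsub>H\<^esub> k" using g'(2)[OF yc(2)] by blast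
        then obtain v where v: "v \<in> N j" "h y = v \<otimes>\<^bsub>H\<^esub> g' [^]\<^bsub>H\<^esub> k" by (auto simp: r_coset_def)
        have vc: "v \<in> carrier H" by (rule subgroup.mem_carrier[OF sN(2) v(1)])
        have hk: "h (g [^] k) = g' [^]\<^bsub>H\<^esub> k" using hom_int_pow[OF g(1)] g(2) by simp
        have gk: "g [^] k \<in> carrier G" using g(1) by simp
        let ?v = "y \<otimes> inv (g [^] k)"
        have "h ?v = h y \<otimes>\<^bsub>H\<^esub> inv\<^bsub>H\<^esub> (g' [^]\<^bsub>H\<^esub> k)"
          using yc(1) gk hk by (simp only: hom_mult hom_inv G.inv_closed)
        also have "\<dots> = v" unfolding v(2) using vc g hk
          by (simp add: H.m_assoc flip: g(2))
        finally have "?v \<in> pre (N j)" using v(1) yc(1) gk by (simp add: pre_def)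
        moreover have "y = ?v \<otimes> g [^] k" using yc(1) gk by (simp add: G.m_assoc)
        ultimately have "y \<in> pre (N j) #> g [^] k" unfolding r_coset_def by blast
        then show ?thesis ..
      qed
      moreover have "g \<in> pre (N (Suc j))" using g g'(1) by (simp add: pre_def)
      ultimately show ?thesis unfolding Suc M by blast
    qed
    then show "cyclic_group (G\<lparr>carrier := M (Suc i)\<rparr> Mod M i)"
      using G.cyclic_section_iff[OF sM nM sub] i by simp
  qed
  moreover have "M (Suc n) = carrier G" unfolding M N(2) pre_def using surj by blast
  ultimately have "M 0 = {\<one>} \<and> M (Suc n) = carrier G \<and> (\<forall>i\<le>Suc n. M i \<lhd> G) \<and>
      (\<forall>i<Suc n. M i \<subseteq> M (Suc i) \<and> cyclic_group (G\<lparr>carrier := M (Suc i)\<rparr> Mod M i))"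
    using M(1) nM by blast
  then show ?thesis unfolding supersolvable_def by blast
qed

section \<open>Recognising the three groups\<close>

text \<open>A finite group together with generators \<open>s j\<close> for \<open>j \<in> J\<close> and a list \<open>w\<close> of words, one for
  each element, on which left multiplication by the generators is given by \<open>m\<close>: the Cayley graph of
  the group.\<close>

definition cayley_table :: "('a, 'b) monoid_scheme \<Rightarrow> 'i set \<Rightarrow> 'i \<Rightarrow> 'j set \<Rightarrow> ('j \<Rightarrow> 'i \<Rightarrow> 'i) \<Rightarrow>
    ('j \<Rightarrow> 'a) \<Rightarrow> ('i \<Rightarrow> 'a) \<Rightarrow> bool" where
  "cayley_table G I p0 J m s w \<longleftrightarrow> finite I \<and> card I = order G \<and> p0 \<in> I \<and> w p0 = \<one>\<^bsub>G\<^esub> \<and>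
     (\<forall>j\<in>J. s j \<in> carrier G) \<and> (\<forall>p\<in>I. w p \<in> carrier G) \<and>
     (\<forall>j\<in>J. \<forall>p\<in>I. m j p \<in> I \<and> w (m j p) = s j \<otimes>\<^bsub>G\<^esub> w p) \<and>
     (\<forall>S. subgroup S G \<longrightarrow> s ` J \<subseteq> S \<longrightarrow> S = carrier G)"

lemma cayley_tableD:
  assumes "cayley_table G I p0 J m s w"
  shows "finite I" "card I = order G" "p0 \<in> I" "w p0 = \<one>\<^bsub>G\<^esub>" "j \<in> J \<Longrightarrow> s j \<in> carrier G"
    "p \<in> I \<Longrightarrow> w p \<in> carrier G" "j \<in> J \<Longrightarrow> p \<in> I \<Longrightarrow> m j p \<in> I"
    "j \<in> J \<Longrightarrow> p \<in> I \<Longrightarrow> w (m j p) = s j \<otimes>\<^bsub>G\<^esub> w p"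
    "subgroup S G \<Longrightarrow> s ` J \<subseteq> S \<Longrightarrow> S = carrier G"
  using assms by (simp_all add: cayley_table_def)

text \<open>The set of elements that map the words to words is a subgroup containing the generators. So the words
  are all elements, and by their number each element occurs once.\<close>

lemma (in finite_group) cayley_table_bij:
  assumes c: "cayley_table G I p0 J m s w"
  shows "bij_betw w I (carrier G)"
proof -
  note C = cayley_tableD[OF c]
  let ?W = "w ` I"
  let ?S = "{g \<in> carrier G. \<forall>u\<in>?W. g \<otimes> u \<in> ?W}"
  have Wc: "?W \<subseteq> carrier G" using C(6) by (rule image_subsetI)
  have fW: "finite ?W" using C(1) by simp
  have 1: "\<one> \<in> ?W" unfolding C(4)[symmetric] by (rule imageI[OF C(3)])
  have "subgroup ?S G"
  proof (rule subgroupI)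
    show "?S \<noteq> {}" using Wc by (auto intro!: exI[of _ \<one>])
    show "inv g \<in> ?S" if g: "g \<in> ?S" for g
    proof -
      have gc: "g \<in> carrier G" using g by simp
      have "inj_on (\<lambda>u. g \<otimes> u) ?W" using gc Wc by (intro inj_onI) (simp add: subset_iff)
      then have e: "(\<lambda>u. g \<otimes> u) ` ?W = ?W" by (rule endo_inj_surj[OF fW, rotated]) (use g in blast)
      have "inv g \<otimes> u \<in> ?W" if u: "u \<in> ?W" for u
      proof -
        have "u \<in> (\<lambda>u. g \<otimes> u) ` ?W" unfolding e by (rule u)
        then obtain v where v: "v \<in> ?W" "u = g \<otimes> v" by (rule imageE)
        have "inv g \<otimes> u = v" unfolding v(2) using gc subsetD[OF Wc v(1)] by (simp flip: m_assoc)
        then show ?thesis using v(1) by simp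
      qed
      then show ?thesis using gc by simp
    qed
    show "g \<otimes> g' \<in> ?S" if "g \<in> ?S" "g' \<in> ?S" for g g'
    proof -
      have "(g \<otimes> g') \<otimes> u \<in> ?W" if u: "u \<in> ?W" for u
      proof -
        have "g \<otimes> (g' \<otimes> u) \<in> ?W" using \<open>g \<in> ?S\<close> \<open>g' \<in> ?S\<close> u by blast
        then show ?thesis using \<open>g \<in> ?S\<close> \<open>g' \<in> ?S\<close> subsetD[OF Wc u] by (simp add: m_assoc)
      qed
      then show ?thesis using that by simp
    qed
  qed blast
  moreover have "s ` J \<subseteq> ?S"
  proof (intro subsetI CollectI conjI ballI)
    fix g assume "g \<in> s ` J"
    then obtain j where j: "j \<in> J" "g = s j" by blast
    show "g \<in> carrier G" unfolding j(2) by (rule C(5)[OF j(1)])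
    fix u assume "u \<in> ?W"
    then obtain p where p: "p \<in> I" "u = w p" by blast
    show "g \<otimes> u \<in> ?W"
      unfolding j(2) p(2) C(8)[OF j(1) p(1), symmetric] by (rule imageI[OF C(7)[OF j(1) p(1)]])
  qed
  ultimately have S: "?S = carrier G" by (rule C(9))
  have "carrier G \<subseteq> ?W"
  proof
    fix g assume g: "g \<in> carrier G"
    then have "g \<in> ?S" using S by simp
    then have "g \<otimes> \<one> \<in> ?W" using 1 by blast
    then show "g \<in> ?W" using g by simp
  qed
  then have W: "?W = carrier G" using Wc by blast
  have "card ?W = card I" unfolding W using C(2) by (simp add: order_def)
  then have "inj_on w I" by (rule eq_card_imp_inj_on[OF C(1)])
  then show ?thesis using W by (simp add: bij_betw_def)
qed

text \<open>The bijection between the words commutes with left multiplication by generators, hence by everything.\<close>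

lemma cayley_table_iso:
  assumes G: "finite_group G" and G': "finite_group G'"
    and c: "cayley_table G I p0 J m s w" and c': "cayley_table G' I p0 J m s' w'"
  shows "G \<cong> G'"
proof -
  interpret G: finite_group G by fact
  interpret G': finite_group G' by fact
  note C = cayley_tableD[OF c] and C' = cayley_tableD[OF c']
  have b: "bij_betw w I (carrier G)" and b': "bij_betw w' I (carrier G')"
    using G.cayley_table_bij[OF c] G'.cayley_table_bij[OF c'] .
  define f where "f = w' \<circ> inv_into I w"
  have bf: "bij_betw f (carrier G) (carrier G')"
    unfolding f_def by (rule bij_betw_trans[OF bij_betw_inv_into[OF b] b'])
  have fw: "f (w p) = w' p" if "p \<in> I" for p
    unfolding f_def using bij_betw_inv_into_left[OF b that] by simp
  have fc: "f g \<in> carrier G'" if "g \<in> carrier G" for g using bf that by (rule bij_betw_apply)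
  have f1: "f \<one>\<^bsub>G\<^esub> = \<one>\<^bsub>G'\<^esub>" using fw[OF C(3)] C(4) C'(4) by simp
  let ?S = "{g \<in> carrier G. \<forall>u\<in>carrier G. f (g \<otimes>\<^bsub>G\<^esub> u) = f g \<otimes>\<^bsub>G'\<^esub> f u}"
  have "subgroup ?S G"
  proof (rule G.subgroupI)
    show "?S \<noteq> {}" using f1 fc by (auto intro!: exI[of _ "\<one>\<^bsub>G\<^esub>"])
    show "inv\<^bsub>G\<^esub> g \<in> ?S" if g: "g \<in> ?S" for g
    proof -
      have gc: "g \<in> carrier G" using g by simp
      have e: "f (inv\<^bsub>G\<^esub> g \<otimes>\<^bsub>G\<^esub> u) = inv\<^bsub>G'\<^esub> (f g) \<otimes>\<^bsub>G'\<^esub> f u" if u: "u \<in> carrier G" for u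
      proof -
        have "inv\<^bsub>G\<^esub> g \<otimes>\<^bsub>G\<^esub> u \<in> carrier G" using gc u by simp
        then have "f (g \<otimes>\<^bsub>G\<^esub> (inv\<^bsub>G\<^esub> g \<otimes>\<^bsub>G\<^esub> u)) = f g \<otimes>\<^bsub>G'\<^esub> f (inv\<^bsub>G\<^esub> g \<otimes>\<^bsub>G\<^esub> u)" using g by blast
        moreover have "g \<otimes>\<^bsub>G\<^esub> (inv\<^bsub>G\<^esub> g \<otimes>\<^bsub>G\<^esub> u) = u" using gc u by (simp flip: G.m_assoc)
        ultimately have "f u = f g \<otimes>\<^bsub>G'\<^esub> f (inv\<^bsub>G\<^esub> g \<otimes>\<^bsub>G\<^esub> u)" by (simp only:)
        then show ?thesis using fc[OF gc] fc[of "inv\<^bsub>G\<^esub> g \<otimes>\<^bsub>G\<^esub> u"] gc u by (simp flip: G'.m_assoc)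
      qed
      have "f (inv\<^bsub>G\<^esub> g) = inv\<^bsub>G'\<^esub> (f g)" using e[of "\<one>\<^bsub>G\<^esub>"] f1 gc fc[OF gc] by simp
      then show ?thesis using e gc by simp
    qed
    show "g \<otimes>\<^bsub>G\<^esub> g' \<in> ?S" if "g \<in> ?S" "g' \<in> ?S" for g g'
      using that fc by (simp add: G.m_assoc G'.m_assoc)
  qed blast
  moreover have "s ` J \<subseteq> ?S"
  proof (intro subsetI CollectI conjI ballI)
    fix g assume "g \<in> s ` J"
    then obtain j where j: "j \<in> J" "g = s j" by blast
    have mj: "m j p \<in> I" "w (m j p) = s j \<otimes>\<^bsub>G\<^esub> w p" "w' (m j p) = s' j \<otimes>\<^bsub>G'\<^esub> w' p" if "p \<in> I" for p
      using C(7)[OF j(1) that] C(8)[OF j(1) that] C'(8)[OF j(1) that] .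
    have sc: "s j \<in> carrier G" "s' j \<in> carrier G'" using C(5)[OF j(1)] C'(5)[OF j(1)] .
    have fm: "f (s j \<otimes>\<^bsub>G\<^esub> w p) = s' j \<otimes>\<^bsub>G'\<^esub> w' p" if "p \<in> I" for p
      using fw[OF mj(1)[OF that]] mj(2,3)[OF that] by simp
    have fs: "f (s j) = s' j" using fm[OF C(3)] C(4) C'(4) sc by simp
    show "g \<in> carrier G" using j(2) sc by simp
    fix u assume "u \<in> carrier G"
    then have "u \<in> w ` I" using b by (simp add: bij_betw_def)
    then obtain p where p: "p \<in> I" "u = w p" by blast
    show "f (g \<otimes>\<^bsub>G\<^esub> u) = f g \<otimes>\<^bsub>G'\<^esub> f u" unfolding j(2) p(2) fm[OF p(1)] fs fw[OF p(1)] ..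
  qed
  ultimately have S: "?S = carrier G" by (rule C(9))
  have "f (g \<otimes>\<^bsub>G\<^esub> u) = f g \<otimes>\<^bsub>G'\<^esub> f u" if "g \<in> carrier G" "u \<in> carrier G" for g u
    using that S by blast
  then have "f \<in> iso G G'" using bf fc by (simp add: iso_def hom_def)
  then show ?thesis by (rule is_isoI)
qed

text \<open>The word \<open>a\<^sup>i b\<^sup>j x\<^sup>k\<close> is coded by \<open>(i, j, k)\<close>, and similarly below.\<close>

definition klein_step :: "nat \<Rightarrow> nat \<Rightarrow> bool \<times> bool \<times> nat \<Rightarrow> bool \<times> bool \<times> nat" where
  "klein_step n t = (\<lambda>(i, j, k). if t = 0 then (\<not> i, j, k) else if t = 1 then (i, \<not> j, k)
     else (j, i \<noteq> j, Suc k mod n))"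

definition gens :: "'a \<Rightarrow> 'a \<Rightarrow> 'a \<Rightarrow> nat \<Rightarrow> 'a" where
  "gens a b x t = (if t = 0 then a else if t = 1 then b else x)"

definition (in group) bpow :: "'a \<Rightarrow> bool \<Rightarrow> 'a" where
  "bpow a i = (if i then a else \<one>)"

lemma (in group) pow_Suc_mod:
  assumes x: "x \<in> carrier G" "x [^] n = \<one>" and k: "k < (n::nat)"
  shows "x [^] (Suc k mod n) = x \<otimes> x [^] k"
proof (cases "Suc k = n")
  case True
  have "x \<otimes> x [^] k = x [^] n" using nat_pow_Suc2[OF x(1), of k] True by simp
  then show ?thesis using True x(2) by simp
next
  case False
  then have "Suc k mod n = Suc k" using k by simp
  then show ?thesis using nat_pow_Suc2[OF x(1), of k] by simp
qed

lemma (in finite_group) klein_rotation_table: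
  assumes r: "rot a b x" and o: "ord x = 3 ^ m" "order G = 4 * 3 ^ m"
  shows "cayley_table G (UNIV \<times> UNIV \<times> {..<3 ^ m}) (False, False, 0) {0, 1, 2} (klein_step (3 ^ m))
    (gens a b x) (\<lambda>(i, j, k). bpow a i \<otimes> (bpow b j \<otimes> x [^] k))"
proof -
  note D = rotD[OF r]
  have aa: "a \<otimes> (a \<otimes> t) = t" if "t \<in> carrier G" for t using D(1,5) that by (simp flip: m_assoc)
  have bb: "b \<otimes> (b \<otimes> t) = t" if "t \<in> carrier G" for t using D(2,6) that by (simp flip: m_assoc)
  have ba: "b \<otimes> (a \<otimes> t) = a \<otimes> (b \<otimes> t)" if "t \<in> carrier G" for t
    using D(1,2) that D(7)[symmetric] by (simp flip: m_assoc)
  have xa: "x \<otimes> (a \<otimes> t) = b \<otimes> (x \<otimes> t)" if "t \<in> carrier G" for t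
    using conj_swap[OF D(3,1)] D(1,2,3,8) that by (simp flip: m_assoc)
  have xb: "x \<otimes> (b \<otimes> t) = a \<otimes> (b \<otimes> (x \<otimes> t))" if "t \<in> carrier G" for t
    using conj_swap[OF D(3,2)] D(1,2,3,9) that by (simp flip: m_assoc)
  have xn: "x [^] ((3::nat) ^ m) = \<one>" using pow_ord_eq_1[OF D(3)] o(1) by simp
  have xk: "x [^] (Suc k mod 3 ^ m) = x \<otimes> x [^] k" if "k < 3 ^ m" for k :: nat
    by (rule pow_Suc_mod[OF D(3) xn that])
  have "klein_step (3 ^ m) t (i, j, k) \<in> UNIV \<times> UNIV \<times> {..<3 ^ m} \<and>
      (case klein_step (3 ^ m) t (i, j, k) of (i, j, k) \<Rightarrow> bpow a i \<otimes> (bpow b j \<otimes> x [^] k)) =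
      gens a b x t \<otimes> (bpow a i \<otimes> (bpow b j \<otimes> x [^] k))"
    if "t \<in> {0, 1, 2}" "k < 3 ^ m" for t i j k
  proof -
    consider "t = 0" | "t = 1" | "t = 2" using \<open>t \<in> {0, 1, 2}\<close> by blast
    then show ?thesis
    proof cases
      case 1 then show ?thesis using D(1-3) \<open>k < 3 ^ m\<close>
        by (cases i; cases j) (simp_all add: klein_step_def gens_def bpow_def aa)
    next
      case 2 then show ?thesis using D(1-3) \<open>k < 3 ^ m\<close>
        by (cases i; cases j) (simp_all add: klein_step_def gens_def bpow_def bb ba)
    next
      case 3 then show ?thesis using D(1-3) \<open>k < 3 ^ m\<close>
        by (cases i; cases j) (simp_all add: klein_step_def gens_def bpow_def xa xb xk bb ba)
    qed
  qed
  moreover have "S = carrier G" if "subgroup S G" "gens a b x ` {0, 1, 2} \<subseteq> S" for S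
    by (rule klein_rotation_generates[OF r o that(1)]) (use that(2) in \<open>simp_all add: gens_def\<close>)
  ultimately show ?thesis
    unfolding cayley_table_def using D(1-3) o(2)
    by (simp add: bpow_def gens_def card_cartesian_product split_paired_all)
qed

definition quaternion_step :: "nat \<Rightarrow> bool \<times> bool \<times> bool \<times> nat \<Rightarrow> bool \<times> bool \<times> bool \<times> nat" where
  "quaternion_step t = (\<lambda>(i, j, l, k). if t = 0 then (\<not> i, j, i \<noteq> l, k)
     else if t = 1 then (i, \<not> j, l \<noteq> (i \<noteq> j), k)
     else (j, i \<noteq> j, l, Suc k mod 3))"

lemma (in finite_group) quaternion_rotation_table:
  assumes q: "quat_rot a b x" and o: "order G = 24"
  shows "cayley_table G (UNIV \<times> UNIV \<times> UNIV \<times> {..<3}) (False, False, False, 0) {0, 1, 2} quaternion_step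
    (gens a b x) (\<lambda>(i, j, l, k). bpow a i \<otimes> (bpow b j \<otimes> (bpow (a \<otimes> a) l \<otimes> x [^] k)))"
proof -
  note Q = q[unfolded quat_rot_def]
  have D: "a \<in> carrier G" "b \<in> carrier G" "x \<in> carrier G" using Q by blast+
  have bb0: "b \<otimes> b = a \<otimes> a" and zz0: "(a \<otimes> a) \<otimes> (a \<otimes> a) = \<one>" and ba0: "b \<otimes> a = a \<otimes> b \<otimes> (a \<otimes> a)"
    and cxa: "conj x a = b" and cxb: "conj x b = a \<otimes> b" and x3: "x [^] (3::nat) = \<one>" using Q by blast+
  define z where "z = a \<otimes> a"
  have zc: "z \<in> carrier G" unfolding z_def using D by simp
  have aa: "a \<otimes> (a \<otimes> t) = z \<otimes> t" if "t \<in> carrier G" for t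
    unfolding z_def using D that by (simp add: m_assoc)
  have bb: "b \<otimes> (b \<otimes> t) = z \<otimes> t" if "t \<in> carrier G" for t
    unfolding z_def bb0[symmetric] using D that by (simp add: m_assoc)
  have zz: "z \<otimes> (z \<otimes> t) = t" if "t \<in> carrier G" for t
    using zz0 zc that unfolding z_def[symmetric] by (simp flip: m_assoc)
  have ba: "b \<otimes> (a \<otimes> t) = a \<otimes> (b \<otimes> (z \<otimes> t))" if "t \<in> carrier G" for t
  proof -
    have "b \<otimes> (a \<otimes> t) = (a \<otimes> b \<otimes> z) \<otimes> t" unfolding z_def ba0[symmetric] using D that by (simp add: m_assoc)
    then show ?thesis using D zc that by (simp add: m_assoc)
  qed
  have za: "z \<otimes> (a \<otimes> t) = a \<otimes> (z \<otimes> t)" if "t \<in> carrier G" for t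
    unfolding z_def using D that by (simp add: m_assoc)
  have zb: "z \<otimes> (b \<otimes> t) = b \<otimes> (z \<otimes> t)" if "t \<in> carrier G" for t
    unfolding z_def bb0[symmetric] using D that by (simp add: m_assoc)
  have xa: "x \<otimes> (a \<otimes> t) = b \<otimes> (x \<otimes> t)" if "t \<in> carrier G" for t
    using conj_swap[OF D(3,1)] D that unfolding cxa by (simp flip: m_assoc)
  have xb: "x \<otimes> (b \<otimes> t) = a \<otimes> (b \<otimes> (x \<otimes> t))" if "t \<in> carrier G" for t
    using conj_swap[OF D(3,2)] D that unfolding cxb by (simp flip: m_assoc)
  have xz: "x \<otimes> (z \<otimes> t) = z \<otimes> (x \<otimes> t)" if "t \<in> carrier G" for t
    using D that zc by (simp add: xa bb flip: aa)
  have xk: "x [^] (Suc k mod 3) = x \<otimes> x [^] k" if "k < 3" for k :: nat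
    by (rule pow_Suc_mod[OF D(3) x3 that])
  have "quaternion_step t (i, j, l, k) \<in> UNIV \<times> UNIV \<times> UNIV \<times> {..<3} \<and>
      (case quaternion_step t (i, j, l, k) of (i, j, l, k) \<Rightarrow> bpow a i \<otimes> (bpow b j \<otimes> (bpow z l \<otimes> x [^] k))) =
      gens a b x t \<otimes> (bpow a i \<otimes> (bpow b j \<otimes> (bpow z l \<otimes> x [^] k)))"
    if "t \<in> {0, 1, 2}" "k < 3" for t i j l k
  proof -
    consider "t = 0" | "t = 1" | "t = 2" using \<open>t \<in> {0, 1, 2}\<close> by blast
    then show ?thesis
    proof cases
      case 1 then show ?thesis using D zc \<open>k < 3\<close>
        by (cases i; cases j; cases l) (simp_all add: quaternion_step_def gens_def bpow_def aa zz za zb)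
    next
      case 2 then show ?thesis using D zc \<open>k < 3\<close>
        by (cases i; cases j; cases l) (simp_all add: quaternion_step_def gens_def bpow_def bb ba zz za zb)
    next
      case 3 then show ?thesis using D zc \<open>k < 3\<close>
        by (cases i; cases j; cases l)
          (simp_all add: quaternion_step_def gens_def bpow_def xa xb xz xk bb ba zz za zb)
    qed
  qed
  moreover have "S = carrier G" if "subgroup S G" "gens a b x ` {0, 1, 2} \<subseteq> S" for S
    by (rule quaternion_rotation_generates[OF q o that(1)]) (use that(2) in \<open>simp_all add: gens_def\<close>)
  ultimately show ?thesis
    unfolding cayley_table_def z_def[symmetric] using D zc o
    by (simp add: bpow_def gens_def card_cartesian_product split_paired_all)
qed

lemma klein_rotation_iso:
  assumes "finite_group G" "group.klein_rotation G m"
    and "finite_group G'" "group.rot G' a b x" "group.ord G' x = 3 ^ m" "order G' = 4 * 3 ^ m"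
  shows "G \<cong> G'"
proof -
  interpret G: finite_group G by fact
  interpret G': finite_group G' by fact
  obtain a' b' x' where "G.rot a' b' x'" "G.ord x' = 3 ^ m" "order G = 4 * 3 ^ m"
    using assms(2) unfolding G.klein_rotation_def by blast
  from cayley_table_iso[OF assms(1,3) G.klein_rotation_table[OF this] G'.klein_rotation_table[OF assms(4-6)]]
  show ?thesis .
qed

lemma quaternion_rotation_iso:
  assumes "finite_group G" "group.quaternion_rotation G"
    and "finite_group G'" "group.quat_rot G' a b x" "order G' = 24"
  shows "G \<cong> G'"
proof -
  interpret G: finite_group G by fact
  interpret G': finite_group G' by fact
  obtain a' b' x' where "G.quat_rot a' b' x'" "order G = 24"
    using assms(2) unfolding G.quaternion_rotation_def by blast
  from cayley_table_iso[OF assms(1,3) G.quaternion_rotation_table[OF this] G'.quaternion_rotation_table[OF assms(4-5)]]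
  show ?thesis .
qed

lemma (in group) conj_eqI:
  "x \<in> carrier G \<Longrightarrow> a \<in> carrier G \<Longrightarrow> b \<in> carrier G \<Longrightarrow> x \<otimes> a = b \<otimes> x \<Longrightarrow> conj x a = b"
  by (simp add: conj_def m_assoc)

text \<open>The witnesses are the double transpositions \<open>(1 2)(3 4)\<close> and \<open>(2 3)(1 4)\<close> and the 3-cycle \<open>(1 2 3)\<close>.\<close>

lemma klein_rotation_iso_A4:
  assumes "finite_group G" "group.klein_rotation G 1"
  shows "G \<cong> alt_group 4"
proof -
  let ?A = "alt_group 4"
  let ?a = "Transposition.transpose 1 2 \<circ> Transposition.transpose 3 (4::nat)" and ?b = "Transposition.transpose 2 3 \<circ> Transposition.transpose 1 (4::nat)"
    and ?x = "Transposition.transpose 1 2 \<circ> Transposition.transpose 2 (3::nat)"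
  have "2 * card (carrier ?A) = 24" using alt_group_card_carrier[of 4] by (simp add: fact_numeral)
  then have c: "card (carrier ?A) = 12" by simp
  then have "finite (carrier ?A)" by (intro card_ge_0_finite) simp
  then have fA: "finite_group ?A"
    by (simp add: finite_group_def finite_group_axioms_def alt_group_is_group)
  interpret A: finite_group ?A by (rule fA)
  have mem: "Transposition.transpose i j \<circ> Transposition.transpose k l \<in> carrier ?A"
    if "i \<in> {1..4}" "j \<in> {1..4}" "k \<in> {1..4}" "l \<in> {1..4}" "i \<noteq> j" "k \<noteq> l" for i j k l :: nat
    unfolding alt_group_carrier using that
    by (auto intro!: permutes_compose permutes_swap_id simp: evenperm_comp evenperm_swap permutation_swap_id)
  have ac: "?a \<in> carrier ?A" "?b \<in> carrier ?A" "?x \<in> carrier ?A" by (rule mem; simp)+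
  have mu: "p \<otimes>\<^bsub>?A\<^esub> q = p \<circ> q" and one: "\<one>\<^bsub>?A\<^esub> = id" for p q
    by (simp_all add: alt_group_mult alt_group_one)
  have e: "?a \<circ> ?a = id" "?b \<circ> ?b = id" "?a \<circ> ?b = ?b \<circ> ?a" "?x \<circ> ?a = ?b \<circ> ?x"
    "?x \<circ> ?b = (?a \<circ> ?b) \<circ> ?x" "?x \<circ> ?x \<circ> ?x = id"
    by (auto simp: fun_eq_iff Transposition.transpose_def)
  have "?a 1 \<noteq> id 1" "?x 1 \<noteq> id 1" by (simp_all add: Transposition.transpose_def)
  then have ne: "?a \<noteq> id" "?x \<noteq> id" by metis+
  have "A.rot ?a ?b ?x"
    unfolding A.rot_def
  proof (intro conjI ac)
    show "A.conj ?x ?a = ?b" by (rule A.conj_eqI[OF ac(3,1,2)]) (use e in \<open>simp only: mu\<close>)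
    show "A.conj ?x ?b = ?a \<otimes>\<^bsub>?A\<^esub> ?b"
      by (rule A.conj_eqI[OF ac(3,2) A.m_closed[OF ac(1,2)]]) (use e in \<open>simp only: mu\<close>)
  qed (use e ne in \<open>simp_all only: mu one not_False_eq_True\<close>)
  moreover have "A.ord ?x = 3 ^ 1"
  proof -
    have "?x [^]\<^bsub>?A\<^esub> (3::nat) = (?x \<otimes>\<^bsub>?A\<^esub> ?x) \<otimes>\<^bsub>?A\<^esub> ?x" using ac(3) by (simp add: numeral_3_eq_3)
    then have "?x [^]\<^bsub>?A\<^esub> (3::nat) = \<one>\<^bsub>?A\<^esub>" using e(6) by (simp only: mu one)
    moreover have "?x \<noteq> \<one>\<^bsub>?A\<^esub>" unfolding one by (rule ne)
    ultimately show ?thesis using A.ord_eq_prime[OF ac(3), of 3] by simp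
  qed
  moreover have "order ?A = 4 * 3 ^ 1" unfolding order_def c by simp
  ultimately show ?thesis by (rule klein_rotation_iso[OF assms fA])
qed

lemma klein_rotation_iso_semidirect:
  assumes "finite_group G" "group.klein_rotation G 2"
  shows "G \<cong> Z2_Z2_semidirect_Z9"
proof -
  let ?S = Z2_Z2_semidirect_Z9
  let ?a = "((1, 0), 0) :: (int \<times> int) \<times> int" and ?b = "((0, 1), 0) :: (int \<times> int) \<times> int"
    and ?x = "((0, 0), 1) :: (int \<times> int) \<times> int"
  have ca: "carrier ?S = {(0, 0), (0, 1), (1, 0), (1, 1)} \<times> {0..<9}"
    by (simp add: Z2_Z2_semidirect_Z9_def semidirect_product_def carrier_Z2_Z2 carrier_integer_mod_group
        del: carrier_DirProd)
  have fS: "finite_group ?S"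
    by (simp add: finite_group_def finite_group_axioms_def group_Z2_Z2_semidirect_Z9 ca)
  interpret S: finite_group ?S by (rule fS)
  interpret P: group "AutoGroup Z2_Z2" by (rule group.AutoGroup[OF group_Z2_Z2])
  have mu: "((i, j), k) \<otimes>\<^bsub>?S\<^esub> ((i', j'), k') =
      (((i + fst (Z9_action k (i', j'))) mod 2, (j + snd (Z9_action k (i', j'))) mod 2), (k + k') mod 9)"
    for i j k i' j' k' :: int
    by (simp add: Z2_Z2_semidirect_Z9_def semidirect_product_def mult_integer_mod_group mult_DirProd'
        case_prod_unfold)
  have one: "\<one>\<^bsub>?S\<^esub> = ((0, 0), 0)"
    by (simp add: Z2_Z2_semidirect_Z9_def semidirect_product_def)
  have ac: "?a \<in> carrier ?S" "?b \<in> carrier ?S" "?x \<in> carrier ?S" unfolding ca by auto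
  have Z: "Z9_action k \<in> carrier (AutoGroup Z2_Z2)" for k
    unfolding Z9_action_def using Z2_Z2_rotation_in_auto by (rule P.int_pow_closed)
  have Z00: "Z9_action k (0, 0) = (0, 0)" for k
  proof -
    have "Z9_action k \<in> hom Z2_Z2 Z2_Z2" using Z[of k] by (simp add: AutoGroup_def auto_def)
    from hom_one[OF this group_Z2_Z2 group_Z2_Z2] show ?thesis by (simp add: one_DirProd)
  qed
  have "Z9_action 0 = \<one>\<^bsub>AutoGroup Z2_Z2\<^esub>" by (simp add: Z9_action_def)
  then have Z0: "Z9_action 0 (i, j) = (i, j)" if "(i, j) \<in> {(0, 0), (0, 1), (1, 0), (1, 1)}" for i j
    using that by (simp add: AutoGroup_def BijGroup_def carrier_Z2_Z2 del: carrier_DirProd)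
  have "Z9_action 1 = Z2_Z2_rotation" unfolding Z9_action_def
    using Z2_Z2_rotation_in_auto by (rule P.int_pow_1)
  then have Z1: "Z9_action 1 (1, 0) = (0, 1)" "Z9_action 1 (0, 1) = (1, 1)"
    by (simp_all add: Z2_Z2_rotation_def carrier_Z2_Z2 del: carrier_DirProd)
  have "S.rot ?a ?b ?x"
    unfolding S.rot_def
  proof (intro conjI ac)
    show "S.conj ?x ?a = ?b" by (rule S.conj_eqI[OF ac(3,1,2)]) (simp add: mu Z0 Z1 Z00)
    show "S.conj ?x ?b = ?a \<otimes>\<^bsub>?S\<^esub> ?b"
      by (rule S.conj_eqI[OF ac(3,2) S.m_closed[OF ac(1,2)]]) (simp add: mu Z0 Z1 Z00)
  qed (simp_all add: mu one Z0)
  moreover have "S.ord ?x = 3 ^ 2"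
  proof -
    have p: "?x [^]\<^bsub>?S\<^esub> n = ((0, 0), int n mod 9)" for n :: nat
      by (induction n) (simp_all add: one mu Z00 mod_simps add.commute)
    have "S.ord ?x dvd 9" using S.pow_eq_id[OF ac(3), of 9] p[of 9] one by simp
    moreover have "int (S.ord ?x) mod 9 = 0" using S.pow_ord_eq_1[OF ac(3)] p one by simp
    then have "9 dvd S.ord ?x" by presburger
    ultimately have "S.ord ?x = 9" by (rule dvd_antisym)
    then show ?thesis by simp
  qed
  moreover have "order ?S = 4 * 3 ^ 2" by (simp add: order_def ca card_cartesian_product)
  ultimately show ?thesis by (rule klein_rotation_iso[OF assms fS])
qed

definition mat2 :: "'a \<Rightarrow> 'a \<Rightarrow> 'a \<Rightarrow> 'a \<Rightarrow> 'a::zero ^ 2 ^ 2" where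
  "mat2 p q r s = vector [vector [p, q], vector [r, s]]"

lemma mat2_nth [simp]: "mat2 p q r s $ 1 $ 1 = p" "mat2 p q r s $ 1 $ 2 = q"
  "mat2 p q r s $ 2 $ 1 = r" "mat2 p q r s $ 2 $ 2 = s"
  by (simp_all add: mat2_def)

lemma mat2_mult: "mat2 p q r s ** mat2 p' q' r' s' =
    mat2 (p * p' + q * r') (p * q' + q * s') (r * p' + s * r') (r * q' + s * s' :: 'a::comm_ring_1)"
  by (simp add: vec_eq_iff forall_2 matrix_matrix_mult_def sum_2)

lemma mat2_eq_iff: "mat2 p q r s = mat2 p' q' r' s' \<longleftrightarrow> p = p' \<and> q = q' \<and> r = r' \<and> s = s'"
  by (auto simp: vec_eq_iff forall_2)

lemma mat2_surj: "A = mat2 (A $ 1 $ 1) (A $ 1 $ 2) (A $ 2 $ 1) (A $ 2 $ 2)"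
  by (simp add: vec_eq_iff forall_2)

lemma mat2_one: "(mat 1 :: 'a::comm_ring_1 ^ 2 ^ 2) = mat2 1 0 0 1"
  by (simp add: vec_eq_iff forall_2 mat_def)

lemma det_mat2: "det (mat2 p q r s :: 'a::comm_ring_1 ^ 2 ^ 2) = p * s - q * r"
  by (simp add: det_2)

lemma finite_group_SL_2_3: "finite_group SL_2_3" and order_SL_2_3: "order SL_2_3 = 24"
proof -
  have "group SL_2_3"
  proof (rule groupI)
    fix A assume A: "A \<in> carrier SL_2_3"
    obtain p q r s where m: "A = mat2 p q r s" using mat2_surj by blast
    have d: "p * s - q * r = 1" using A by (simp add: special_linear_group_def m det_mat2)
    have "mat2 s (- q) (- r) p \<in> carrier SL_2_3"
      using d by (simp add: special_linear_group_def det_mat2 algebra_simps)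
    moreover have "mat2 s (- q) (- r) p \<otimes>\<^bsub>SL_2_3\<^esub> A = \<one>\<^bsub>SL_2_3\<^esub>"
      using d by (simp add: special_linear_group_def m mat2_mult mat2_one mat2_eq_iff algebra_simps)
    ultimately show "\<exists>B\<in>carrier SL_2_3. B \<otimes>\<^bsub>SL_2_3\<^esub> A = \<one>\<^bsub>SL_2_3\<^esub>" by blast
  qed (simp_all add: special_linear_group_def det_mul matrix_mul_assoc)
  then show "finite_group SL_2_3"
    by (simp add: finite_group_def finite_group_axioms_def)
  let ?P = "\<lambda>t. case t of (p, q, r, s :: 3) \<Rightarrow> p * s - q * r = (1 :: 3)"
  let ?f = "\<lambda>(p, q, r, s). mat2 p q r s"
  have "carrier SL_2_3 = ?f ` {t. ?P t}"
  proof (intro equalityI subsetI)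
    fix A assume A: "A \<in> carrier SL_2_3"
    obtain p q r s where m: "A = mat2 p q r s" using mat2_surj by blast
    have "?P (p, q, r, s)" using A by (simp add: special_linear_group_def m det_mat2)
    then show "A \<in> ?f ` {t. ?P t}" unfolding m by (intro image_eqI[of _ _ "(p, q, r, s)"]) simp_all
  qed (auto simp: special_linear_group_def det_mat2)
  moreover have "inj_on ?f {t. ?P t}" by (auto simp: inj_on_def mat2_eq_iff)
  ultimately have "order SL_2_3 = card {t. ?P t}" unfolding order_def by (simp only: card_image)
  also have "\<dots> = (\<Sum>t\<in>UNIV. if ?P t then 1 else 0)" by (simp add: sum.If_cases)
  also have "\<dots> = (\<Sum>p\<in>UNIV. \<Sum>q\<in>UNIV. \<Sum>r\<in>UNIV. \<Sum>s\<in>UNIV. if p * s - q * r = (1 :: 3) then 1 else 0)"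
    by (simp only: UNIV_Times_UNIV[symmetric] sum.cartesian_product[symmetric] split_conv case_prod_unfold
        sum.cartesian_product)
  also have "\<dots> = 24" by (simp add: sum_3)
  finally show "order SL_2_3 = 24" .
qed

text \<open>The witnesses \<open>a\<close> and \<open>b\<close> are elements of order 4 that generate the quaternion group.\<close>

lemma quaternion_rotation_iso_SL_2_3:
  assumes "finite_group G" "group.quaternion_rotation G"
  shows "G \<cong> SL_2_3"
proof -
  let ?a = "mat2 0 1 2 0 :: 3 ^ 2 ^ 2" and ?b = "mat2 1 1 1 2 :: 3 ^ 2 ^ 2" and ?x = "mat2 0 1 2 2 :: 3 ^ 2 ^ 2"
  interpret S: finite_group SL_2_3 by (rule finite_group_SL_2_3)
  have mu: "A \<otimes>\<^bsub>SL_2_3\<^esub> B = A ** B" and one: "\<one>\<^bsub>SL_2_3\<^esub> = mat2 1 0 0 1" for A B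
    by (simp_all add: special_linear_group_def mat2_one)
  have ac: "?a \<in> carrier SL_2_3" "?b \<in> carrier SL_2_3" "?x \<in> carrier SL_2_3"
    by (simp_all add: special_linear_group_def det_mat2)
  have "S.quat_rot ?a ?b ?x"
    unfolding S.quat_rot_def
  proof (intro conjI ac)
    show "S.conj ?x ?a = ?b" by (rule S.conj_eqI[OF ac(3,1,2)]) (simp add: mu mat2_mult mat2_eq_iff)
    show "S.conj ?x ?b = ?a \<otimes>\<^bsub>SL_2_3\<^esub> ?b"
      by (rule S.conj_eqI[OF ac(3,2) S.m_closed[OF ac(1,2)]]) (simp add: mu mat2_mult mat2_eq_iff)
    have "?x [^]\<^bsub>SL_2_3\<^esub> (3::nat) = (?x \<otimes>\<^bsub>SL_2_3\<^esub> ?x) \<otimes>\<^bsub>SL_2_3\<^esub> ?x" using ac(3) by (simp add: numeral_3_eq_3)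
    then show "?x [^]\<^bsub>SL_2_3\<^esub> (3::nat) = \<one>\<^bsub>SL_2_3\<^esub>" by (simp add: mu one mat2_mult mat2_eq_iff)
  qed (simp_all add: mu one mat2_mult mat2_eq_iff)
  then show ?thesis by (rule quaternion_rotation_iso[OF assms finite_group_SL_2_3 _ order_SL_2_3])
qed

section \<open>The classification\<close>

text \<open>If the minimal normal subgroup has prime order \<open>r\<close>, the quotient is known by induction. It is pulled
  back along a kernel of order \<open>r\<close>; a quaternion quotient with \<open>r\<close> odd is traded for a kernel of order 2.\<close>

theorem small_comax_classification:
  fixes G :: "nat monoid" assumes "small_comax G"
  shows "supersolvable G \<or> group.klein_rotation G 1 \<or> group.klein_rotation G 2 \<or> group.quaternion_rotation G"
  using assms
proof (induction "order G" arbitrary: G rule: less_induct)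
  case less
  interpret small_comax G by (rule less.prems)
  let ?C = "\<lambda>K :: nat monoid. supersolvable K \<or> group.klein_rotation K 1 \<or> group.klein_rotation K 2 \<or>
    group.quaternion_rotation K"
  have quotient: thesis
    if N: "N \<lhd> G" "card N = r" "prime r"
      and that: "\<And>(K :: nat monoid) h. prime_kernel G K h r \<Longrightarrow> ?C K \<Longrightarrow> thesis" for N r thesis
  proof -
    obtain K :: "nat monoid" and h where K: "surj_hom G K h" "kernel G K h = N"
      using quotient_nat_copy[OF N(1)] by blast
    interpret K: surj_hom G K h by (rule K(1))
    have sK: "small_comax K" by (rule K.small_comax_image[OF less.prems])
    have "order K * r = order G" using K.order_kernel K(2) N(2) by simp
    moreover have "r > 1" using N(3) by (rule prime_gt_1_nat)
    moreover have "order G > 0" by (rule order_pos)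
    ultimately have "order K < order G" by (metis mult.right_neutral mult_less_cancel1 mult_is_0 not_gr_zero)
    then have "?C K" using sK by (rule less.hyps)
    moreover have "prime_kernel G K h r"
      by (intro prime_kernel.intro prime_kernel_axioms.intro less.prems K(1)) (use N K(2) in simp_all)
    ultimately show thesis using that by blast
  qed
  have two: "?C G" if K: "prime_kernel G K h 2" "?C K" for K :: "nat monoid" and h
  proof -
    interpret K: two_kernel G K h 2 by (intro two_kernel.intro two_kernel_axioms.intro K(1) refl)
    from K(2) show ?thesis
    proof (elim disjE)
      assume ss: "supersolvable K"
      obtain n0 where "n0 \<in> kernel G K h" "\<And>n. n \<in> kernel G K h \<Longrightarrow> \<exists>i::nat. n = n0 [^]\<^bsub>G\<^esub> i"
        by (rule K.kernel_cyclic) blast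
      from K.supersolvable_pullback[OF this ss] show ?thesis ..
    next
      assume "group.klein_rotation K 1"
      from K.klein_rotation_lifts_two[OF this] show ?thesis by auto
    next
      assume "group.klein_rotation K 2"
      from K.klein_rotation_lifts_two[OF this] show ?thesis by auto
    next
      assume "group.quaternion_rotation K"
      then show ?thesis by (rule K.quaternion_rotation_not_lifts_two[THEN FalseE])
    qed
  qed
  show ?case
  proof (cases "order G = 1")
    case True
    then have "carrier G = {\<one>\<^bsub>G\<^esub>}" using order_one_triv_iff by blast
    then have "supersolvable G" unfolding supersolvable_def
      by (intro exI[of _ 0] exI[of _ "\<lambda>_. {\<one>\<^bsub>G\<^esub>}"]) (simp add: one_is_normal)
    then show ?thesis ..
  next
    case False
    have sol: "solvable G" by (rule small_comax_solvable[OF less.prems])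
    obtain N q where N: "N \<lhd> G" "N \<noteq> {\<one>\<^bsub>G\<^esub>}" "prime q" "\<And>u. u \<in> N \<Longrightarrow> u [^]\<^bsub>G\<^esub> (q::nat) = \<one>\<^bsub>G\<^esub>"
      "\<And>u v. u \<in> N \<Longrightarrow> v \<in> N \<Longrightarrow> u \<otimes>\<^bsub>G\<^esub> v = v \<otimes>\<^bsub>G\<^esub> u"
      "\<And>B. B \<lhd> G \<Longrightarrow> B \<subseteq> N \<Longrightarrow> B = {\<one>\<^bsub>G\<^esub>} \<or> B = N"
      by (rule minimal_normal_subgroup[OF sol False]) (rule that)
    show ?thesis
    proof (cases "prime (card N)")
      case np: False
      obtain a b x where R: "rot a b x" and e: "N = {\<one>\<^bsub>G\<^esub>, a, b, a \<otimes>\<^bsub>G\<^esub> b}"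
        by (rule noncyclic_minimal_normal[OF sol N(1-6) np]) blast+
      from klein_rotation_if_rot[OF R N(1)[unfolded e]] show ?thesis by blast
    next
      case p: True
      show ?thesis
      proof (rule quotient[OF N(1) refl p])
        fix K :: "nat monoid" and h
        assume K: "prime_kernel G K h (card N)" and C: "?C K"
        show ?thesis
        proof (cases "card N = 2")
          case True then show ?thesis using two[OF _ C, of h] K by simp
        next
          case False
          have "card N > 1" using p by (rule prime_gt_1_nat)
          then have "odd (card N)" using prime_odd_nat[OF p] False by simp
          then interpret K: odd_kernel G K h "card N" by (intro odd_kernel.intro odd_kernel_axioms.intro K)
          from C show ?thesis
          proof (elim disjE)
            assume ss: "supersolvable K"
            obtain n0 where "n0 \<in> kernel G K h" "\<And>n. n \<in> kernel G K h \<Longrightarrow> \<exists>i::nat. n = n0 [^]\<^bsub>G\<^esub> i"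
              by (rule K.kernel_cyclic) blast
            from K.supersolvable_pullback[OF this ss] show ?thesis ..
          next
            assume "group.klein_rotation K 1"
            from K.klein_rotation_lifts_odd[OF this] show ?thesis by auto
          next
            assume "group.klein_rotation K 2"
            from K.klein_rotation_lifts_odd[OF this] show ?thesis by auto
          next
            \<comment> \<open>The central involution of the quotient lifts, and dividing by it instead is the case above.\<close>
            assume "group.quaternion_rotation K"
            then obtain z where z: "z \<noteq> \<one>\<^bsub>G\<^esub>" "{\<one>\<^bsub>G\<^esub>, z} \<lhd> G" by (rule K.quaternion_center_lifts) (rule that)
            have "card {\<one>\<^bsub>G\<^esub>, z} = 2" using z(1) by simp
            then show ?thesis by (rule quotient[OF z(2) _ two_is_prime_nat]) (rule two)
          qed
        qed
      qed
    qed
  qed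
qed

theorem theorem3p1:
  fixes G :: "('a, 'b) monoid_scheme"
  assumes "group G" and "finite (carrier G)"
    and "independence_number (comaximal_subgroup_graph G) \<le> 14"
  shows "supersolvable G \<or> G \<cong> alt_group 4 \<or> G \<cong> SL_2_3 \<or> G \<cong> Z2_Z2_semidirect_Z9"
proof -
  interpret small_comax G by (rule small_comaxI[OF assms])
  have fG: "finite_group G" by (rule finite_group_axioms)
  \<comment> \<open>The classification is an induction over groups of natural numbers, so it is applied to a copy.\<close>
  obtain K :: "nat monoid" and f where K: "finite_group K" "f \<in> iso G K" using nat_copy by blast
  interpret K: surj_hom G K f by (rule iso_surj_hom[OF fG K])
  have GK: "G \<cong> K" using K(2) by (rule is_isoI)
  have sK: "small_comax K" by (rule K.small_comax_image[OF small_comax_axioms])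
  from small_comax_classification[OF sK] show ?thesis
  proof (elim disjE)
    assume ss: "supersolvable K"
    have "inj_on f (carrier G)" using K(2) by (simp add: iso_def bij_betw_def)
    then have "kernel G K f = {\<one>\<^bsub>G\<^esub>}" by (intro equalityI subsetI) (auto simp: kernel_def inj_on_def dest: bspec[of _ _ "\<one>\<^bsub>G\<^esub>"])
    then have "supersolvable G" by (intro K.supersolvable_pullback[OF _ _ ss, of "\<one>\<^bsub>G\<^esub>"]) auto
    then show ?thesis ..
  next
    assume "group.klein_rotation K 1"
    then show ?thesis using iso_trans[OF GK klein_rotation_iso_A4[OF K(1)]] by blast
  next
    assume "group.klein_rotation K 2"
    then show ?thesis using iso_trans[OF GK klein_rotation_iso_semidirect[OF K(1)]] by blast
  next
    assume "group.quaternion_rotation K"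
    then show ?thesis using iso_trans[OF GK quaternion_rotation_iso_SL_2_3[OF K(1)]] by blast
  qed
qed

end
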